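(* Let $d\in\mathbb N$, $\alpha,\beta\in(0,1)$ with $\alpha(1+\beta)>1$, $A\in C^\alpha_tC^{1+\beta}_x$ (vector field on $\mathbb R^d$) and $c\in C^\alpha_tC^{1+\beta}_x$ (scalar). Then: (i) for any $u_0\in C^1_{\mathrm{loc}}$ there exists a unique weak solution $u$ to the Young transport equation $u_{\mathrm{d} t}+A_{\mathrm{d} t}\cdot\nabla u_t+c_{\mathrm{d} t}u_t=0$ with initial condition $u_0$ in the class $C^\alpha_tC^0_{\mathrm{loc}}\cap C^0_tC^1_{\mathrm{loc}}$, and it is given by \[ u(t,x)=u_0(\Phi_{0\leftarrow t}(x))\exp\Big(-\int_0^tc(\mathrm{d} s,\Phi_{s\leftarrow t}(x))\Big); \] (ii) for any $\mu_0\in M_{\mathrm{loc}}$ there exists a unique weak solution $v$ to the Young continuity equation $v_{\mathrm{d} t}+\nabla\cdot(A_{\mathrm{d} t}v_t)-c_{\mathrm{d} t}v_t=0$ with initial condition $\mu_0$ in the class $L^\infty_t(C^0_c)^\ast\cap C^{\alpha\beta}_t(C^\beta_c)^\ast$, and it is given, with $\tilde c:=\operatorname{div}A-c$, by \[ \langle v_t,\varphi\rangle=\int\varphi(\Phi_{0\to t}(x))\exp\Big(\int_0^t(\operatorname{div}A-\tilde c)(\mathrm{d} s,\Phi_{0\to s}(x))\Big)\mu_0(\mathrm{d} x)\quad\forall\varphi\in C^\infty_c. \]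
   Context: Fix $T>0$. For $g:\mathbb R^d\to\mathbb R^m$, $\|g\|_\beta=\sup_{x\ne y}|g(x)-g(y)|/|x-y|^\beta+\sup|g|$. A field $F:[0,T]\times\mathbb R^d\to\mathbb R^m$ with $F(0,\cdot)=0$, $F_{s,t}(x)=F(t,x)-F(s,x)$, lies in $C^\alpha_tC^\beta_x$ if $\sup_{s<t}\|F_{s,t}\|_\beta/|t-s|^\alpha<\infty$, and in $C^\alpha_tC^{1+\beta}_x$ if moreover $F(t,\cdot)$ is differentiable with $DF\in C^\alpha_tC^\beta_x$. For a path $y\in C^\gamma([0,T];\mathbb R^d)$ with $\alpha+\beta\gamma>1$, $\int_s^tF(\mathrm{d} r,y_r):=\lim_{|\Pi|\to0}\sum_iF_{t_i,t_{i+1}}(y_{t_i})$. For $A\in C^\alpha_tC^{1+\beta}_x$, for every $s\in[0,T]$, $x\in\mathbb R^d$ the equation $y_t=x+\int_s^tA(\mathrm{d} r,y_r)$, $t\in[s,T]$, has a unique solution denoted $\Phi_{s\to t}(x)$; each $\Phi_{s\to t}$ is a diffeomorphism of $\mathbb R^d$ with inverse $\Phi_{s\leftarrow t}$. Function spaces: $C^\beta_K$ is the Banach space of $\beta$-Hölder functions supported in the compact $K$, $C^\beta_c=\bigcup_KC^\beta_K$, $(C^\beta_c)^\ast$ its dual, $\langle\cdot,\cdot\rangle$ the pairing; $u\in C^{\gamma}_t(C^\beta_c)^\ast$ means $u\in C^\gamma([0,T];(C^\beta_K)^\ast)$ for every compact $K$, and $u\in L^\infty_t(C^0_c)^\ast$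 means $\sup_t\|u_t\|_{(C^0_K)^\ast}<\infty$ for every compact $K$; $M_{\mathrm{loc}}=(C^0_c)^\ast$ are Radon measures. $C^\alpha_tC^0_{\mathrm{loc}}$: continuous $u:[0,T]\times\mathbb R^d\to\mathbb R$ with $\sup_{s<t}\sup_{|x|\le R}|u(t,x)-u(s,x)|/|t-s|^\alpha<\infty$ for all $R$; $C^0_tC^1_{\mathrm{loc}}$: $u,\nabla u$ continuous on $[0,T]\times\mathbb R^d$; functions are identified with measures $u(t,x)\mathrm{d} x$. Weak solution: given $A,c,\operatorname{div}A\in C^\alpha_tC^\beta_x$, $u\in L^\infty_tM_{\mathrm{loc}}\cap C^{\alpha\beta}_t(C^\beta_c)^\ast$ is a weak solution of $u_{\mathrm{d} t}+A_{\mathrm{d} t}\cdot\nabla u_t+c_{\mathrm{d} t}u_t=0$ if for all $\varphi\in C^\infty_c$ and $t$, $\langle u_t,\varphi\rangle-\langle u_0,\varphi\rangle=\int_0^t\langle A_{\mathrm{d} s}\cdot\nabla\varphi+(\operatorname{div}A_{\mathrm{d} s}-c_{\mathrm{d} s})\varphi,u_s\rangle$, where the right side is $\lim_{|\Pi|\to0}\sum_i\langle A_{t_i,t_{i+1}}\cdot\nabla\varphi+(\operatorname{div}A_{t_i,t_{i+1}}-c_{t_i,t_{i+1}})\varphi,u_{t_i}\rangle$. A weak solution of the continuity equation $v_{\mathrm{d} t}+\nabla\cdot(A_{\mathrm{d} t}v_t)-c_{\mathrm{d} t}v_t=0$ is by definition a weak solution of the transport equation with coefficients $(A,\tilde c)$,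 $\tilde c=\operatorname{div}A-c$. *)

theory Defs
  imports "HOL-Analysis.Analysis"
begin

definition is_partition :: "real \<Rightarrow> real \<Rightarrow> real list \<Rightarrow> bool" where
  "is_partition s t ts \<longleftrightarrow> ts \<noteq> [] \<and> hd ts = s \<and> last ts = t \<and> sorted_wrt (<) ts"

definition riemann_lim :: "(real list \<Rightarrow> 'b::real_normed_vector) \<Rightarrow> real \<Rightarrow> real \<Rightarrow> 'b \<Rightarrow> bool" where
  "riemann_lim S s t L \<longleftrightarrow>
     (\<forall>e>0. \<exists>\<delta>>0. \<forall>ts. is_partition s t ts \<and> (\<forall>i < length ts - 1. ts ! Suc i - ts ! i < \<delta>)
        \<longrightarrow> norm (S ts - L) < e)"

definition young_sum :: "(real \<Rightarrow> 'a \<Rightarrow> 'b::real_normed_vector) \<Rightarrow> (real \<Rightarrow> 'a) \<Rightarrow> real list \<Rightarrow> 'b" where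
  "young_sum F y ts = (\<Sum>i < length ts - 1. F (ts ! Suc i) (y (ts ! i)) - F (ts ! i) (y (ts ! i)))"

definition young_int :: "(real \<Rightarrow> 'a \<Rightarrow> 'b::real_normed_vector) \<Rightarrow> (real \<Rightarrow> 'a) \<Rightarrow> real \<Rightarrow> real \<Rightarrow> 'b" where
  "young_int F y s t = (THE I. riemann_lim (young_sum F y) s t I)"

definition holder_seminorm :: "real \<Rightarrow> ('a::metric_space \<Rightarrow> 'b::real_normed_vector) \<Rightarrow> real" where
  "holder_seminorm \<beta> g = Sup {norm (g x - g y) / (dist x y powr \<beta>) | x y. x \<noteq> y}"

definition sup_norm :: "('a \<Rightarrow> 'b::real_normed_vector) \<Rightarrow> real" where
  "sup_norm g = Sup (range (\<lambda>x. norm (g x)))"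

definition holder_norm :: "real \<Rightarrow> ('a::metric_space \<Rightarrow> 'b::real_normed_vector) \<Rightarrow> real" where
  "holder_norm \<beta> g = holder_seminorm \<beta> g + sup_norm g"

definition CtCx :: "real \<Rightarrow> real \<Rightarrow> real \<Rightarrow> (real \<Rightarrow> 'a::metric_space \<Rightarrow> 'b::real_normed_vector) \<Rightarrow> bool" where
  "CtCx T \<alpha> \<beta> F \<longleftrightarrow> (\<forall>x. F 0 x = 0) \<and>
     (\<exists>C. \<forall>s\<in>{0..T}. \<forall>t\<in>{0..T}. s < t \<longrightarrow>
        (\<forall>x y. x \<noteq> y \<longrightarrow> norm ((F t x - F s x) - (F t y - F s y)) \<le> C * (t - s) powr \<alpha> * dist x y powr \<beta>) \<and>
        (\<forall>x. norm (F t x - F s x) \<le> C * (t - s) powr \<alpha>))"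

definition CtC1x :: "real \<Rightarrow> real \<Rightarrow> real \<Rightarrow> (real \<Rightarrow> 'a::euclidean_space \<Rightarrow> 'b::real_normed_vector) \<Rightarrow> bool" where
  "CtC1x T \<alpha> \<beta> F \<longleftrightarrow> CtCx T \<alpha> \<beta> F \<and>
     (\<exists>DF :: real \<Rightarrow> 'a \<Rightarrow> ('a \<Rightarrow>\<^sub>L 'b).
        (\<forall>t\<in>{0..T}. \<forall>x. (F t has_derivative blinfun_apply (DF t x)) (at x)) \<and> CtCx T \<alpha> \<beta> DF)"

definition divergence :: "(real \<Rightarrow> 'a::euclidean_space \<Rightarrow> 'a) \<Rightarrow> real \<Rightarrow> 'a \<Rightarrow> real" where
  "divergence A t x = (\<Sum>b\<in>Basis. frechet_derivative (A t) (at x) b \<bullet> b)"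

definition holder_path :: "real \<Rightarrow> real set \<Rightarrow> (real \<Rightarrow> 'a::real_normed_vector) \<Rightarrow> bool" where
  "holder_path \<gamma> I y \<longleftrightarrow> (\<exists>C. \<forall>s\<in>I. \<forall>t\<in>I. norm (y t - y s) \<le> C * \<bar>t - s\<bar> powr \<gamma>)"

definition young_ode_sol :: "real \<Rightarrow> real \<Rightarrow> real \<Rightarrow> (real \<Rightarrow> 'a::euclidean_space \<Rightarrow> 'a) \<Rightarrow> real \<Rightarrow> 'a \<Rightarrow> (real \<Rightarrow> 'a) \<Rightarrow> bool" where
  "young_ode_sol T \<alpha> \<beta> A s x y \<longleftrightarrow>
     (\<exists>\<gamma>. 0 < \<gamma> \<and> \<gamma> \<le> 1 \<and> \<alpha> + \<beta> * \<gamma> > 1 \<and> holder_path \<gamma> {s..T} y) \<and>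
     (\<forall>t\<in>{s..T}. riemann_lim (young_sum A y) s t (y t - x))"

definition flow_fwd :: "real \<Rightarrow> real \<Rightarrow> real \<Rightarrow> (real \<Rightarrow> 'a::euclidean_space \<Rightarrow> 'a) \<Rightarrow> real \<Rightarrow> real \<Rightarrow> 'a \<Rightarrow> 'a" where
  "flow_fwd T \<alpha> \<beta> A s t x = (THE z. \<exists>y. young_ode_sol T \<alpha> \<beta> A s x y \<and> y t = z)"

definition flow_bwd :: "real \<Rightarrow> real \<Rightarrow> real \<Rightarrow> (real \<Rightarrow> 'a::euclidean_space \<Rightarrow> 'a) \<Rightarrow> real \<Rightarrow> real \<Rightarrow> 'a \<Rightarrow> 'a" where
  "flow_bwd T \<alpha> \<beta> A s t x = (THE z. flow_fwd T \<alpha> \<beta> A s t z = x)"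

coinductive smooth :: "('a::euclidean_space \<Rightarrow> real) \<Rightarrow> bool" where
  "continuous_on UNIV f \<Longrightarrow>
   (\<exists>Df. (\<forall>x. (f has_derivative Df x) (at x)) \<and> (\<forall>v. smooth (\<lambda>x. Df x v))) \<Longrightarrow> smooth f"

definition Cinf_c :: "('a::euclidean_space \<Rightarrow> real) set" where
  "Cinf_c = {f. smooth f \<and> (\<exists>K. compact K \<and> (\<forall>x. x \<notin> K \<longrightarrow> f x = 0))}"

definition C0_K :: "'a::euclidean_space set \<Rightarrow> ('a \<Rightarrow> real) set" where
  "C0_K K = {f. continuous_on UNIV f \<and> (\<forall>x. x \<notin> K \<longrightarrow> f x = 0)}"

definition Cbeta_K :: "real \<Rightarrow> 'a::euclidean_space set \<Rightarrow> ('a \<Rightarrow> real) set" where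
  "Cbeta_K \<beta> K = {f. (\<exists>C. \<forall>x y. \<bar>f x - f y\<bar> \<le> C * dist x y powr \<beta>) \<and> (\<forall>x. x \<notin> K \<longrightarrow> f x = 0)}"

definition C0_c :: "('a::euclidean_space \<Rightarrow> real) set" where
  "C0_c = (\<Union>K\<in>{K. compact K}. C0_K K)"

text \<open>A linear functional on C^0_c (values on other functions are irrelevant).\<close>
definition linear_on_Cc :: "(('a::euclidean_space \<Rightarrow> real) \<Rightarrow> real) \<Rightarrow> bool" where
  "linear_on_Cc \<Lambda> \<longleftrightarrow> (\<forall>f\<in>C0_c. \<forall>g\<in>C0_c. \<forall>a b. \<Lambda> (\<lambda>x. a * f x + b * g x) = a * \<Lambda> f + b * \<Lambda> g)"

text \<open>M_loc = (C^0_c)^*  (Radon measures), represented by their action on C^0_c.\<close>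
definition Mloc :: "(('a::euclidean_space \<Rightarrow> real) \<Rightarrow> real) \<Rightarrow> bool" where
  "Mloc \<mu> \<longleftrightarrow> linear_on_Cc \<mu> \<and>
     (\<forall>K. compact K \<longrightarrow> (\<exists>C. \<forall>f\<in>C0_K K. \<bar>\<mu> f\<bar> \<le> C * sup_norm f))"

text \<open>u in L^infinity_t (C^0_c)^* intersected with C^{alpha beta}_t (C^beta_c)^* on [0,T];
  u t f stands for the pairing <u_t, f>.\<close>
definition dist_class :: "real \<Rightarrow> real \<Rightarrow> real \<Rightarrow> (real \<Rightarrow> ('a::euclidean_space \<Rightarrow> real) \<Rightarrow> real) \<Rightarrow> bool" where
  "dist_class T \<alpha> \<beta> u \<longleftrightarrow> (\<forall>t\<in>{0..T}. linear_on_Cc (u t)) \<and>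
     (\<forall>K. compact K \<longrightarrow> (\<exists>C. \<forall>t\<in>{0..T}. \<forall>f\<in>C0_K K. \<bar>u t f\<bar> \<le> C * sup_norm f)) \<and>
     (\<forall>K. compact K \<longrightarrow> (\<exists>C. \<forall>s\<in>{0..T}. \<forall>t\<in>{0..T}. \<forall>f\<in>Cbeta_K \<beta> K.
        \<bar>u t f - u s f\<bar> \<le> C * \<bar>t - s\<bar> powr (\<alpha> * \<beta>) * holder_norm \<beta> f))"

definition fun_dist :: "(real \<Rightarrow> 'a::euclidean_space \<Rightarrow> real) \<Rightarrow> real \<Rightarrow> ('a \<Rightarrow> real) \<Rightarrow> real" where
  "fun_dist u t f = (LINT x|lborel. u t x * f x)"

definition weak_sol_transport :: "real \<Rightarrow> real \<Rightarrow> real \<Rightarrow> (real \<Rightarrow> 'a::euclidean_space \<Rightarrow> 'a) \<Rightarrow>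
    (real \<Rightarrow> 'a \<Rightarrow> real) \<Rightarrow> (real \<Rightarrow> ('a \<Rightarrow> real) \<Rightarrow> real) \<Rightarrow> bool" where
  "weak_sol_transport T \<alpha> \<beta> A c u \<longleftrightarrow> dist_class T \<alpha> \<beta> u \<and>
     (\<forall>\<phi>\<in>Cinf_c. \<forall>t\<in>{0..T}.
        riemann_lim (\<lambda>ts. \<Sum>i < length ts - 1.
            u (ts ! i) (\<lambda>x. frechet_derivative \<phi> (at x) (A (ts ! Suc i) x - A (ts ! i) x)
              + ((divergence A (ts ! Suc i) x - divergence A (ts ! i) x)
                 - (c (ts ! Suc i) x - c (ts ! i) x)) * \<phi> x))
          0 t (u t \<phi> - u 0 \<phi>))"

definition weak_sol_continuity :: "real \<Rightarrow> real \<Rightarrow> real \<Rightarrow> (real \<Rightarrow> 'a::euclidean_space \<Rightarrow> 'a) \<Rightarrow>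
    (real \<Rightarrow> 'a \<Rightarrow> real) \<Rightarrow> (real \<Rightarrow> ('a \<Rightarrow> real) \<Rightarrow> real) \<Rightarrow> bool" where
  "weak_sol_continuity T \<alpha> \<beta> A c v \<longleftrightarrow>
     weak_sol_transport T \<alpha> \<beta> A (\<lambda>t x. divergence A t x - c t x) v"

definition C1_loc :: "('a::euclidean_space \<Rightarrow> real) \<Rightarrow> bool" where
  "C1_loc u0 \<longleftrightarrow> (\<exists>g. continuous_on UNIV g \<and> (\<forall>x. (u0 has_derivative (\<lambda>h. g x \<bullet> h)) (at x)))"

definition fun_class :: "real \<Rightarrow> real \<Rightarrow> (real \<Rightarrow> 'a::euclidean_space \<Rightarrow> real) \<Rightarrow> bool" where
  "fun_class T \<alpha> u \<longleftrightarrow>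
     continuous_on ({0..T} \<times> UNIV) (\<lambda>(t, x). u t x) \<and>
     (\<forall>R. \<exists>C. \<forall>s\<in>{0..T}. \<forall>t\<in>{0..T}. \<forall>x. norm x \<le> R \<longrightarrow> \<bar>u t x - u s x\<bar> \<le> C * \<bar>t - s\<bar> powr \<alpha>) \<and>
     (\<exists>g. continuous_on ({0..T} \<times> UNIV) (\<lambda>(t, x). g t x) \<and>
        (\<forall>t\<in>{0..T}. \<forall>x. (u t has_derivative (\<lambda>h. g t x \<bullet> h)) (at x)))"

end

theory Submission
  imports Defs
begin

text \<open>
  A path solves the Young equation iff its increments agree with those of \<open>A\<close> up to \<open>O(\<bar>t - s\<bar> powr \<theta>)\<close>
  with \<open>\<theta> = \<alpha> (1 + \<beta>) > 1\<close>; Euler schemes converge to such paths by Davie's estimate, and a discrete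
  Gronwall argument for their differences yields a flow of \<open>C1\<close> diffeomorphisms in both time directions.
  By sewing, the two weak equations are likewise equivalent to first order expansions with error
  \<open>O(\<bar>t - s\<bar> powr \<theta>)\<close>, and such expansions hold for transported functions and pushed forward measures.

  Uniqueness is by duality: if \<open>u\<close> solves the transport and \<open>v\<close> the continuity equation, then \<open>\<langle>v t, u t\<rangle>\<close>
  is constant in time. When \<open>u\<close> is mollified at scale \<open>\<epsilon>\<close>, the increments of the pairing agree up to
  \<open>O(\<bar>t - s\<bar> powr \<theta>)\<close>, uniformly in \<open>\<epsilon>\<close>, with \<open>v\<close> applied to a commutator of size \<open>O(\<epsilon>)\<close>; hence the pairing
  is Hoelder continuous of exponent \<open>\<theta> > 1\<close>. Taking for \<open>v\<close> a transported Dirac mass determines \<open>u\<close>,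
  taking for \<open>u\<close> a transported test function determines \<open>v\<close>.
\<close>

section \<open>Sewing of Riemann sums\<close>

text \<open>The exponent \<theta> = \<alpha> (1 + \<beta>) arises twice in the same way: a path that
  is \<alpha>-Hoelder in time meets a derivative that is \<beta>-Hoelder in space, and a measure
  that is \<alpha> \<beta>-Hoelder in time meets a test function of size \<bar>t - s\<bar> powr
  \<alpha>. Nothing can be differentiated in time, and after mollification the constant of an
  expansion is no longer controlled as \<epsilon> tends to 0. What saves the argument is that sewing
  and Gronwall forget this constant: once some expansion with exponent \<theta> is known, its
  constant is bounded through the germ alone. A qualitative expansion is therefore enough to start
  with, and only germs and their defects have to be estimated uniformly. The divergence of A is
  merely Hoelder in space, so smallness of the commutator cannot come from its regularity; it comes
  from an integration by parts in the mollification variable, see \<open>cker_mean\<close>. Finally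
  u need not have compact support; it is cut off, and the equation for the cut function is used only
  near the set where the measure lives.\<close>

lemma norm_split3:
 fixes a b c :: "'b::real_normed_vector"
 assumes "x = a + b - c"
 shows "norm x <= norm a + norm b + norm c"
 using norm_triangle_ineq4[of "a + b" c] norm_triangle_ineq[of a b] unfolding assms by linarith

text \<open>Induction on the number of steps. The cut is made at the last index i of the first half:
  the pieces from j to i and from i + 1 to k have at most half the length, and the single step
  between them is covered by \<open>E\<close>. The premise on splitting may use the bound on the
  left piece; Davie-type germs, whose defect depends on the increment of the path over that piece,
  rely on this.\<close>

lemma discrete_sewing:
 fixes N :: "nat => nat => real" and t :: "nat => real"
 assumes \<theta>: "1 < \<theta>" and K0: "0 <= K" and E: "0 <= E"
  and K: "2 * D <= K * (1 - 2 powr (1 - \<theta>))"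
  and mono: "\<And>j k. m <= j ==> j <= k ==> k <= n ==> t j <= t k"
  and diag: "\<And>j. m <= j ==> j <= n ==> N j j <= 0"
  and step: "\<And>j. m <= j ==> j < n ==> N j (Suc j) <= E * (t (Suc j) - t j)"
  and split: "\<And>j i k. m <= j ==> j <= i ==> i <= k ==> k <= n ==>
   N j i <= K * (t i - t j) powr \<theta> + E * (t i - t j) ==>
   N j k <= N j i + N i k + D * (t k - t j) powr \<theta>"
  and D0: "0 <= D"
 shows "m <= j ==> j <= k ==> k <= n ==> N j k <= K * (t k - t j) powr \<theta> + E * (t k - t j)"
proof (induction "k - j" arbitrary: j k rule: less_induct)
 case less
 have tjk: "t j <= t k" using mono less.prems by auto
 consider "k = j" | "k = Suc j" | "Suc j < k" using less.prems by linarith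
 then show ?case
 proof cases
  case 1
  then show ?thesis using diag less.prems by simp
 next
  case 2
  have "N j k <= E * (t k - t j)" using step[of j] 2 less.prems by simp
  moreover have "0 <= K * (t k - t j) powr \<theta>" using K0 by simp
  ultimately show ?thesis by linarith
 next
  case 3
  \<comment> \<open>Its maximum is the cutting index; the next index already lies beyond the
    midpoint, or is k itself.\<close>
  define I where "I = {i. j <= i \<and> i < k \<and> t i - t j <= (t k - t j) / 2}"
  have fin: "finite I" unfolding I_def by (rule finite_subset[of _ "{..<k}"]) auto
  have jI: "j \<in> I" unfolding I_def using less.prems 3 tjk by auto
  define i where "i = Max I"
  have iI: "i \<in> I" unfolding i_def using fin jI Max_in by blast
  have ij: "j <= i" "i < k" "t i - t j <= (t k - t j) / 2" using iI by (auto simp: I_def)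
  have i1: "t k - t (Suc i) <= (t k - t j) / 2"
  proof (cases "Suc i = k")
   case True then show ?thesis using tjk by simp
  next
   case False
   have "Suc i \<notin> I" using Max_ge[OF fin, of "Suc i"] i_def by auto
   then have "t (Suc i) - t j > (t k - t j) / 2" unfolding I_def using ij False by auto
   then show ?thesis by (simp add: field_simps)
  qed
  have ti: "t j <= t i" "t i <= t (Suc i)" "t (Suc i) <= t k"
   using mono ij less.prems by auto
  have A: "N j i <= K * (t i - t j) powr \<theta> + E * (t i - t j)"
   by (rule less.hyps) (use ij less.prems in auto)
  have B: "N (Suc i) k <= K * (t k - t (Suc i)) powr \<theta> + E * (t k - t (Suc i))"
   by (rule less.hyps) (use ij less.prems in auto)
  have C: "N i (Suc i) <= E * (t (Suc i) - t i)"
   using step ij less.prems by auto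
  have C': "N i (Suc i) <= K * (t (Suc i) - t i) powr \<theta> + E * (t (Suc i) - t i)"
   using C mult_nonneg_nonneg[OF K0 powr_ge_zero[of "t (Suc i) - t i" \<theta>]] by linarith
  have S1: "N j k <= N j i + N i k + D * (t k - t j) powr \<theta>"
   using split[of j i k] A ij less.prems by auto
  have S2: "N i k <= N i (Suc i) + N (Suc i) k + D * (t k - t i) powr \<theta>"
   using split[of i "Suc i" k] C' ij less.prems by auto
  have p1: "(t i - t j) powr \<theta> <= ((t k - t j) / 2) powr \<theta>"
   by (rule powr_mono2) (use \<theta> ij ti in auto)
  have p2: "(t k - t (Suc i)) powr \<theta> <= ((t k - t j) / 2) powr \<theta>"
   by (rule powr_mono2) (use \<theta> i1 ti in auto)
  have p3: "(t k - t i) powr \<theta> <= (t k - t j) powr \<theta>"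
   by (rule powr_mono2) (use \<theta> i1 ti in auto)
  \<comment> \<open>Here \<theta> > 1 enters: the two halves together carry the factor 2 powr (1 -
    \<theta>) < 1, and \<open>K\<close> is so large that the gain pays for the two defects.\<close>
  have half: "2 * ((t k - t j) / 2) powr \<theta> = 2 powr (1 - \<theta>) * (t k - t j) powr \<theta>"
   using tjk by (simp add: powr_divide powr_diff)
  have "N j k <= K * ((t k - t j) / 2) powr \<theta> + K * ((t k - t j) / 2) powr \<theta>
    + E * (t k - t j) + 2 * D * (t k - t j) powr \<theta>"
  proof -
   have "K * (t i - t j) powr \<theta> <= K * ((t k - t j) / 2) powr \<theta>"
    using p1 K0 by (rule mult_left_mono)
   moreover have "K * (t k - t (Suc i)) powr \<theta> <= K * ((t k - t j) / 2) powr \<theta>"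
    using p2 K0 by (rule mult_left_mono)
   moreover have "D * (t k - t i) powr \<theta> <= D * (t k - t j) powr \<theta>"
    using p3 D0 by (rule mult_left_mono)
   moreover have "E * (t i - t j) + E * (t (Suc i) - t i) + E * (t k - t (Suc i)) = E * (t k - t j)"
    by (simp add: algebra_simps)
   ultimately show ?thesis using S1 S2 A B C by linarith
  qed
  also have "... = (K * 2 powr (1 - \<theta>) + 2 * D) * (t k - t j) powr \<theta> + E * (t k - t j)"
   using half by (simp add: algebra_simps)
  also have "... <= K * (t k - t j) powr \<theta> + E * (t k - t j)"
  proof -
   have "K * 2 powr (1 - \<theta>) + 2 * D <= K" using K by (simp add: algebra_simps)
   then show ?thesis by (simp add: mult_right_mono)
  qed
  finally show ?thesis .
 qed
qed

text \<open>\<open>sewing_const \<theta> * D\<close> is the least \<open>K\<close> that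
  \<open>discrete_sewing\<close> admits for the defect constant \<open>D\<close>.\<close>

definition sewing_const :: "real => real" where
 "sewing_const \<theta> = 2 / (1 - 2 powr (1 - \<theta>))"

lemma sewing_const:
 assumes "1 < \<theta>"
 shows "0 < sewing_const \<theta>" "2 * D = sewing_const \<theta> * D * (1 - 2 powr (1 - \<theta>))"
proof -
 have "2 powr (1 - \<theta>) < (2::real) powr 0"
  by (rule powr_less_mono) (use assms in auto)
 then have p: "0 < 1 - (2::real) powr (1 - \<theta>)" by simp
 then show "0 < sewing_const \<theta>" unfolding sewing_const_def by simp
 define q where "q = 1 - (2::real) powr (1 - \<theta>)"
 have "2 / q * D * q = 2 * D" using p by (simp add: q_def[symmetric])
 then show "2 * D = sewing_const \<theta> * D * (1 - 2 powr (1 - \<theta>))"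
  unfolding sewing_const_def q_def by simp
qed

lemma sum_lessThan_add:
 fixes f :: "nat => 'b::comm_monoid_add"
 shows "(\<Sum>i<m+n. f i) = (\<Sum>i<m. f i) + (\<Sum>i<n. f (m + i))"
 by (induction n) (auto simp: algebra_simps)

text \<open>Telescoping \<open>I\<close> along the partition leaves one error per step, and for a
  step of length d < \<delta> the error is at most M * \<delta> powr (\<theta> - 1) * d; the total
  is of order \<delta> powr (\<theta> - 1). Existence of Riemann limits is always obtained in this
  way.\<close>

lemma riemann_lim_of_expansion:
 fixes I :: "real => 'b::real_normed_vector"
 assumes st: "s <= t" and \<theta>: "1 < \<theta>"
  and ex: "\<And>a b. s <= a ==> a < b ==> b <= t ==> norm (I b - I a - \<Xi> a b) <= M * (b - a) powr \<theta>"
 shows "riemann_lim (\<lambda>ts. \<Sum>i < length ts - 1. \<Xi> (ts ! i) (ts ! Suc i)) s t (I t - I s)"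
 unfolding riemann_lim_def
proof (intro allI impI)
 fix e :: real assume e: "0 < e"
 define M' where "M' = max M 0"
 define X where "X = M' * (t - s) + 1"
 have X: "X > 0" unfolding X_def M'_def using st by (simp add: add_nonneg_pos)
 \<comment> \<open>Chosen so that \<delta> powr (\<theta> - 1) = e / X. The summand 1 in
   \<open>X\<close> makes M' * (t - s) / X < 1 strict and keeps \<open>X\<close> positive for M' =
   0.\<close>
 define \<delta> where "\<delta> = (e / X) powr (1 / (\<theta> - 1))"
 have \<delta>: "\<delta> > 0" unfolding \<delta>_def using e X by simp
 have \<delta>p: "\<delta> powr (\<theta> - 1) = e / X"
  unfolding \<delta>_def using e X \<theta> by (simp add: powr_powr)
 show "\<exists>\<delta>>0. \<forall>ts. is_partition s t ts \<and> (\<forall>i<length ts - 1. ts ! Suc i - ts ! i < \<delta>) -->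
   norm ((\<Sum>i<length ts - 1. \<Xi> (ts ! i) (ts ! Suc i)) - (I t - I s)) < e"
 proof (intro exI[of _ \<delta>] conjI allI impI \<delta>)
  fix ts assume ts: "is_partition s t ts \<and> (\<forall>i<length ts - 1. ts ! Suc i - ts ! i < \<delta>)"
  let ?n = "length ts - 1"
  have ne: "ts \<noteq> []" and hd: "ts ! 0 = s" and la: "ts ! ?n = t" and so: "sorted_wrt (<) ts"
   using ts by (auto simp: is_partition_def hd_conv_nth last_conv_nth)
  have inc: "i < j ==> j < length ts ==> ts ! i < ts ! j" for i j
   using so by (auto simp: sorted_wrt_iff_nth_less)
  have lo: "s <= ts ! i" if "i < length ts" for i
   using inc[of 0 i] that hd by (cases "i = 0") (use ne in \<open>auto intro: less_imp_le\<close>)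
  have hi: "ts ! i <= t" if "i < length ts" for i
   using inc[of i ?n] that la by (cases "i = ?n") (use ne in \<open>auto intro: less_imp_le\<close>)
  have tel: "I t - I s = (\<Sum>i<?n. I (ts ! Suc i) - I (ts ! i))"
   using hd la sum_lessThan_telescope[of "\<lambda>i. I (ts ! i)" ?n] by simp
  have telt: "t - s = (\<Sum>i<?n. ts ! Suc i - ts ! i)"
   using hd la sum_lessThan_telescope[of "\<lambda>i. ts ! i" ?n] by simp
  have "norm ((\<Sum>i<?n. \<Xi> (ts ! i) (ts ! Suc i)) - (I t - I s))
    = norm (\<Sum>i<?n. \<Xi> (ts ! i) (ts ! Suc i) - (I (ts ! Suc i) - I (ts ! i)))"
   unfolding tel by (simp add: sum_subtractf)
  also have "... <= (\<Sum>i<?n. norm (\<Xi> (ts ! i) (ts ! Suc i) - (I (ts ! Suc i) - I (ts ! i))))"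
   by (rule norm_sum)
  also have "... <= (\<Sum>i<?n. M' * (e / X) * (ts ! Suc i - ts ! i))"
  proof (rule sum_mono)
   fix i assume i: "i \<in> {..<?n}"
   let ?d = "ts ! Suc i - ts ! i"
   have d: "0 < ?d" "?d < \<delta>" using inc[of i "Suc i"] i ts by auto
   have "norm (\<Xi> (ts ! i) (ts ! Suc i) - (I (ts ! Suc i) - I (ts ! i)))
     = norm (I (ts ! Suc i) - I (ts ! i) - \<Xi> (ts ! i) (ts ! Suc i))"
    by (simp add: norm_minus_commute)
   also have "... <= M * ?d powr \<theta>"
    by (rule ex) (use i d lo hi in auto)
   also have "... <= M' * (?d powr (\<theta> - 1) * ?d)"
    using d by (simp add: M'_def powr_diff)
   also have "... <= M' * ((e / X) * ?d)"
   proof -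
    have "?d powr (\<theta> - 1) <= \<delta> powr (\<theta> - 1)" by (rule powr_mono2) (use d \<theta> in auto)
    then show ?thesis using d unfolding \<delta>p M'_def by (intro mult_left_mono mult_right_mono) auto
   qed
   finally show "norm (\<Xi> (ts ! i) (ts ! Suc i) - (I (ts ! Suc i) - I (ts ! i))) <= M' * (e / X) * ?d"
    by (simp add: algebra_simps)
  qed
  also have "... = M' * (e / X) * (t - s)" unfolding telt by (simp add: sum_distrib_left)
  also have "... = e * (M' * (t - s) / X)" by simp
  also have "... < e * 1"
   by (rule mult_strict_left_mono) (use e X in \<open>auto simp: X_def\<close>)
  finally show "norm ((\<Sum>i<?n. \<Xi> (ts ! i) (ts ! Suc i)) - (I t - I s)) < e" by simp
 qed
qed

text \<open>Partitions are lists by definition, whereas grids given by index functions are easier to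
  build and to glue. The value n = 0 covers the one-point partition of the degenerate interval s =
  t.\<close>

lemma riemann_lim_grid:
 fixes g :: "nat => real"
 assumes "riemann_lim (\<lambda>ts. \<Sum>i < length ts - 1. \<Xi> (ts ! i) (ts ! Suc i)) s t L" "0 < e"
 shows "\<exists>\<delta>>0. \<forall>n g. g 0 = s \<and> g n = t \<and> (\<forall>i<n. g i < g (Suc i) \<and> g (Suc i) - g i < \<delta>) -->
  norm ((\<Sum>i<n. \<Xi> (g i) (g (Suc i))) - L) < e"
proof -
 obtain \<delta> where \<delta>: "\<delta> > 0" and H: "\<And>ts. is_partition s t ts ==>
   (\<And>i. i<length ts - 1 ==> ts ! Suc i - ts ! i < \<delta>) ==>
   norm ((\<Sum>i<length ts - 1. \<Xi> (ts ! i) (ts ! Suc i)) - L) < e"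
  using assms unfolding riemann_lim_def by metis
 show ?thesis
 proof (intro exI[of _ \<delta>] conjI allI impI \<delta>)
  fix n :: nat and g :: "nat => real"
  assume g: "g 0 = s \<and> g n = t \<and> (\<forall>i<n. g i < g (Suc i) \<and> g (Suc i) - g i < \<delta>)"
  define ts where "ts = map g [0..<Suc n]"
  have len: "length ts = Suc n" by (simp add: ts_def)
  have nth: "ts ! i = g i" if "i <= n" for i using that by (simp add: ts_def del: upt_Suc)
  have gi: "g i < g j" if "i < j" "j <= n" for i j
   using that
  proof (induction j)
   case (Suc j)
   then show ?case using g by (metis Suc_le_lessD less_SucE less_imp_le order.strict_trans)
  qed simp
  have "is_partition s t ts"
   unfolding is_partition_def
  proof (intro conjI)
   show "ts \<noteq> []" using len by auto
   then show "hd ts = s" "last ts = t" using g nth len by (auto simp: hd_conv_nth last_conv_nth)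
   show "sorted_wrt (<) ts" unfolding sorted_wrt_iff_nth_less using gi nth len by auto
  qed
  then have "norm ((\<Sum>i<length ts - 1. \<Xi> (ts ! i) (ts ! Suc i)) - L) < e"
   by (rule H) (use g nth len in auto)
  moreover have "(\<Sum>i<length ts - 1. \<Xi> (ts ! i) (ts ! Suc i)) = (\<Sum>i<n. \<Xi> (g i) (g (Suc i)))"
   using len nth by (intro sum.cong) auto
  ultimately show "norm ((\<Sum>i<n. \<Xi> (g i) (g (Suc i))) - L) < e" by simp
 qed
qed

lemma riemann_lim_unique:
 assumes st: "s <= t"
  and L: "riemann_lim (\<lambda>ts. \<Sum>i < length ts - 1. \<Xi> (ts ! i) (ts ! Suc i)) s t L"
  and L': "riemann_lim (\<lambda>ts. \<Sum>i < length ts - 1. \<Xi> (ts ! i) (ts ! Suc i)) s t L'"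
 shows "L = L'"
proof (rule ccontr)
 assume "L \<noteq> L'"
 define e where "e = norm (L - L') / 2"
 have e: "e > 0" using \<open>L \<noteq> L'\<close> by (simp add: e_def)
 obtain \<delta> where \<delta>: "\<delta> > 0" "\<And>n g. g 0 = s \<and> g n = t \<and> (\<forall>i<n. g i < g (Suc i) \<and> g (Suc i) - g i < \<delta>) ==>
  norm ((\<Sum>i<n. \<Xi> (g i) (g (Suc i))) - L) < e" using riemann_lim_grid[OF L e] by blast
 obtain \<delta>' where \<delta>': "\<delta>' > 0" "\<And>n g. g 0 = s \<and> g n = t \<and> (\<forall>i<n. g i < g (Suc i) \<and> g (Suc i) - g i < \<delta>') ==>
  norm ((\<Sum>i<n. \<Xi> (g i) (g (Suc i))) - L') < e" using riemann_lim_grid[OF L' e] by blast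
 \<comment> \<open>A grid fine enough for both limits: equidistant for s < t, without any step for s
   = t.\<close>
 have "\<exists>n g. g 0 = s \<and> g n = t \<and> (\<forall>i<n. g i < g (Suc i) \<and> g (Suc i) - g i < min \<delta> \<delta>')"
 proof (cases "s = t")
  case True then show ?thesis by (intro exI[of _ 0] exI[of _ "\<lambda>_. s"]) auto
 next
  case False
  obtain n :: nat where n: "(t - s) / min \<delta> \<delta>' < real n" using reals_Archimedean2 by blast
  have "0 < (t - s) / min \<delta> \<delta>'" using False st \<delta> \<delta>' by simp
  then have n0: "0 < real n" using n by linarith
  have "(t - s) / n < min \<delta> \<delta>'" using n n0 \<delta> \<delta>' pos_divide_less_eq[of "min \<delta> \<delta>'" "t - s" n]
   pos_divide_less_eq[of n "t - s" "min \<delta> \<delta>'"] by (simp add: mult.commute)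
  moreover have "0 < (t - s) / n" using False st n0 by simp
  ultimately have "\<forall>i<n. s + real i * ((t - s) / n) < s + real (Suc i) * ((t - s) / n) \<and>
    s + real (Suc i) * ((t - s) / n) - (s + real i * ((t - s) / n)) < min \<delta> \<delta>'"
   by (simp add: distrib_right del: times_divide_eq_right)
  then show ?thesis using n0
   by (intro exI[of _ n] exI[of _ "\<lambda>i. s + real i * ((t - s) / n)"]) simp
 qed
 then obtain n g where g: "g 0 = s \<and> g n = t \<and> (\<forall>i<n. g i < g (Suc i) \<and> g (Suc i) - g i < min \<delta> \<delta>')" by blast
 have "norm ((\<Sum>i<n. \<Xi> (g i) (g (Suc i))) - L) < e" by (rule \<delta>) (use g in auto)
 moreover have "norm ((\<Sum>i<n. \<Xi> (g i) (g (Suc i))) - L') < e" by (rule \<delta>') (use g in auto)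
 ultimately have "norm (L - L') < 2 * e"
  using norm_triangle_ineq4[of "(\<Sum>i<n. \<Xi> (g i) (g (Suc i))) - L'" "(\<Sum>i<n. \<Xi> (g i) (g (Suc i))) - L"] by simp
 then show False by (simp add: e_def)
qed

text \<open>Converse of \<open>riemann_lim_of_expansion\<close>, with a constant that sees only the
  defect of the germ. Limits are known only from the base point \<open>s0\<close>, so the grid is
  made to pass through \<open>s\<close>: removing the sum over [s0, s] from the sum over [s0, t]
  leaves a sum over [s, t], to which discrete sewing applies.\<close>

lemma expansion_of_riemann_lim:
 fixes I :: "real => 'b::real_normed_vector"
 assumes \<theta>: "1 < \<theta>" and D: "0 <= D"
  and lim: "\<And>t. s0 <= t ==> t <= T ==>
   riemann_lim (\<lambda>ts. \<Sum>i < length ts - 1. \<Xi> (ts ! i) (ts ! Suc i)) s0 t (I t - x0)"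
  and germ: "\<And>a b c. s0 <= a ==> a <= b ==> b <= c ==> c <= T ==>
   norm (\<Xi> a c - \<Xi> a b - \<Xi> b c) <= D * (c - a) powr \<theta>"
  and diag: "\<And>a. s0 <= a ==> a <= T ==> \<Xi> a a = 0"
  and st: "s0 <= s" "s <= t" "t <= T"
 shows "norm (I t - I s - \<Xi> s t) <= sewing_const \<theta> * D * (t - s) powr \<theta>"
proof (cases "s = t")
 case True then show ?thesis using diag st by simp
next
 case False
 then have st': "s < t" using st by simp
 show ?thesis
 proof (rule field_le_epsilon)
  fix e :: real assume e: "0 < e"
  then have e2: "0 < e / 2" by simp
  obtain \<delta> where \<delta>: "\<delta> > 0" "\<And>n g. g 0 = s0 \<and> g n = s \<and> (\<forall>i<n. g i < g (Suc i) \<and> g (Suc i) - g i < \<delta>) ==>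
   norm ((\<Sum>i<n. \<Xi> (g i) (g (Suc i))) - (I s - x0)) < e / 2"
   using riemann_lim_grid[OF lim[of s] e2] st by auto
  obtain \<delta>' where \<delta>': "\<delta>' > 0" "\<And>n g. g 0 = s0 \<and> g n = t \<and> (\<forall>i<n. g i < g (Suc i) \<and> g (Suc i) - g i < \<delta>') ==>
   norm ((\<Sum>i<n. \<Xi> (g i) (g (Suc i))) - (I t - x0)) < e / 2"
   using riemann_lim_grid[OF lim[of t] e2] st by auto
  define d where "d = min \<delta> \<delta>'"
  have d: "d > 0" using \<delta> \<delta>' by (simp add: d_def)
  obtain n :: nat where n: "(T - s0 + 1) / d < real n" using reals_Archimedean2 by blast
  have "0 < (T - s0 + 1) / d" using st d by simp
  then have n0: "0 < real n" using n by linarith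
  then have n0': "0 < n" by simp
  have nd: "(T - s0 + 1) / n < d" using n n0 d by (simp add: field_simps)
  \<comment> \<open>Partitions increase strictly, so for s0 = s the first stretch must contain no
    step at all.\<close>
  define n1 where "n1 = (if s0 = s then 0 else n)"
  define g where "g i = (if i < n1 then s0 + real i * ((s - s0) / n)
   else s + real (i - n1) * ((t - s) / n))" for i
  have g0: "g 0 = s0" using st n0' by (auto simp: g_def n1_def)
  have gn1: "g n1 = s" by (auto simp: g_def)
  have gn: "g (n1 + n) = t" using n0 by (auto simp: g_def)
  have gs: "g i < g (Suc i) \<and> g (Suc i) - g i < d" if i: "i < n1 + n" for i
  proof -
   have "(s - s0) / n <= (T - s0 + 1) / n" "(t - s) / n <= (T - s0 + 1) / n"
    using n0 st by (auto intro!: divide_right_mono)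
   then have x1: "(s - s0) / n < d" and x2: "(t - s) / n < d" using nd by linarith+
   have x3: "0 < (t - s) / n" using st' n0 by simp
   consider "Suc i < n1" | "Suc i = n1" | "n1 <= i" by linarith
   then show ?thesis
   proof cases
    case 1
    then have "s0 < s" using st by (auto simp: n1_def split: if_splits)
    then have "0 < (s - s0) / n" using n0 by simp
    moreover have "g (Suc i) = g i + (s - s0) / n"
     using 1 by (simp add: g_def distrib_right del: times_divide_eq_right)
    ultimately show ?thesis using x1 by simp
   next
    case 2
    then have ss: "s0 < s" "n1 = n" using st by (auto simp: n1_def split: if_splits)
    then have p: "0 < (s - s0) / n" using n0 by simp
    have "g (Suc i) = s" using 2 gn1 by simp
    moreover have "g i = s0 + real i * ((s - s0) / n)" using 2 by (simp add: g_def)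
    moreover have "real i = real n - 1" using 2 ss by linarith
    moreover have "(real n - 1) * ((s - s0) / n) = (s - s0) - (s - s0) / n"
     using n0 by (simp add: field_simps)
    ultimately have "g (Suc i) = s" "g i = s - (s - s0) / n" by simp_all
    then show ?thesis using p x1 by simp
   next
    case 3
    then have "g (Suc i) = g i + (t - s) / n"
     by (simp add: g_def Suc_diff_le distrib_right ring_distribs del: times_divide_eq_right)
    then show ?thesis using x2 x3 by simp
   qed
  qed
  have S1: "norm ((\<Sum>i<n1. \<Xi> (g i) (g (Suc i))) - (I s - x0)) < e / 2"
   by (rule \<delta>) (use g0 gn1 gs d_def in auto)
  have S2: "norm ((\<Sum>i<n1+n. \<Xi> (g i) (g (Suc i))) - (I t - x0)) < e / 2"
   by (rule \<delta>') (use g0 gn gs d_def in auto)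
  define r where "r i = g (n1 + i)" for i
  have rmono: "r j <= r k" if "j <= k" "k <= n" for j k
   using that
  proof (induction k)
   case (Suc k) then show ?case using gs[of "n1+k"] by (cases "j = Suc k") (auto simp: r_def)
  qed simp
  have r0: "r 0 = s" "r n = t" using gn1 gn by (auto simp: r_def)
  have rb: "s <= r j" "r j <= t" if "j <= n" for j using rmono[of 0 j] rmono[of j n] that r0 by auto
  define N where "N j k = norm ((\<Sum>i\<in>{j..<k}. \<Xi> (r i) (r (Suc i))) - \<Xi> (r j) (r k))" for j k
  \<comment> \<open>What is sewn is the gap between a Riemann sum and the germ over the whole
    stretch. It vanishes on single steps, hence the choice 0 for the linear error.\<close>
  have "N 0 n <= (sewing_const \<theta> * D) * (r n - r 0) powr \<theta> + 0 * (r n - r 0)"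
  proof (rule discrete_sewing[where m = 0 and n = n and D = D])
   show "0 <= sewing_const \<theta> * D" using sewing_const[OF \<theta>] D by simp
   show "2 * D <= sewing_const \<theta> * D * (1 - 2 powr (1 - \<theta>))" using sewing_const(2)[OF \<theta>, of D] by linarith
   show "r j <= r k" if "j <= k" "k <= n" for j k using rmono that by auto
   show "N j j <= 0" if "j <= n" for j using diag[of "r j"] rb[OF that] st that by (auto simp: N_def)
   show "N j (Suc j) <= 0 * (r (Suc j) - r j)" for j by (simp add: N_def)
   fix j i k assume ijk: "j <= i" "i <= k" "k <= n"
   have un: "{j..<k} = {j..<i} \<union> {i..<k}" using ijk by auto
   have "(\<Sum>i\<in>{j..<k}. \<Xi> (r i) (r (Suc i))) = (\<Sum>i\<in>{j..<i}. \<Xi> (r i) (r (Suc i))) + (\<Sum>i\<in>{i..<k}. \<Xi> (r i) (r (Suc i)))"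
    unfolding un by (rule sum.union_disjoint) auto
   then have "(\<Sum>i\<in>{j..<k}. \<Xi> (r i) (r (Suc i))) - \<Xi> (r j) (r k) =
    ((\<Sum>i\<in>{j..<i}. \<Xi> (r i) (r (Suc i))) - \<Xi> (r j) (r i)) +
    ((\<Sum>i\<in>{i..<k}. \<Xi> (r i) (r (Suc i))) - \<Xi> (r i) (r k)) - (\<Xi> (r j) (r k) - \<Xi> (r j) (r i) - \<Xi> (r i) (r k))"
    by simp
   then have "N j k <= N j i + N i k + norm (\<Xi> (r j) (r k) - \<Xi> (r j) (r i) - \<Xi> (r i) (r k))"
    unfolding N_def by (rule norm_split3)
   also have "norm (\<Xi> (r j) (r k) - \<Xi> (r j) (r i) - \<Xi> (r i) (r k)) <= D * (r k - r j) powr \<theta>"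
    by (rule germ) (use rb[of j] rb[of k] rmono ijk st in auto)
   finally show "N j k <= N j i + N i k + D * (r k - r j) powr \<theta>" by simp
  qed (use \<theta> D in auto)
  then have S3: "norm ((\<Sum>i<n. \<Xi> (r i) (r (Suc i))) - \<Xi> s t) <= sewing_const \<theta> * D * (t - s) powr \<theta>"
   by (simp add: N_def r0 atLeast0LessThan)
  have eq: "(\<Sum>i<n1+n. \<Xi> (g i) (g (Suc i))) = (\<Sum>i<n1. \<Xi> (g i) (g (Suc i))) + (\<Sum>i<n. \<Xi> (r i) (r (Suc i)))"
   unfolding sum_lessThan_add by (simp add: r_def)
  let ?a = "(\<Sum>i<n1. \<Xi> (g i) (g (Suc i)))" and ?b = "(\<Sum>i<n. \<Xi> (r i) (r (Suc i)))"
  have "I t - I s - \<Xi> s t = (?b - \<Xi> s t) + (?a - (I s - x0)) - (?a + ?b - (I t - x0))"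
   by simp
  then have "norm (I t - I s - \<Xi> s t) <= norm (?b - \<Xi> s t) + norm (?a - (I s - x0)) + norm (?a + ?b - (I t - x0))"
   by (rule norm_split3)
  then show "norm (I t - I s - \<Xi> s t) <= sewing_const \<theta> * D * (t - s) powr \<theta> + e"
   using S1 S2 S3 eq by auto
 qed
qed

section \<open>Discrete Gronwall estimates\<close>

text \<open>Davie's argument for a germ driven by the path itself: the bound on the left piece gives
  an \<alpha>-Hoelder increment of \<open>p\<close>, hence a defect of order \<theta>.
  \<open>B\<close> bounds the size of the germ, in applications through the maximum of the path, and
  \<open>E\<close> is the error per unit time of single steps.\<close>

lemma discrete_davie:
 fixes p :: "nat => 'b::real_normed_vector" and G :: "nat => nat => 'b" and t :: "nat => real"
 assumes \<alpha>: "0 < \<alpha>" "\<alpha> <= 1" and \<theta>: "1 < \<theta>" "\<theta> <= 2 * \<alpha>"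
  and nn: "0 <= C" "0 <= B" "0 <= E" "0 <= K" "0 < \<tau>" "\<tau> <= 1"
  and mono: "\<And>j k. m <= j ==> j <= k ==> k <= n ==> t j <= t k"
  and len: "t n - t m <= \<tau>"
  and g1: "\<And>j k. m <= j ==> j <= k ==> k <= n ==> norm (G j k) <= C * B * (t k - t j) powr \<alpha>"
  and g2: "\<And>j i k. m <= j ==> j <= i ==> i <= k ==> k <= n ==> norm (G j k - G j i - G i k)
    <= C * (t k - t j) powr \<alpha> * norm (p i - p j) + C * B * (t k - t j) powr \<theta>"
  and g3: "\<And>j. m <= j ==> j < n ==> norm (p (Suc j) - p j - G j (Suc j)) <= E * (t (Suc j) - t j)"
  and K: "2 * (C * (C + 3)) <= K * (1 - 2 powr (1 - \<theta>))" and K\<tau>: "K * \<tau> powr (\<theta> - \<alpha>) <= 1"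
  and jk: "m <= j" "j <= k" "k <= n"
 shows "norm (p k - p j - G j k) <= K * (B + E) * (t k - t j) powr \<theta> + E * (t k - t j)"
proof -
 define N where "N j k = norm (p k - p j - G j k)" for j k
 have "N j k <= K * (B + E) * (t k - t j) powr \<theta> + E * (t k - t j)"
 \<comment> \<open>In C + 3 the part C + 2 bounds the increment of the path, and the last unit is
   the second term of the germ defect.\<close>
 proof (rule discrete_sewing[where m = m and n = n and D = "C * (C + 3) * (B + E)"])
  show "0 <= K * (B + E)" using nn by simp
  show "0 <= C * (C + 3) * (B + E)" using nn by simp
  show "2 * (C * (C + 3) * (B + E)) <= K * (B + E) * (1 - 2 powr (1 - \<theta>))"
  proof -
   have "2 * (C * (C + 3)) * (B + E) <= K * (1 - 2 powr (1 - \<theta>)) * (B + E)"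
    using K nn by (intro mult_right_mono) auto
   then show ?thesis by (simp add: mult.assoc mult.left_commute mult.commute)
  qed
  show "N j j <= 0" if "m <= j" "j <= n" for j
   using g1[of j j] that by (simp add: N_def)
  show "N j (Suc j) <= E * (t (Suc j) - t j)" if "m <= j" "j < n" for j
   using g3 that by (simp add: N_def)
  fix j i k assume ijk: "m <= j" "j <= i" "i <= k" "k <= n"
   and H: "N j i <= K * (B + E) * (t i - t j) powr \<theta> + E * (t i - t j)"
  define s where "s = t i - t j"
  define r where "r = t k - t j"
  have s: "0 <= s" "s <= r" "r <= \<tau>" using mono[of j i] mono[of i k] ijk len mono[of m j] mono[of k n]
   unfolding s_def r_def by linarith+
  have sa: "s <= s powr \<alpha>"
   using s \<alpha> nn powr_mono'[of \<alpha> 1 s] by (cases "s = 0") auto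
  \<comment> \<open>The interval is so short that the unknown \<open>K\<close> drops out of the
    increment bound. Otherwise \<open>K\<close> would return in the defect and its choice would be
    circular.\<close>
  have sth: "K * s powr \<theta> <= s powr \<alpha>"
  proof -
   have "s powr \<theta> = s powr (\<theta> - \<alpha>) * s powr \<alpha>" by (simp add: powr_add[symmetric])
   moreover have "K * s powr (\<theta> - \<alpha>) <= 1"
   proof -
    have "s powr (\<theta> - \<alpha>) <= \<tau> powr (\<theta> - \<alpha>)" by (rule powr_mono2) (use s \<theta> \<alpha> in auto)
    then show ?thesis using K\<tau> nn by (meson mult_left_mono order_trans)
   qed
   ultimately show ?thesis
    using mult_right_mono[of "K * s powr (\<theta> - \<alpha>)" 1 "s powr \<alpha>"] by (simp add: mult.assoc)
  qed
  have "norm (p i - p j) <= N j i + norm (G j i)"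
   unfolding N_def using norm_triangle_ineq[of "p i - p j - G j i" "G j i"] by simp
  also have "... <= K * (B + E) * s powr \<theta> + E * s + C * B * s powr \<alpha>"
   using H g1[of j i] ijk by (auto simp: s_def)
  also have "... <= (B + E) * s powr \<alpha> + E * s powr \<alpha> + C * B * s powr \<alpha>"
   using mult_left_mono[OF sth, of "B + E"] mult_left_mono[OF sa, of E] nn by (simp add: mult.commute mult.left_commute)
  also have "... <= (C + 2) * (B + E) * s powr \<alpha>"
  proof -
   have "B + E + E + C * B <= (C + 2) * (B + E)" using nn by (simp add: algebra_simps)
   then have "(B + E + E + C * B) * s powr \<alpha> <= (C + 2) * (B + E) * s powr \<alpha>" by (rule mult_right_mono) simp
   then show ?thesis by (simp add: algebra_simps)
  qed
  also have "... <= (C + 2) * (B + E) * r powr \<alpha>"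
   using s nn \<alpha> by (intro mult_left_mono powr_mono2) auto
  finally have pd: "norm (p i - p j) <= (C + 2) * (B + E) * r powr \<alpha>" .
  have ra: "r powr \<alpha> * r powr \<alpha> <= r powr \<theta>"
  proof (cases "r = 0")
   case False
   then have "r powr (\<alpha> + \<alpha>) <= r powr \<theta>" using s nn \<theta> by (intro powr_mono') auto
   then show ?thesis unfolding powr_add .
  qed simp
  have "norm (G j k - G j i - G i k) <= C * r powr \<alpha> * ((C + 2) * (B + E) * r powr \<alpha>) + C * B * r powr \<theta>"
   using g2[OF ijk] mult_left_mono[OF pd, of "C * r powr \<alpha>"] nn by (simp add: r_def)
  also have "... = C * (C + 2) * (B + E) * (r powr \<alpha> * r powr \<alpha>) + C * B * r powr \<theta>" by (simp add: algebra_simps)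
  also have "... <= C * (C + 2) * (B + E) * r powr \<theta> + C * (B + E) * r powr \<theta>"
   using nn ra by (intro add_mono mult_left_mono mult_right_mono) auto
  also have "... = C * (C + 3) * (B + E) * r powr \<theta>" by (simp add: algebra_simps)
  finally have d: "norm (G j k - G j i - G i k) <= C * (C + 3) * (B + E) * r powr \<theta>" .
  have "p k - p j - G j k = (p i - p j - G j i) + (p k - p i - G i k) - (G j k - G j i - G i k)" by simp
  then have "N j k <= N j i + N i k + norm (G j k - G j i - G i k)"
   unfolding N_def by (rule norm_split3)
  then show "N j k <= N j i + N i k + C * (C + 3) * (B + E) * (t k - t j) powr \<theta>"
   using d by (simp add: r_def)
 qed (use assms in auto)
 then show ?thesis by (simp add: N_def)
qed

text \<open>Constants of the Gronwall argument: on intervals of length at most \<open>\<tau>\<close> a germ with constant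
 \<open>C\<close> changes the path by at most half of its maximum.\<close>

lemma gronwall_constants:
 fixes C \<alpha> \<theta> :: real
 assumes "0 < \<alpha>" "\<alpha> < \<theta>" "1 < \<theta>" "0 <= C"
 obtains K \<tau> where "0 <= K" "0 < \<tau>" "\<tau> <= 1" "2 * (C * (C + 3)) <= K * (1 - 2 powr (1 - \<theta>))"
  "K * \<tau> powr (\<theta> - \<alpha>) <= 1" "C * \<tau> powr \<alpha> + K * \<tau> powr \<theta> <= 1 / 2"
proof -
 \<comment> \<open>\<open>K\<close> depends on \<open>C\<close> and \<theta> only, so \<tau> can be
   made small afterwards.\<close>
 define K where "K = sewing_const \<theta> * (C * (C + 3))"
 have K0: "0 <= K" using sewing_const[of \<theta>] assms by (simp add: K_def)
 have K: "2 * (C * (C + 3)) = K * (1 - 2 powr (1 - \<theta>))"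
  unfolding K_def by (rule sewing_const) (use assms in auto)
 have z: "((\<lambda>\<tau>::real. \<tau> powr a) \<longlongrightarrow> 0) (at_right 0)" if "0 < a" for a
 proof (rule tendsto_zero_powrI)
  show "((\<lambda>\<tau>::real. \<tau>) \<longlongrightarrow> 0) (at_right 0)" by (rule tendsto_ident_at)
  show "\<forall>\<^sub>F \<tau>::real in at_right 0. 0 <= \<tau>" by (simp add: eventually_at_filter)
 qed (use that in auto)
 have "((\<lambda>\<tau>. K * \<tau> powr (\<theta> - \<alpha>)) \<longlongrightarrow> K * 0) (at_right 0)"
  using assms by (intro tendsto_mult tendsto_const z) auto
 then have e1: "\<forall>\<^sub>F \<tau> in at_right 0. K * \<tau> powr (\<theta> - \<alpha>) < 1" by (rule order_tendstoD) simp
 have "((\<lambda>\<tau>. C * \<tau> powr \<alpha> + K * \<tau> powr \<theta>) \<longlongrightarrow> C * 0 + K * 0) (at_right 0)"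
  using assms by (intro tendsto_add tendsto_mult tendsto_const z) auto
 then have e2: "\<forall>\<^sub>F \<tau> in at_right 0. C * \<tau> powr \<alpha> + K * \<tau> powr \<theta> < 1 / 2" by (rule order_tendstoD) simp
 have e3: "\<forall>\<^sub>F \<tau>::real in at_right 0. 0 < \<tau> \<and> \<tau> < 1"
  unfolding eventually_at_right[OF zero_less_one] by (intro exI[of _ 1]) auto
 from e1 e2 e3 have "\<forall>\<^sub>F \<tau> in at_right 0. K * \<tau> powr (\<theta> - \<alpha>) < 1 \<and> C * \<tau> powr \<alpha> + K * \<tau> powr \<theta> < 1 / 2 \<and> 0 < \<tau> \<and> \<tau> < 1"
  by eventually_elim auto
 from eventually_happens'[OF trivial_limit_at_right_real this]
 obtain \<tau> where "K * \<tau> powr (\<theta> - \<alpha>) < 1" "C * \<tau> powr \<alpha> + K * \<tau> powr \<theta> < 1 / 2" "0 < \<tau>" "\<tau> < 1"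
  by blast
 then show ?thesis using that[of K \<tau>] K0 K by auto
qed

text \<open>Discrete form of a linear equation: size and defect of the germ are proportional to the
  current value of \<open>p\<close>, as for the difference of two solutions or for the derivative of
  a flow. \<open>E\<close> is an inhomogeneity per unit time.\<close>

locale discrete_germ =
 fixes p :: "nat => 'b::real_normed_vector" and G :: "nat => nat => 'b" and t :: "nat => real"
  and n :: nat and C E \<alpha> \<theta> :: real
 assumes mono: "j <= k ==> k <= n ==> t j <= t k"
  and g1: "j <= k ==> k <= n ==> norm (G j k) <= C * norm (p j) * (t k - t j) powr \<alpha>"
  and g2: "j <= i ==> i <= k ==> k <= n ==> norm (G j k - G j i - G i k)
    <= C * (t k - t j) powr \<alpha> * norm (p i - p j) + C * norm (p j) * (t k - t j) powr \<theta>"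
  and g3: "j < n ==> norm (p (Suc j) - p j - G j (Suc j)) <= E * (t (Suc j) - t j)"
  and E0: "0 <= E" and C0: "0 <= C" and \<alpha>: "0 < \<alpha>" "\<alpha> <= 1" and \<theta>: "1 < \<theta>" "\<theta> <= 2 * \<alpha>"
begin

text \<open>With \<open>B\<close> the maximum of the path on the block, Davie's bound gives B <=
  norm (p j) + B / 2 + 3 / 2 * E, and half of \<open>B\<close> is absorbed. Carrying the summand 3 *
  E along turns the result into a pure doubling, which can be iterated.\<close>

lemma gronwall_short:
 assumes K: "0 <= K" "0 < \<tau>" "\<tau> <= 1" "2 * (C * (C + 3)) <= K * (1 - 2 powr (1 - \<theta>))"
  "K * \<tau> powr (\<theta> - \<alpha>) <= 1" "C * \<tau> powr \<alpha> + K * \<tau> powr \<theta> <= 1 / 2"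
  and jk: "j <= k" "k <= n" "t k - t j <= \<tau>"
 shows "norm (p k) + 3 * E <= 2 * (norm (p j) + 3 * E)"
proof -
 define B where "B = Max ((\<lambda>i. norm (p i)) ` {j..k})"
 have Bi: "norm (p i) <= B" if "i \<in> {j..k}" for i unfolding B_def using that by auto
 have B0: "0 <= B" using Bi[of j] jk norm_ge_zero[of "p j"] by (metis atLeastAtMost_iff order_refl order_trans)
 have "norm (p i) <= norm (p j) + B / 2 + 3 / 2 * E" if i: "i \<in> {j..k}" for i
 proof -
  have tt: "t j <= t i" "t i <= t k" using mono i jk by auto
  have "norm (p i - p j - G j i) <= K * (B + E) * (t i - t j) powr \<theta> + E * (t i - t j)"
  proof (rule discrete_davie[where m = j and n = k and \<tau> = \<tau> and \<alpha> = \<alpha> and C = C])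
   show "norm (G i l) <= C * B * (t l - t i) powr \<alpha>" if "j <= i" "i <= l" "l <= k" for i l
   proof -
    have "norm (G i l) <= C * norm (p i) * (t l - t i) powr \<alpha>" using g1 that jk by auto
    also have "... <= C * B * (t l - t i) powr \<alpha>"
     using Bi[of i] that C0 by (intro mult_right_mono mult_left_mono) auto
    finally show ?thesis .
   qed
   show "norm (G i l - G i h - G h l) <= C * (t l - t i) powr \<alpha> * norm (p h - p i) + C * B * (t l - t i) powr \<theta>"
    if "j <= i" "i <= h" "h <= l" "l <= k" for i h l
   proof -
    have "norm (G i l - G i h - G h l) <= C * (t l - t i) powr \<alpha> * norm (p h - p i) + C * norm (p i) * (t l - t i) powr \<theta>"
     using g2[of i h l] that jk by auto
    moreover have "C * norm (p i) * (t l - t i) powr \<theta> <= C * B * (t l - t i) powr \<theta>"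
     using Bi[of i] that C0 by (intro mult_right_mono mult_left_mono) auto
    ultimately show ?thesis by linarith
   qed
  qed (use mono g3 jk \<alpha> \<theta> C0 B0 E0 K i in auto)
  moreover have "(t i - t j) powr \<theta> <= \<tau> powr \<theta>" "(t i - t j) powr \<alpha> <= \<tau> powr \<alpha>"
   using tt jk \<theta> \<alpha> by (auto intro!: powr_mono2)
  then have "K * (B + E) * (t i - t j) powr \<theta> <= K * (B + E) * \<tau> powr \<theta>"
   "C * B * (t i - t j) powr \<alpha> <= C * B * \<tau> powr \<alpha>"
   using K B0 E0 C0 by (auto intro!: mult_left_mono)
  moreover have "E * (t i - t j) <= E * 1" using tt jk K E0 by (intro mult_left_mono) auto
  moreover have "norm (G j i) <= C * B * (t i - t j) powr \<alpha>"
  proof -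
   have "norm (G j i) <= C * norm (p j) * (t i - t j) powr \<alpha>" using g1 i jk by auto
   also have "... <= C * B * (t i - t j) powr \<alpha>"
     using Bi[of j] jk C0 by (intro mult_right_mono mult_left_mono) auto
   finally show ?thesis .
  qed
  moreover have "norm (p i) <= norm (p i - p j - G j i) + norm (p j) + norm (G j i)"
   using norm_triangle_ineq[of "p i - p j - G j i" "p j + G j i"] norm_triangle_ineq[of "p j" "G j i"] by simp
  moreover have "C * B * \<tau> powr \<alpha> + K * (B + E) * \<tau> powr \<theta> <= (B + E) / 2"
  proof -
   have "C * B * \<tau> powr \<alpha> + K * (B + E) * \<tau> powr \<theta> <= (B + E) * (C * \<tau> powr \<alpha> + K * \<tau> powr \<theta>)"
    using C0 E0 by (simp add: algebra_simps)
   also have "... <= (B + E) * (1 / 2)" using K B0 E0 by (intro mult_left_mono) auto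
   finally show ?thesis by simp
  qed
  ultimately show ?thesis by (simp add: field_simps)
 qed
 then have "B <= norm (p j) + B / 2 + 3 / 2 * E" unfolding B_def using jk by (subst Max_le_iff) auto
 then show ?thesis using Bi[of k] jk by simp
qed

text \<open>Induction on the number of blocks of length \<tau>. A single grid step may be longer
  than \<tau>, so each block is followed by one explicit step, which costs the factor 1 + C * L powr
  \<alpha> + L; the factor 2 is the doubling inside the block.\<close>

lemma gronwall_chain:
 assumes K: "0 <= K" "0 < \<tau>" "\<tau> <= 1" "2 * (C * (C + 3)) <= K * (1 - 2 powr (1 - \<theta>))"
  "K * \<tau> powr (\<theta> - \<alpha>) <= 1" "C * \<tau> powr \<alpha> + K * \<tau> powr \<theta> <= 1 / 2"
  and L: "t n - t 0 <= L"
  and jk: "j <= k" "k <= n" "t k - t j <= real (Suc r) * \<tau>"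
 shows "norm (p k) + 3 * E <= (2 * (1 + C * L powr \<alpha> + L)) ^ Suc r * (norm (p j) + 3 * E)"
 using jk
proof (induction r arbitrary: j)
 case 0
 have L0: "0 <= L" using L mono[of 0 n] by auto
 have "norm (p k) + 3 * E <= 2 * (norm (p j) + 3 * E)"
  by (rule gronwall_short[OF K]) (use 0 in auto)
 also have "... <= 2 * (1 + C * L powr \<alpha> + L) * (norm (p j) + 3 * E)"
  using C0 L0 E0 by (intro mult_right_mono) auto
 finally show ?case by simp
next
 case (Suc r)
 let ?Q = "2 * (1 + C * L powr \<alpha> + L)"
 have L0: "0 <= L" using L mono[of 0 n] by auto
 have Q2: "?Q \<ge> 2" using C0 L0 by simp
 have Qr: "?Q ^ Suc r * X <= ?Q ^ Suc (Suc r) * X" if "0 <= X" for X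
  using Q2 that by (intro mult_right_mono power_increasing) auto
 show ?case
 proof (cases "t k - t j <= real (Suc r) * \<tau>")
  case True
  then have "norm (p k) + 3 * E <= ?Q ^ Suc r * (norm (p j) + 3 * E)" using Suc by auto
  also have "... <= ?Q ^ Suc (Suc r) * (norm (p j) + 3 * E)" using E0 by (intro Qr) auto
  finally show ?thesis .
 next
  case False
  \<comment> \<open>The indices still within \<tau> of the start. The step after the last of them
    leaves the block, so the remaining length drops by more than \<tau>.\<close>
  define I where "I = {i. j <= i \<and> i <= k \<and> t i - t j <= \<tau>}"
  have fin: "finite I" unfolding I_def by (rule finite_subset[of _ "{..k}"]) auto
  have jI: "j \<in> I" unfolding I_def using Suc.prems K by auto
  define i where "i = Max I"
  have iI: "i \<in> I" unfolding i_def using fin jI Max_in by blast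
  have i: "j <= i" "i <= k" "t i - t j <= \<tau>" using iI by (auto simp: I_def)
  have "i \<noteq> k"
  proof
   assume "i = k"
   then have "t k - t j <= 1 * \<tau>" using i by simp
   also have "... <= real (Suc r) * \<tau>" using K by (intro mult_right_mono) auto
   finally show False using False by simp
  qed
  then have ik: "i < k" using i by simp
  have "Suc i \<notin> I" using Max_ge[OF fin, of "Suc i"] i_def by auto
  then have i1: "t (Suc i) - t j > \<tau>" unfolding I_def using i ik by auto
  have L': "t (Suc i) - t i <= L" "0 <= t (Suc i) - t i"
   using L mono[of 0 i] mono[of i "Suc i"] mono[of "Suc i" n] ik Suc.prems by auto
  have "norm (p i) + 3 * E <= 2 * (norm (p j) + 3 * E)"
   by (rule gronwall_short[OF K]) (use i Suc in auto)
  moreover have "norm (p (Suc i)) + 3 * E <= (1 + C * L powr \<alpha> + L) * (norm (p i) + 3 * E)"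
  proof -
   have "norm (p (Suc i)) <= norm (p (Suc i) - p i - G i (Suc i)) + norm (p i) + norm (G i (Suc i))"
    using norm_triangle_ineq[of "p (Suc i) - p i - G i (Suc i)" "p i + G i (Suc i)"]
     norm_triangle_ineq[of "p i" "G i (Suc i)"] by simp
   also have "... <= E * L + norm (p i) + C * norm (p i) * L powr \<alpha>"
   proof -
    have "norm (p (Suc i) - p i - G i (Suc i)) <= E * (t (Suc i) - t i)" using g3 ik Suc by auto
    also have "... <= E * L" using L' E0 by (intro mult_left_mono) auto
    finally have 1: "norm (p (Suc i) - p i - G i (Suc i)) <= E * L" .
    have "norm (G i (Suc i)) <= C * norm (p i) * (t (Suc i) - t i) powr \<alpha>" using g1 ik Suc by auto
    also have "... <= C * norm (p i) * L powr \<alpha>" using L' C0 \<alpha> by (intro mult_left_mono powr_mono2) auto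
    finally show ?thesis using 1 by linarith
   qed
   also have "... + 3 * E <= (1 + C * L powr \<alpha> + L) * (norm (p i) + 3 * E)"
    using E0 C0 L0 by (simp add: algebra_simps)
   finally show ?thesis by simp
  qed
  ultimately have "norm (p (Suc i)) + 3 * E <= (1 + C * L powr \<alpha> + L) * (2 * (norm (p j) + 3 * E))"
   using C0 L0 by (smt (verit) mult_left_mono mult_nonneg_nonneg powr_ge_zero)
  then have s: "norm (p (Suc i)) + 3 * E <= ?Q * (norm (p j) + 3 * E)" by (simp only: mult_ac)
  have "norm (p k) + 3 * E <= ?Q ^ Suc r * (norm (p (Suc i)) + 3 * E)"
   by (rule Suc.IH) (use ik i1 Suc.prems in \<open>auto simp: algebra_simps\<close>)
  also have "... <= ?Q ^ Suc r * (?Q * (norm (p j) + 3 * E))"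
   using s Q2 by (intro mult_left_mono) auto
  finally show ?thesis by (simp add: mult.assoc mult.left_commute)
 qed
qed

end

text \<open>The factor counts blocks of length \<tau> and not grid points: \<open>Q\<close> depends
  only on \<alpha>, \<theta>, \<open>C\<close> and \<open>L\<close>, and therefore survives
  refinement of the grid.\<close>

lemma discrete_gronwall:
 fixes C \<alpha> \<theta> L :: real
 assumes \<alpha>: "0 < \<alpha>" "\<alpha> <= 1" and \<theta>: "1 < \<theta>" "\<theta> <= 2 * \<alpha>" and C: "0 <= C" and L: "0 <= L"
 shows "\<exists>Q\<ge>1. \<forall>(p::nat => 'b::real_normed_vector) G t n E j k.
  discrete_germ p G t n C E \<alpha> \<theta> --> t n - t 0 <= L --> j <= k --> k <= n --> norm (p k) <= Q * (norm (p j) + E)"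
proof -
 have at: "\<alpha> < \<theta>" using \<alpha> \<theta> by linarith
 obtain K \<tau> where K: "0 <= K" "0 < \<tau>" "\<tau> <= 1" "2 * (C * (C + 3)) <= K * (1 - 2 powr (1 - \<theta>))"
  "K * \<tau> powr (\<theta> - \<alpha>) <= 1" "C * \<tau> powr \<alpha> + K * \<tau> powr \<theta> <= 1 / 2"
  using gronwall_constants[of \<alpha> \<theta> C] \<alpha> \<theta> C at by auto
 obtain r :: nat where r: "L / \<tau> < real r" using reals_Archimedean2 by blast
 have Lr: "L <= real (Suc r) * \<tau>"
 proof -
  have "L <= real r * \<tau>" using r K by (simp add: divide_less_eq)
  also have "... <= real (Suc r) * \<tau>" using K by (intro mult_right_mono) auto
  finally show ?thesis .
 qed
 let ?Q = "3 * (2 * (1 + C * L powr \<alpha> + L)) ^ Suc r"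
 have P1: "1 <= (2 * (1 + C * L powr \<alpha> + L)) ^ Suc r" using C L by (intro one_le_power) auto
 show ?thesis
 proof (intro exI[of _ ?Q] conjI allI impI)
  show "1 <= ?Q" using P1 by linarith
  fix p :: "nat => 'b" and G t n E j k
  assume dg: "discrete_germ p G t n C E \<alpha> \<theta>" and tn: "t n - t 0 <= L" and jk: "j <= k" "k <= n"
  interpret discrete_germ p G t n C E \<alpha> \<theta> by (rule dg)
  have "t k - t j <= L" using mono[of 0 j] mono[of k n] tn jk by auto
  then have "norm (p k) + 3 * E <= (2 * (1 + C * L powr \<alpha> + L)) ^ Suc r * (norm (p j) + 3 * E)"
   using gronwall_chain[OF K tn jk, of r] Lr by linarith
  moreover have "(2 * (1 + C * L powr \<alpha> + L)) ^ Suc r * (norm (p j) + 3 * E)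
   <= (2 * (1 + C * L powr \<alpha> + L)) ^ Suc r * (3 * (norm (p j) + E))"
   using P1 E0 by (intro mult_left_mono) auto
  ultimately have "norm (p k) <= (2 * (1 + C * L powr \<alpha> + L)) ^ Suc r * (3 * (norm (p j) + E))"
   using E0 by linarith
  then show "norm (p k) <= ?Q * (norm (p j) + E)" by (simp only: mult_ac)
 qed
qed

text \<open>Continuous-time counterpart of \<open>discrete_germ\<close>, with bounds for both orders
  of the time points. The same estimate then controls a path backwards in time, as the inverse flow
  requires.\<close>

locale young_germ =
 fixes lo hi \<alpha> \<theta> C :: real and p :: "real => 'b::real_normed_vector" and G :: "real => real => 'b"
 assumes germ_bound: "a \<in> {lo..hi} ==> b \<in> {lo..hi} ==> norm (G a b) <= C * norm (p a) * \<bar>b - a\<bar> powr \<alpha>"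
  and germ_defect: "a \<in> {lo..hi} ==> b \<in> {lo..hi} ==> c \<in> {lo..hi} ==> (a <= b \<and> b <= c) \<or> (c <= b \<and> b <= a) ==>
   norm (G a c - G a b - G b c) <= C * \<bar>c - a\<bar> powr \<alpha> * norm (p b - p a) + C * norm (p a) * \<bar>c - a\<bar> powr \<theta>"

lemma grid_in_interval:
 fixes s t lo hi :: real
 assumes "s \<in> {lo..hi}" "t \<in> {lo..hi}" "k <= n" "0 < n"
 shows "s + real k * ((t - s) / real n) \<in> {lo..hi}"
proof -
 define u where "u = real k / real n"
 have u: "0 <= u" "u <= 1" using assms by (auto simp: u_def)
 have "s + real k * ((t - s) / real n) = (1 - u) * s + u * t" by (simp add: u_def algebra_simps diff_divide_distrib)
 moreover have "(1 - u) *\<^sub>R s + u *\<^sub>R t \<in> {lo..hi}"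
  by (rule convexD_alt[OF convex_real_interval(5)]) (use assms u in auto)
 ultimately show ?thesis by simp
qed

text \<open>The step \<open>h\<close> may be negative; measuring discrete time by k * \<bar>h\<bar>
  reduces the backward case to the forward one.\<close>

lemma (in young_germ) discrete_germ_grid:
 assumes st: "s \<in> {lo..hi}" "t \<in> {lo..hi}" and n: "0 < n" and h: "h = (t - s) / real n"
  and err: "\<And>a b. a \<in> {lo..hi} ==> b \<in> {lo..hi} ==> \<bar>b - a\<bar> = \<bar>h\<bar> ==> norm (p b - p a - G a b) <= E * \<bar>h\<bar>"
  and E: "0 <= E" and C: "0 <= C" and \<alpha>: "0 < \<alpha>" "\<alpha> <= 1" and \<theta>: "1 < \<theta>" "\<theta> <= 2 * \<alpha>"
 shows "discrete_germ (\<lambda>k. p (s + real k * h)) (\<lambda>j k. G (s + real j * h) (s + real k * h))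
  (\<lambda>k. real k * \<bar>h\<bar>) n C E \<alpha> \<theta>"
proof
 have pt: "s + real k * h \<in> {lo..hi}" if "k <= n" for k
  unfolding h using grid_in_interval st n that by blast
 have dist: "\<bar>s + real k * h - (s + real j * h)\<bar> = real k * \<bar>h\<bar> - real j * \<bar>h\<bar>" if "j <= k" for j k
 proof -
  have "s + real k * h - (s + real j * h) = (real k - real j) * h" by (simp add: algebra_simps)
  then have "\<bar>s + real k * h - (s + real j * h)\<bar> = \<bar>real k - real j\<bar> * \<bar>h\<bar>" by (simp only: abs_mult)
  then show ?thesis using that by (simp add: left_diff_distrib del: abs_mult)
 qed
 show "real j * \<bar>h\<bar> <= real k * \<bar>h\<bar>" if "j <= k" for j k :: nat using that by (intro mult_right_mono) auto
 show "norm (G (s + real j * h) (s + real k * h)) <= C * norm (p (s + real j * h)) * (real k * \<bar>h\<bar> - real j * \<bar>h\<bar>) powr \<alpha>"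
  if "j <= k" "k <= n" for j k
  using germ_bound[OF pt pt, of j k] that unfolding dist[OF that(1)] by simp
 show "norm (G (s + real j * h) (s + real k * h) - G (s + real j * h) (s + real i * h) - G (s + real i * h) (s + real k * h))
  <= C * (real k * \<bar>h\<bar> - real j * \<bar>h\<bar>) powr \<alpha> * norm (p (s + real i * h) - p (s + real j * h))
   + C * norm (p (s + real j * h)) * (real k * \<bar>h\<bar> - real j * \<bar>h\<bar>) powr \<theta>"
  if "j <= i" "i <= k" "k <= n" for j i k
 proof -
  have "(s + real j * h <= s + real i * h \<and> s + real i * h <= s + real k * h) \<or>
   (s + real k * h <= s + real i * h \<and> s + real i * h <= s + real j * h)"
   using that by (cases "0 <= h") (auto intro: mult_right_mono mult_right_mono_neg)
  then show ?thesis
   using germ_defect[OF pt pt pt, of j i k] that unfolding dist[OF order_trans[OF that(1,2)]] by simp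
 qed
 show "norm (p (s + real (Suc j) * h) - p (s + real j * h) - G (s + real j * h) (s + real (Suc j) * h))
  <= E * (real (Suc j) * \<bar>h\<bar> - real j * \<bar>h\<bar>)" if "j < n" for j
 proof -
  have "\<bar>s + real (Suc j) * h - (s + real j * h)\<bar> = \<bar>h\<bar>" using dist[of j "Suc j"] by (simp add: algebra_simps)
  then have "norm (p (s + real (Suc j) * h) - p (s + real j * h) - G (s + real j * h) (s + real (Suc j) * h)) <= E * \<bar>h\<bar>"
   by (intro err pt) (use that in auto)
  then show ?thesis by (simp add: algebra_simps)
 qed
qed (use assms in auto)

text \<open>The two error terms are evaluated on a grid of about \<open>n\<close> steps: an error of order \<open>\<bar>b - a\<bar> powr \<alpha>\<close>
 with \<open>\<alpha> < 1\<close> is harmless as long as its coefficient \<open>\<eta>\<close> is small compared to the grid.\<close>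

lemma coarse_gronwall:
 fixes lo hi \<alpha> \<theta> C :: real
 assumes \<alpha>: "0 < \<alpha>" "\<alpha> <= 1" and \<theta>: "1 < \<theta>" "\<theta> <= 2 * \<alpha>" and C: "0 <= C" and lh: "lo < hi"
 shows "\<exists>Q\<ge>1. \<forall>(p :: real => 'b::real_normed_vector) G M \<eta> n s t. young_germ lo hi \<alpha> \<theta> C p G -->
  0 <= M --> 0 <= \<eta> --> 0 < n -->
  (\<forall>a\<in>{lo..hi}. \<forall>b\<in>{lo..hi}. norm (p b - p a - G a b) <= M * \<bar>b - a\<bar> powr \<theta> + \<eta> * \<bar>b - a\<bar> powr \<alpha>) -->
  s \<in> {lo..hi} --> t \<in> {lo..hi} -->
  norm (p t) <= Q * (norm (p s) + M * real n powr (1 - \<theta>) + \<eta> * real n powr (1 - \<alpha>))"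
proof -
 define L where "L = hi - lo"
 have L: "0 < L" using lh by (simp add: L_def)
 obtain Q where Q: "1 <= Q" "\<And>(p::nat => 'b::real_normed_vector) G t n E j k.
  discrete_germ p G t n C E \<alpha> \<theta> ==> t n - t 0 <= L ==> j <= k ==> k <= n ==> norm (p k) <= Q * (norm (p j) + E)"
  using discrete_gronwall[of \<alpha> \<theta> C L] assms L by (metis less_imp_le)
 define R where "R = (1 + C * L powr \<alpha> + L powr \<theta> + L powr \<alpha>) + Q * (1 + L powr (\<theta> - 1) + (L / 2) powr (\<alpha> - 1))"
 show ?thesis
 proof (intro exI[of _ R] conjI allI impI)
  have Qp: "0 <= Q * (1 + L powr (\<theta> - 1) + (L / 2) powr (\<alpha> - 1))" using Q by simp
  have "1 <= 1 + C * L powr \<alpha> + L powr \<theta> + L powr \<alpha>" using C by simp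
  then show "1 <= R" unfolding R_def using Qp by linarith
  fix p :: "real => 'b" and G M \<eta> s t and n :: nat
  assume yg: "young_germ lo hi \<alpha> \<theta> C p G" and M: "0 <= M" and \<eta>: "0 <= \<eta>" and n: "0 < n"
   and err: "\<forall>a\<in>{lo..hi}. \<forall>b\<in>{lo..hi}. norm (p b - p a - G a b) <= M * \<bar>b - a\<bar> powr \<theta> + \<eta> * \<bar>b - a\<bar> powr \<alpha>"
   and st: "s \<in> {lo..hi}" "t \<in> {lo..hi}"
  interpret young_germ lo hi \<alpha> \<theta> C p G by (rule yg)
  define X where "X = norm (p s)"
  define Y where "Y = M * real n powr (1 - \<theta>)"
  define Z where "Z = \<eta> * real n powr (1 - \<alpha>)"
  have nn: "0 <= X" "0 <= Y" "0 <= Z" using M \<eta> by (auto simp: X_def Y_def Z_def)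
  have tsL: "\<bar>t - s\<bar> <= L" using st by (auto simp: L_def)
  show "norm (p t) <= R * (norm (p s) + M * real n powr (1 - \<theta>) + \<eta> * real n powr (1 - \<alpha>))"
  proof (cases "\<bar>t - s\<bar> <= L / n")
   case True
   have "norm (p t) <= norm (p t - p s - G s t) + norm (p s) + norm (G s t)"
    using norm_triangle_ineq[of "p t - p s - G s t" "p s + G s t"] norm_triangle_ineq[of "p s" "G s t"] by simp
   moreover have "norm (G s t) <= C * X * L powr \<alpha>"
    using germ_bound[OF st] mult_left_mono[OF powr_mono2[of \<alpha> "\<bar>t - s\<bar>" L], of "C * X"] tsL \<alpha> C
    by (auto simp: X_def)
   moreover have "norm (p t - p s - G s t) <= M * \<bar>t - s\<bar> powr \<theta> + \<eta> * \<bar>t - s\<bar> powr \<alpha>" using err st by blast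
   moreover have "M * \<bar>t - s\<bar> powr \<theta> <= M * (L powr \<theta> * real n powr (1 - \<theta>))"
   proof (rule mult_left_mono[OF _ M])
    have "\<bar>t - s\<bar> powr \<theta> <= (L / n) powr \<theta>" using True \<theta> by (intro powr_mono2) auto
    also have "... = L powr \<theta> * real n powr (- \<theta>)" using L by (simp add: powr_divide powr_minus_divide)
    also have "... <= L powr \<theta> * real n powr (1 - \<theta>)" using n by (intro mult_left_mono powr_mono) auto
    finally show "\<bar>t - s\<bar> powr \<theta> <= L powr \<theta> * real n powr (1 - \<theta>)" .
   qed
   moreover have "\<eta> * \<bar>t - s\<bar> powr \<alpha> <= \<eta> * (L powr \<alpha> * real n powr (1 - \<alpha>))"
   proof (rule mult_left_mono[OF _ \<eta>])
    have "\<bar>t - s\<bar> powr \<alpha> <= (L / n) powr \<alpha>" using True \<alpha> by (intro powr_mono2) auto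
    also have "... = L powr \<alpha> * real n powr (- \<alpha>)" using L by (simp add: powr_divide powr_minus_divide)
    also have "... <= L powr \<alpha> * real n powr (1 - \<alpha>)" using n by (intro mult_left_mono powr_mono) auto
    finally show "\<bar>t - s\<bar> powr \<alpha> <= L powr \<alpha> * real n powr (1 - \<alpha>)" .
   qed
   ultimately have "norm (p t) <= X * (1 + C * L powr \<alpha>) + Y * L powr \<theta> + Z * L powr \<alpha>"
    by (simp add: X_def Y_def Z_def algebra_simps)
   also have "... <= (1 + C * L powr \<alpha> + L powr \<theta> + L powr \<alpha>) * (X + Y + Z)"
    using nn C by (simp add: algebra_simps)
   also have "... <= R * (X + Y + Z)"
    using nn Qp by (intro mult_right_mono) (auto simp: R_def)
   finally show ?thesis by (simp add: X_def Y_def Z_def)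
  next
   case False
   \<comment> \<open>The number of steps is rounded up so that the mesh lies between L / (2 n) and L
     / n. The upper bound serves the positive exponent \<theta> - 1, the lower bound the negative
     exponent \<alpha> - 1.\<close>
   define n' where "n' = nat \<lceil>\<bar>t - s\<bar> * n / L\<rceil>"
   have x1: "1 < \<bar>t - s\<bar> * n / L" using False L n by (simp add: field_simps)
   then have n': "0 < n'" "\<bar>t - s\<bar> * n / L <= real n'" "real n' <= 2 * (\<bar>t - s\<bar> * n / L)"
    unfolding n'_def by linarith+
   define h where "h = (t - s) / real n'"
   have h1: "\<bar>h\<bar> <= L / n" using n' L n by (simp add: h_def field_simps)
   have h2: "L / 2 / n <= \<bar>h\<bar>" using n' L n by (simp add: h_def field_simps)
   have h0: "0 < \<bar>h\<bar>" using h2 L n by (smt (verit) divide_pos_pos of_nat_0_less_iff half_gt_zero)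
   define E where "E = M * \<bar>h\<bar> powr (\<theta> - 1) + \<eta> * \<bar>h\<bar> powr (\<alpha> - 1)"
   have E: "0 <= E" using M \<eta> by (simp add: E_def)
   have Eh: "E * \<bar>h\<bar> = M * \<bar>h\<bar> powr \<theta> + \<eta> * \<bar>h\<bar> powr \<alpha>"
    using h0 by (simp add: E_def algebra_simps powr_diff)
   have err': "norm (p b - p a - G a b) <= E * \<bar>h\<bar>" if "a \<in> {lo..hi}" "b \<in> {lo..hi}" "\<bar>b - a\<bar> = \<bar>h\<bar>" for a b
    using err[rule_format, OF that(1,2)] that(3) Eh by simp
   have dg: "discrete_germ (\<lambda>k. p (s + real k * h)) (\<lambda>j k. G (s + real j * h) (s + real k * h))
    (\<lambda>k. real k * \<bar>h\<bar>) n' C E \<alpha> \<theta>"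
    by (rule discrete_germ_grid) (use st n' h_def err' E assms in auto)
   have "norm (p (s + real n' * h)) <= Q * (norm (p (s + real 0 * h)) + E)"
    by (rule Q(2)[OF dg]) (use n' h_def tsL in auto)
   moreover have "s + real n' * h = t" using n' by (simp add: h_def)
   ultimately have pt: "norm (p t) <= Q * (X + E)" by (simp add: X_def)
   have "M * \<bar>h\<bar> powr (\<theta> - 1) <= L powr (\<theta> - 1) * Y"
   proof -
    have "\<bar>h\<bar> powr (\<theta> - 1) <= (L / n) powr (\<theta> - 1)" using h1 \<theta> by (intro powr_mono2) auto
    also have "... = L powr (\<theta> - 1) * real n powr (1 - \<theta>)"
     using L powr_minus_divide[of "real n" "\<theta> - 1"] by (simp add: powr_divide)
    finally show ?thesis using mult_left_mono[OF _ M] by (fastforce simp: Y_def mult_ac)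
   qed
   moreover have "\<eta> * \<bar>h\<bar> powr (\<alpha> - 1) <= (L / 2) powr (\<alpha> - 1) * Z"
   proof -
    have "\<bar>h\<bar> powr (\<alpha> - 1) <= (L / 2 / n) powr (\<alpha> - 1)" using h2 \<alpha> L n by (intro powr_mono2') auto
    also have "... = (L / 2) powr (\<alpha> - 1) * real n powr (1 - \<alpha>)"
     using L powr_minus_divide[of "real n" "\<alpha> - 1"] powr_divide[of "L / 2" "real n" "\<alpha> - 1"] by simp
    finally show ?thesis using mult_left_mono[OF _ \<eta>] by (fastforce simp: Z_def mult_ac)
   qed
   ultimately have "E <= L powr (\<theta> - 1) * Y + (L / 2) powr (\<alpha> - 1) * Z" by (simp add: E_def)
   then have "Q * (X + E) <= Q * (X + (L powr (\<theta> - 1) * Y + (L / 2) powr (\<alpha> - 1) * Z))"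
    using Q by (intro mult_left_mono) auto
   also have "... <= Q * ((1 + L powr (\<theta> - 1) + (L / 2) powr (\<alpha> - 1)) * (X + Y + Z))"
    using nn Q by (intro mult_left_mono) (auto simp: algebra_simps)
   also have "... <= R * (X + Y + Z)"
    using nn C L by (simp add: R_def algebra_simps)
   finally show ?thesis using pt by (simp add: X_def Y_def Z_def)
  qed
 qed
qed

lemma powr_nat_tendsto_0: "a < 0 ==> (\<lambda>n. real n powr a) \<longlonglongrightarrow> 0"
 using tendsto_neg_powr[of a real] filterlim_real_sequentially by auto

lemma le_of_le_plus_vanishing:
 fixes x y :: real and e :: "nat => real"
 assumes "\<And>n. 0 < n ==> x <= y + e n" "e \<longlonglongrightarrow> 0"
 shows "x <= y"
proof -
 have "(\<lambda>n. y + e n) \<longlonglongrightarrow> y + 0" using assms by (intro tendsto_intros)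
 moreover have "\<forall>\<^sub>F n in sequentially. x <= y + e n" using eventually_gt_at_top[of "0::nat"]
  by eventually_elim (rule assms)
 ultimately show ?thesis by (metis tendsto_lowerbound add_0_right trivial_limit_sequentially)
qed

text \<open>With \<eta> = 0 in the coarse estimate and n tending to infinity the constant
  \<open>M\<close> disappears: an expansion with any \<open>M\<close> improves to one with constant
  Q * norm (p s). In particular a path that vanishes at one time vanishes at all times, which is the
  source of uniqueness.\<close>

lemma exact_gronwall:
 fixes lo hi \<alpha> \<theta> C :: real
 assumes \<alpha>: "0 < \<alpha>" "\<alpha> <= 1" and \<theta>: "1 < \<theta>" "\<theta> <= 2 * \<alpha>" and C: "0 <= C" and lh: "lo < hi"
 shows "\<exists>Q\<ge>1. \<forall>(p :: real => 'b::real_normed_vector) G M s t. young_germ lo hi \<alpha> \<theta> C p G -->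
  0 <= M --> (\<forall>a\<in>{lo..hi}. \<forall>b\<in>{lo..hi}. norm (p b - p a - G a b) <= M * \<bar>b - a\<bar> powr \<theta>) -->
  s \<in> {lo..hi} --> t \<in> {lo..hi} -->
  norm (p t) <= Q * norm (p s) \<and> norm (p t - p s - G s t) <= Q * norm (p s) * \<bar>t - s\<bar> powr \<theta>"
proof -
 obtain Q where Q: "1 <= Q" and Qb: "\<And>(p :: real => 'b::real_normed_vector) G M \<eta> n s t. young_germ lo hi \<alpha> \<theta> C p G ==>
  0 <= M ==> 0 <= \<eta> ==> 0 < n ==>
  (\<forall>a\<in>{lo..hi}. \<forall>b\<in>{lo..hi}. norm (p b - p a - G a b) <= M * \<bar>b - a\<bar> powr \<theta> + \<eta> * \<bar>b - a\<bar> powr \<alpha>) ==>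
  s \<in> {lo..hi} ==> t \<in> {lo..hi} ==>
  norm (p t) <= Q * (norm (p s) + M * real n powr (1 - \<theta>) + \<eta> * real n powr (1 - \<alpha>))"
  using coarse_gronwall[OF assms] by blast
 define L where "L = hi - lo"
 have L: "0 < L" using lh by (simp add: L_def)
 have at: "\<alpha> < \<theta>" using \<alpha> \<theta> by linarith
 obtain K \<tau> where K: "0 <= K" "0 < \<tau>" "\<tau> <= 1" "2 * (C * (C + 3)) <= K * (1 - 2 powr (1 - \<theta>))"
  "K * \<tau> powr (\<theta> - \<alpha>) <= 1" "C * \<tau> powr \<alpha> + K * \<tau> powr \<theta> <= 1 / 2"
  using gronwall_constants[of \<alpha> \<theta> C] \<alpha> \<theta> C at by auto
 define R where "R = Q + K * Q + (Q + 1 + C * L powr \<alpha>) * \<tau> powr (-\<theta>)"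
 show ?thesis
 proof (intro exI[of _ R] conjI allI impI)
  have R: "Q <= R" "K * Q <= R" "(Q + 1 + C * L powr \<alpha>) * \<tau> powr (-\<theta>) <= R"
   using Q K C by (auto simp: R_def)
  then show "1 <= R" using Q by simp
  fix p :: "real => 'b" and G M s t
  assume yg: "young_germ lo hi \<alpha> \<theta> C p G" and M: "0 <= M"
   and err: "\<forall>a\<in>{lo..hi}. \<forall>b\<in>{lo..hi}. norm (p b - p a - G a b) <= M * \<bar>b - a\<bar> powr \<theta>"
   and st: "s \<in> {lo..hi}" "t \<in> {lo..hi}"
  interpret young_germ lo hi \<alpha> \<theta> C p G by (rule yg)
  have pb: "norm (p r) <= Q * norm (p s)" if r: "r \<in> {lo..hi}" for r
  proof (rule le_of_le_plus_vanishing)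
   fix n :: nat assume "0 < n"
   from Qb[OF yg M order_refl this _ st(1) r] err
   show "norm (p r) <= Q * norm (p s) + Q * M * real n powr (1 - \<theta>)" by (simp add: algebra_simps)
  next
   have "(\<lambda>n. Q * M * real n powr (1 - \<theta>)) \<longlonglongrightarrow> Q * M * 0"
    using \<theta> by (intro tendsto_intros powr_nat_tendsto_0) auto
   then show "(\<lambda>n. Q * M * real n powr (1 - \<theta>)) \<longlonglongrightarrow> 0" by simp
  qed
  then show "norm (p t) <= R * norm (p s)" using R st by (meson mult_right_mono norm_ge_zero order_trans)
  have tsL: "\<bar>t - s\<bar> <= L" using st by (auto simp: L_def)
  show "norm (p t - p s - G s t) <= R * norm (p s) * \<bar>t - s\<bar> powr \<theta>"
  proof (cases "\<bar>t - s\<bar> <= \<tau>")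
   case True
   define B where "B = Q * norm (p s)"
   have B0: "0 <= B" using Q by (simp add: B_def)
   \<comment> \<open>Error per unit time on the grid with n steps. It tends to 0, so Davie's bound
     holds in the limit with \<open>B\<close> alone.\<close>
   define e where "e n = M * (\<bar>t - s\<bar> powr (\<theta> - 1) * real n powr (1 - \<theta>))" for n :: nat
   have e0: "e \<longlonglongrightarrow> 0"
   proof -
    have "e \<longlonglongrightarrow> M * (\<bar>t - s\<bar> powr (\<theta> - 1) * 0)"
     unfolding e_def using \<theta> by (intro tendsto_intros powr_nat_tendsto_0) auto
    then show ?thesis by simp
   qed
   have "norm (p t - p s - G s t) <= K * B * \<bar>t - s\<bar> powr \<theta>"
   proof (rule le_of_le_plus_vanishing)
    fix n :: nat assume n: "0 < n"
    define h where "h = (t - s) / real n"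
    have E: "0 <= e n" using M by (simp add: e_def)
    have hh: "\<bar>h\<bar> powr (\<theta> - 1) = \<bar>t - s\<bar> powr (\<theta> - 1) * real n powr (1 - \<theta>)"
     using powr_minus_divide[of "real n" "\<theta> - 1"] by (simp add: h_def powr_divide)
    have Eh: "e n * \<bar>h\<bar> = M * \<bar>h\<bar> powr \<theta>"
     unfolding e_def hh[symmetric] by (cases "h = 0") (auto simp: powr_diff)
    have err': "norm (p b - p a - G a b) <= e n * \<bar>h\<bar>" if "a \<in> {lo..hi}" "b \<in> {lo..hi}" "\<bar>b - a\<bar> = \<bar>h\<bar>" for a b
     using err[rule_format, OF that(1,2)] that(3) Eh by simp
    interpret d: discrete_germ "\<lambda>k. p (s + real k * h)" "\<lambda>j k. G (s + real j * h) (s + real k * h)"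
     "\<lambda>k. real k * \<bar>h\<bar>" n C "e n" \<alpha> \<theta>
     by (rule discrete_germ_grid) (use st n h_def err' E assms in auto)
    have pk: "norm (p (s + real k * h)) <= B" if "k <= n" for k
     unfolding B_def h_def using grid_in_interval[OF st that n] pb by blast
    have "norm (p (s + real n * h) - p (s + real 0 * h) - G (s + real 0 * h) (s + real n * h))
     <= K * (B + e n) * (real n * \<bar>h\<bar> - real 0 * \<bar>h\<bar>) powr \<theta> + e n * (real n * \<bar>h\<bar> - real 0 * \<bar>h\<bar>)"
    proof (rule discrete_davie[where m = 0 and n = n and \<tau> = \<tau> and \<alpha> = \<alpha> and C = C])
     show "norm (G (s + real j * h) (s + real k * h)) <= C * B * (real k * \<bar>h\<bar> - real j * \<bar>h\<bar>) powr \<alpha>"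
      if "j <= k" "k <= n" for j k
      by (rule order_trans[OF d.g1[OF that]])
       (use pk[of j] that C in \<open>auto intro!: mult_right_mono mult_left_mono\<close>)
     show "norm (G (s + real j * h) (s + real k * h) - G (s + real j * h) (s + real i * h) - G (s + real i * h) (s + real k * h))
      <= C * (real k * \<bar>h\<bar> - real j * \<bar>h\<bar>) powr \<alpha> * norm (p (s + real i * h) - p (s + real j * h))
      + C * B * (real k * \<bar>h\<bar> - real j * \<bar>h\<bar>) powr \<theta>"
      if "j <= i" "i <= k" "k <= n" for j i k
      by (rule order_trans[OF d.g2[OF that]])
       (use pk[of j] that C in \<open>auto intro!: mult_right_mono mult_left_mono\<close>)
     show "real n * \<bar>h\<bar> - real 0 * \<bar>h\<bar> <= \<tau>" using True n by (simp add: h_def)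
    qed (use assms K B0 E d.mono d.g3 in auto)
    moreover have eqs: "s + real n * h = t" "real n * \<bar>h\<bar> = \<bar>t - s\<bar>" using n by (auto simp: h_def)
    ultimately have "norm (p t - p s - G s t) <= K * (B + e n) * \<bar>t - s\<bar> powr \<theta> + e n * \<bar>t - s\<bar>"
     unfolding eqs by simp
    then show "norm (p t - p s - G s t) <= K * B * \<bar>t - s\<bar> powr \<theta> + (K * \<bar>t - s\<bar> powr \<theta> + \<bar>t - s\<bar>) * e n"
     by (simp add: algebra_simps)
   next
    have "(\<lambda>n. (K * \<bar>t - s\<bar> powr \<theta> + \<bar>t - s\<bar>) * e n) \<longlonglongrightarrow> (K * \<bar>t - s\<bar> powr \<theta> + \<bar>t - s\<bar>) * 0"
     by (intro tendsto_intros e0)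
    then show "(\<lambda>n. (K * \<bar>t - s\<bar> powr \<theta> + \<bar>t - s\<bar>) * e n) \<longlonglongrightarrow> 0" by simp
   qed
   also have "... = (K * Q) * (norm (p s) * \<bar>t - s\<bar> powr \<theta>)" by (simp add: B_def)
   also have "... <= R * (norm (p s) * \<bar>t - s\<bar> powr \<theta>)" using R by (intro mult_right_mono) auto
   finally show ?thesis by (simp add: mult.assoc)
  next
   \<comment> \<open>Away from the diagonal the crude bound is enough, since \<bar>t - s\<bar> powr
     \<theta> is at least \<tau> powr \<theta>.\<close>
   case False
   have "norm (p t - p s - G s t) <= norm (p t) + norm (p s) + norm (G s t)"
    using norm_triangle_ineq4[of "p t - p s" "G s t"] norm_triangle_ineq4[of "p t" "p s"] by linarith
   also have "norm (p t) <= Q * norm (p s)" using pb st by auto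
   also have "norm (G s t) <= C * norm (p s) * L powr \<alpha>"
    using germ_bound[OF st] mult_left_mono[OF powr_mono2[of \<alpha> "\<bar>t - s\<bar>" L], of "C * norm (p s)"] tsL \<alpha> C
    by auto
   finally have "norm (p t - p s - G s t) <= (Q + 1 + C * L powr \<alpha>) * norm (p s) * 1"
    by (simp add: algebra_simps)
   also have "... <= (Q + 1 + C * L powr \<alpha>) * norm (p s) * (\<tau> powr (-\<theta>) * \<bar>t - s\<bar> powr \<theta>)"
   proof (rule mult_left_mono)
    have "\<tau> powr (-\<theta>) * \<tau> powr \<theta> = 1" using K by (simp add: powr_add[symmetric])
    moreover have "\<tau> powr \<theta> <= \<bar>t - s\<bar> powr \<theta>" using False K \<theta> by (intro powr_mono2) auto
    ultimately show "1 <= \<tau> powr (-\<theta>) * \<bar>t - s\<bar> powr \<theta>" by (metis mult_left_mono powr_ge_zero)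
    show "0 <= (Q + 1 + C * L powr \<alpha>) * norm (p s)" using Q C by simp
   qed
   also have "... = ((Q + 1 + C * L powr \<alpha>) * \<tau> powr (-\<theta>)) * (norm (p s) * \<bar>t - s\<bar> powr \<theta>)" by (simp add: mult_ac)
   also have "... <= R * (norm (p s) * \<bar>t - s\<bar> powr \<theta>)" using R by (intro mult_right_mono) auto
   finally show ?thesis by (simp add: mult.assoc)
  qed
 qed
qed

section \<open>Young differential equations: uniqueness and existence\<close>

text \<open>The interval is arbitrary and no value of the field is prescribed at \<open>lo\<close>,
  so that subintervals and the time-reversed field are again instances. All bounds concern
  increments in time and are symmetric in s and t.\<close>

locale young_field =
 fixes lo hi \<alpha> \<beta> \<theta> C :: real and A :: "real => 'a::euclidean_space => 'a" and DA :: "real => 'a => 'a => 'a"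
 assumes lh: "lo < hi" and \<alpha>: "0 < \<alpha>" "\<alpha> < 1" and \<beta>: "0 < \<beta>" "\<beta> < 1"
  and \<theta>_def: "\<theta> = \<alpha> * (1 + \<beta>)" and \<theta>1: "1 < \<theta>" and C0: "0 <= C"
  and A_bound: "s \<in> {lo..hi} ==> t \<in> {lo..hi} ==> norm (A t x - A s x) <= C * \<bar>t - s\<bar> powr \<alpha>"
  and A_deriv: "t \<in> {lo..hi} ==> (A t has_derivative DA t x) (at x)"
  and DA_bound: "s \<in> {lo..hi} ==> t \<in> {lo..hi} ==> norm (DA t x h - DA s x h) <= C * \<bar>t - s\<bar> powr \<alpha> * norm h"
  and DA_holder: "s \<in> {lo..hi} ==> t \<in> {lo..hi} ==>
   norm ((DA t x h - DA s x h) - (DA t y h - DA s y h)) <= C * \<bar>t - s\<bar> powr \<alpha> * norm (x - y) powr \<beta> * norm h"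
begin

abbreviation I where "I \<equiv> {lo..hi}"
definition inc where "inc s t x = A t x - A s x"
definition dinc where "dinc s t x h = DA t x h - DA s x h"
definition L where "L = hi - lo"

lemma L: "0 < L" using lh by (simp add: L_def)
lemma dist_I: "s \<in> I ==> t \<in> I ==> \<bar>t - s\<bar> <= L" by (auto simp: L_def)

lemma \<theta>: "\<theta> = \<alpha> + \<alpha> * \<beta>" "\<theta> <= 2 * \<alpha>" "\<alpha> < \<theta>" "0 < \<theta>"
proof -
 show 1: "\<theta> = \<alpha> + \<alpha> * \<beta>" by (simp add: \<theta>_def algebra_simps)
 have "\<alpha> * \<beta> <= \<alpha> * 1" using \<alpha> \<beta> by (intro mult_left_mono) auto
 then show "\<theta> <= 2 * \<alpha>" using 1 by simp
 show "\<alpha> < \<theta>" using 1 \<alpha> \<beta> by auto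
 show "0 < \<theta>" using \<theta>1 by simp
qed

lemma inc_bound: "s \<in> I ==> t \<in> I ==> norm (inc s t x) <= C * \<bar>t - s\<bar> powr \<alpha>"
 using A_bound by (simp add: inc_def)

lemma dinc_bound: "s \<in> I ==> t \<in> I ==> norm (dinc s t x h) <= C * \<bar>t - s\<bar> powr \<alpha> * norm h"
 using DA_bound by (simp add: dinc_def)

lemma dinc_holder: "s \<in> I ==> t \<in> I ==>
 norm (dinc s t x h - dinc s t y h) <= C * \<bar>t - s\<bar> powr \<alpha> * norm (x - y) powr \<beta> * norm h"
 using DA_holder by (simp add: dinc_def)

lemma inc_deriv:
 assumes "s \<in> I" "t \<in> I" shows "(inc s t has_derivative dinc s t x) (at x within S)"
 unfolding inc_def[abs_def] dinc_def[abs_def]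
 by (intro has_derivative_diff has_derivative_at_withinI[OF A_deriv] assms)

lemma inc_deriv_shift:
 assumes "s \<in> I" "t \<in> I"
 shows "((\<lambda>v. inc s t (x + v)) has_derivative dinc s t (x + v)) (at v within S)"
proof -
 have "((\<lambda>v. x + v) has_derivative (\<lambda>h. h)) (at v within S)" by (auto intro!: derivative_eq_intros)
 from has_derivative_compose[OF this inc_deriv[OF assms]] show ?thesis by simp
qed

lemma inc_add: "inc a c x = inc a b x + inc b c x" by (simp add: inc_def)
lemma dinc_add: "dinc a c x h = dinc a b x h + dinc b c x h" by (simp add: dinc_def)

lemma dinc_linear: assumes "s \<in> I" "t \<in> I" shows "linear (dinc s t x)"
 using has_derivative_linear[OF inc_deriv[OF assms]] .

lemma inc_lip:
 assumes "s \<in> I" "t \<in> I"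
 shows "norm (inc s t x - inc s t y) <= C * \<bar>t - s\<bar> powr \<alpha> * norm (x - y)"
 by (rule differentiable_bound[of UNIV "inc s t" "dinc s t"])
  (use inc_deriv dinc_bound assms in \<open>auto intro: onorm_le\<close>)

text \<open>Write x' = x + z and y' = y + w. Passing from z to w costs the Lipschitz bound, and v
  \<mapsto> inc s t (x + v) - inc s t (y + v) has a derivative of size norm (x - y) powr \<beta>.
  Applied to two solutions at two times, both terms are linear in the difference of the solutions,
  so this difference is driven by a linear germ.\<close>

lemma inc_four:
 assumes "s \<in> I" "t \<in> I"
 shows "norm ((inc s t x' - inc s t x) - (inc s t y' - inc s t y)) <=
  C * \<bar>t - s\<bar> powr \<alpha> * norm ((x' - x) - (y' - y)) + C * \<bar>t - s\<bar> powr \<alpha> * norm (x - y) powr \<beta> * norm (y' - y)"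
proof -
 define z where "z = x' - x"
 define w where "w = y' - y"
 define g where "g v = inc s t (x + v) - inc s t (y + v)" for v
 have "norm (g w - g 0) <= C * \<bar>t - s\<bar> powr \<alpha> * norm (x - y) powr \<beta> * norm (w - 0)"
 proof (rule differentiable_bound[of UNIV g "\<lambda>v h. dinc s t (x + v) h - dinc s t (y + v) h"])
  fix v
  show "(g has_derivative (\<lambda>h. dinc s t (x + v) h - dinc s t (y + v) h)) (at v within UNIV)"
   unfolding g_def[abs_def] by (intro has_derivative_diff inc_deriv_shift assms)
  show "onorm (\<lambda>h. dinc s t (x + v) h - dinc s t (y + v) h) <= C * \<bar>t - s\<bar> powr \<alpha> * norm (x - y) powr \<beta>"
   using dinc_holder[OF assms, of "x + v" _ "y + v"] by (intro onorm_le) simp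
 qed auto
 moreover have "norm (inc s t (x + z) - inc s t (x + w)) <= C * \<bar>t - s\<bar> powr \<alpha> * norm (z - w)"
  using inc_lip[OF assms, of "x + z" "x + w"] by simp
 moreover have eq: "(inc s t x' - inc s t x) - (inc s t y' - inc s t y) = (inc s t (x + z) - inc s t (x + w)) + (g w - g 0)"
  by (simp add: g_def z_def w_def)
 ultimately show ?thesis
  unfolding eq z_def[symmetric] w_def[symmetric]
  using norm_triangle_ineq[of "inc s t (x + z) - inc s t (x + w)" "g w - g 0"] by simp
qed

lemma inc_taylor:
 assumes "s \<in> I" "t \<in> I"
 shows "norm (inc s t (x + z) - inc s t x - dinc s t x z) <= C * \<bar>t - s\<bar> powr \<alpha> * norm z powr (1 + \<beta>)"
proof -
 define g where "g v = inc s t (x + v) - dinc s t x v" for v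
 have "norm (g z - g 0) <= C * \<bar>t - s\<bar> powr \<alpha> * norm z powr \<beta> * norm (z - 0)"
 proof (rule differentiable_bound[of "cball 0 (norm z)" g "\<lambda>v h. dinc s t (x + v) h - dinc s t x h"])
  fix v :: 'a assume v: "v \<in> cball 0 (norm z)"
  have "(dinc s t x has_derivative dinc s t x) (at v within cball 0 (norm z))"
   using dinc_linear[OF assms] by (intro bounded_linear_imp_has_derivative linear_conv_bounded_linear[THEN iffD1])
  then show "(g has_derivative (\<lambda>h. dinc s t (x + v) h - dinc s t x h)) (at v within cball 0 (norm z))"
   unfolding g_def[abs_def] by (intro has_derivative_diff inc_deriv_shift assms)
  have "norm (dinc s t (x + v) h - dinc s t x h) <= C * \<bar>t - s\<bar> powr \<alpha> * norm z powr \<beta> * norm h" for h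
  proof -
   have "norm (dinc s t (x + v) h - dinc s t x h) <= C * \<bar>t - s\<bar> powr \<alpha> * norm v powr \<beta> * norm h"
    using dinc_holder[OF assms, of "x + v" h x] by simp
   also have "... <= C * \<bar>t - s\<bar> powr \<alpha> * norm z powr \<beta> * norm h"
    using v C0 \<beta> by (intro mult_right_mono mult_left_mono powr_mono2) auto
   finally show ?thesis .
  qed
  then show "onorm (\<lambda>h. dinc s t (x + v) h - dinc s t x h) <= C * \<bar>t - s\<bar> powr \<alpha> * norm z powr \<beta>"
   by (intro onorm_le)
 qed auto
 moreover have "dinc s t x 0 = 0" using linear_0[OF dinc_linear[OF assms]] .
 moreover have "norm z powr (1 + \<beta>) = norm z powr \<beta> * norm z" by (simp add: powr_add)
 ultimately show ?thesis by (simp add: g_def mult.assoc algebra_simps)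
qed

text \<open>Davie's notion of solution. The constant \<open>M\<close> stays explicit because
  stability is uniform over all solutions with the same \<open>M\<close>; the times a and b come in
  either order, so a solution can be read backwards.\<close>

definition sol :: "real => (real => 'a) => bool" where
 "sol M y \<longleftrightarrow> 0 <= M \<and> (\<forall>a\<in>I. \<forall>b\<in>I. norm (y b - y a - inc a b (y a)) <= M * \<bar>b - a\<bar> powr \<theta>)"

lemma powr_le_L: "0 <= r ==> r <= L ==> 0 <= e ==> r powr (a + e) <= L powr e * r powr a"
 unfolding powr_add mult.commute[of "r powr a"] by (intro mult_right_mono powr_mono2) auto

text \<open>Stated for bare values instead of a path, so that it serves solutions in continuous time
  and Euler schemes on a grid alike.\<close>

lemma davie_imp_holder:
 assumes "norm (y' - y - v) <= M * r powr \<theta>" "norm v <= C * r powr \<alpha>" "0 <= r" "r <= L" "0 <= M"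
 shows "norm (y' - y) <= (M * L powr (\<theta> - \<alpha>) + C) * r powr \<alpha>"
proof -
 have "norm (y' - y) <= norm (y' - y - v) + norm v" using norm_triangle_ineq[of "y' - y - v" v] by simp
 also have "... <= M * r powr (\<alpha> + (\<theta> - \<alpha>)) + C * r powr \<alpha>" using assms by simp
 also have "... <= M * (L powr (\<theta> - \<alpha>) * r powr \<alpha>) + C * r powr \<alpha>"
  using assms \<theta> by (intro add_right_mono mult_left_mono powr_le_L) auto
 finally show ?thesis by (simp add: algebra_simps)
qed

lemma sol_holder:
 assumes "sol M y" "a \<in> I" "b \<in> I"
 shows "norm (y b - y a) <= (M * L powr (\<theta> - \<alpha>) + C) * \<bar>b - a\<bar> powr \<alpha>"
 by (rule davie_imp_holder[where v = "inc a b (y a)"]) (use assms dist_I inc_bound in \<open>auto simp: sol_def\<close>)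

text \<open>Reversing the order of the times moves the base point of the increment from b to a. This
  costs C * r powr \<alpha> times a path increment of order r powr \<alpha>, and 2 * \<alpha> >=
  \<theta> absorbs it.\<close>

lemma sol_of_ordered:
 assumes "0 <= M" and H: "\<And>a b. a \<in> I ==> b \<in> I ==> a <= b ==> norm (y b - y a - inc a b (y a)) <= M * (b - a) powr \<theta>"
 shows "sol (M + C * (M * L powr (\<theta> - \<alpha>) + C) * L powr (2 * \<alpha> - \<theta>)) y"
 unfolding sol_def
proof (intro conjI ballI)
 let ?H = "M * L powr (\<theta> - \<alpha>) + C"
 have H0: "0 <= ?H" using assms C0 by simp
 then show "0 <= M + C * ?H * L powr (2 * \<alpha> - \<theta>)" using assms C0 by simp
 fix a b assume ab: "a \<in> I" "b \<in> I"
 show "norm (y b - y a - inc a b (y a)) <= (M + C * ?H * L powr (2 * \<alpha> - \<theta>)) * \<bar>b - a\<bar> powr \<theta>"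
 proof (cases "a <= b")
  case True
  have "norm (y b - y a - inc a b (y a)) <= M * \<bar>b - a\<bar> powr \<theta>" using H ab True by simp
  also have "... <= (M + C * ?H * L powr (2 * \<alpha> - \<theta>)) * \<bar>b - a\<bar> powr \<theta>"
   using C0 H0 by (intro mult_right_mono) auto
  finally show ?thesis .
 next
  case False
  define r where "r = a - b"
  have r: "0 <= r" "r <= L" "\<bar>b - a\<bar> = r" "\<bar>a - b\<bar> = r" using False dist_I[OF ab] by (auto simp: r_def)
  have h: "norm (y a - y b) <= ?H * r powr \<alpha>"
   by (rule davie_imp_holder[where v = "inc b a (y b)"])
    (use H[of b a] ab False r inc_bound[of b a] assms in \<open>auto simp: r_def\<close>)
  have "y b - y a - inc a b (y a) = - (y a - y b - inc b a (y b)) + (inc b a (y a) - inc b a (y b))"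
   by (simp add: inc_def)
  then have "norm (y b - y a - inc a b (y a)) <= norm (y a - y b - inc b a (y b)) + norm (inc b a (y a) - inc b a (y b))"
   by (metis norm_minus_cancel norm_triangle_ineq)
  also have "... <= M * r powr \<theta> + C * r powr \<alpha> * (?H * r powr \<alpha>)"
   using H[of b a] ab False inc_lip[of b a "y a" "y b"] r C0
    mult_left_mono[OF h, of "C * r powr \<alpha>"] by (auto simp: r_def)
  also have "C * r powr \<alpha> * (?H * r powr \<alpha>) = C * ?H * r powr (\<theta> + (2 * \<alpha> - \<theta>))"
   using powr_add[of r \<alpha> \<alpha>] by (simp add: algebra_simps)
  also have "... <= C * ?H * (L powr (2 * \<alpha> - \<theta>) * r powr \<theta>)"
   using C0 H0 r \<theta> by (intro mult_left_mono powr_le_L) auto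
  finally show ?thesis using r by (simp add: algebra_simps)
 qed
qed

text \<open>Two paths solving the equation up to error differ by a path driven by the increments of the
 field along them.\<close>

lemma difference_germ:
 assumes y: "\<And>a b. a \<in> I ==> b \<in> I ==> norm (y b - y a) <= H * \<bar>b - a\<bar> powr \<alpha>" and H: "0 <= H"
 shows "young_germ lo hi \<alpha> \<theta> (C * (1 + H powr \<beta>)) (\<lambda>r. y' r - y r) (\<lambda>a b. inc a b (y' a) - inc a b (y a))"
proof
 fix a b assume ab: "a \<in> I" "b \<in> I"
 have "norm (inc a b (y' a) - inc a b (y a)) <= C * \<bar>b - a\<bar> powr \<alpha> * norm (y' a - y a)" by (rule inc_lip[OF ab])
 also have "... = C * 1 * norm (y' a - y a) * \<bar>b - a\<bar> powr \<alpha>" by simp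
 also have "... <= C * (1 + H powr \<beta>) * norm (y' a - y a) * \<bar>b - a\<bar> powr \<alpha>"
  using C0 by (intro mult_right_mono mult_left_mono) auto
 finally show "norm (inc a b (y' a) - inc a b (y a)) <= C * (1 + H powr \<beta>) * norm (y' a - y a) * \<bar>b - a\<bar> powr \<alpha>" .
next
 fix a b c assume I: "a \<in> I" "b \<in> I" "c \<in> I" and o: "(a <= b \<and> b <= c) \<or> (c <= b \<and> b <= a)"
 define r where "r = \<bar>c - a\<bar>"
 have r: "\<bar>b - a\<bar> <= r" "\<bar>c - b\<bar> <= r" "0 <= r" using o by (auto simp: r_def)
 have pa: "\<bar>c - b\<bar> powr \<alpha> <= r powr \<alpha>" using r \<alpha> by (intro powr_mono2) auto
 have yb: "norm (y b - y a) powr \<beta> <= H powr \<beta> * r powr (\<alpha> * \<beta>)"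
 proof -
  have "norm (y b - y a) <= H * r powr \<alpha>"
   using y[OF I(1,2)] H r \<alpha> by (meson abs_ge_zero mult_left_mono order_trans powr_mono2 less_imp_le)
  then have "norm (y b - y a) powr \<beta> <= (H * r powr \<alpha>) powr \<beta>" using \<beta> by (intro powr_mono2) auto
  then show ?thesis using H by (simp add: powr_mult powr_powr)
 qed
 have "norm (inc a c (y' a) - inc a c (y a) - (inc a b (y' a) - inc a b (y a)) - (inc b c (y' b) - inc b c (y b)))
  = norm ((inc b c (y' b) - inc b c (y b)) - (inc b c (y' a) - inc b c (y a)))"
  by (simp add: inc_add[of a c _ b] norm_minus_commute algebra_simps)
 also have "... <= C * \<bar>c - b\<bar> powr \<alpha> * norm ((y' b - y b) - (y' a - y a))
  + C * \<bar>c - b\<bar> powr \<alpha> * norm (y b - y a) powr \<beta> * norm (y' a - y a)"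
  by (rule inc_four[OF I(2,3)])
 also have "... <= C * r powr \<alpha> * norm ((y' b - y b) - (y' a - y a))
  + C * r powr \<alpha> * (H powr \<beta> * r powr (\<alpha> * \<beta>)) * norm (y' a - y a)"
  using pa yb C0 by (intro add_mono mult_right_mono mult_left_mono mult_mono) auto
 also have "... = C * 1 * r powr \<alpha> * norm ((y' b - y b) - (y' a - y a))
  + C * H powr \<beta> * norm (y' a - y a) * r powr \<theta>"
  by (simp add: \<theta>(1) powr_add algebra_simps)
 also have "... <= C * (1 + H powr \<beta>) * r powr \<alpha> * norm ((y' b - y b) - (y' a - y a))
  + C * (1 + H powr \<beta>) * norm (y' a - y a) * r powr \<theta>"
  using C0 by (intro add_mono mult_right_mono mult_left_mono) auto
 finally show "norm (inc a c (y' a) - inc a c (y a) - (inc a b (y' a) - inc a b (y a)) - (inc b c (y' b) - inc b c (y b)))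
  <= C * (1 + H powr \<beta>) * \<bar>c - a\<bar> powr \<alpha> * norm ((y' b - y b) - (y' a - y a))
  + C * (1 + H powr \<beta>) * norm (y' a - y a) * \<bar>c - a\<bar> powr \<theta>" by (simp add: r_def)
qed

lemma difference_error:
 assumes "sol M y" "sol M y'"
 shows "\<forall>a\<in>I. \<forall>b\<in>I. norm ((y' b - y b) - (y' a - y a) - (inc a b (y' a) - inc a b (y a))) <= 2 * M * \<bar>b - a\<bar> powr \<theta>"
proof (intro ballI)
 fix a b assume ab: "a \<in> I" "b \<in> I"
 have "(y' b - y b) - (y' a - y a) - (inc a b (y' a) - inc a b (y a)) =
  (y' b - y' a - inc a b (y' a)) - (y b - y a - inc a b (y a))" by simp
 then have "norm ((y' b - y b) - (y' a - y a) - (inc a b (y' a) - inc a b (y a))) <=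
  norm (y' b - y' a - inc a b (y' a)) + norm (y b - y a - inc a b (y a))" by (metis norm_triangle_ineq4)
 also have "... <= M * \<bar>b - a\<bar> powr \<theta> + M * \<bar>b - a\<bar> powr \<theta>"
  using assms ab unfolding sol_def by (intro add_mono) auto
 finally show "norm ((y' b - y b) - (y' a - y a) - (inc a b (y' a) - inc a b (y a))) <= 2 * M * \<bar>b - a\<bar> powr \<theta>" by simp
qed

text \<open>\<open>exact_gronwall\<close> for the difference of two solutions. The second bound is
  linear in the initial distance; later this permits division by the step of a difference
  quotient.\<close>

lemma sol_stability:
 "\<exists>Q\<ge>1. \<forall>y y' s t. sol M y --> sol M y' --> s \<in> I --> t \<in> I --> norm (y' t - y t) <= Q * norm (y' s - y s) \<and>
  norm ((y' t - y t) - (y' s - y s) - (inc s t (y' s) - inc s t (y s))) <= Q * norm (y' s - y s) * \<bar>t - s\<bar> powr \<theta>"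
proof -
 \<comment> \<open>For negative \<open>M\<close> no path is a solution, but \<open>Q\<close> has to
   be chosen before the paths are given; the maximum with 0 makes \<open>H\<close> admissible for
   every \<open>M\<close>.\<close>
 define H where "H = max 0 (M * L powr (\<theta> - \<alpha>) + C)"
 have CH: "0 <= C * (1 + H powr \<beta>)" using C0 by simp
 obtain Q where Q: "1 <= Q" "\<And>(p :: real => 'a) G M s t. young_germ lo hi \<alpha> \<theta> (C * (1 + H powr \<beta>)) p G ==>
  0 <= M ==> (\<forall>a\<in>{lo..hi}. \<forall>b\<in>{lo..hi}. norm (p b - p a - G a b) <= M * \<bar>b - a\<bar> powr \<theta>) ==>
  s \<in> {lo..hi} ==> t \<in> {lo..hi} ==>
  norm (p t) <= Q * norm (p s) \<and> norm (p t - p s - G s t) <= Q * norm (p s) * \<bar>t - s\<bar> powr \<theta>"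
  using exact_gronwall[OF \<alpha>(1) less_imp_le[OF \<alpha>(2)] \<theta>1 \<theta>(2) CH lh] by blast
 show ?thesis
 proof (intro exI[of _ Q] conjI allI impI Q(1))
  fix y y' s t assume a: "sol M y" "sol M y'" "s \<in> I" "t \<in> I"
  have M: "0 <= 2 * M" using a by (simp add: sol_def)
  have yH: "norm (y b - y a) <= H * \<bar>b - a\<bar> powr \<alpha>" if "a \<in> I" "b \<in> I" for a b
   using order_trans[OF sol_holder[OF a(1) that] mult_right_mono] by (simp add: H_def)
  have H0: "0 <= H" by (simp add: H_def)
  note * = Q(2)[OF difference_germ[of y H y', OF yH H0] M difference_error[OF a(1,2)] a(3,4)]
  show "norm (y' t - y t) <= Q * norm (y' s - y s)"
   "norm ((y' t - y t) - (y' s - y s) - (inc s t (y' s) - inc s t (y s))) <= Q * norm (y' s - y s) * \<bar>t - s\<bar> powr \<theta>"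
   using * by auto
 qed
qed

lemma sol_mono: "sol M y ==> M <= M' ==> sol M' y"
 unfolding sol_def by (meson mult_right_mono order_trans powr_ge_zero)

lemma sol_unique:
 assumes "sol M y" "sol M' y'" "s \<in> I" "t \<in> I" "y s = y' s"
 shows "y t = y' t"
proof -
 have "sol (max M M') y" "sol (max M M') y'" using assms sol_mono by auto
 then show ?thesis using sol_stability[of "max M M'"] assms by fastforce
qed

end

section \<open>Existence: Euler schemes on dyadic grids\<close>

primrec euler :: "(real => 'a => 'a) => (nat => real) => 'a => nat => 'a::real_vector" where
 "euler A t x 0 = x"
| "euler A t x (Suc k) = euler A t x k + (A (t (Suc k)) (euler A t x k) - A (t k) (euler A t x k))"

context young_field
begin

text \<open>The defect is bounded by a multiple of \<open>\<bar>y i - y j\<bar> powr \<beta>\<close>, which is sublinear in the constant \<open>K\<close>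
 of the bound being proved; this is why the bound can be made self-consistent on the whole interval.\<close>

lemma euler_davie:
 "\<exists>K\<ge>0. \<forall>t n x j k. (\<forall>j k. j <= k --> k <= n --> t j <= t k) --> (\<forall>k\<le>n. t k \<in> I) --> j <= k --> k <= n -->
  norm (euler A t x k - euler A t x j - inc (t j) (t k) (euler A t x j)) <= K * (t k - t j) powr \<theta>"
proof -
 define a where "a = L powr (\<theta> - \<alpha>)"
 define \<sigma> where "\<sigma> = 1 - 2 powr (1 - \<theta>)"
 have "2 powr (1 - \<theta>) < 2 powr 0" using \<theta>1 by (intro powr_less_mono) auto
 then have \<sigma>: "0 < \<sigma>" by (simp add: \<sigma>_def)
 define X where "X = 4 * C * (a + C) powr \<beta> / \<sigma>"
 have X: "0 <= X" using C0 \<sigma> by (simp add: X_def)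
 \<comment> \<open>This \<open>K\<close> satisfies X * K powr \<beta> <= K: because \<beta> < 1 one
   can arrange K powr (1 - \<beta>) = 1 + X.\<close>
 define K where "K = (1 + X) powr (1 / (1 - \<beta>))"
 have K1: "1 <= K" unfolding K_def using X \<beta> by (intro ge_one_powr_ge_zero) auto
 have Kb: "X * K powr \<beta> <= K"
 proof -
  have "K powr (1 - \<beta>) = 1 + X" using X \<beta> by (simp add: K_def powr_powr)
  then have "X * K powr \<beta> <= K powr (1 - \<beta>) * K powr \<beta>" by (intro mult_right_mono) auto
  also have "... = K" using K1 by (simp add: powr_add[symmetric])
  finally show ?thesis .
 qed
 define D where "D = 2 * C * (K * a + C) powr \<beta>"
 have D0: "0 <= D" using C0 by (simp add: D_def)
 have a0: "0 <= a" by (simp add: a_def)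
 have DK: "2 * D <= K * \<sigma>"
 proof -
  have "K * a + C <= (a + C) * K" using K1 C0 mult_left_mono[of 1 K C] by (simp add: algebra_simps)
  then have "(K * a + C) powr \<beta> <= ((a + C) * K) powr \<beta>" using K1 a0 C0 \<beta> by (intro powr_mono2) auto
  also have "... = (a + C) powr \<beta> * K powr \<beta>" using a0 C0 K1 by (simp add: powr_mult)
  finally have "2 * D <= 4 * C * ((a + C) powr \<beta> * K powr \<beta>)" using C0 by (simp add: D_def mult_left_mono)
  also have "... = X * K powr \<beta> * \<sigma>" using \<sigma> by (simp add: X_def)
  also have "... <= K * \<sigma>" using Kb \<sigma> by (intro mult_right_mono) auto
  finally show ?thesis .
 qed
 show ?thesis
 proof (intro exI[of _ K] conjI allI impI)
  show "0 <= K" using K1 by simp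
  fix t :: "nat => real" and n x j k
  assume mono: "\<forall>j k. j <= k --> k <= n --> t j <= t k" and tI: "\<forall>k\<le>n. t k \<in> I" and jk: "j <= k" "k <= n"
  define y where "y = euler A t x"
  define N where "N j k = norm (y k - y j - inc (t j) (t k) (y j))" for j k
  have "N j k <= K * (t k - t j) powr \<theta> + 0 * (t k - t j)"
  proof (rule discrete_sewing[where m = 0 and n = n and D = D])
   show "N j j <= 0" for j by (simp add: N_def inc_def)
   show "N j (Suc j) <= 0 * (t (Suc j) - t j)" for j by (simp add: N_def inc_def y_def)
   fix j i k assume ijk: "j <= i" "i <= k" "k <= n" and H: "N j i <= K * (t i - t j) powr \<theta> + 0 * (t i - t j)"
   define r where "r = t k - t j"
   have ts: "t j <= t i" "t i <= t k" "t j \<in> I" "t i \<in> I" "t k \<in> I" using mono tI ijk by auto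
   have r: "0 <= t i - t j" "t i - t j <= r" "0 <= t k - t i" "t k - t i <= r" "r <= L" using ts by (auto simp: r_def L_def)
   have "norm (y i - y j) <= (K * a + C) * (t i - t j) powr \<alpha>"
    unfolding a_def by (rule davie_imp_holder[where v = "inc (t j) (t i) (y j)"])
     (use H K1 r inc_bound[of "t j" "t i" "y j"] ts in \<open>auto simp: N_def\<close>)
   also have "... <= (K * a + C) * r powr \<alpha>"
    using r K1 a0 C0 \<alpha> by (intro mult_left_mono powr_mono2) auto
   finally have "norm (y i - y j) powr \<beta> <= ((K * a + C) * r powr \<alpha>) powr \<beta>" using \<beta> by (intro powr_mono2) auto
   then have d: "norm (y i - y j) powr \<beta> <= (K * a + C) powr \<beta> * r powr (\<alpha> * \<beta>)"
    using K1 a0 C0 by (simp add: powr_mult powr_powr)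
   let ?d = "norm (y i - y j)" and ?s = "t k - t i"
   \<comment> \<open>Interpolation between the Lipschitz bound and the sup bound of the increment:
     the distance is traded for its \<beta>-th power at the price of a factor 2.\<close>
   have mn: "min ?d 2 <= 2 * ?d powr \<beta>"
   proof (cases "?d <= 1")
    case True
    then have "?d powr 1 <= ?d powr \<beta>" using \<beta> by (intro powr_mono') auto
    moreover have "?d powr 1 = ?d" by simp
    ultimately show ?thesis using norm_ge_zero[of "y i - y j"] by linarith
   next
    case False
    then have "1 <= ?d powr \<beta>" using \<beta> by (intro ge_one_powr_ge_zero) auto
    then show ?thesis by linarith
   qed
   have "norm (inc (t i) (t k) (y j) - inc (t i) (t k) (y i)) <= C * ?s powr \<alpha> * ?d"
    using inc_lip[of "t i" "t k" "y j" "y i"] ts by (simp add: norm_minus_commute)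
   moreover have "norm (inc (t i) (t k) (y j) - inc (t i) (t k) (y i)) <= C * ?s powr \<alpha> * 2"
    using inc_bound[of "t i" "t k" "y i"] inc_bound[of "t i" "t k" "y j"] ts
     norm_triangle_ineq4[of "inc (t i) (t k) (y j)" "inc (t i) (t k) (y i)"] by simp
   ultimately have "norm (inc (t i) (t k) (y j) - inc (t i) (t k) (y i)) <= C * ?s powr \<alpha> * min ?d 2"
    by (simp add: min_def)
   also have "... <= C * r powr \<alpha> * (2 * ((K * a + C) powr \<beta> * r powr (\<alpha> * \<beta>)))"
    using r \<alpha> C0 mn d by (intro mult_mono mult_left_mono powr_mono2 order_trans[OF mn]) auto
   also have "... = D * r powr \<theta>" by (simp add: D_def \<theta>(1) powr_add)
   finally have e: "norm (inc (t i) (t k) (y j) - inc (t i) (t k) (y i)) <= D * r powr \<theta>" .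
   have "y k - y j - inc (t j) (t k) (y j) = (y i - y j - inc (t j) (t i) (y j)) +
    (y k - y i - inc (t i) (t k) (y i)) - (inc (t i) (t k) (y j) - inc (t i) (t k) (y i))"
    by (simp add: inc_def)
   then have "N j k <= N j i + N i k + norm (inc (t i) (t k) (y j) - inc (t i) (t k) (y i))"
    unfolding N_def by (rule norm_split3)
   then show "N j k <= N j i + N i k + D * (t k - t j) powr \<theta>" using e by (simp add: r_def)
  qed (use \<theta>1 K1 D0 DK mono jk \<sigma>_def in auto)
  then show "norm (euler A t x k - euler A t x j - inc (t j) (t k) (euler A t x j)) <= K * (t k - t j) powr \<theta>"
   by (simp add: N_def y_def)
 qed
qed

lemma A_tendsto:
 assumes "\<forall>n. s n \<in> I" "s \<longlonglongrightarrow> s'" "s' \<in> I" "x \<longlonglongrightarrow> x'"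
 shows "(\<lambda>n. A (s n) (x n)) \<longlonglongrightarrow> A s' x'"
proof -
 have "(\<lambda>n. C * \<bar>s n - s'\<bar> powr \<alpha>) \<longlonglongrightarrow> C * \<bar>s' - s'\<bar> powr \<alpha>"
  using assms \<alpha> by (intro tendsto_intros tendsto_powr') auto
 then have "(\<lambda>n. C * \<bar>s n - s'\<bar> powr \<alpha>) \<longlonglongrightarrow> 0" by simp
 then have "(\<lambda>n. A (s n) (x n) - A s' (x n)) \<longlonglongrightarrow> 0"
  by (rule Lim_null_comparison[rotated]) (use A_bound assms in auto)
 moreover have "(\<lambda>n. A s' (x n)) \<longlonglongrightarrow> A s' x'"
  using has_derivative_continuous[OF A_deriv[OF assms(3), of x']] assms(4) by (simp add: isCont_tendsto_compose)
 ultimately have "(\<lambda>n. A (s n) (x n) - A s' (x n) + A s' (x n)) \<longlonglongrightarrow> 0 + A s' x'" by (intro tendsto_add)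
 then show ?thesis by simp
qed

text \<open>The Euler values of a finer level, read at the nodes of level m, satisfy the scheme of
  level m up to K * \<delta> m powr \<theta> per step, by Davie's estimate. The discrete Gronwall
  lemma turns this into a uniform Cauchy bound, so the limit is found without compactness, and the
  constant \<open>M\<close> is the same for all initial points.\<close>

lemma sol_exists_from_lo: "\<exists>M\<ge>0. \<forall>x. \<exists>y. y lo = x \<and> sol M y"
proof -
 obtain K where K: "0 <= K" and Kb: "\<And>t n x j k. (\<forall>j k. j <= k --> k <= n --> t j <= t k) ==> (\<forall>k\<le>n. t k \<in> I) ==> j <= k ==> k <= n ==>
  norm (euler A t x k - euler A t x j - inc (t j) (t k) (euler A t x j)) <= K * (t k - t j) powr \<theta>"
  using euler_davie by blast
 define H where "H = K * L powr (\<theta> - \<alpha>) + C"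
 have H0: "0 <= H" using K C0 by (simp add: H_def)
 define C' where "C' = C * (1 + H powr \<beta>)"
 have C': "0 <= C'" using C0 by (simp add: C'_def)
 obtain Q where Q: "1 <= Q" "\<And>(p::nat => 'a) G t n E j k.
  discrete_germ p G t n C' E \<alpha> \<theta> ==> t n - t 0 <= L ==> j <= k ==> k <= n ==> norm (p k) <= Q * (norm (p j) + E)"
  using discrete_gronwall[of \<alpha> \<theta> C' L] \<alpha> \<theta> \<theta>1 C' L by (metis less_imp_le)
 have "\<exists>y. y lo = x \<and> sol (K + C * (K * L powr (\<theta> - \<alpha>) + C) * L powr (2 * \<alpha> - \<theta>)) y" for x
 proof -
  define \<delta> where "\<delta> m = L / 2 ^ m" for m :: nat
  have \<delta>: "0 < \<delta> m" for m using L by (simp add: \<delta>_def)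
  define t where "t m k = lo + real k * \<delta> m" for m k :: nat
  define e where "e m = euler A (t m) x" for m
  have tI: "t m k \<in> I" if "k <= 2 ^ m" for m k
  proof -
   have "real k * \<delta> m <= 2 ^ m * \<delta> m" using that \<delta>[of m] by (intro mult_right_mono) (auto simp: of_nat_le_iff[symmetric] simp del: of_nat_le_iff)
   moreover have "2 ^ m * \<delta> m = L" by (simp add: \<delta>_def)
   moreover have "0 <= real k * \<delta> m" using \<delta>[of m] by simp
   ultimately show ?thesis unfolding t_def by (auto simp: L_def)
  qed
  have tmono: "t m j <= t m k" if "j <= k" for m j k
   using that \<delta>[of m] by (auto simp: t_def intro!: mult_right_mono)
  have dav: "norm (e m k - e m j - inc (t m j) (t m k) (e m j)) <= K * (t m k - t m j) powr \<theta>"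
   if "j <= k" "k <= 2 ^ m" for m j k
   unfolding e_def by (rule Kb[of "2 ^ m"]) (use that tI tmono in auto)
  have hol: "norm (e m k - e m j) <= H * (t m k - t m j) powr \<alpha>" if "j <= k" "k <= 2 ^ m" for m j k
   unfolding H_def
   by (rule davie_imp_holder[where v = "inc (t m j) (t m k) (e m j)"])
    (use dav[OF that] tI[of k m] tI[of j m] that tmono[OF that(1)] inc_bound[of "t m j" "t m k"] K
     dist_I[of "t m j" "t m k"] in auto)
  have tsub: "t (m + d) (k * 2 ^ d) = t m k" for m d k
   by (simp add: t_def \<delta>_def power_add)
  \<comment> \<open>Error per unit time of level m; it tends to 0 because \<theta> > 1.\<close>
  define E where "E m = K * \<delta> m powr (\<theta> - 1)" for m
  have comp: "norm (e (m + d) (k * 2 ^ d) - e m k) <= Q * E m" if k: "k <= 2 ^ m" for m d k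
  proof -
   define e' where "e' j = e (m + d) (j * 2 ^ d)" for j
   have le: "j * 2 ^ d <= 2 ^ (m + d)" if "j <= 2 ^ m" for j :: nat
    using that by (simp add: power_add)
   have dg: "discrete_germ (\<lambda>k. e' k - e m k) (\<lambda>j k. inc (t m j) (t m k) (e' j) - inc (t m j) (t m k) (e m j))
    (t m) (2 ^ m) C' (E m) \<alpha> \<theta>"
   proof
    show "t m j <= t m k" if "j <= k" for j k by (rule tmono[OF that])
    show "norm (inc (t m j) (t m k) (e' j) - inc (t m j) (t m k) (e m j)) <= C' * norm (e' j - e m j) * (t m k - t m j) powr \<alpha>"
     if "j <= k" "k <= 2 ^ m" for j k
    proof -
     have "norm (inc (t m j) (t m k) (e' j) - inc (t m j) (t m k) (e m j)) <= C * norm (e' j - e m j) * (t m k - t m j) powr \<alpha>"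
      using inc_lip[of "t m j" "t m k" "e' j" "e m j"] tI[of j m] tI[of k m] that tmono[OF that(1)] by (simp add: mult_ac)
     also have "... <= C' * norm (e' j - e m j) * (t m k - t m j) powr \<alpha>"
      using C0 by (intro mult_right_mono) (auto simp: C'_def algebra_simps)
     finally show ?thesis .
    qed
    show "norm (e' (Suc j) - e m (Suc j) - (e' j - e m j) -
      (inc (t m j) (t m (Suc j)) (e' j) - inc (t m j) (t m (Suc j)) (e m j))) <= E m * (t m (Suc j) - t m j)"
     if "j < 2 ^ m" for j
    proof -
     have "e m (Suc j) - e m j - inc (t m j) (t m (Suc j)) (e m j) = 0" by (simp add: e_def inc_def)
     then have "norm (e' (Suc j) - e m (Suc j) - (e' j - e m j) -
      (inc (t m j) (t m (Suc j)) (e' j) - inc (t m j) (t m (Suc j)) (e m j)))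
      = norm (e' (Suc j) - e' j - inc (t m j) (t m (Suc j)) (e' j))" by (simp add: algebra_simps)
     also have "... <= K * (t m (Suc j) - t m j) powr \<theta>"
      using dav[of "j * 2 ^ d" "Suc j * 2 ^ d" "m + d"] le[of "Suc j"] that
      unfolding e'_def tsub by (simp del: mult_Suc)
     also have "t m (Suc j) - t m j = \<delta> m" by (simp add: t_def algebra_simps)
     also have "K * \<delta> m powr \<theta> = E m * \<delta> m" using \<delta>[of m] by (simp add: E_def powr_diff)
     finally show ?thesis by (simp add: t_def algebra_simps)
    qed
    show "norm (inc (t m j) (t m k) (e' j) - inc (t m j) (t m k) (e m j)
      - (inc (t m j) (t m i) (e' j) - inc (t m j) (t m i) (e m j))
      - (inc (t m i) (t m k) (e' i) - inc (t m i) (t m k) (e m i)))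
     <= C' * (t m k - t m j) powr \<alpha> * norm (e' i - e m i - (e' j - e m j)) + C' * norm (e' j - e m j) * (t m k - t m j) powr \<theta>"
     if ijk: "j <= i" "i <= k" "k <= 2 ^ m" for j i k
    proof -
     define r where "r = t m k - t m j"
     have ts: "t m j <= t m i" "t m i <= t m k" using ijk tmono by auto
     have r: "0 <= r" "t m k - t m i <= r" "t m i - t m j <= r" using ts by (auto simp: r_def)
     have pa: "(t m k - t m i) powr \<alpha> <= r powr \<alpha>" using r ts \<alpha> by (intro powr_mono2) auto
     have yb: "norm (e m i - e m j) powr \<beta> <= H powr \<beta> * r powr (\<alpha> * \<beta>)"
     proof -
      have "norm (e m i - e m j) <= H * (t m i - t m j) powr \<alpha>" using hol ijk by auto
      also have "... <= H * r powr \<alpha>" using r ts \<alpha> H0 by (intro mult_left_mono powr_mono2) auto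
      finally have "norm (e m i - e m j) powr \<beta> <= (H * r powr \<alpha>) powr \<beta>" using \<beta> by (intro powr_mono2) auto
      then show ?thesis using H0 by (simp add: powr_mult powr_powr)
     qed
     have "norm (inc (t m j) (t m k) (e' j) - inc (t m j) (t m k) (e m j)
      - (inc (t m j) (t m i) (e' j) - inc (t m j) (t m i) (e m j))
      - (inc (t m i) (t m k) (e' i) - inc (t m i) (t m k) (e m i)))
      = norm ((inc (t m i) (t m k) (e' i) - inc (t m i) (t m k) (e m i))
       - (inc (t m i) (t m k) (e' j) - inc (t m i) (t m k) (e m j)))"
      by (simp add: inc_add[of "t m j" "t m k" _ "t m i"] norm_minus_commute algebra_simps)
     also have "... <= C * \<bar>t m k - t m i\<bar> powr \<alpha> * norm ((e' i - e m i) - (e' j - e m j))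
      + C * \<bar>t m k - t m i\<bar> powr \<alpha> * norm (e m i - e m j) powr \<beta> * norm (e' j - e m j)"
      by (rule inc_four) (use tI ijk in auto)
     also have "... = C * (t m k - t m i) powr \<alpha> * norm ((e' i - e m i) - (e' j - e m j))
      + C * (t m k - t m i) powr \<alpha> * norm (e m i - e m j) powr \<beta> * norm (e' j - e m j)"
      using ts by simp
     also have "... <= C * r powr \<alpha> * norm ((e' i - e m i) - (e' j - e m j))
      + C * r powr \<alpha> * (H powr \<beta> * r powr (\<alpha> * \<beta>)) * norm (e' j - e m j)"
      using pa yb C0 by (intro add_mono mult_right_mono mult_left_mono mult_mono) auto
     also have "... = C * 1 * r powr \<alpha> * norm ((e' i - e m i) - (e' j - e m j))
      + C * H powr \<beta> * norm (e' j - e m j) * r powr \<theta>"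
      by (simp add: \<theta>(1) powr_add algebra_simps)
     also have "... <= C' * r powr \<alpha> * norm ((e' i - e m i) - (e' j - e m j))
      + C' * norm (e' j - e m j) * r powr \<theta>"
      unfolding C'_def using C0 by (intro add_mono mult_right_mono mult_left_mono) auto
     finally show ?thesis by (simp add: r_def)
    qed
   qed (use K C' \<alpha> \<theta> \<theta>1 in \<open>auto simp: E_def\<close>)
   have "norm (e' k - e m k) <= Q * (norm (e' 0 - e m 0) + E m)"
    by (rule Q(2)[OF dg]) (use k in \<open>auto simp: t_def \<delta>_def\<close>)
   then show ?thesis by (simp add: e'_def e_def)
  qed
  \<comment> \<open>Index of the last node of level m at or before r. Nodes of a coarse level are
    nodes of all finer ones, so two levels can be compared at the coarse node.\<close>
  define \<kappa> where "\<kappa> m r = nat \<lfloor>(r - lo) / \<delta> m\<rfloor>" for m r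
  have \<kappa>: "t m (\<kappa> m r) <= r" "r < t m (\<kappa> m r) + \<delta> m" "\<kappa> m r <= 2 ^ m" "t m (\<kappa> m r) \<in> I" if "r \<in> I" for m r
  proof -
   have q: "0 <= (r - lo) / \<delta> m" using that \<delta>[of m] by simp
   have k1: "real (\<kappa> m r) <= (r - lo) / \<delta> m" "(r - lo) / \<delta> m < real (\<kappa> m r) + 1" unfolding \<kappa>_def using q by linarith+
   show "t m (\<kappa> m r) <= r" "r < t m (\<kappa> m r) + \<delta> m" using k1 \<delta>[of m] by (auto simp: t_def field_simps)
   have "(r - lo) / \<delta> m <= 2 ^ m" using that L by (simp add: \<delta>_def L_def field_simps)
   then have "real (\<kappa> m r) <= real (2 ^ m)" using k1 unfolding of_nat_power of_nat_numeral by linarith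
   then show "\<kappa> m r <= 2 ^ m" by (simp only: of_nat_le_iff)
   then show "t m (\<kappa> m r) \<in> I" by (rule tI)
  qed
  define f where "f m r = e m (\<kappa> m r)" for m r
  have fd: "norm (f (m + d) r - f m r) <= H * \<delta> m powr \<alpha> + Q * E m" if r: "r \<in> I" for m d r
  proof -
   have "t (m + d) (\<kappa> m r * 2 ^ d) < t (m + d) (\<kappa> (m + d) r) + \<delta> (m + d)"
    unfolding tsub using \<kappa>[OF r, of m] \<kappa>[OF r, of "m + d"] by linarith
   then have "real (\<kappa> m r * 2 ^ d) * \<delta> (m + d) < (real (\<kappa> (m + d) r) + 1) * \<delta> (m + d)" by (simp add: t_def algebra_simps)
   then have "real (\<kappa> m r * 2 ^ d) < real (\<kappa> (m + d) r) + 1" using \<delta>[of "m + d"] by (simp only: mult_less_cancel_right_pos)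
   then have le: "\<kappa> m r * 2 ^ d <= \<kappa> (m + d) r" by linarith
   have "norm (f (m + d) r - e (m + d) (\<kappa> m r * 2 ^ d)) <= H * (t (m + d) (\<kappa> (m + d) r) - t m (\<kappa> m r)) powr \<alpha>"
    using hol[OF le \<kappa>(3)[OF r]] by (simp add: f_def tsub)
   also have "... <= H * \<delta> m powr \<alpha>"
    using \<kappa>[OF r, of m] \<kappa>[OF r, of "m + d"] tmono[OF le, of "m + d"] H0 \<alpha>
    by (intro mult_left_mono powr_mono2) (auto simp: tsub)
   finally have 1: "norm (f (m + d) r - e (m + d) (\<kappa> m r * 2 ^ d)) <= H * \<delta> m powr \<alpha>" .
   have 2: "norm (e (m + d) (\<kappa> m r * 2 ^ d) - f m r) <= Q * E m"
    unfolding f_def by (rule comp) (use \<kappa>[OF r] in auto)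
   show ?thesis using norm_triangle_ineq[of "f (m + d) r - e (m + d) (\<kappa> m r * 2 ^ d)" "e (m + d) (\<kappa> m r * 2 ^ d) - f m r"] 1 2 by simp
  qed
  have \<delta>0: "\<delta> \<longlonglongrightarrow> 0"
   unfolding \<delta>_def[abs_def] using LIMSEQ_divide_realpow_zero[of 2 L] by simp
  have "(\<lambda>m. H * \<delta> m powr \<alpha> + Q * E m) \<longlonglongrightarrow> H * 0 powr \<alpha> + Q * (K * 0 powr (\<theta> - 1))"
   unfolding E_def using \<delta>0 \<delta> \<alpha> \<theta>1 by (intro tendsto_intros tendsto_powr') (auto simp: less_imp_le)
  then have \<omega>0: "(\<lambda>m. H * \<delta> m powr \<alpha> + Q * E m) \<longlonglongrightarrow> 0" by simp
  have "\<exists>l. (\<lambda>m. f m r) \<longlonglongrightarrow> l" if r: "r \<in> I" for r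
  proof -
   have "Cauchy (\<lambda>m. f m r)"
   proof (rule CauchyI')
    fix \<epsilon> :: real assume "0 < \<epsilon>"
    then obtain m0 where m0: "\<And>m. m \<ge> m0 ==> H * \<delta> m powr \<alpha> + Q * E m < \<epsilon>"
     using order_tendstoD(2)[OF \<omega>0] by (auto simp: eventually_sequentially)
    show "\<exists>M. \<forall>m\<ge>M. \<forall>n>m. dist (f m r) (f n r) < \<epsilon>"
    proof (intro exI[of _ m0] allI impI)
     fix m n assume "m0 <= m" "m < n"
     then show "dist (f m r) (f n r) < \<epsilon>"
      using fd[OF r, of m "n - m"] m0[of m] by (simp add: dist_norm norm_minus_commute)
    qed
   qed
   then show ?thesis by (simp add: Cauchy_convergent_iff convergent_def)
  qed
  then obtain y where y: "\<And>r. r \<in> I ==> (\<lambda>m. f m r) \<longlonglongrightarrow> y r" by metis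
  have t\<kappa>: "(\<lambda>m. t m (\<kappa> m r)) \<longlonglongrightarrow> r" if r: "r \<in> I" for r
  proof -
   have "(\<lambda>m. r - \<delta> m) \<longlonglongrightarrow> r - 0" by (intro tendsto_intros \<delta>0)
   then have 1: "(\<lambda>m. r - \<delta> m) \<longlonglongrightarrow> r" by simp
   show ?thesis
   proof (rule tendsto_sandwich[OF _ _ 1 tendsto_const])
    show "\<forall>\<^sub>F m in sequentially. r - \<delta> m <= t m (\<kappa> m r)"
     by (intro always_eventually allI) (use \<kappa>(2)[OF r] in \<open>auto simp: algebra_simps intro: less_imp_le\<close>)
    show "\<forall>\<^sub>F m in sequentially. t m (\<kappa> m r) <= r"
     by (intro always_eventually allI \<kappa>(1)[OF r])
   qed
  qed
  \<comment> \<open>Along the nodes Davie's expansion holds with \<open>K\<close> independent of m;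
    it passes to the limit since the field is jointly continuous.\<close>
  have ord: "norm (y b - y a - inc a b (y a)) <= K * (b - a) powr \<theta>" if ab: "a \<in> I" "b \<in> I" "a <= b" for a b
  proof (rule tendsto_le[OF trivial_limit_sequentially])
   show "(\<lambda>m. norm (f m b - f m a - (A (t m (\<kappa> m b)) (f m a) - A (t m (\<kappa> m a)) (f m a)))) \<longlonglongrightarrow> norm (y b - y a - inc a b (y a))"
    unfolding inc_def using \<kappa> ab y t\<kappa> by (intro tendsto_intros A_tendsto) auto
   show "(\<lambda>m. K * (t m (\<kappa> m b) - t m (\<kappa> m a)) powr \<theta>) \<longlonglongrightarrow> K * (b - a) powr \<theta>"
   proof (intro tendsto_intros tendsto_powr' t\<kappa> ab)
    have "t m (\<kappa> m a) <= t m (\<kappa> m b)" for m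
     unfolding \<kappa>_def using ab \<delta>[of m] by (intro tmono nat_mono floor_mono divide_right_mono) auto
    then show "b - a \<noteq> 0 \<or> 0 < \<theta> \<and> (\<forall>\<^sub>F m in sequentially. 0 <= t m (\<kappa> m b) - t m (\<kappa> m a))" using \<theta> by auto
   qed
   show "\<forall>\<^sub>F m in sequentially. norm (f m b - f m a - (A (t m (\<kappa> m b)) (f m a) - A (t m (\<kappa> m a)) (f m a)))
    <= K * (t m (\<kappa> m b) - t m (\<kappa> m a)) powr \<theta>"
   proof (intro always_eventually allI)
    fix m
    have "\<kappa> m a <= \<kappa> m b" unfolding \<kappa>_def using ab \<delta>[of m] by (intro nat_mono floor_mono divide_right_mono) auto
    then show "norm (f m b - f m a - (A (t m (\<kappa> m b)) (f m a) - A (t m (\<kappa> m a)) (f m a)))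
     <= K * (t m (\<kappa> m b) - t m (\<kappa> m a)) powr \<theta>"
     using dav[of "\<kappa> m a" "\<kappa> m b" m] \<kappa>(3)[OF ab(2), of m] by (simp add: f_def inc_def)
   qed
  qed
  have "lo \<in> I" using lh by simp
  then have "(\<lambda>m. f m lo) \<longlonglongrightarrow> y lo" by (rule y)
  moreover have "f m lo = x" for m by (simp add: f_def \<kappa>_def e_def)
  ultimately have "(\<lambda>m::nat. x) \<longlonglongrightarrow> y lo" by simp
  then have "y lo = x" by (simp add: LIMSEQ_const_iff)
  moreover have "sol (K + C * (K * L powr (\<theta> - \<alpha>) + C) * L powr (2 * \<alpha> - \<theta>)) y"
   using ord K by (intro sol_of_ordered) auto
  ultimately show ?thesis by blast
 qed
 moreover have "0 <= K + C * (K * L powr (\<theta> - \<alpha>) + C) * L powr (2 * \<alpha> - \<theta>)" using K C0 by simp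
 ultimately show ?thesis by blast
qed

end

section \<open>Solutions through any point at any time, and the two-sided flow\<close>

lemma (in young_field) young_field_sub:
 assumes "lo <= a" "a < b" "b <= hi"
 shows "young_field a b \<alpha> \<beta> \<theta> C A DA"
 by unfold_locales
  (use assms \<alpha> \<beta> \<theta>_def \<theta>1 C0 A_bound A_deriv DA_bound DA_holder in auto)

lemma (in young_field) young_field_reverse:
 "young_field (- hi) (- lo) \<alpha> \<beta> \<theta> C (\<lambda>t. A (- t)) (\<lambda>t. DA (- t))"
proof
 fix s t x h assume "s \<in> {- hi..- lo}" "t \<in> {- hi..- lo}"
 then have st: "- s \<in> I" "- t \<in> I" "\<bar>- t - - s\<bar> = \<bar>t - s\<bar>" by auto
 show "norm (A (- t) x - A (- s) x) <= C * \<bar>t - s\<bar> powr \<alpha>" using A_bound[OF st(1,2)] st(3) by simp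
 show "(A (- t) has_derivative DA (- t) x) (at x)" using A_deriv st by simp
 show "norm (DA (- t) x h - DA (- s) x h) <= C * \<bar>t - s\<bar> powr \<alpha> * norm h" using DA_bound[OF st(1,2)] st(3) by simp
 show "norm (DA (- t) x h - DA (- s) x h - (DA (- t) y h - DA (- s) y h)) <= C * \<bar>t - s\<bar> powr \<alpha> * norm (x - y) powr \<beta> * norm h" for y
  using DA_holder[OF st(1,2)] st(3) by simp
qed (use lh \<alpha> \<beta> \<theta>_def \<theta>1 C0 in auto)

context young_field
begin

text \<open>Solve the reversed field from (s, x) back to \<open>lo\<close> and start the forward
  solution there; uniqueness on [lo, s] makes it pass through x at time s. The constant remains that
  of solutions started at \<open>lo\<close>, uniformly in s and x.\<close>

lemma sol_exists: "\<exists>M\<ge>0. \<forall>s\<in>I. \<forall>x. \<exists>y. y s = x \<and> sol M y"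
proof -
 obtain M where M: "0 <= M" and ex: "\<And>x. \<exists>y. y lo = x \<and> sol M y" using sol_exists_from_lo by blast
 have "\<exists>y. y s = x \<and> sol M y" if s: "s \<in> I" for s x
 proof (cases "s = lo")
  case True then show ?thesis using ex by simp
 next
  case False
  then have ls: "lo < s" "s <= hi" using s by auto
  interpret S: young_field lo s \<alpha> \<beta> \<theta> C A DA by (rule young_field_sub) (use ls in auto)
  interpret R: young_field "- s" "- lo" \<alpha> \<beta> \<theta> C "\<lambda>t. A (- t)" "\<lambda>t. DA (- t)" by (rule S.young_field_reverse)
  obtain M' z where z: "z (- s) = x" "R.sol M' z" using R.sol_exists_from_lo by blast
  obtain y where y: "y lo = z (- lo)" "sol M y" using ex by blast
  have "S.sol M' (\<lambda>r. z (- r))"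
   unfolding S.sol_def
  proof (intro conjI ballI)
   show "0 <= M'" using z by (simp add: R.sol_def)
   fix a b assume "a \<in> {lo..s}" "b \<in> {lo..s}"
   then have "norm (z (- b) - z (- a) - R.inc (- a) (- b) (z (- a))) <= M' * \<bar>- b - - a\<bar> powr \<theta>"
    using z(2)[unfolded R.sol_def, THEN conjunct2, rule_format, of "- a" "- b"] by simp
   moreover have "\<bar>- b - - a\<bar> = \<bar>b - a\<bar>" by simp
   ultimately show "norm (z (- b) - z (- a) - S.inc a b (z (- a))) <= M' * \<bar>b - a\<bar> powr \<theta>"
    by (simp add: R.inc_def S.inc_def)
  qed
  moreover have "S.sol M y" using y ls unfolding S.sol_def sol_def S.inc_def inc_def by auto
  ultimately have "y s = z (- s)" using S.sol_unique[of M y M' "\<lambda>r. z (- r)" lo s] y ls by auto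
  then show ?thesis using y z by auto
 qed
 then show ?thesis using M by blast
qed

definition Msol where "Msol = (SOME M. 0 <= M \<and> (\<forall>s\<in>I. \<forall>x. \<exists>y. y s = x \<and> sol M y))"

lemma Msol: "0 <= Msol" "s \<in> I ==> \<exists>y. y s = x \<and> sol Msol y"
 using someI_ex[OF sol_exists[unfolded Bex_def]] unfolding Msol_def by auto

text \<open>No order of the two times is required: for times in the interval \<open>flow t s\<close>
  inverts \<open>flow s t\<close>, so both directions of the characteristics come from one object.
  The choice operator does no harm, by \<open>sol_unique\<close>.\<close>

definition flow where "flow s t x = (SOME y. y s = x \<and> sol Msol y) t"

lemma flow_sol: assumes "s \<in> I" shows "flow s s x = x" "sol Msol (\<lambda>t. flow s t x)"
 using someI_ex[OF Msol(2)[OF assms, of x]] by (auto simp: flow_def)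

lemma flow_unique: assumes "sol M y" "s \<in> I" "t \<in> I" shows "flow s t (y s) = y t"
 using sol_unique[OF flow_sol(2) assms(1) assms(2,3)] flow_sol(1) assms by auto

lemma flow_flow: assumes "s \<in> I" "t \<in> I" "r \<in> I" shows "flow t r (flow s t x) = flow s r x"
 using flow_unique[OF flow_sol(2)[OF assms(1), of x] assms(2,3)] .

end

section \<open>Differentiability of the flow\<close>

lemma half_sum_less:
 fixes X Y Z e :: real
 assumes "X < e / 2" "Y < e / 2" "Z < e / 2"
 shows "X + (Y + Z) / 2 < e"
proof -
 have "Y + Z < e" using assms by simp
 then have "(Y + Z) / 2 < e / 2" by simp
 then have "X + (Y + Z) / 2 < e / 2 + e / 2" using assms by (intro add_strict_mono)
 then show ?thesis by simp
qed

context young_field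
begin

definition Hsol where "Hsol = Msol * L powr (\<theta> - \<alpha>) + C"

lemma Hsol: "0 <= Hsol" using Msol(1) C0 by (simp add: Hsol_def)

lemma flow_holder:
 "s \<in> I ==> a \<in> I ==> b \<in> I ==> norm (flow s b x - flow s a x) <= Hsol * \<bar>b - a\<bar> powr \<alpha>"
 unfolding Hsol_def by (rule sol_holder[OF flow_sol(2)])

lemma flow_near: "s \<in> I ==> t \<in> I ==> norm (flow s t x - x) <= Hsol * \<bar>t - s\<bar> powr \<alpha>"
 using flow_holder[of s s t x] flow_sol(1) by simp

lemma flow_stability:
 obtains Q where "1 <= Q"
  "\<And>s t x x'. s \<in> I ==> t \<in> I ==> norm (flow s t x' - flow s t x) <= Q * norm (x' - x)"
  "\<And>s a b x x'. s \<in> I ==> a \<in> I ==> b \<in> I ==>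
   norm ((flow s b x' - flow s b x) - (flow s a x' - flow s a x) - (inc a b (flow s a x') - inc a b (flow s a x)))
   <= Q * norm (x' - x) * \<bar>b - a\<bar> powr \<theta>"
proof -
 obtain Q where Q: "1 <= Q" and Qb: "\<And>y y' s t. sol Msol y ==> sol Msol y' ==> s \<in> I ==> t \<in> I ==>
  norm (y' t - y t) <= Q * norm (y' s - y s) \<and>
  norm ((y' t - y t) - (y' s - y s) - (inc s t (y' s) - inc s t (y s))) <= Q * norm (y' s - y s) * \<bar>t - s\<bar> powr \<theta>"
  using sol_stability[of Msol] by blast
 have 1: "norm (flow s t x' - flow s t x) <= Q * norm (x' - x)" if "s \<in> I" "t \<in> I" for s t x x'
  using Qb[OF flow_sol(2)[of s x] flow_sol(2)[of s x'] that] flow_sol(1) that by simp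
 have QQ: "Q <= Q * Q" using Q mult_mono[of 1 Q Q Q] by simp
 show ?thesis
 proof (rule that[of "Q * Q"])
  show "1 <= Q * Q" using Q QQ by linarith
  show "norm (flow s t x' - flow s t x) <= Q * Q * norm (x' - x)" if "s \<in> I" "t \<in> I" for s t x x'
   using 1[OF that] mult_right_mono[OF QQ] by (meson norm_ge_zero order_trans)
  fix s a b x x' assume I: "s \<in> I" "a \<in> I" "b \<in> I"
  have "norm ((flow s b x' - flow s b x) - (flow s a x' - flow s a x) - (inc a b (flow s a x') - inc a b (flow s a x)))
   <= Q * norm (flow s a x' - flow s a x) * \<bar>b - a\<bar> powr \<theta>"
   using Qb[OF flow_sol(2)[of s x] flow_sol(2)[of s x'] I(2,3)] I by simp
  also have "... <= Q * (Q * norm (x' - x)) * \<bar>b - a\<bar> powr \<theta>"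
   using 1[OF I(1,2)] Q by (intro mult_right_mono mult_left_mono) auto
  finally show "norm ((flow s b x' - flow s b x) - (flow s a x' - flow s a x) - (inc a b (flow s a x') - inc a b (flow s a x)))
   <= Q * Q * norm (x' - x) * \<bar>b - a\<bar> powr \<theta>" by (simp add: mult.assoc)
 qed
qed

text \<open>Continuity in the starting time, for a fixed final time: the transport solution
  evaluates the flow from (t, x) to time 0. The cocycle identity moves the start from s to s' and
  costs norm (flow s s' x - x), which is Hoelder in time.\<close>

lemma flow_jointly_continuous: "t \<in> I ==> continuous_on (I \<times> UNIV) (\<lambda>(s, x). flow s t x)"
proof -
 assume t: "t \<in> I"
 obtain Q where Q: "1 <= Q" "\<And>s t x x'. s \<in> I ==> t \<in> I ==> norm (flow s t x' - flow s t x) <= Q * norm (x' - x)"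
  using flow_stability by metis
 have est: "norm (flow s t x - flow s' t x') <= Q * (Hsol * \<bar>s' - s\<bar> powr \<alpha> + norm (x' - x))"
  if "s \<in> I" "s' \<in> I" for s s' x x'
 proof -
  have "norm (flow s t x - flow s' t x') = norm (flow s' t (flow s s' x) - flow s' t x')"
   using flow_flow[OF that t] by simp
  also have "... <= Q * norm (flow s s' x - x')" by (rule Q) (use that t in auto)
  also have "... <= Q * (norm (flow s s' x - x) + norm (x - x'))"
   using Q norm_triangle_ineq[of "flow s s' x - x" "x - x'"] by (intro mult_left_mono) auto
  also have "... <= Q * (Hsol * \<bar>s' - s\<bar> powr \<alpha> + norm (x' - x))"
   using flow_near[OF that, of x] Q by (intro mult_left_mono add_mono) (auto simp: norm_minus_commute)
  finally show ?thesis .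
 qed
 show ?thesis
  unfolding continuous_on_def
 proof
  fix z :: "real \<times> 'a" assume z: "z \<in> I \<times> UNIV"
  obtain s' x' where sx: "z = (s', x')" by (cases z)
  have "((\<lambda>w. Q * (Hsol * \<bar>s' - fst w\<bar> powr \<alpha> + norm (x' - snd w))) \<longlongrightarrow> Q * (Hsol * \<bar>s' - fst z\<bar> powr \<alpha> + norm (x' - snd z))) (at z within I \<times> UNIV)"
   using \<alpha> by (intro tendsto_intros tendsto_powr') (auto simp: sx intro!: always_eventually)
  then have "((\<lambda>w. Q * (Hsol * \<bar>s' - fst w\<bar> powr \<alpha> + norm (x' - snd w))) \<longlongrightarrow> 0) (at z within I \<times> UNIV)"
   by (simp add: sx)
  then have "((\<lambda>w. flow (fst w) t (snd w) - flow s' t x') \<longlongrightarrow> 0) (at z within I \<times> UNIV)"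
   by (rule Lim_null_comparison[rotated])
    (use est[of _ s' _ x'] z sx in \<open>auto simp: eventually_at_filter intro!: always_eventually\<close>)
  then show "((\<lambda>(s, x). flow s t x) \<longlongrightarrow> (case z of (s, x) => flow s t x)) (at z within I \<times> UNIV)"
   by (simp add: sx case_prod_beta' LIM_zero_iff)
 qed
qed

text \<open>Germ of the linearised equation along \<open>y\<close>. It obeys the same bounds as the
  germ of a difference of solutions, here for an arbitrary path \<open>p\<close>, so Gronwall
  applies to approximate solutions of the linear equation as well.\<close>

lemma tangent_germ:
 assumes y: "\<And>a b. a \<in> I ==> b \<in> I ==> norm (y b - y a) <= H * \<bar>b - a\<bar> powr \<alpha>" and H: "0 <= H"
 shows "young_germ lo hi \<alpha> \<theta> (C * (1 + H powr \<beta>)) p (\<lambda>a b. dinc a b (y a) (p a))"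
proof
 fix a b assume ab: "a \<in> I" "b \<in> I"
 have "norm (dinc a b (y a) (p a)) <= C * \<bar>b - a\<bar> powr \<alpha> * norm (p a)" by (rule dinc_bound[OF ab])
 also have "... = C * 1 * norm (p a) * \<bar>b - a\<bar> powr \<alpha>" by simp
 also have "... <= C * (1 + H powr \<beta>) * norm (p a) * \<bar>b - a\<bar> powr \<alpha>"
  using C0 by (intro mult_right_mono mult_left_mono) auto
 finally show "norm (dinc a b (y a) (p a)) <= C * (1 + H powr \<beta>) * norm (p a) * \<bar>b - a\<bar> powr \<alpha>" .
next
 fix a b c assume I: "a \<in> I" "b \<in> I" "c \<in> I" and o: "(a <= b \<and> b <= c) \<or> (c <= b \<and> b <= a)"
 define r where "r = \<bar>c - a\<bar>"
 have r: "\<bar>b - a\<bar> <= r" "\<bar>c - b\<bar> <= r" "0 <= r" using o by (auto simp: r_def)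
 have pa: "\<bar>c - b\<bar> powr \<alpha> <= r powr \<alpha>" using r \<alpha> by (intro powr_mono2) auto
 have yb: "norm (y a - y b) powr \<beta> <= H powr \<beta> * r powr (\<alpha> * \<beta>)"
 proof -
  have "norm (y a - y b) <= H * r powr \<alpha>"
   using y[OF I(1,2)] H r \<alpha> by (metis abs_ge_zero mult_left_mono order_trans powr_mono2 less_imp_le norm_minus_commute)
  then have "norm (y a - y b) powr \<beta> <= (H * r powr \<alpha>) powr \<beta>" using \<beta> by (intro powr_mono2) auto
  then show ?thesis using H by (simp add: powr_mult powr_powr)
 qed
 interpret lin: linear "dinc b c (y b)" by (rule dinc_linear[OF I(2,3)])
 have "dinc a c (y a) (p a) - dinc a b (y a) (p a) - dinc b c (y b) (p b) =
  (dinc b c (y a) (p a) - dinc b c (y b) (p a)) + - dinc b c (y b) (p b - p a)"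
  by (simp add: dinc_add[of a c _ _ b] lin.diff)
 then have "norm (dinc a c (y a) (p a) - dinc a b (y a) (p a) - dinc b c (y b) (p b)) <=
  norm (dinc b c (y a) (p a) - dinc b c (y b) (p a)) + norm (dinc b c (y b) (p b - p a))"
  by (metis norm_triangle_ineq norm_minus_cancel)
 also have "... <= C * \<bar>c - b\<bar> powr \<alpha> * norm (y a - y b) powr \<beta> * norm (p a) + C * \<bar>c - b\<bar> powr \<alpha> * norm (p b - p a)"
  by (intro add_mono dinc_holder dinc_bound I)
 also have "... <= C * r powr \<alpha> * (H powr \<beta> * r powr (\<alpha> * \<beta>)) * norm (p a) + C * r powr \<alpha> * norm (p b - p a)"
  using pa yb C0 by (intro add_mono mult_right_mono mult_left_mono mult_mono) auto
 also have "... = C * 1 * r powr \<alpha> * norm (p b - p a) + C * H powr \<beta> * norm (p a) * r powr \<theta>"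
  by (simp add: \<theta>(1) powr_add algebra_simps)
 also have "... <= C * (1 + H powr \<beta>) * r powr \<alpha> * norm (p b - p a) + C * (1 + H powr \<beta>) * norm (p a) * r powr \<theta>"
  using C0 by (intro add_mono mult_right_mono mult_left_mono) auto
 finally show "norm (dinc a c (y a) (p a) - dinc a b (y a) (p a) - dinc b c (y b) (p b))
  <= C * (1 + H powr \<beta>) * \<bar>c - a\<bar> powr \<alpha> * norm (p b - p a) + C * (1 + H powr \<beta>) * norm (p a) * \<bar>c - a\<bar> powr \<theta>"
  by (simp add: r_def)
qed

text \<open>Difference quotients of the flow solve the linearised equation up to an error whose coefficient
 vanishes with the increment, so by the coarse Gronwall estimate they form a uniform Cauchy family.\<close>

lemma flow_C1:
 "\<exists>J. (\<forall>s\<in>I. \<forall>t\<in>I. \<forall>x. (flow s t has_derivative J s t x) (at x)) \<and>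
   (\<forall>t\<in>I. \<forall>h. continuous_on (I \<times> UNIV) (\<lambda>(s, x). J s t x h))"
proof -
 obtain Q where Q: "1 <= Q"
  and Q1: "\<And>s t x x'. s \<in> I ==> t \<in> I ==> norm (flow s t x' - flow s t x) <= Q * norm (x' - x)"
  and Q2: "\<And>s a b x x'. s \<in> I ==> a \<in> I ==> b \<in> I ==>
   norm ((flow s b x' - flow s b x) - (flow s a x' - flow s a x) - (inc a b (flow s a x') - inc a b (flow s a x)))
   <= Q * norm (x' - x) * \<bar>b - a\<bar> powr \<theta>"
  using flow_stability by metis
 define C' where "C' = C * (1 + Hsol powr \<beta>)"
 have C': "0 <= C'" using C0 by (simp add: C'_def)
 obtain R where R: "1 <= R" and Rb: "\<And>(p :: real => 'a) G M \<eta> n s t. young_germ lo hi \<alpha> \<theta> C' p G ==>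
  0 <= M ==> 0 <= \<eta> ==> 0 < n ==>
  (\<forall>a\<in>{lo..hi}. \<forall>b\<in>{lo..hi}. norm (p b - p a - G a b) <= M * \<bar>b - a\<bar> powr \<theta> + \<eta> * \<bar>b - a\<bar> powr \<alpha>) ==>
  s \<in> {lo..hi} ==> t \<in> {lo..hi} ==>
  norm (p t) <= R * (norm (p s) + M * real n powr (1 - \<theta>) + \<eta> * real n powr (1 - \<alpha>))"
  using coarse_gronwall[OF \<alpha>(1) less_imp_le[OF \<alpha>(2)] \<theta>1 \<theta>(2) C' lh] by blast
 define B where "B = C * Q powr (1 + \<beta>)"
 have B: "0 <= B" using C0 by (simp add: B_def)
 define z where "z s x h a = flow s a (x + h) - flow s a x" for s x h a
 have zs: "z s x h s = h" if "s \<in> I" for s x h using flow_sol(1)[OF that] by (simp add: z_def)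
 have zb: "norm (z s x h a) <= Q * norm h" if "s \<in> I" "a \<in> I" for s x h a
  using Q1[OF that, of "x + h" x] by (simp add: z_def)
 \<comment> \<open>Residual of the linearised equation along the trajectory of x. It is linear in
   \<open>p\<close>, so the difference of two candidates has at most the sum of their
   residuals.\<close>
 define rem where "rem s x p a b = p b - p a - dinc a b (flow s a x) (p a)" for s x a b and p :: "real => 'a"
 have rem_diff: "norm (rem s x (\<lambda>r. p r - p' r) a b) <= norm (rem s x p a b) + norm (rem s x p' a b)"
  if ab: "a \<in> I" "b \<in> I" for s x p p' a b
 proof -
  interpret lin: linear "dinc a b (flow s a x)" by (rule dinc_linear[OF ab])
  have "rem s x (\<lambda>r. p r - p' r) a b = rem s x p a b - rem s x p' a b" by (simp add: rem_def lin.diff)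
  then show ?thesis by (metis norm_triangle_ineq4)
 qed
 have zerr: "norm (rem s x (z s x h) a b)
  <= Q * norm h * \<bar>b - a\<bar> powr \<theta> + B * norm h powr (1 + \<beta>) * \<bar>b - a\<bar> powr \<alpha>"
  if sab: "s \<in> I" "a \<in> I" "b \<in> I" for s a b x h
 proof -
  let ?y = "flow s a x" and ?z = "z s x h a"
  have yz: "flow s a (x + h) = ?y + ?z" by (simp add: z_def)
  have "norm (z s x h b - ?z - (inc a b (?y + ?z) - inc a b ?y)) <= Q * norm h * \<bar>b - a\<bar> powr \<theta>"
   using Q2[OF sab, of "x + h" x] unfolding yz[symmetric] by (simp add: z_def)
  moreover have "norm (inc a b (?y + ?z) - inc a b ?y - dinc a b ?y ?z) <= B * norm h powr (1 + \<beta>) * \<bar>b - a\<bar> powr \<alpha>"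
  proof -
   have "norm (inc a b (?y + ?z) - inc a b ?y - dinc a b ?y ?z) <= C * \<bar>b - a\<bar> powr \<alpha> * norm ?z powr (1 + \<beta>)"
    by (rule inc_taylor[OF sab(2,3)])
   also have "... <= C * \<bar>b - a\<bar> powr \<alpha> * (Q * norm h) powr (1 + \<beta>)"
    using zb[OF sab(1,2)] \<beta> C0 by (intro mult_left_mono powr_mono2) auto
   also have "(Q * norm h) powr (1 + \<beta>) = Q powr (1 + \<beta>) * norm h powr (1 + \<beta>)" using Q by (simp add: powr_mult)
   finally show ?thesis by (simp add: B_def mult_ac)
  qed
  ultimately show ?thesis
   using norm_triangle_ineq[of "z s x h b - ?z - (inc a b (?y + ?z) - inc a b ?y)" "inc a b (?y + ?z) - inc a b ?y - dinc a b ?y ?z"]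
   by (simp add: rem_def)
 qed
 have tg: "young_germ lo hi \<alpha> \<theta> C' p (\<lambda>a b. dinc a b (flow s a x) (p a))" if "s \<in> I" for s x p
  unfolding C'_def by (rule tangent_germ) (use flow_holder that Hsol in auto)
 \<comment> \<open>Difference quotients in direction b with step 1 / (m + 1), packed as functions of
   the triple (s, t, x) so that uniform convergence can be stated.\<close>
 define q where "q b m = (\<lambda>(s, t, x). z s x (inverse (real (Suc m)) *\<^sub>R b) t /\<^sub>R inverse (real (Suc m)))" for b m
 define \<epsilon> where "\<epsilon> m = inverse (real (Suc m))" for m
 have \<epsilon>: "0 < \<epsilon> m" for m by (simp add: \<epsilon>_def)
 have \<epsilon>0: "\<epsilon> \<longlonglongrightarrow> 0" unfolding \<epsilon>_def by (rule LIMSEQ_inverse_real_of_nat)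
 have qdef: "q b m (s, t, x) = z s x (\<epsilon> m *\<^sub>R b) t /\<^sub>R \<epsilon> m" for b m s t x by (simp add: q_def \<epsilon>_def)
 have qerr: "norm (rem s x (\<lambda>r. q v m (s, r, x)) a b) <= Q * \<bar>b - a\<bar> powr \<theta> + B * \<epsilon> m powr \<beta> * \<bar>b - a\<bar> powr \<alpha>"
  if sab: "s \<in> I" "a \<in> I" "b \<in> I" and v: "norm v = 1" for s a b x v m
 proof -
  interpret lin: linear "dinc a b (flow s a x)" by (rule dinc_linear[OF sab(2,3)])
  have "rem s x (\<lambda>r. q v m (s, r, x)) a b = rem s x (z s x (\<epsilon> m *\<^sub>R v)) a b /\<^sub>R \<epsilon> m"
   unfolding rem_def qdef lin.scale by (simp add: algebra_simps)
  then have "norm (rem s x (\<lambda>r. q v m (s, r, x)) a b) = norm (rem s x (z s x (\<epsilon> m *\<^sub>R v)) a b) / \<epsilon> m"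
   using \<epsilon>[of m] by (simp add: divide_inverse mult.commute)
  also have "... <= (Q * \<epsilon> m * \<bar>b - a\<bar> powr \<theta> + B * \<epsilon> m powr (1 + \<beta>) * \<bar>b - a\<bar> powr \<alpha>) / \<epsilon> m"
   using zerr[OF sab, of x "\<epsilon> m *\<^sub>R v"] v \<epsilon>[of m] by (intro divide_right_mono) auto
  also have "... = Q * \<bar>b - a\<bar> powr \<theta> + B * \<epsilon> m powr \<beta> * \<bar>b - a\<bar> powr \<alpha>"
   using \<epsilon>[of m] by (simp add: powr_add add_divide_distrib)
  finally show ?thesis .
 qed
 have qs: "q v m (s, s, x) = v" if "s \<in> I" for v m s x using \<epsilon>[of m] zs[OF that] by (simp add: qdef)
 have qdiff: "norm (q v m (s, t, x) - q v m' (s, t, x)) <= R * (2 * Q * real n powr (1 - \<theta>) + B * (\<epsilon> m powr \<beta> + \<epsilon> m' powr \<beta>) * real n powr (1 - \<alpha>))"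
  if st: "s \<in> I" "t \<in> I" and v: "norm v = 1" and n: "0 < n" for s t x v m m' n
 proof -
  define p where "p a = q v m (s, a, x) - q v m' (s, a, x)" for a
  have "norm (p t) <= R * (norm (p s) + (2 * Q) * real n powr (1 - \<theta>) + (B * (\<epsilon> m powr \<beta> + \<epsilon> m' powr \<beta>)) * real n powr (1 - \<alpha>))"
  proof (rule Rb[OF tg[OF st(1), of p x]])
   show "\<forall>a\<in>{lo..hi}. \<forall>b\<in>{lo..hi}. norm (p b - p a - dinc a b (flow s a x) (p a))
    <= 2 * Q * \<bar>b - a\<bar> powr \<theta> + B * (\<epsilon> m powr \<beta> + \<epsilon> m' powr \<beta>) * \<bar>b - a\<bar> powr \<alpha>"
   proof (intro ballI)
    fix a b assume ab: "a \<in> {lo..hi}" "b \<in> {lo..hi}"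
    have "norm (rem s x p a b) <= 2 * Q * \<bar>b - a\<bar> powr \<theta> + B * (\<epsilon> m powr \<beta> + \<epsilon> m' powr \<beta>) * \<bar>b - a\<bar> powr \<alpha>"
     using rem_diff[OF ab, of s x "\<lambda>r. q v m (s, r, x)" "\<lambda>r. q v m' (s, r, x)"]
      qerr[OF st(1) ab v, of x m] qerr[OF st(1) ab v, of x m'] unfolding p_def[abs_def] by (simp add: algebra_simps)
    then show "norm (p b - p a - dinc a b (flow s a x) (p a))
     <= 2 * Q * \<bar>b - a\<bar> powr \<theta> + B * (\<epsilon> m powr \<beta> + \<epsilon> m' powr \<beta>) * \<bar>b - a\<bar> powr \<alpha>" by (simp add: rem_def)
   qed
  qed (use Q B st n in auto)
  moreover have "norm (p s) = 0" using qs[OF st(1)] by (simp add: p_def)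
  ultimately show ?thesis by (simp add: p_def)
 qed
 \<comment> \<open>Order of choice in both applications of the coarse estimate: n makes the
   \<theta>-term small, and only then is the increment taken so small that its coefficient beats n
   powr (1 - \<alpha>).\<close>
 have small: "\<exists>n>0. X * real n powr (1 - \<theta>) < e" if "0 < e" for e X
 proof -
  have "(\<lambda>n. X * real n powr (1 - \<theta>)) \<longlonglongrightarrow> X * 0" using \<theta>1 by (intro tendsto_intros powr_nat_tendsto_0) auto
  then have "\<forall>\<^sub>F n in sequentially. X * real n powr (1 - \<theta>) < e" using that by (intro order_tendstoD(2)) auto
  then have "\<forall>\<^sub>F n in sequentially. X * real n powr (1 - \<theta>) < e \<and> 0 < n"
   using eventually_gt_at_top[of "0::nat"] by eventually_elim auto
  then show ?thesis using eventually_happens'[OF trivial_limit_sequentially] by auto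
 qed
 have "\<exists>l. \<forall>e>0. \<exists>N. \<forall>n u. N <= n \<and> u \<in> I \<times> I \<times> UNIV --> dist (q v n u) (l u) < e" if v: "norm v = 1" for v
  unfolding uniformly_convergent_eq_cauchy
 proof (intro allI impI)
  fix e :: real assume e: "0 < e"
  then obtain n where n: "0 < n" "(R * (2 * Q)) * real n powr (1 - \<theta>) < e / 2"
   using small[OF half_gt_zero, of e "R * (2 * Q)"] by blast
  have "(\<lambda>m. R * (B * (2 * \<epsilon> m powr \<beta>) * real n powr (1 - \<alpha>))) \<longlonglongrightarrow> R * (B * (2 * 0 powr \<beta>) * real n powr (1 - \<alpha>))"
   using \<beta> \<epsilon> by (intro tendsto_intros tendsto_powr' \<epsilon>0) (auto simp: less_imp_le)
  then have "\<forall>\<^sub>F m in sequentially. R * (B * (2 * \<epsilon> m powr \<beta>) * real n powr (1 - \<alpha>)) < e / 2"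
   using e by (intro order_tendstoD(2)) auto
  then obtain N where N: "\<And>m. N <= m ==> R * (B * (2 * \<epsilon> m powr \<beta>) * real n powr (1 - \<alpha>)) < e / 2"
   by (auto simp: eventually_sequentially)
  show "\<exists>N. \<forall>m n u. N <= m \<and> N <= n \<and> u \<in> I \<times> I \<times> UNIV --> dist (q v m u) (q v n u) < e"
  proof (intro exI[of _ N] allI impI)
   fix m m' and u :: "real \<times> real \<times> 'a" assume mm: "N <= m \<and> N <= m' \<and> u \<in> I \<times> I \<times> UNIV"
   obtain s t x where u: "u = (s, t, x)" "s \<in> I" "t \<in> I" using mm by (cases u) auto
   have "norm (q v m u - q v m' u) <= R * (2 * Q * real n powr (1 - \<theta>) + B * (\<epsilon> m powr \<beta> + \<epsilon> m' powr \<beta>) * real n powr (1 - \<alpha>))"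
    unfolding u by (rule qdiff) (use u v n in auto)
   also have "... = (R * (2 * Q)) * real n powr (1 - \<theta>) + (R * (B * (2 * \<epsilon> m powr \<beta>) * real n powr (1 - \<alpha>))
    + R * (B * (2 * \<epsilon> m' powr \<beta>) * real n powr (1 - \<alpha>))) / 2" by (simp add: algebra_simps)
   also have "... < e"
   proof -
    have "X + (Y + Z) / 2 < e" if "X < e / 2" "Y < e / 2" "Z < e / 2" for X Y Z :: real by (rule half_sum_less[OF that])
    then show ?thesis using n(2) N[of m] N[of m'] mm by blast
   qed
   finally show "dist (q v m u) (q v m' u) < e" by (simp add: dist_norm)
  qed
 qed
 then obtain K where K: "\<And>v e. norm v = 1 ==> e > 0 ==> \<exists>N. \<forall>n u. N <= n \<and> u \<in> I \<times> I \<times> UNIV --> dist (q v n u) (K v u) < e"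
  by metis
 have Klim: "(\<lambda>m. q v m (s, t, x)) \<longlonglongrightarrow> K v (s, t, x)" if v: "norm v = 1" and st: "s \<in> I" "t \<in> I" for v s t x
 proof (rule LIMSEQ_I)
  fix e :: real assume "0 < e"
  then obtain N where "\<forall>n u. N <= n \<and> u \<in> I \<times> I \<times> UNIV --> dist (q v n u) (K v u) < e" using K[OF v] by blast
  then show "\<exists>no. \<forall>n\<ge>no. norm (q v n (s, t, x) - K v (s, t, x)) < e"
   using st by (intro exI[of _ N]) (auto simp: dist_norm)
 qed
 \<comment> \<open>Continuity of the derivative comes from uniform convergence of continuous
   quotients, not from an estimate of its increments.\<close>
 have Kcont: "continuous_on (I \<times> UNIV) (\<lambda>(s, x). K v (s, t, x))" if v: "norm v = 1" and t: "t \<in> I" for v t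
 proof (rule uniform_limit_theorem[where f = "\<lambda>m (s, x). q v m (s, t, x)" and F = sequentially])
  show "\<forall>\<^sub>F m in sequentially. continuous_on (I \<times> UNIV) (\<lambda>(s, x). q v m (s, t, x))"
  proof (intro always_eventually allI)
   fix m
   have shift: "continuous_on (I \<times> UNIV) (\<lambda>w. flow (fst w) t (snd w + h))" for h
    by (rule continuous_on_compose2[OF flow_jointly_continuous[OF t], of _ "\<lambda>w. (fst w, snd w + h)", simplified case_prod_beta fst_conv snd_conv])
     (auto intro!: continuous_intros)
   show "continuous_on (I \<times> UNIV) (\<lambda>(s, x). q v m (s, t, x))"
    unfolding qdef z_def case_prod_beta using shift[of "\<epsilon> m *\<^sub>R v"] shift[of 0]
    by (intro continuous_intros) auto
  qed
  show "uniform_limit (I \<times> UNIV) (\<lambda>m (s, x). q v m (s, t, x)) (\<lambda>(s, x). K v (s, t, x)) sequentially"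
   unfolding uniform_limit_sequentially_iff
  proof (intro allI impI)
   fix e :: real assume "0 < e"
   then obtain N where "\<forall>n u. N <= n \<and> u \<in> I \<times> I \<times> UNIV --> dist (q v n u) (K v u) < e" using K[OF v] by blast
   then show "\<exists>N. \<forall>n\<ge>N. \<forall>w\<in>I \<times> UNIV. dist (case w of (s, x) => q v n (s, t, x)) (case w of (s, x) => K v (s, t, x)) < e"
    using t by (intro exI[of _ N]) auto
  qed
 qed auto
 have Ks: "K v (s, s, x) = v" if "norm v = 1" "s \<in> I" for v s x
  using Klim[OF that(1,2,2), of x] qs[OF that(2)] LIMSEQ_unique tendsto_const by (metis (no_types, lifting) LIMSEQ_const_iff ext)
 have Kerr: "norm (rem s x (\<lambda>r. K v (s, r, x)) a b) <= Q * \<bar>b - a\<bar> powr \<theta>"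
  if v: "norm v = 1" and sab: "s \<in> I" "a \<in> I" "b \<in> I" for v s a b x
 proof (rule tendsto_le[OF trivial_limit_sequentially])
  have "isCont (dinc a b (flow s a x)) w" for w
   using dinc_linear[OF sab(2,3)] by (simp add: linear_continuous_at linear_conv_bounded_linear)
  then show "(\<lambda>m. norm (rem s x (\<lambda>r. q v m (s, r, x)) a b)) \<longlonglongrightarrow> norm (rem s x (\<lambda>r. K v (s, r, x)) a b)"
   unfolding rem_def using Klim[OF v sab(1)] sab by (intro tendsto_intros isCont_tendsto_compose[of _ "dinc a b (flow s a x)"]) auto
  have "(\<lambda>m. Q * \<bar>b - a\<bar> powr \<theta> + B * \<epsilon> m powr \<beta> * \<bar>b - a\<bar> powr \<alpha>) \<longlonglongrightarrow> Q * \<bar>b - a\<bar> powr \<theta> + B * 0 powr \<beta> * \<bar>b - a\<bar> powr \<alpha>"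
   using \<beta> \<epsilon> by (intro tendsto_intros tendsto_powr' \<epsilon>0) (auto simp: less_imp_le)
  then show "(\<lambda>m. Q * \<bar>b - a\<bar> powr \<theta> + B * \<epsilon> m powr \<beta> * \<bar>b - a\<bar> powr \<alpha>) \<longlonglongrightarrow> Q * \<bar>b - a\<bar> powr \<theta>" by simp
  show "\<forall>\<^sub>F m in sequentially. norm (rem s x (\<lambda>r. q v m (s, r, x)) a b) <= Q * \<bar>b - a\<bar> powr \<theta> + B * \<epsilon> m powr \<beta> * \<bar>b - a\<bar> powr \<alpha>"
   using qerr[OF sab v] by auto
 qed
 \<comment> \<open>The limits were formed for directions of norm 1, so the Jacobian is assembled
   from the basis vectors. Linearity is then built in, and by linearity the residual bound passes
   from the columns to every direction.\<close>
 define J where "J s t x h = (\<Sum>v\<in>Basis. (h \<bullet> v) *\<^sub>R K v (s, t, x))" for s t x h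
 define N where "N = real DIM('a)"
 have Jlin: "linear (J s t x)" for s t x
  unfolding J_def[abs_def]
  by (intro linear_compose_sum ballI linearI) (auto simp: inner_add_left scaleR_add_left)
 have Js: "J s s x h = h" if "s \<in> I" for s x h
  unfolding J_def using Ks that by (simp add: euclidean_representation)
 have Jerr: "norm (rem s x (\<lambda>r. J s r x h) a b) <= N * Q * norm h * \<bar>b - a\<bar> powr \<theta>"
  if sab: "s \<in> I" "a \<in> I" "b \<in> I" for s a b x h
 proof -
  interpret lin: linear "dinc a b (flow s a x)" by (rule dinc_linear[OF sab(2,3)])
  let ?k = "\<lambda>v. rem s x (\<lambda>r. K v (s, r, x)) a b"
  have "rem s x (\<lambda>r. J s r x h) a b = (\<Sum>v\<in>Basis. (h \<bullet> v) *\<^sub>R ?k v)"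
   unfolding rem_def J_def lin.sum lin.scale by (simp add: sum_subtractf scaleR_diff_right)
  moreover have "norm (\<Sum>v\<in>Basis. (h \<bullet> v) *\<^sub>R ?k v) <= (\<Sum>v\<in>(Basis::'a set). norm h * (Q * \<bar>b - a\<bar> powr \<theta>))"
  proof (rule sum_norm_le)
   fix v :: 'a assume v: "v \<in> Basis"
   show "norm ((h \<bullet> v) *\<^sub>R ?k v) <= norm h * (Q * \<bar>b - a\<bar> powr \<theta>)"
    using Kerr[OF _ sab, of v x] Basis_le_norm[OF v, of h] v by (auto intro!: mult_mono)
  qed
  moreover have "(\<Sum>v\<in>(Basis::'a set). norm h * (Q * \<bar>b - a\<bar> powr \<theta>)) = N * Q * norm h * \<bar>b - a\<bar> powr \<theta>"
   by (simp add: N_def)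
  ultimately show ?thesis by (simp only:)
 qed
 have der: "(flow s t has_derivative J s t x) (at x)" if st: "s \<in> I" "t \<in> I" for s t x
  unfolding has_derivative_at_alt
 proof (intro conjI allI impI)
  show "bounded_linear (J s t x)" by (rule linear_conv_bounded_linear[THEN iffD1, OF Jlin])
  fix e :: real assume e: "0 < e"
  then obtain n where n: "0 < n" "(R * (Q + N * Q)) * real n powr (1 - \<theta>) < e / 2"
   using small[OF half_gt_zero, of e "R * (Q + N * Q)"] by blast
  have "((\<lambda>r. R * (B * r powr \<beta> * real n powr (1 - \<alpha>))) \<longlongrightarrow> R * (B * 0 powr \<beta> * real n powr (1 - \<alpha>))) (at_right 0)"
   using \<beta> by (intro tendsto_intros tendsto_powr') (auto simp: eventually_at_filter)
  then have "\<forall>\<^sub>F r in at_right 0. R * (B * r powr \<beta> * real n powr (1 - \<alpha>)) < e / 2"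
   using e by (intro order_tendstoD(2)) auto
  then obtain d where d: "0 < d" "\<And>r. 0 < r ==> r < d ==> R * (B * r powr \<beta> * real n powr (1 - \<alpha>)) < e / 2"
   unfolding eventually_at_right_field by auto
  show "\<exists>d>0. \<forall>y. norm (y - x) < d --> norm (flow s t y - flow s t x - J s t x (y - x)) <= e * norm (y - x)"
  proof (intro exI[of _ d] conjI allI impI d(1))
   fix y assume y: "norm (y - x) < d"
   define h where "h = y - x"
   define p where "p a = z s x h a - J s a x h" for a
   have "norm (p t) <= R * (norm (p s) + ((Q + N * Q) * norm h) * real n powr (1 - \<theta>) + (B * norm h powr (1 + \<beta>)) * real n powr (1 - \<alpha>))"
   proof (rule Rb[OF tg[OF st(1), of p x]])
    show "\<forall>a\<in>{lo..hi}. \<forall>b\<in>{lo..hi}. norm (p b - p a - dinc a b (flow s a x) (p a))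
     <= (Q + N * Q) * norm h * \<bar>b - a\<bar> powr \<theta> + B * norm h powr (1 + \<beta>) * \<bar>b - a\<bar> powr \<alpha>"
    proof (intro ballI)
     fix a b assume ab: "a \<in> {lo..hi}" "b \<in> {lo..hi}"
     have "norm (rem s x p a b) <= (Q + N * Q) * norm h * \<bar>b - a\<bar> powr \<theta> + B * norm h powr (1 + \<beta>) * \<bar>b - a\<bar> powr \<alpha>"
      using rem_diff[OF ab, of s x "z s x h" "\<lambda>r. J s r x h"]
       zerr[OF st(1) ab, of x h] Jerr[OF st(1) ab, of x h] unfolding p_def[abs_def] by (simp add: algebra_simps)
     then show "norm (p b - p a - dinc a b (flow s a x) (p a))
      <= (Q + N * Q) * norm h * \<bar>b - a\<bar> powr \<theta> + B * norm h powr (1 + \<beta>) * \<bar>b - a\<bar> powr \<alpha>" by (simp add: rem_def)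
    qed
   qed (use Q B st n in \<open>auto simp: N_def\<close>)
   also have "norm (p s) = 0" using zs[OF st(1)] Js[OF st(1)] by (simp add: p_def)
   also have "R * (0 + ((Q + N * Q) * norm h) * real n powr (1 - \<theta>) + (B * norm h powr (1 + \<beta>)) * real n powr (1 - \<alpha>))
    = ((R * (Q + N * Q)) * real n powr (1 - \<theta>) + R * (B * norm h powr \<beta> * real n powr (1 - \<alpha>))) * norm h"
    by (simp add: powr_add algebra_simps)
   also have "... <= e * norm h"
   proof (cases "h = 0")
    case False
    then have "R * (B * norm h powr \<beta> * real n powr (1 - \<alpha>)) < e / 2" using d(2)[of "norm h"] y by (simp add: h_def)
    then show ?thesis using n(2) by (intro mult_right_mono) auto
   qed simp
   finally show "norm (flow s t y - flow s t x - J s t x (y - x)) <= e * norm (y - x)"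
    by (simp add: p_def z_def h_def)
  qed
 qed
 have "continuous_on (I \<times> UNIV) (\<lambda>(s, x). J s t x h)" if t: "t \<in> I" for t h
  unfolding J_def case_prod_beta
  using Kcont[OF _ t] by (intro continuous_intros) (auto simp: case_prod_beta)
 then show ?thesis using der by blast
qed

end

section \<open>The joint flow of the vector field and the zeroth order coefficient\<close>

text \<open>The class orders the times by s < t and admits a constant of any sign. Here the bounds
  become symmetric in s and t, with a nonnegative constant and with x = y included.\<close>

lemma CtCx_bounds:
 fixes F :: "real => 'a::real_normed_vector => 'b::real_normed_vector"
 assumes "CtCx T \<alpha> \<beta> F"
 obtains C where "0 <= C"
  "\<And>s t x. s \<in> {0..T} ==> t \<in> {0..T} ==> norm (F t x - F s x) <= C * \<bar>t - s\<bar> powr \<alpha>"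
  "\<And>s t x y. s \<in> {0..T} ==> t \<in> {0..T} ==>
   norm ((F t x - F s x) - (F t y - F s y)) <= C * \<bar>t - s\<bar> powr \<alpha> * norm (x - y) powr \<beta>"
proof -
 let ?B = "\<lambda>C s t. (\<forall>x y. x \<noteq> y --> norm ((F t x - F s x) - (F t y - F s y)) <= C * (t - s) powr \<alpha> * dist x y powr \<beta>) \<and>
   (\<forall>x. norm (F t x - F s x) <= C * (t - s) powr \<alpha>)"
 obtain C where all: "\<forall>s\<in>{0..T}. \<forall>t\<in>{0..T}. s < t --> ?B C s t"
  using assms unfolding CtCx_def by (elim conjE exE) (rule that)
 have C: "?B C s t" if "s \<in> {0..T}" "t \<in> {0..T}" "s < t" for s t
  using all[THEN bspec, OF that(1), THEN bspec, OF that(2), THEN mp, OF that(3)] .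
 define C' where "C' = max C 0"
 have C': "0 <= C'" "C <= C'" by (auto simp: C'_def)
 have A: "norm (F t x - F s x) <= C' * (t - s) powr \<alpha>" if "s \<in> {0..T}" "t \<in> {0..T}" "s < t" for s t x
  using order_trans[OF C[OF that, THEN conjunct2, THEN spec, of x] mult_right_mono[OF C'(2) powr_ge_zero]] .
 have B: "norm ((F t x - F s x) - (F t y - F s y)) <= C' * (t - s) powr \<alpha> * norm (x - y) powr \<beta>"
  if "s \<in> {0..T}" "t \<in> {0..T}" "s < t" for s t x y
 proof (cases "x = y")
  case False
  then have "norm ((F t x - F s x) - (F t y - F s y)) <= C * (t - s) powr \<alpha> * dist x y powr \<beta>"
   using C[OF that, THEN conjunct1] by simp
  also have "... <= C' * (t - s) powr \<alpha> * dist x y powr \<beta>" using C' by (intro mult_right_mono) auto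
  finally show ?thesis by (simp add: dist_norm)
 qed simp
 show ?thesis
 proof (rule that[OF C'(1)])
  fix s t x assume st: "s \<in> {0..T}" "t \<in> {0..T}"
  consider "s < t" | "s = t" | "t < s" by linarith
  then show "norm (F t x - F s x) <= C' * \<bar>t - s\<bar> powr \<alpha>"
  proof cases
   case 1 then show ?thesis using A[OF st 1, of x] by simp
  next
   case 3 then show ?thesis using A[OF st(2,1) 3, of x] by (simp add: norm_minus_commute)
  qed simp
 next
  fix s t x y assume st: "s \<in> {0..T}" "t \<in> {0..T}"
  consider "s < t" | "s = t" | "t < s" by linarith
  then show "norm ((F t x - F s x) - (F t y - F s y)) <= C' * \<bar>t - s\<bar> powr \<alpha> * norm (x - y) powr \<beta>"
  proof cases
   case 1 then show ?thesis using B[OF st 1, of x y] by simp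
  next
   case 3
   have "(F t x - F s x) - (F t y - F s y) = - ((F s x - F t x) - (F s y - F t y))" by simp
   then have "norm ((F t x - F s x) - (F t y - F s y)) = norm ((F s x - F t x) - (F s y - F t y))"
    by (simp only: norm_minus_cancel)
   then show ?thesis using B[OF st(2,1) 3, of x y] 3 by simp
  qed simp
 qed
qed

text \<open>One constant for both coefficients and their derivatives, in symmetric form. \<theta> is
  a separate variable only to keep the exponents readable.\<close>

locale transport_coeffs =
 fixes T \<alpha> \<beta> \<theta> C :: real and A :: "real => 'a::euclidean_space => 'a" and DA :: "real => 'a => 'a => 'a"
  and c :: "real => 'a => real" and Dc :: "real => 'a => 'a => real"
 assumes T: "0 < T" and \<alpha>: "0 < \<alpha>" "\<alpha> < 1" and \<beta>: "0 < \<beta>" "\<beta> < 1"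
  and \<theta>_def: "\<theta> = \<alpha> * (1 + \<beta>)" and \<theta>1: "1 < \<theta>" and C0: "0 <= C"
  and A_bound: "s \<in> {0..T} ==> t \<in> {0..T} ==> norm (A t x - A s x) <= C * \<bar>t - s\<bar> powr \<alpha>"
  and A_deriv: "t \<in> {0..T} ==> (A t has_derivative DA t x) (at x)"
  and DA_bound: "s \<in> {0..T} ==> t \<in> {0..T} ==> norm (DA t x h - DA s x h) <= C * \<bar>t - s\<bar> powr \<alpha> * norm h"
  and DA_holder: "s \<in> {0..T} ==> t \<in> {0..T} ==>
   norm ((DA t x h - DA s x h) - (DA t y h - DA s y h)) <= C * \<bar>t - s\<bar> powr \<alpha> * norm (x - y) powr \<beta> * norm h"
  and c_bound: "s \<in> {0..T} ==> t \<in> {0..T} ==> \<bar>c t x - c s x\<bar> <= C * \<bar>t - s\<bar> powr \<alpha>"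
  and c_deriv: "t \<in> {0..T} ==> (c t has_derivative Dc t x) (at x)"
  and Dc_bound: "s \<in> {0..T} ==> t \<in> {0..T} ==> \<bar>Dc t x h - Dc s x h\<bar> <= C * \<bar>t - s\<bar> powr \<alpha> * norm h"
  and Dc_holder: "s \<in> {0..T} ==> t \<in> {0..T} ==>
   \<bar>(Dc t x h - Dc s x h) - (Dc t y h - Dc s y h)\<bar> <= C * \<bar>t - s\<bar> powr \<alpha> * norm (x - y) powr \<beta> * norm h"

lemma transport_coeffs_exist:
 fixes A :: "real => 'a::euclidean_space => 'a"
 assumes "0 < T" "0 < \<alpha>" "\<alpha> < 1" "0 < \<beta>" "\<beta> < 1" "1 < \<alpha> * (1 + \<beta>)" "CtC1x T \<alpha> \<beta> A" "CtC1x T \<alpha> \<beta> c"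
 shows "\<exists>C DA Dc. transport_coeffs T \<alpha> \<beta> (\<alpha> * (1 + \<beta>)) C A DA c Dc"
proof -
 obtain DA where DA: "\<forall>t\<in>{0..T}. \<forall>x. (A t has_derivative blinfun_apply (DA t x)) (at x)" "CtCx T \<alpha> \<beta> DA" "CtCx T \<alpha> \<beta> A"
  using assms(7) unfolding CtC1x_def by blast
 obtain Dc where Dc: "\<forall>t\<in>{0..T}. \<forall>x. (c t has_derivative blinfun_apply (Dc t x)) (at x)" "CtCx T \<alpha> \<beta> Dc" "CtCx T \<alpha> \<beta> c"
  using assms(8) unfolding CtC1x_def by blast
 obtain C1 where C1: "0 <= C1" "\<And>s t x. s \<in> {0..T} ==> t \<in> {0..T} ==> norm (A t x - A s x) <= C1 * \<bar>t - s\<bar> powr \<alpha>"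
  using CtCx_bounds[OF DA(3)] by metis
 obtain C2 where C2: "0 <= C2" "\<And>s t x. s \<in> {0..T} ==> t \<in> {0..T} ==> norm (c t x - c s x) <= C2 * \<bar>t - s\<bar> powr \<alpha>"
  using CtCx_bounds[OF Dc(3)] by metis
 obtain C3 where C3: "0 <= C3" "\<And>s t x. s \<in> {0..T} ==> t \<in> {0..T} ==> norm (DA t x - DA s x) <= C3 * \<bar>t - s\<bar> powr \<alpha>"
  "\<And>s t x y. s \<in> {0..T} ==> t \<in> {0..T} ==>
   norm ((DA t x - DA s x) - (DA t y - DA s y)) <= C3 * \<bar>t - s\<bar> powr \<alpha> * norm (x - y) powr \<beta>"
  using CtCx_bounds[OF DA(2)] by metis
 obtain C4 where C4: "0 <= C4" "\<And>s t x. s \<in> {0..T} ==> t \<in> {0..T} ==> norm (Dc t x - Dc s x) <= C4 * \<bar>t - s\<bar> powr \<alpha>"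
  "\<And>s t x y. s \<in> {0..T} ==> t \<in> {0..T} ==>
   norm ((Dc t x - Dc s x) - (Dc t y - Dc s y)) <= C4 * \<bar>t - s\<bar> powr \<alpha> * norm (x - y) powr \<beta>"
  using CtCx_bounds[OF Dc(2)] by metis
 define K where "K = C1 + C2 + C3 + C4"
 have K: "C1 <= K" "C2 <= K" "C3 <= K" "C4 <= K" "0 <= K" using C1 C2 C3 C4 by (auto simp: K_def)
 have up: "X <= K * r" if "X <= k * r" "k <= K" "0 <= r" for X k r
  using that by (meson mult_right_mono order_trans)
 have "transport_coeffs T \<alpha> \<beta> (\<alpha> * (1 + \<beta>)) K A (\<lambda>t x. blinfun_apply (DA t x)) c (\<lambda>t x. blinfun_apply (Dc t x))"
 proof
  fix s t x y h assume st: "s \<in> {0..T}" "t \<in> {0..T}"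
  show "norm (A t x - A s x) <= K * \<bar>t - s\<bar> powr \<alpha>" by (rule up[OF C1(2)[OF st] K(1)]) simp
  show "\<bar>c t x - c s x\<bar> <= K * \<bar>t - s\<bar> powr \<alpha>" using up[OF C2(2)[OF st] K(2)] by simp
  have "norm (DA t x h - DA s x h) <= norm (DA t x - DA s x) * norm h"
   by (metis blinfun.diff_left norm_blinfun)
  also have "... <= K * \<bar>t - s\<bar> powr \<alpha> * norm h" by (intro mult_right_mono up[OF C3(2)[OF st] K(3)]) auto
  finally show "norm (DA t x h - DA s x h) <= K * \<bar>t - s\<bar> powr \<alpha> * norm h" .
  have "norm (Dc t x h - Dc s x h) <= norm (Dc t x - Dc s x) * norm h"
   by (metis blinfun.diff_left norm_blinfun)
  also have "... <= K * \<bar>t - s\<bar> powr \<alpha> * norm h" by (intro mult_right_mono up[OF C4(2)[OF st] K(4)]) auto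
  finally show "\<bar>Dc t x h - Dc s x h\<bar> <= K * \<bar>t - s\<bar> powr \<alpha> * norm h" by simp
  have "norm (DA t x h - DA s x h - (DA t y h - DA s y h)) <= norm ((DA t x - DA s x) - (DA t y - DA s y)) * norm h"
   by (metis blinfun.diff_left norm_blinfun)
  also have "... <= K * (\<bar>t - s\<bar> powr \<alpha> * norm (x - y) powr \<beta>) * norm h"
   using C3(3)[OF st, of x y] by (intro mult_right_mono up[OF _ K(3)]) (auto simp: mult.assoc)
  finally show "norm (DA t x h - DA s x h - (DA t y h - DA s y h)) <= K * \<bar>t - s\<bar> powr \<alpha> * norm (x - y) powr \<beta> * norm h"
   by (simp add: mult.assoc)
  have "norm (Dc t x h - Dc s x h - (Dc t y h - Dc s y h)) <= norm ((Dc t x - Dc s x) - (Dc t y - Dc s y)) * norm h"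
   by (metis blinfun.diff_left norm_blinfun)
  also have "... <= K * (\<bar>t - s\<bar> powr \<alpha> * norm (x - y) powr \<beta>) * norm h"
   using C4(3)[OF st, of x y] by (intro mult_right_mono up[OF _ K(4)]) (auto simp: mult.assoc)
  finally show "\<bar>Dc t x h - Dc s x h - (Dc t y h - Dc s y h)\<bar> <= K * \<bar>t - s\<bar> powr \<alpha> * norm (x - y) powr \<beta> * norm h"
   by (simp add: mult.assoc)
 qed (use assms DA Dc K in auto)
 then show ?thesis by blast
qed

context transport_coeffs
begin

abbreviation I where "I \<equiv> {0..T}"

text \<open>Appending the scalar coefficient as a further component of the vector field makes the integral
 of \<open>c\<close> along the characteristics a component of a flow.\<close>

definition AC where "AC t = (\<lambda>(x, z::real). (A t x, c t x))"
definition DAC where "DAC t = (\<lambda>(x, z::real) (h, k::real). (DA t x h, Dc t x h))"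

lemma field_A: "young_field 0 T \<alpha> \<beta> \<theta> C A DA"
 by unfold_locales (use T \<alpha> \<beta> \<theta>_def \<theta>1 C0 A_bound A_deriv DA_bound DA_holder in auto)

text \<open>The added component is never read by the field, so only the spatial parts of points and
  directions enter; the two bounds of each pair add up to 2 * C.\<close>

lemma field_AC: "young_field 0 T \<alpha> \<beta> \<theta> (2 * C) AC DAC"
proof
 fix s t :: real and x h :: "'a \<times> real" assume st: "s \<in> {0..T}" "t \<in> {0..T}"
 obtain x1 x2 h1 h2 where xh: "x = (x1, x2)" "h = (h1, h2)" by (cases x, cases h) auto
 show "norm (AC t x - AC s x) <= 2 * C * \<bar>t - s\<bar> powr \<alpha>"
  using norm_Pair_le[of "A t x1 - A s x1" "c t x1 - c s x1"] A_bound[OF st, of x1] c_bound[OF st, of x1]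
  by (simp add: AC_def xh)
 have hn: "norm h1 <= norm h" using norm_fst_le[of h1 h2] by (simp add: xh)
 have up: "2 * C * \<bar>t - s\<bar> powr \<alpha> * norm h1 <= 2 * C * \<bar>t - s\<bar> powr \<alpha> * norm h"
  using hn C0 by (intro mult_left_mono) auto
 show "norm (DAC t x h - DAC s x h) <= 2 * C * \<bar>t - s\<bar> powr \<alpha> * norm h"
  using norm_Pair_le[of "DA t x1 h1 - DA s x1 h1" "Dc t x1 h1 - Dc s x1 h1"] DA_bound[OF st, of x1 h1] Dc_bound[OF st, of x1 h1] up
  by (simp add: DAC_def xh)
 fix y :: "'a \<times> real"
 obtain y1 y2 where y: "y = (y1, y2)" by (cases y)
 have xyn: "norm (x1 - y1) <= norm (x - y)" using norm_fst_le[of "x1 - y1" "x2 - y2"] by (simp add: xh y)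
 have "2 * C * \<bar>t - s\<bar> powr \<alpha> * norm (x1 - y1) powr \<beta> * norm h1 <= 2 * C * \<bar>t - s\<bar> powr \<alpha> * norm (x - y) powr \<beta> * norm h"
  using hn xyn C0 \<beta> by (intro mult_mono mult_left_mono powr_mono2) auto
 then show "norm ((DAC t x h - DAC s x h) - (DAC t y h - DAC s y h)) <= 2 * C * \<bar>t - s\<bar> powr \<alpha> * norm (x - y) powr \<beta> * norm h"
  using norm_Pair_le[of "(DA t x1 h1 - DA s x1 h1) - (DA t y1 h1 - DA s y1 h1)" "(Dc t x1 h1 - Dc s x1 h1) - (Dc t y1 h1 - Dc s y1 h1)"]
   DA_holder[OF st, of x1 h1 y1] Dc_holder[OF st, of x1 h1 y1]
  by (simp add: DAC_def xh y)
next
 fix t :: real and x :: "'a \<times> real" assume t: "t \<in> {0..T}"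
 have "((\<lambda>x. (A t (fst x), c t (fst x))) has_derivative (\<lambda>h. (DA t (fst x) (fst h), Dc t (fst x) (fst h)))) (at x)"
  by (intro has_derivative_Pair has_derivative_compose[OF has_derivative_fst[OF has_derivative_ident]] A_deriv c_deriv t)
 then show "(AC t has_derivative DAC t x) (at x)"
  by (simp add: AC_def DAC_def case_prod_beta')
qed (use T \<alpha> \<beta> \<theta>_def \<theta>1 C0 in auto)

end

sublocale transport_coeffs \<subseteq> F: young_field 0 T \<alpha> \<beta> \<theta> C A DA by (rule field_A)
sublocale transport_coeffs \<subseteq> P: young_field 0 T \<alpha> \<beta> \<theta> "2 * C" AC DAC by (rule field_AC)

section \<open>The flow, the integral of c along it, and the Young equation\<close>

context transport_coeffs
begin

definition dA where "dA s t x = A t x - A s x"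
definition dc where "dc s t x = c t x - c s x"
text \<open>For s <= t the map \<Phi> t s is the inverse flow. The companion Z s t x stands for the
  Young integral of c from s to t along the trajectory that is at x at time s; for t < s it is minus
  the integral over [t, s].\<close>

definition flow (\<open>\<Phi>\<close>) where "\<Phi> s t x = fst (P.flow s t (x, 0))"
definition flow_int (\<open>Z\<close>) where "Z s t x = snd (P.flow s t (x, 0))"

lemma P_inc: "P.inc a b w = (dA a b (fst w), dc a b (fst w))"
 by (cases w) (simp add: P.inc_def AC_def dA_def dc_def)

text \<open>The field does not depend on the last component, so a solution remains one when that
  component is shifted, and uniqueness identifies it. This makes Z additive along
  trajectories.\<close>

lemma P_flow_shift: assumes "s \<in> I" "t \<in> I" shows "P.flow s t (x, w) = (\<Phi> s t x, w + Z s t x)"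
proof -
 define y where "y a = P.flow s a (x, 0) + (0, w)" for a
 have "P.sol P.Msol y"
  using P.flow_sol(2)[OF assms(1), of "(x, 0)"] unfolding P.sol_def y_def P_inc by simp
 from P.flow_unique[OF this assms] show ?thesis
  using P.flow_sol(1)[OF assms(1), of "(x, 0)"]
  by (simp add: y_def flow_def flow_int_def prod_eq_iff)
qed

lemma flow_self [simp]: "s \<in> I ==> \<Phi> s s x = x" "s \<in> I ==> Z s s x = 0"
 using P.flow_sol(1)[of s "(x, 0)"] by (auto simp: flow_def flow_int_def)

lemma cocycle:
 assumes "s \<in> I" "t \<in> I" "r \<in> I"
 shows "\<Phi> t r (\<Phi> s t x) = \<Phi> s r x" "Z s t x + Z t r (\<Phi> s t x) = Z s r x"
 using P.flow_flow[OF assms, of "(x, 0)"] P_flow_shift[OF assms(1,2), of x 0] P_flow_shift[OF assms(1,3), of x 0]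
  P_flow_shift[OF assms(2,3), of "\<Phi> s t x" "Z s t x"] by simp_all

lemma flow_inv: assumes "s \<in> I" "t \<in> I" shows "\<Phi> t s (\<Phi> s t x) = x"
 using cocycle(1)[OF assms assms(1)] assms by simp

definition Hf where "Hf = P.Hsol"
definition Mf where "Mf = P.Msol"
definition Qf where "Qf = (SOME Q. 1 <= Q \<and> (\<forall>s\<in>I. \<forall>t\<in>I. \<forall>x x'. norm (P.flow s t x' - P.flow s t x) <= Q * norm (x' - x)))"

lemma Hf: "0 <= Hf" and Mf: "0 <= Mf"
 by (auto simp: Hf_def Mf_def P.Hsol P.Msol(1))

lemma Qf: "1 <= Qf" "s \<in> I ==> t \<in> I ==> norm (P.flow s t x' - P.flow s t x) <= Qf * norm (x' - x)"
proof -
 obtain Q where "1 <= Q" "\<And>s t x x'. s \<in> I ==> t \<in> I ==> norm (P.flow s t x' - P.flow s t x) <= Q * norm (x' - x)"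
  using P.flow_stability by metis
 then have "\<exists>Q. 1 <= Q \<and> (\<forall>s\<in>I. \<forall>t\<in>I. \<forall>x x'. norm (P.flow s t x' - P.flow s t x) <= Q * norm (x' - x))"
  by blast
 from someI_ex[OF this] show "1 <= Qf" "s \<in> I ==> t \<in> I ==> norm (P.flow s t x' - P.flow s t x) <= Qf * norm (x' - x)"
  unfolding Qf_def by blast+
qed

lemma Pair_norm_leD:
 fixes u :: "'b::real_normed_vector" and v :: real
 assumes "norm (u, v) <= r"
 shows "norm u <= r" "\<bar>v\<bar> <= r"
 using assms norm_fst_le[of u v] norm_snd_le[of v u] by auto

lemma P_flow_eq: "P.flow s t (x, 0) = (\<Phi> s t x, Z s t x)" by (simp add: flow_def flow_int_def)

lemma flow_holder:
 assumes "s \<in> I" "a \<in> I" "b \<in> I"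
 shows "norm (\<Phi> s b x - \<Phi> s a x) <= Hf * \<bar>b - a\<bar> powr \<alpha>" "\<bar>Z s b x - Z s a x\<bar> <= Hf * \<bar>b - a\<bar> powr \<alpha>"
 using Pair_norm_leD[of "\<Phi> s b x - \<Phi> s a x" "Z s b x - Z s a x"] P.flow_holder[OF assms, of "(x, 0)"]
 unfolding P_flow_eq Hf_def by auto

lemma flow_davie:
 assumes "s \<in> I" "a \<in> I" "b \<in> I"
 shows "norm (\<Phi> s b x - \<Phi> s a x - dA a b (\<Phi> s a x)) <= Mf * \<bar>b - a\<bar> powr \<theta>"
  "\<bar>Z s b x - Z s a x - dc a b (\<Phi> s a x)\<bar> <= Mf * \<bar>b - a\<bar> powr \<theta>"
proof -
 have "norm (P.flow s b (x, 0) - P.flow s a (x, 0) - P.inc a b (P.flow s a (x, 0))) <= P.Msol * \<bar>b - a\<bar> powr \<theta>"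
  using P.flow_sol(2)[OF assms(1), of "(x, 0)"] assms unfolding P.sol_def by blast
 then show "norm (\<Phi> s b x - \<Phi> s a x - dA a b (\<Phi> s a x)) <= Mf * \<bar>b - a\<bar> powr \<theta>"
  "\<bar>Z s b x - Z s a x - dc a b (\<Phi> s a x)\<bar> <= Mf * \<bar>b - a\<bar> powr \<theta>"
  using Pair_norm_leD[of "\<Phi> s b x - \<Phi> s a x - dA a b (\<Phi> s a x)" "Z s b x - Z s a x - dc a b (\<Phi> s a x)"]
  unfolding P_flow_eq P_inc Mf_def by auto
qed

lemma flow_lipschitz:
 assumes "s \<in> I" "t \<in> I"
 shows "norm (\<Phi> s t x - \<Phi> s t y) <= Qf * norm (x - y)" "\<bar>Z s t x - Z s t y\<bar> <= Qf * norm (x - y)"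
 using Pair_norm_leD[of "\<Phi> s t x - \<Phi> s t y" "Z s t x - Z s t y"] Qf(2)[OF assms, of "(x, 0)" "(y, 0)"]
 unfolding P_flow_eq by auto

lemma flow_continuous:
 assumes "r \<in> I"
 shows "continuous_on (I \<times> UNIV) (\<lambda>w. \<Phi> (fst w) r (snd w))" "continuous_on (I \<times> UNIV) (\<lambda>w. Z (fst w) r (snd w))"
proof -
 have "continuous_on (I \<times> UNIV) (\<lambda>w. P.flow (fst w) r (snd w, 0))"
  by (rule continuous_on_compose2[OF P.flow_jointly_continuous[OF assms], of _ "\<lambda>w. (fst w, (snd w, 0))", simplified case_prod_beta fst_conv snd_conv])
   (auto intro!: continuous_intros)
 then show "continuous_on (I \<times> UNIV) (\<lambda>w. \<Phi> (fst w) r (snd w))" "continuous_on (I \<times> UNIV) (\<lambda>w. Z (fst w) r (snd w))"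
  unfolding flow_def flow_int_def by (auto intro: continuous_intros)
qed

text \<open>Derivatives in x that are jointly continuous in starting time and point, for a fixed
  final time: the form in which the gradient of a transported function needs them.\<close>

lemma flow_deriv:
 assumes r: "r \<in> I"
 obtains J K where
  "\<And>t x. t \<in> I ==> (\<Phi> t r has_derivative J t x) (at x)" "\<And>t x. t \<in> I ==> (Z t r has_derivative K t x) (at x)"
  "\<And>h. continuous_on (I \<times> UNIV) (\<lambda>w. J (fst w) (snd w) h)" "\<And>h. continuous_on (I \<times> UNIV) (\<lambda>w. K (fst w) (snd w) h)"
proof -
 obtain J where J: "\<And>s t w. s \<in> I ==> t \<in> I ==> (P.flow s t has_derivative J s t w) (at w)"
  "\<And>t h. t \<in> I ==> continuous_on (I \<times> UNIV) (\<lambda>(s, w). J s t w h)"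
  using P.flow_C1 by blast
 have d: "((\<lambda>x. P.flow t r (x, 0)) has_derivative (\<lambda>h. J t r (x, 0) (h, 0))) (at x)" if "t \<in> I" for t x
  by (rule has_derivative_compose[of "\<lambda>x. (x, 0)" "\<lambda>h. (h, 0)"])
   (use J(1)[OF that r] in \<open>auto intro!: derivative_eq_intros\<close>)
 have cont: "continuous_on (I \<times> UNIV) (\<lambda>w. J (fst w) r (snd w, 0) h)" for h
  by (rule continuous_on_compose2[OF J(2)[OF r, of h], of _ "\<lambda>w. (fst w, (snd w, 0))", simplified case_prod_beta fst_conv snd_conv])
   (auto intro!: continuous_intros)
 show ?thesis
 proof (rule that[of "\<lambda>t x h. fst (J t r (x, 0) (h, 0))" "\<lambda>t x h. snd (J t r (x, 0) (h, 0))"])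
  show "(\<Phi> t r has_derivative (\<lambda>h. fst (J t r (x, 0) (h, 0)))) (at x)" if "t \<in> I" for t x
   using has_derivative_fst[OF d[OF that]] by (simp add: flow_def[abs_def])
  show "(Z t r has_derivative (\<lambda>h. snd (J t r (x, 0) (h, 0)))) (at x)" if "t \<in> I" for t x
   using has_derivative_snd[OF d[OF that]] by (simp add: flow_int_def[abs_def])
  show "continuous_on (I \<times> UNIV) (\<lambda>w. fst (J (fst w) r (snd w, 0) (h, 0)))"
   "continuous_on (I \<times> UNIV) (\<lambda>w. snd (J (fst w) r (snd w, 0) (h, 0)))" for h
   using cont by (auto intro: continuous_intros)
 qed
qed

lemma young_ode_sol_flow:
 assumes "s \<in> I" shows "young_ode_sol T \<alpha> \<beta> A s x (\<lambda>t. \<Phi> s t x)"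
 unfolding young_ode_sol_def
proof (intro conjI ballI)
 \<comment> \<open>Witness \<gamma> = \<alpha>; the condition on the exponents then reads \<theta> >
   1.\<close>
 show "\<exists>\<gamma>>0. \<gamma> <= 1 \<and> 1 < \<alpha> + \<beta> * \<gamma> \<and> holder_path \<gamma> {s..T} (\<lambda>t. \<Phi> s t x)"
  using \<alpha> \<theta>1 F.\<theta>(1) flow_holder(1)[OF assms] assms
  by (intro exI[of _ \<alpha>]) (auto simp: holder_path_def mult.commute intro!: exI[of _ Hf])
 fix t assume t: "t \<in> {s..T}"
 have "riemann_lim (\<lambda>ts. \<Sum>i < length ts - 1. dA (ts ! i) (ts ! Suc i) (\<Phi> s (ts ! i) x)) s t (\<Phi> s t x - \<Phi> s s x)"
  proof (rule riemann_lim_of_expansion[OF _ \<theta>1])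
  show "norm (\<Phi> s b x - \<Phi> s a x - dA a b (\<Phi> s a x)) <= Mf * (b - a) powr \<theta>" if "s <= a" "a < b" "b <= t" for a b
   using flow_davie(1)[OF assms, of a b x] that t assms by auto
 qed (use t in auto)
 then show "riemann_lim (young_sum A (\<lambda>t. \<Phi> s t x)) s t (\<Phi> s t x - x)"
  using assms by (simp add: young_sum_def[abs_def] dA_def)
qed

text \<open>The definition grants only some Hoelder exponent \<gamma> and Riemann limits from s.
  Sewing with exponent \<alpha> + \<gamma> > 1 first upgrades the path to \<alpha>-Hoelder; sewing
  again with 2 * \<alpha> >= \<theta> yields Davie's expansion, for which uniqueness is
  known.\<close>

lemma young_ode_sol_unique:
 assumes s: "s \<in> I" and y: "young_ode_sol T \<alpha> \<beta> A s x y" and t: "t \<in> {s..T}"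
 shows "y t = \<Phi> s t x"
proof -
 define \<Xi> where "\<Xi> a b = dA a b (y a)" for a b
 obtain \<gamma> K where \<gamma>: "0 < \<gamma>" "\<gamma> <= 1" "\<alpha> + \<beta> * \<gamma> > 1"
  and K: "\<And>a b. a \<in> {s..T} ==> b \<in> {s..T} ==> norm (y b - y a) <= K * \<bar>b - a\<bar> powr \<gamma>"
  using y unfolding young_ode_sol_def holder_path_def by blast
 have "\<beta> * \<gamma> <= 1 * \<gamma>" using \<beta> \<gamma> by (intro mult_right_mono) auto
 then have \<alpha>\<gamma>: "1 < \<alpha> + \<gamma>" using \<gamma> by linarith
 have \<alpha>2: "1 < \<alpha> + \<alpha>" using F.\<theta>(2) \<theta>1 by simp
 have lim: "riemann_lim (\<lambda>ts. \<Sum>i < length ts - 1. \<Xi> (ts ! i) (ts ! Suc i)) s r (y r - x)" if "s <= r" "r <= T" for r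
  using y that unfolding young_ode_sol_def by (auto simp: \<Xi>_def young_sum_def[abs_def] dA_def)
 \<comment> \<open>The initial value is encoded in the equation at t = s, where partitions have no
   steps and the limit is 0.\<close>
 have ys: "y s = x"
 proof -
  have "riemann_lim (\<lambda>ts. \<Sum>i < length ts - 1. \<Xi> (ts ! i) (ts ! Suc i)) s s (y s - y s)"
   by (rule riemann_lim_of_expansion[OF _ \<theta>1]) auto
  then show ?thesis using riemann_lim_unique[OF order_refl lim[of s]] s by fastforce
 qed
 have step: "norm (y b - y a - \<Xi> a b) <= sewing_const (\<alpha> + e) * (C * k) * (b - a) powr (\<alpha> + e)"
  if k: "\<And>a b. s <= a ==> a <= b ==> b <= T ==> norm (y b - y a) <= k * (b - a) powr e" and k0: "0 <= k"
   and e: "1 < \<alpha> + e" "0 <= e" and ab: "s <= a" "a <= b" "b <= T" for k e a b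
 proof (rule expansion_of_riemann_lim[OF e(1) _ lim])
  show "0 <= C * k" using C0 k0 by simp
  fix a b c assume abc: "s <= a" "a <= b" "b <= c" "c <= T"
  have "norm (\<Xi> a c - \<Xi> a b - \<Xi> b c) = norm (dA b c (y a) - dA b c (y b))" by (simp add: \<Xi>_def dA_def)
  also have "... <= C * \<bar>c - b\<bar> powr \<alpha> * norm (y a - y b)"
   using F.inc_lip[of b c "y a" "y b"] abc s by (simp add: F.inc_def dA_def)
  also have "... <= C * (c - a) powr \<alpha> * (k * (c - a) powr e)"
  proof (intro mult_mono)
   show "\<bar>c - b\<bar> powr \<alpha> <= (c - a) powr \<alpha>" using abc \<alpha> by (intro powr_mono2) auto
   have "norm (y a - y b) <= k * (b - a) powr e" using k[of a b] abc by (simp add: norm_minus_commute)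
   also have "... <= k * (c - a) powr e" using abc k0 e by (intro mult_left_mono powr_mono2) auto
   finally show "norm (y a - y b) <= k * (c - a) powr e" .
  qed (use C0 k0 in auto)
  finally show "norm (\<Xi> a c - \<Xi> a b - \<Xi> b c) <= C * k * (c - a) powr (\<alpha> + e)" by (simp add: powr_add mult_ac)
 qed (use ab in \<open>auto simp: \<Xi>_def dA_def\<close>)
 define k where "k = max K 0"
 have k0: "0 <= k" by (simp add: k_def)
 have kb: "norm (y b - y a) <= k * (b - a) powr \<gamma>" if "s <= a" "a <= b" "b <= T" for a b
 proof -
  have "norm (y b - y a) <= K * (b - a) powr \<gamma>" using K[of a b] that by simp
  also have "... <= k * (b - a) powr \<gamma>" by (intro mult_right_mono) (auto simp: k_def)
  finally show ?thesis .
 qed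
 define M1 where "M1 = sewing_const (\<alpha> + \<gamma>) * (C * k)"
 have M1: "0 <= M1" using sewing_const(1)[OF \<alpha>\<gamma>] C0 k0 by (simp add: M1_def)
 define k1 where "k1 = M1 * T powr \<gamma> + C"
 have k10: "0 <= k1" using M1 C0 by (simp add: k1_def)
 have kb1: "norm (y b - y a) <= k1 * (b - a) powr \<alpha>" if ab: "s <= a" "a <= b" "b <= T" for a b
 proof -
  have "norm (y b - y a) <= norm (y b - y a - \<Xi> a b) + norm (\<Xi> a b)"
   using norm_triangle_ineq[of "y b - y a - \<Xi> a b" "\<Xi> a b"] by simp
  also have "... <= M1 * (b - a) powr (\<alpha> + \<gamma>) + C * (b - a) powr \<alpha>"
   using step[OF kb k0 \<alpha>\<gamma> _ ab] \<gamma> A_bound[of a b "y a"] ab s by (intro add_mono) (auto simp: M1_def \<Xi>_def dA_def)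
  also have "... <= M1 * (T powr \<gamma> * (b - a) powr \<alpha>) + C * (b - a) powr \<alpha>"
   using ab s \<gamma> M1 unfolding powr_add mult.commute[of "(b - a) powr \<alpha>"]
   by (intro add_right_mono mult_left_mono mult_right_mono powr_mono2) auto
  finally show ?thesis by (simp add: k1_def algebra_simps)
 qed
 define M2 where "M2 = sewing_const (\<alpha> + \<alpha>) * (C * k1)"
 have M2: "0 <= M2"
  unfolding M2_def by (rule mult_nonneg_nonneg[OF less_imp_le[OF sewing_const(1)[OF \<alpha>2]] mult_nonneg_nonneg[OF C0 k10]])
 define M3 where "M3 = M2 * T powr (2 * \<alpha> - \<theta>)"
 have M3: "0 <= M3" using M2 by (simp add: M3_def)
 have ex: "norm (y b - y a - \<Xi> a b) <= M3 * (b - a) powr \<theta>" if ab: "s <= a" "a <= b" "b <= T" for a b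
 proof -
  have "norm (y b - y a - \<Xi> a b) <= M2 * (b - a) powr (\<alpha> + \<alpha>)"
   using step[OF kb1 k10 \<alpha>2 _ ab] \<alpha> by (simp add: M2_def)
  also have "\<alpha> + \<alpha> = \<theta> + (2 * \<alpha> - \<theta>)" by simp
  also have "M2 * (b - a) powr (\<theta> + (2 * \<alpha> - \<theta>)) <= M2 * (T powr (2 * \<alpha> - \<theta>) * (b - a) powr \<theta>)"
   using ab s F.\<theta> M2 unfolding powr_add mult.commute[of "(b - a) powr \<theta>"]
   by (intro mult_left_mono mult_right_mono powr_mono2) auto
  finally show ?thesis by (simp add: M3_def mult_ac)
 qed
 show ?thesis
 proof (cases "s = T")
  \<comment> \<open>The locale of fields needs a nondegenerate interval; for s = T the initial value
    decides.\<close>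
  case True then show ?thesis using t ys s by simp
 next
  case False
  then have sT: "s < T" using s by simp
  interpret S: young_field s T \<alpha> \<beta> \<theta> C A DA by (rule F.young_field_sub) (use s sT in auto)
  have "S.sol Mf (\<lambda>t. \<Phi> s t x)"
   unfolding S.sol_def using flow_davie(1)[OF s] s Mf by (auto simp: S.inc_def dA_def)
  moreover obtain M' where "S.sol M' y"
   using S.sol_of_ordered[OF M3, of y] ex by (auto simp: \<Xi>_def S.inc_def dA_def)
  ultimately show ?thesis using S.sol_unique[of M' y Mf "\<lambda>t. \<Phi> s t x" s t] t ys s sT by auto
 qed
qed

lemma flow_fwd_eq: assumes "s \<in> I" "t \<in> {s..T}" shows "flow_fwd T \<alpha> \<beta> A s t x = \<Phi> s t x"
 unfolding flow_fwd_def
proof (rule the_equality)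
 show "\<exists>y. young_ode_sol T \<alpha> \<beta> A s x y \<and> y t = \<Phi> s t x"
  using young_ode_sol_flow[OF assms(1), of x] by (intro exI[of _ "\<lambda>t. \<Phi> s t x"]) simp
 show "z = \<Phi> s t x" if "\<exists>y. young_ode_sol T \<alpha> \<beta> A s x y \<and> y t = z" for z
  using that young_ode_sol_unique[OF assms(1) _ assms(2)] by auto
qed

lemma flow_bwd_eq: assumes "s \<in> I" "t \<in> {s..T}" shows "flow_bwd T \<alpha> \<beta> A s t x = \<Phi> t s x"
proof -
 have st: "s \<in> I" "t \<in> I" using assms by auto
 show ?thesis
  unfolding flow_bwd_def flow_fwd_eq[OF assms]
  by (rule the_equality) (use flow_inv[OF st(2,1)] flow_inv[OF st] in auto)
qed

text \<open>\<open>r\<close> is the time at which the characteristic sits at x: r = 0 for the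
  continuity equation, r = t for the transport equation. Agreement of \<open>y\<close> with the flow
  is asked on {0..t} only, because the backward flow to time s from time t is meaningful for s <=
  t.\<close>

lemma young_int_along_flow:
 assumes r: "r \<in> I" and t: "t \<in> I" and y: "\<And>a. a \<in> {0..t} ==> y a = \<Phi> r a x"
 shows "young_int c y 0 t = Z r t x - Z r 0 x"
proof -
 define \<Xi> where "\<Xi> a b = dc a b (y a)" for a b
 have "riemann_lim (\<lambda>ts. \<Sum>i < length ts - 1. \<Xi> (ts ! i) (ts ! Suc i)) 0 t (Z r t x - Z r 0 x)"
 proof (rule riemann_lim_of_expansion[OF _ \<theta>1])
  show "norm (Z r b x - Z r a x - \<Xi> a b) <= Mf * (b - a) powr \<theta>" if "0 <= a" "a < b" "b <= t" for a b
   using flow_davie(2)[OF r, of a b x] that t y[of a] by (simp add: \<Xi>_def)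
 qed (use t in auto)
 moreover have "young_sum c y = (\<lambda>ts. \<Sum>i < length ts - 1. \<Xi> (ts ! i) (ts ! Suc i))"
  by (simp add: young_sum_def[abs_def] \<Xi>_def dc_def)
 ultimately have lim: "riemann_lim (young_sum c y) 0 t (Z r t x - Z r 0 x)" by simp
 show ?thesis
  unfolding young_int_def
 proof (rule the_equality, rule lim)
  show "L = Z r t x - Z r 0 x" if "riemann_lim (young_sum c y) 0 t L" for L
   using riemann_lim_unique[of 0 t \<Xi> L "Z r t x - Z r 0 x"] that lim t
   by (simp add: young_sum_def[abs_def] \<Xi>_def dc_def)
 qed
qed

lemma divergence_eq: "t \<in> I ==> divergence A t x = (\<Sum>b\<in>Basis. DA t x b \<bullet> b)"
 unfolding divergence_def using frechet_derivative_at[OF A_deriv[of t x]] by simp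

end

section \<open>Integration by parts for compactly supported fields\<close>

lemma integrable_compact_support:
 fixes f :: "'a::euclidean_space => real"
 assumes "continuous_on UNIV f" "\<And>x. x \<notin> cball 0 R ==> f x = 0"
 shows "integrable lborel f"
proof -
 have "integrable lborel (\<lambda>x. indicator (cball 0 R) x *\<^sub>R f x)"
  by (rule borel_integrable_compact) (use continuous_on_subset[OF assms(1) subset_UNIV] in auto)
 moreover have "(\<lambda>x. indicator (cball 0 R) x *\<^sub>R f x) = f"
  using assms(2) by (auto simp: indicator_def fun_eq_iff)
 ultimately show ?thesis by simp
qed

text \<open>If f is not integrable, its integral is 0 by convention and nonnegativity of
  \<open>B\<close> is read off from a point of the ball; an empty ball has measure 0.\<close>

lemma integral_bound_compact_support:
 fixes f :: "'a::euclidean_space => real"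
 assumes "\<And>x. x \<notin> cball y R ==> f x = 0" "\<And>x. x \<in> cball y R ==> \<bar>f x\<bar> <= B"
 shows "\<bar>LINT x|lborel. f x\<bar> <= B * measure lborel (cball y R)"
proof (cases "integrable lborel f")
 case True
 have fin: "emeasure lborel (cball y R) < \<infinity>" using emeasure_bounded_finite[OF bounded_cball] .
 have i: "integrable lborel (\<lambda>x. B * indicator (cball y R) x)" using fin by (intro integrable_mult_right integrable_real_indicator) auto
 have "\<bar>LINT x|lborel. f x\<bar> <= (LINT x|lborel. \<bar>f x\<bar>)" using integral_norm_bound[of lborel f] by simp
 also have "... <= (LINT x|lborel. B * indicator (cball y R) x)"
 proof (rule integral_mono[OF _ i])
  show "\<bar>f x\<bar> <= B * indicator (cball y R) x" for x using assms[of x] by (auto simp: indicator_def)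
 qed (use True in auto)
 also have "... = B * measure lborel (cball y R)" by simp
 finally show ?thesis .
next
 case False
 show ?thesis
 proof (cases "cball y R = {}")
  case False
  then obtain x where "x \<in> cball y R" by blast
  then have "0 <= B" using assms(2)[of x] by linarith
  then show ?thesis using \<open>\<not> integrable lborel f\<close> by (simp add: not_integrable_integral_eq)
 qed (use \<open>\<not> integrable lborel f\<close> in \<open>simp add: not_integrable_integral_eq\<close>)
qed

lemma lborel_integral_translate:
 fixes f :: "'a::euclidean_space => real"
 shows "(LINT x|lborel. f (c + x)) = (LINT x|lborel. f x)"
proof (cases "f \<in> borel_measurable borel")
 case True
 have "(LINT x|lborel. f x) = (LINT x|distr lborel borel ((+) c). f x)" by (simp add: lborel_distr_plus)
 also have "... = (LINT x|lborel. f (c + x))" using True by (intro integral_distr) auto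
 finally show ?thesis ..
next
 case False
 have "(\<lambda>x. f (c + x)) \<notin> borel_measurable borel"
 proof
  assume "(\<lambda>x. f (c + x)) \<in> borel_measurable borel"
  then have "(\<lambda>x. f (c + (x - c))) \<in> borel_measurable borel" by measurable
  then show False using False by simp
 qed
 then have "\<not> integrable lborel f" "\<not> integrable lborel (\<lambda>x. f (c + x))"
  using False by (auto dest: borel_measurable_integrable)
 then show ?thesis by (simp add: not_integrable_integral_eq)
qed

lemma lborel_integral_reflect:
 fixes f :: "'a::euclidean_space => real"
 assumes [measurable]: "f \<in> borel_measurable borel"
 shows "(LINT x|lborel. f (c - x)) = (LINT x|lborel. f x)"
proof -
 have "lborel = density (distr lborel borel (\<lambda>x::'a. c + (-1) *\<^sub>R x)) (\<lambda>_. \<bar>-1::real\<bar> ^ DIM('a))"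
  by (rule lborel_affine) simp
 then have "(lborel :: 'a measure) = distr lborel borel (\<lambda>x. c - x)" by (simp add: density_1)
 then have "(LINT x|lborel. f x) = (LINT x|distr lborel borel (\<lambda>x. c - x). f x)" by simp
 also have "... = (LINT x|lborel. f (c - x))" by (rule integral_distr) auto
 finally show ?thesis ..
qed

text \<open>Each difference quotient has integral 0 by translation invariance; Lipschitz continuity
  and compact support dominate the passage to the limit.\<close>

lemma integral_directional_derivative_eq_0:
 fixes f :: "'a::euclidean_space => real"
 assumes f: "\<And>x. (f has_derivative f' x) (at x)" and lip: "\<And>x y. \<bar>f x - f y\<bar> <= B * norm (x - y)"
  and supp: "\<And>x. x \<notin> cball 0 R ==> f x = 0"
 shows "(LINT x|lborel. f' x b) = 0"
proof -
 have contf: "continuous_on UNIV f" using f by (meson continuous_at_imp_continuous_on has_derivative_continuous)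
 have fi: "integrable lborel f" by (rule integrable_compact_support[OF contf supp])
 have B0: "0 <= B * norm (b)" using lip[of b 0] by (metis abs_ge_zero diff_zero order_trans)
 define q where "q n x = (f (inverse (real (Suc n)) *\<^sub>R b + x) - f x) / inverse (real (Suc n))" for n x
 \<comment> \<open>The steps are at most 1, so every translate of f used here vanishes outside this
   ball.\<close>
 define S where "S = cball (0::'a) (\<bar>R\<bar> + norm b)"
 have "(\<lambda>n. LINT x|lborel. q n x) \<longlonglongrightarrow> (LINT x|lborel. f' x b)"
 proof (rule integral_dominated_convergence[where w = "\<lambda>x. (B * norm b) * indicator S x"])
  have lim: "(\<lambda>n. q n x) \<longlonglongrightarrow> f' x b" for x
  proof -
   have "((\<lambda>h. (f (x + h *\<^sub>R b) - f x) / h) \<longlongrightarrow> f' x b) (at 0)"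
   proof -
    have "((\<lambda>h. f (x + h *\<^sub>R b)) has_derivative (\<lambda>h. f' x (h *\<^sub>R b))) (at 0)"
    proof -
     have g: "((\<lambda>h::real. x + h *\<^sub>R b) has_derivative (\<lambda>h. h *\<^sub>R b)) (at 0)" by (auto intro!: derivative_eq_intros)
     show ?thesis using has_derivative_compose[OF g, of f "f' x"] f[of x] by simp
    qed
    moreover have "(\<lambda>h. f' x (h *\<^sub>R b)) = (\<lambda>h. h * f' x b)"
     using linear_scale[OF has_derivative_linear[OF f]] by auto
    ultimately have "((\<lambda>h. f (x + h *\<^sub>R b)) has_real_derivative f' x b) (at 0)"
     by (simp add: has_field_derivative_def mult.commute[of _ "f' x b"] fun_eq_iff)
    then show ?thesis by (simp add: DERIV_def)
   qed
   moreover have "(\<lambda>n. inverse (real (Suc n))) \<longlonglongrightarrow> 0" by (rule LIMSEQ_inverse_real_of_nat)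
   then have "filterlim (\<lambda>n. inverse (real (Suc n))) (at 0) sequentially"
    by (simp add: filterlim_at)
   ultimately have "(\<lambda>n. (f (x + inverse (real (Suc n)) *\<^sub>R b) - f x) / inverse (real (Suc n))) \<longlonglongrightarrow> f' x b"
    by (rule filterlim_compose)
   then show ?thesis by (simp add: q_def add.commute)
  qed
  show "AE x in lborel. (\<lambda>n. q n x) \<longlonglongrightarrow> f' x b" using lim by simp
  have qm: "q n \<in> borel_measurable lborel" for n
   unfolding q_def using contf
   by (auto intro!: borel_measurable_continuous_onI continuous_intros continuous_on_compose2[OF contf])
  show "(\<lambda>x. q n x) \<in> borel_measurable lborel" for n using qm by simp
  show "(\<lambda>x. f' x b) \<in> borel_measurable lborel" using borel_measurable_LIMSEQ_real[OF lim qm] by simp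
  show "integrable lborel (\<lambda>x. (B * norm b) * indicator S x)"
   using emeasure_bounded_finite[of S] by (intro integrable_mult_right integrable_real_indicator) (auto simp: S_def)
  fix n
  have "norm (q n x) <= (B * norm b) * indicator S x" for x
  proof (cases "x \<in> S")
   case True
   let ?h = "inverse (real (Suc n))"
   have "\<bar>f (?h *\<^sub>R b + x) - f x\<bar> <= B * norm b * ?h" using lip[of "?h *\<^sub>R b + x" x] by (simp add: mult_ac)
   then have "\<bar>f (?h *\<^sub>R b + x) - f x\<bar> / ?h <= B * norm b" by (subst pos_divide_le_eq) auto
   then show ?thesis using True by (simp add: q_def abs_divide)
  next
   case False
   let ?h = "inverse (real (Suc n))"
   have x: "norm x > \<bar>R\<bar> + norm b" using False by (simp add: S_def)
   have "?h * norm b <= 1 * norm b" by (intro mult_right_mono) (auto simp: inverse_le_1_iff)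
   then have "norm (?h *\<^sub>R b + x) > \<bar>R\<bar>" using x norm_triangle_ineq4[of "?h *\<^sub>R b + x" "?h *\<^sub>R b"] by simp
   then have "f (?h *\<^sub>R b + x) = 0" by (intro supp) auto
   moreover have "\<not> norm x <= R" using x norm_ge_zero[of b] abs_ge_self[of R] by linarith
   then have "f x = 0" by (intro supp) simp
   ultimately show ?thesis using False by (simp add: q_def)
  qed
  then show "AE x in lborel. norm (q n x) <= (B * norm b) * indicator S x" by simp
 qed
 moreover have "(LINT x|lborel. q n x) = 0" for n
 proof -
  let ?h = "inverse (real (Suc n))"
  have "integrable lborel (\<lambda>x. f (?h *\<^sub>R b + x))"
  proof (rule integrable_compact_support[where R = "\<bar>R\<bar> + norm b"])
   show "continuous_on UNIV (\<lambda>x. f (?h *\<^sub>R b + x))"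
    by (rule continuous_on_compose2[OF contf]) (auto intro!: continuous_intros)
   fix x :: 'a assume "x \<notin> cball 0 (\<bar>R\<bar> + norm b)"
   then have x: "norm x > \<bar>R\<bar> + norm b" by simp
   have "?h * norm b <= 1 * norm b" by (intro mult_right_mono) (auto simp: inverse_le_1_iff)
   then have "norm (?h *\<^sub>R b + x) > \<bar>R\<bar>" using x norm_triangle_ineq4[of "?h *\<^sub>R b + x" "?h *\<^sub>R b"] by simp
   then show "f (?h *\<^sub>R b + x) = 0" by (intro supp) auto
  qed
  then have "(LINT x|lborel. f (?h *\<^sub>R b + x) - f x) = 0"
   using fi lborel_integral_translate[of f "?h *\<^sub>R b"] by simp
  then show ?thesis unfolding q_def by simp
 qed
 ultimately show ?thesis by (simp add: LIMSEQ_const_iff)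
qed

lemma integral_divergence_eq_0:
 fixes V :: "'a::euclidean_space => 'a"
 assumes V: "\<And>x. (V has_derivative V' x) (at x)" and lip: "\<And>x y. norm (V x - V y) <= B * norm (x - y)"
  and supp: "\<And>x. x \<notin> cball 0 R ==> V x = 0"
  and int: "\<And>b. b \<in> Basis ==> integrable lborel (\<lambda>x. V' x b \<bullet> b)"
 shows "(LINT x|lborel. (\<Sum>b\<in>Basis. V' x b \<bullet> b)) = 0"
proof -
 have "(LINT x|lborel. V' x b \<bullet> b) = 0" if b: "b \<in> Basis" for b
 proof (rule integral_directional_derivative_eq_0[where f = "\<lambda>x. V x \<bullet> b" and f' = "\<lambda>x h. V' x h \<bullet> b" and B = B and R = R])
  show "((\<lambda>x. V x \<bullet> b) has_derivative (\<lambda>h. V' x h \<bullet> b)) (at x)" for x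
   by (intro has_derivative_inner_left V)
  show "\<bar>V x \<bullet> b - V y \<bullet> b\<bar> <= B * norm (x - y)" for x y
   using Basis_le_norm[OF b, of "V x - V y"] lip[of x y] by (simp add: inner_diff_left)
 qed (use supp in auto)
 then show ?thesis using int by (subst Bochner_Integration.integral_sum) auto
qed

text \<open>The Leibniz rule is applied to integrals of continuous functions over a box; compact
  support allows the Lebesgue integral over the whole space to be exchanged for such an
  integral.\<close>

lemma integral_has_real_derivative:
 fixes F F' :: "real => 'a::euclidean_space => real"
 assumes F: "\<And>l x. l \<in> {0..1} ==> ((\<lambda>l. F l x) has_real_derivative F' l x) (at l within {0..1})"
  and cF: "\<And>l. l \<in> {0..1} ==> continuous_on UNIV (F l)"
  and cF': "continuous_on ({0..1} \<times> UNIV) (\<lambda>(l, x). F' l x)"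
  and supp: "\<And>l x. x \<notin> cball 0 R ==> F l x = 0" "\<And>l x. x \<notin> cball 0 R ==> F' l x = 0"
  and l: "l \<in> {0..1}"
 shows "((\<lambda>l. LINT x|lborel. F l x) has_real_derivative (LINT x|lborel. F' l x)) (at l within {0..1})"
proof -
 obtain a b :: 'a where ab: "cball 0 R \<subseteq> cbox a b" using bounded_subset_cbox_symmetric[OF bounded_cball] by metis
 have eq: "integral (cbox a b) f = (LINT x|lborel. f x)"
  if "continuous_on UNIV f" "\<And>x. x \<notin> cball 0 R ==> f x = 0" for f :: "'a => real"
 proof -
  have "f x = 0" if "x \<notin> cbox a b" for x using \<open>\<And>x. x \<notin> cball 0 R ==> f x = 0\<close>[of x] that ab by blast
  then have "(\<lambda>x. if x \<in> cbox a b then f x else 0) = f" by (auto simp: fun_eq_iff)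
  then have "integral (cbox a b) f = integral UNIV f" using integral_restrict_UNIV[of "cbox a b" f] by simp
  then show ?thesis using integral_lborel[OF integrable_compact_support[OF that]] by simp
 qed
 have cF'l: "continuous_on UNIV (F' l)" if "l \<in> {0..1}" for l
  by (rule continuous_on_compose2[OF cF', of _ "\<lambda>x. (l, x)", simplified]) (use that in \<open>auto intro!: continuous_intros\<close>)
 have "((\<lambda>l. integral (cbox a b) (F l)) has_real_derivative integral (cbox a b) (F' l)) (at l within {0..1})"
 proof (rule leibniz_rule_field_derivative)
  show "F l integrable_on cbox a b" if "l \<in> {0..1}" for l
   using cF[OF that] by (intro integrable_continuous) (auto intro: continuous_on_subset)
  show "continuous_on ({0..1} \<times> cbox a b) (\<lambda>(x, t). F' x t)" by (rule continuous_on_subset[OF cF']) auto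
 qed (use F l in auto)
 then have "((\<lambda>l. LINT x|lborel. F l x) has_real_derivative integral (cbox a b) (F' l)) (at l within {0..1})"
  by (rule has_field_derivative_transform_within[where d = 1]) (use l eq[OF cF supp(1)] in auto)
 moreover have "integral (cbox a b) (F' l) = (LINT x|lborel. F' l x)" by (rule eq[OF cF'l[OF l] supp(2)])
 ultimately show ?thesis by simp
qed

lemma has_derivative_0_outside:
 fixes f :: "'a::euclidean_space => 'b::real_normed_vector"
 assumes f: "(f has_derivative f') (at x)" and supp: "\<And>x. x \<notin> cball 0 R ==> f x = 0" and x: "x \<notin> cball 0 R"
 shows "f' = (\<lambda>_. 0)"
proof -
 have "((\<lambda>_. 0) has_derivative f') (at x)"
  by (rule has_derivative_transform_within_open[OF f, of "- cball 0 R"]) (use supp x in auto)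
 then show ?thesis using has_derivative_unique[OF has_derivative_const] by blast
qed

lemma C1_compact_support_lipschitz:
 fixes f :: "'a::euclidean_space => 'b::real_normed_vector"
 assumes f: "\<And>x. (f has_derivative f' x) (at x)" and supp: "\<And>x. x \<notin> cball 0 R ==> f x = 0"
  and cont: "\<And>b. b \<in> Basis ==> continuous_on UNIV (\<lambda>x. f' x b)"
 obtains B where "\<And>x y. norm (f x - f y) <= B * norm (x - y)"
proof -
 have "\<exists>B. \<forall>x \<in> cball 0 R. norm (f' x b) <= B" if "b \<in> Basis" for b
 proof -
  have "bounded ((\<lambda>x. f' x b) ` cball 0 R)"
   by (intro compact_imp_bounded compact_continuous_image continuous_on_subset[OF cont[OF that]]) auto
  then show ?thesis by (auto simp: bounded_iff)
 qed
 then obtain K where K: "\<And>b x. b \<in> Basis ==> x \<in> cball 0 R ==> norm (f' x b) <= K b" by metis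
 define B where "B = (\<Sum>b\<in>Basis. \<bar>K b\<bar>)"
 have "norm (f' x h) <= B * norm h" for x h
 proof (cases "x \<in> cball 0 R")
  case True
  interpret lin: linear "f' x" by (rule has_derivative_linear[OF f])
  have "f' x h = f' x (\<Sum>b\<in>Basis. (h \<bullet> b) *\<^sub>R b)" by (simp add: euclidean_representation)
  also have "... = (\<Sum>b\<in>Basis. (h \<bullet> b) *\<^sub>R f' x b)" by (simp add: lin.sum lin.scale)
  finally have eq: "f' x h = (\<Sum>b\<in>Basis. (h \<bullet> b) *\<^sub>R f' x b)" .
  have "norm (f' x h) <= (\<Sum>b\<in>Basis. norm ((h \<bullet> b) *\<^sub>R f' x b))" unfolding eq by (rule norm_sum)
  also have "... <= (\<Sum>b\<in>Basis. norm h * \<bar>K b\<bar>)"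
  proof (rule sum_mono)
   fix b :: 'a assume b: "b \<in> Basis"
   have "\<bar>h \<bullet> b\<bar> * norm (f' x b) <= norm h * \<bar>K b\<bar>"
    using K[OF b True] Basis_le_norm[OF b, of h] by (intro mult_mono) auto
   then show "norm ((h \<bullet> b) *\<^sub>R f' x b) <= norm h * \<bar>K b\<bar>" by simp
  qed
  finally show ?thesis by (simp add: B_def sum_distrib_left mult.commute)
 next
  case False
  then show ?thesis using has_derivative_0_outside[OF f supp False] by (simp add: B_def sum_nonneg)
 qed
 then have "onorm (f' x) <= B" for x by (intro onorm_le)
 then have "norm (f x - f y) <= B * norm (x - y)" for x y
  by (intro differentiable_bound[of UNIV f f']) (use f has_derivative_at_withinI in auto)
 then show ?thesis using that by blast
qed

lemma lipschitz_of_gradient: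
 fixes f :: "'a::euclidean_space => real"
 assumes f: "\<And>x. (f has_derivative (\<lambda>h. g x \<bullet> h)) (at x)" and B: "\<And>x. x \<in> cball 0 R ==> norm (g x) <= B"
  and xy: "x \<in> cball 0 R" "y \<in> cball 0 R"
 shows "\<bar>f x - f y\<bar> <= B * norm (x - y)"
proof -
 have "norm (f x - f y) <= B * norm (x - y)"
 proof (rule differentiable_bound[of "cball 0 R" f "\<lambda>x h. g x \<bullet> h"])
  show "onorm (\<lambda>h. g z \<bullet> h) <= B" if z: "z \<in> cball 0 R" for z
  proof (rule onorm_le)
   fix h
   have "\<bar>g z \<bullet> h\<bar> <= norm (g z) * norm h" by (rule Cauchy_Schwarz_ineq2)
   also have "... <= B * norm h" by (intro mult_right_mono B z) auto
   finally show "norm (g z \<bullet> h) <= B * norm h" by simp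
  qed
 qed (use xy in \<open>auto intro: has_derivative_at_withinI[OF f]\<close>)
 then show ?thesis by simp
qed

lemma holder_imp_continuous_on:
 fixes f :: "'a::real_normed_vector => 'b::real_normed_vector"
 assumes "0 < \<beta>" "\<And>x y. norm (f x - f y) <= K * norm (x - y) powr \<beta>"
 shows "continuous_on UNIV f"
proof (rule continuous_at_imp_continuous_on, rule ballI)
 fix x :: 'a
 have "((\<lambda>y. K * norm (y - x) powr \<beta>) \<longlongrightarrow> K * norm (x - x) powr \<beta>) (at x)"
  using assms(1) by (intro tendsto_intros tendsto_powr') (auto intro!: always_eventually)
 then have "((\<lambda>y. K * norm (y - x) powr \<beta>) \<longlongrightarrow> 0) (at x)" by simp
 then have "((\<lambda>y. f y - f x) \<longlongrightarrow> 0) (at x)"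
  by (rule Lim_null_comparison[rotated]) (use assms(2) in \<open>auto intro!: always_eventually\<close>)
 then show "isCont f x" by (simp add: isCont_def LIM_zero_iff)
qed

text \<open>Quantitative test functions of class C1,1: a support radius and one constant for the
  value, the gradient and the Lipschitz constant of the gradient. The expansions are linear in
  \<open>Q\<close> for fixed \<open>R\<close>, hence uniform over the translates of a mollifying
  kernel. \<open>G\<close> is the gradient as a vector field.\<close>

definition tame :: "real => real => ('a::euclidean_space => real) => ('a => 'a) => bool" where
 "tame R Q \<phi> G \<longleftrightarrow> (\<forall>x. (\<phi> has_derivative (\<lambda>h. G x \<bullet> h)) (at x)) \<and> (\<forall>x. x \<notin> cball 0 R --> \<phi> x = 0) \<and>
  (\<forall>x. \<bar>\<phi> x\<bar> <= Q) \<and> (\<forall>x. norm (G x) <= Q) \<and> (\<forall>x y. norm (G x - G y) <= Q * norm (x - y))"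

lemma tameD:
 assumes "tame R Q \<phi> G"
 shows "(\<phi> has_derivative (\<lambda>h. G x \<bullet> h)) (at x)" "x \<notin> cball 0 R ==> \<phi> x = 0" "x \<notin> cball 0 R ==> G x = 0"
  "\<bar>\<phi> x\<bar> <= Q" "norm (G x) <= Q" "norm (G x - G y) <= Q * norm (x - y)" "0 <= Q"
  "\<bar>\<phi> x - \<phi> y\<bar> <= Q * norm (x - y)" "continuous_on UNIV \<phi>" "continuous_on UNIV G"
  "frechet_derivative \<phi> (at x) = (\<lambda>h. G x \<bullet> h)"
proof -
 show d: "(\<phi> has_derivative (\<lambda>h. G x \<bullet> h)) (at x)" for x using assms by (auto simp: tame_def)
 show s: "\<phi> x = 0" if "x \<notin> cball 0 R" for x using assms that by (auto simp: tame_def)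
 show "G x = 0" if "x \<notin> cball 0 R"
 proof -
  have "(\<lambda>h. G x \<bullet> h) = (\<lambda>_. 0)" by (rule has_derivative_0_outside[OF d s that])
  then have "G x \<bullet> G x = 0" by metis
  then show ?thesis by simp
 qed
 show "\<bar>\<phi> x\<bar> <= Q" "norm (G x - G y) <= Q * norm (x - y)" using assms by (auto simp: tame_def)
 show Gb: "norm (G x) <= Q" for x using assms by (auto simp: tame_def)
 show Q0: "0 <= Q" using Gb[of 0] norm_ge_zero order_trans by blast
 show "\<bar>\<phi> x - \<phi> y\<bar> <= Q * norm (x - y)"
  by (rule lipschitz_of_gradient[where R = "max (norm x) (norm y)", OF d Gb]) auto
 show "continuous_on UNIV \<phi>" using d by (meson continuous_at_imp_continuous_on has_derivative_continuous)
 show "continuous_on UNIV G"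
  by (rule lipschitz_on_continuous_on[of Q]) (use assms Q0 in \<open>auto simp: lipschitz_on_def dist_norm tame_def\<close>)
 show "frechet_derivative \<phi> (at x) = (\<lambda>h. G x \<bullet> h)" by (rule frechet_derivative_at[OF d, symmetric])
qed

section \<open>Increments of the coefficients in space, and displacement inside an integral\<close>

context transport_coeffs
begin

definition da where "da s t x h = DA t x h - DA s x h"
definition diva where "diva s t x = (\<Sum>b\<in>Basis. da s t x b \<bullet> b)"
definition N where "N = real DIM('a)"

lemma N: "1 <= N" unfolding N_def using DIM_positive[where 'a='a] by linarith

lemma da_eq: "da = F.dinc" by (simp add: fun_eq_iff da_def F.dinc_def)
lemma dA_eq: "dA = F.inc" by (simp add: fun_eq_iff dA_def F.inc_def)

lemma dA_bound: "s \<in> I ==> t \<in> I ==> norm (dA s t x) <= C * \<bar>t - s\<bar> powr \<alpha>" by (simp add: dA_def A_bound)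
lemma dA_lip: "s \<in> I ==> t \<in> I ==> norm (dA s t x - dA s t y) <= C * \<bar>t - s\<bar> powr \<alpha> * norm (x - y)"
 using F.inc_lip by (simp add: dA_eq)
lemma dc_bound: "s \<in> I ==> t \<in> I ==> \<bar>dc s t x\<bar> <= C * \<bar>t - s\<bar> powr \<alpha>" by (simp add: dc_def c_bound)
lemma dc_lip:
 assumes "s \<in> I" "t \<in> I" shows "\<bar>dc s t x - dc s t y\<bar> <= C * \<bar>t - s\<bar> powr \<alpha> * norm (x - y)"
proof -
 have "norm (dc s t x - dc s t y) <= C * \<bar>t - s\<bar> powr \<alpha> * norm (x - y)"
  unfolding dc_def
  by (rule differentiable_bound[of UNIV "\<lambda>x. c t x - c s x" "\<lambda>x h. Dc t x h - Dc s x h"])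
   (use Dc_bound assms in \<open>auto intro!: onorm_le has_derivative_diff has_derivative_at_withinI[OF c_deriv]\<close>)
 then show ?thesis by simp
qed
lemma da_bound: "s \<in> I ==> t \<in> I ==> norm (da s t x h) <= C * \<bar>t - s\<bar> powr \<alpha> * norm h" by (simp add: da_def DA_bound)

lemma diva_bound: assumes "s \<in> I" "t \<in> I" shows "\<bar>diva s t x\<bar> <= N * C * \<bar>t - s\<bar> powr \<alpha>"
proof -
 have "\<bar>diva s t x\<bar> <= (\<Sum>b\<in>(Basis::'a set). C * \<bar>t - s\<bar> powr \<alpha>)"
  unfolding diva_def
 proof (rule order_trans[OF sum_abs sum_mono])
  fix b :: 'a assume b: "b \<in> Basis"
  show "\<bar>da s t x b \<bullet> b\<bar> <= C * \<bar>t - s\<bar> powr \<alpha>"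
   using da_bound[OF assms, of x b] Basis_le_norm[OF b, of "da s t x b"] b by simp
 qed
 then show ?thesis by (simp add: N_def mult.assoc)
qed

lemma diva_holder:
 assumes "s \<in> I" "t \<in> I"
 shows "\<bar>diva s t x - diva s t y\<bar> <= N * C * \<bar>t - s\<bar> powr \<alpha> * norm (x - y) powr \<beta>"
proof -
 have "\<bar>diva s t x - diva s t y\<bar> <= (\<Sum>b\<in>(Basis::'a set). C * \<bar>t - s\<bar> powr \<alpha> * norm (x - y) powr \<beta>)"
  unfolding diva_def sum_subtractf[symmetric]
 proof (rule order_trans[OF sum_abs sum_mono])
  fix b :: 'a assume b: "b \<in> Basis"
  show "\<bar>da s t x b \<bullet> b - da s t y b \<bullet> b\<bar> <= C * \<bar>t - s\<bar> powr \<alpha> * norm (x - y) powr \<beta>"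
   using DA_holder[OF assms, of x b y] Basis_le_norm[OF b, of "da s t x b - da s t y b"] b
   by (simp add: inner_diff_left da_def)
 qed
 then show ?thesis by (simp add: N_def mult.assoc)
qed

lemma da_continuous: assumes "s \<in> I" "t \<in> I" shows "continuous_on UNIV (\<lambda>x. da s t x h)"
 by (rule holder_imp_continuous_on[OF \<beta>(1), where K = "C * \<bar>t - s\<bar> powr \<alpha> * norm h"])
  (use DA_holder[OF assms, of _ h] in \<open>simp add: da_def mult_ac\<close>)

lemma diva_continuous: assumes "s \<in> I" "t \<in> I" shows "continuous_on UNIV (\<lambda>x. diva s t x)"
 unfolding diva_def by (intro continuous_intros da_continuous assms)

lemma dA_deriv: assumes "s \<in> I" "t \<in> I" shows "(dA s t has_derivative da s t x) (at x)"
 using F.inc_deriv[OF assms] by (simp add: dA_eq da_eq)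

lemma dA_continuous: assumes "s \<in> I" "t \<in> I" shows "continuous_on UNIV (\<lambda>x. dA s t x)"
 by (meson dA_deriv[OF assms] continuous_at_imp_continuous_on has_derivative_continuous)

lemma dc_continuous: assumes "s \<in> I" "t \<in> I" shows "continuous_on UNIV (\<lambda>x. dc s t x)"
 unfolding dc_def using has_derivative_continuous[OF c_deriv[OF assms(1)]] has_derivative_continuous[OF c_deriv[OF assms(2)]]
 by (intro continuous_intros continuous_at_imp_continuous_on) auto

lemma powr_2\<alpha>: "0 <= r ==> r <= T ==> r powr \<alpha> * r powr \<alpha> <= T powr (2 * \<alpha> - \<theta>) * r powr \<theta>"
 using F.powr_le_L[of r "2 * \<alpha> - \<theta>" \<theta>] F.\<theta>(2) powr_add[of r \<alpha> \<alpha>] by (simp add: F.L_def)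

text \<open>Moving the points by \<open>- dA s t\<close> changes the integral against a test function as the divergence
 of the test vector field predicts. The homotopy \<open>x - l *\<^sub>R dA s t x\<close> and integration by parts
 replace a change of variables.\<close>

lemma homotopy:
 assumes st: "s \<in> I" "t \<in> I" and \<phi>: "tame R Q \<phi> G"
  and f: "\<And>x. (f has_derivative (\<lambda>h. g x \<bullet> h)) (at x)" and cg: "continuous_on UNIV g"
  and B: "\<And>x. x \<in> cball 0 (R + C * \<bar>t - s\<bar> powr \<alpha>) ==> norm (g x) <= B"
 shows "\<bar>(LINT x|lborel. (f (x - dA s t x) - f x) * \<phi> x) - (LINT x|lborel. f x * (G x \<bullet> dA s t x + diva s t x * \<phi> x))\<bar>
  <= B * Q * C ^ 2 * (N + 2) * (\<bar>t - s\<bar> powr \<alpha> * \<bar>t - s\<bar> powr \<alpha>) * measure lborel (cball (0::'a) R)"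
proof (cases "0 <= R")
 case False
 then have "\<phi> x = 0" "G x = 0" for x using tameD(2,3)[OF \<phi>, of x] norm_ge_zero[of x] by auto
 then show ?thesis using False by simp
next
 case R: True
 define \<tau> where "\<tau> = \<bar>t - s\<bar> powr \<alpha>"
 have \<tau>: "0 <= \<tau>" by (simp add: \<tau>_def)
 define a where "a = dA s t"
 define a' where "a' = da s t"
 have a_b: "norm (a x) <= C * \<tau>" for x using dA_bound[OF st] by (simp add: a_def \<tau>_def)
 have a'_b: "norm (a' x h) <= C * \<tau> * norm h" for x h using da_bound[OF st] by (simp add: a'_def \<tau>_def)
 have a_d: "(a has_derivative a' x) (at x)" for x using dA_deriv[OF st] by (simp add: a_def a'_def)
 have a'_lin: "linear (a' x)" for x using has_derivative_linear[OF a_d] .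
 have a_c[continuous_intros]: "continuous_on S a" for S using continuous_on_subset[OF dA_continuous[OF st]] by (simp add: a_def[abs_def])
 have a'_c[continuous_intros]: "continuous_on S (\<lambda>x. a' x h)" for h S using continuous_on_subset[OF da_continuous[OF st]] by (simp add: a'_def)
 have div_c[continuous_intros]: "continuous_on S (diva s t)" for S using continuous_on_subset[OF diva_continuous[OF st]] by simp
 have a'a: "a' x (a x) = (\<Sum>b\<in>Basis. (a x \<bullet> b) *\<^sub>R a' x b)" for x
 proof -
  interpret lin: linear "a' x" by (rule a'_lin)
  have "a' x (a x) = a' x (\<Sum>b\<in>Basis. (a x \<bullet> b) *\<^sub>R b)" by (simp add: euclidean_representation)
  then show ?thesis by (simp add: lin.sum lin.scale)
 qed
 have a'a_c[continuous_intros]: "continuous_on S (\<lambda>x. a' x (a x))" for S unfolding a'a by (intro continuous_intros)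
 have f_c: "continuous_on UNIV f" using f by (meson continuous_at_imp_continuous_on has_derivative_continuous)
 have \<phi>_c[continuous_intros]: "continuous_on S \<phi>" for S by (rule continuous_on_subset[OF tameD(9)[OF \<phi>]]) simp
 have G_c[continuous_intros]: "continuous_on S G" for S by (rule continuous_on_subset[OF tameD(10)[OF \<phi>]]) simp
 have f_c'[continuous_intros]: "continuous_on S (\<lambda>x. f (k x))" if "continuous_on S k" for S and k :: "'c::topological_space => 'a"
  by (rule continuous_on_compose2[OF f_c that]) auto
 have g_c'[continuous_intros]: "continuous_on S (\<lambda>x. g (k x))" if "continuous_on S k" for S and k :: "'c::topological_space => 'a"
  by (rule continuous_on_compose2[OF cg that]) auto
 have \<phi>0: "\<phi> x = 0" "G x = 0" if "x \<notin> cball 0 R" for x using tameD(2,3)[OF \<phi> that] .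
 have intg: "integrable lborel k" if "continuous_on UNIV k" "\<And>x. x \<notin> cball 0 R ==> k x = 0" for k :: "'a => real"
  using integrable_compact_support that by blast
 define X where "X = (LINT x|lborel. f x * (G x \<bullet> a x + diva s t x * \<phi> x))"
 define K where "K = B * Q * C ^ 2 * (N + 2) * (\<tau> * \<tau>) * measure lborel (cball (0::'a) R)"
 \<comment> \<open>F 0 and F 1 are the ends of the homotopy, so the first integral of the claim is
   the increment of the integral of F l over [0, 1].\<close>
 define F where "F l x = f (x - l *\<^sub>R a x) * \<phi> x" for l x
 define F' where "F' l x = - (g (x - l *\<^sub>R a x) \<bullet> a x) * \<phi> x" for l x
 have deriv: "((\<lambda>l. LINT x|lborel. F l x) has_real_derivative (LINT x|lborel. F' l x)) (at l within {0..1})"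
  if "l \<in> {0..1}" for l
 proof (rule integral_has_real_derivative[where R = R])
  fix l x
  have "((\<lambda>l. x - l *\<^sub>R a x) has_derivative (\<lambda>h. - (h *\<^sub>R a x))) (at l within {0..1})"
   by (auto intro!: derivative_eq_intros)
  from has_derivative_compose[OF this f]
  have "((\<lambda>l. f (x - l *\<^sub>R a x)) has_derivative (\<lambda>h. g (x - l *\<^sub>R a x) \<bullet> - (h *\<^sub>R a x))) (at l within {0..1})" .
  from has_derivative_mult_left[OF this, of "\<phi> x"]
  show "((\<lambda>l. F l x) has_real_derivative F' l x) (at l within {0..1})"
   unfolding has_field_derivative_def F_def F'_def by (rule has_derivative_eq_rhs) (simp add: fun_eq_iff)
 next
  show "continuous_on UNIV (F l)" for l unfolding F_def[abs_def] by (intro continuous_intros)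
  have "continuous_on ({0..1} \<times> UNIV) (\<lambda>w. F' (fst w) (snd w))"
   unfolding F'_def
   by (intro continuous_intros continuous_on_compose2[OF a_c[of UNIV]] continuous_on_compose2[OF \<phi>_c[of UNIV]]) auto
  then show "continuous_on ({0..1} \<times> UNIV) (\<lambda>(l, x). F' l x)" by (simp add: case_prod_beta')
 qed (use \<phi>0 that in \<open>auto simp: F_def F'_def\<close>)
 have Yb: "\<bar>(LINT x|lborel. F' l x) - X\<bar> <= K" if l: "l \<in> {0..1}" for l
 proof -
  define p where "p x = x - l *\<^sub>R a x" for x
  have p_c[continuous_intros]: "continuous_on S p" for S unfolding p_def[abs_def] by (intro continuous_intros)
  \<comment> \<open>The divergence of this field contains the leading term of \<open>F'\<close> with
    opposite sign, and the target integrand with f taken at the displaced point. Adding its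
    vanishing integral cancels the former and produces the latter.\<close>
  define V where "V x = (f (p x) * \<phi> x) *\<^sub>R a x" for x
  define V' where "V' x h = ((g (p x) \<bullet> (h - l *\<^sub>R a' x h)) * \<phi> x + f (p x) * (G x \<bullet> h)) *\<^sub>R a x + (f (p x) * \<phi> x) *\<^sub>R a' x h" for x h
  have V_d: "(V has_derivative V' x) (at x)" for x
  proof -
   have "(p has_derivative (\<lambda>h. h - l *\<^sub>R a' x h)) (at x)"
    unfolding p_def[abs_def] by (rule has_derivative_diff[OF has_derivative_ident has_derivative_scaleR_right[OF a_d]])
   note 1 = has_derivative_compose[OF this f]
   note 2 = has_derivative_mult[OF 1 tameD(1)[OF \<phi>]]
   show ?thesis
    using has_derivative_scaleR[OF 2 a_d] unfolding V_def[abs_def] V'_def[abs_def]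
    by (simp add: algebra_simps)
  qed
  have V_0: "V x = 0" if "x \<notin> cball 0 R" for x using \<phi>0[OF that] by (simp add: V_def)
  have V'_0: "V' x h = 0" if "x \<notin> cball 0 R" for x h using \<phi>0[OF that] by (simp add: V'_def)
  have V'_c: "continuous_on UNIV (\<lambda>x. V' x h)" for h unfolding V'_def by (intro continuous_intros)
  obtain BV where BV: "\<And>x y. norm (V x - V y) <= BV * norm (x - y)"
   using C1_compact_support_lipschitz[OF V_d V_0 V'_c] by blast
  have "(LINT x|lborel. (\<Sum>b\<in>Basis. V' x b \<bullet> b)) = 0"
  proof (rule integral_divergence_eq_0[OF V_d BV V_0])
   show "integrable lborel (\<lambda>x. V' x b \<bullet> b)" for b
    by (rule intg) (use V'_0 in \<open>auto intro!: continuous_intros V'_c\<close>)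
  qed
  moreover have "(\<Sum>b\<in>Basis. V' x b \<bullet> b) = (g (p x) \<bullet> (a x - l *\<^sub>R a' x (a x))) * \<phi> x + f (p x) * (G x \<bullet> a x) + f (p x) * \<phi> x * diva s t x" for x
  proof -
   interpret lin: linear "a' x" by (rule a'_lin)
   define k where "k h = (g (p x) \<bullet> (h - l *\<^sub>R a' x h)) * \<phi> x + f (p x) * (G x \<bullet> h)" for h
   have kl: "linear k"
    unfolding k_def by (intro linearI) (simp_all add: lin.add lin.scale inner_add_right inner_diff_right algebra_simps)
   interpret k: linear k by (rule kl)
   have "(\<Sum>b\<in>Basis. V' x b \<bullet> b) = (\<Sum>b\<in>Basis. k b * (a x \<bullet> b)) + (f (p x) * \<phi> x) * (\<Sum>b\<in>Basis. a' x b \<bullet> b)"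
    by (simp add: V'_def k_def inner_add_left sum.distrib sum_distrib_left)
   also have "(\<Sum>b\<in>Basis. k b * (a x \<bullet> b)) = k (\<Sum>b\<in>Basis. (a x \<bullet> b) *\<^sub>R b)"
    by (simp add: k.sum k.scale mult.commute)
   also have "... = k (a x)" by (simp add: euclidean_representation)
   finally show ?thesis by (simp add: k_def diva_def a'_def)
  qed
  ultimately have 0: "(LINT x|lborel. (g (p x) \<bullet> (a x - l *\<^sub>R a' x (a x))) * \<phi> x + f (p x) * (G x \<bullet> a x) + f (p x) * \<phi> x * diva s t x) = 0"
   by simp
  have i1: "integrable lborel (\<lambda>x. (g (p x) \<bullet> (a x - l *\<^sub>R a' x (a x))) * \<phi> x + f (p x) * (G x \<bullet> a x) + f (p x) * \<phi> x * diva s t x)"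
   by (rule intg) (use \<phi>0 in \<open>auto intro!: continuous_intros\<close>)
  have i2: "integrable lborel (F' l)" unfolding F'_def by (rule intg) (use \<phi>0 in \<open>auto intro!: continuous_intros\<close>)
  have i3: "integrable lborel (\<lambda>x. f x * (G x \<bullet> a x + diva s t x * \<phi> x))"
   by (rule intg) (use \<phi>0 in \<open>auto intro!: continuous_intros\<close>)
  have "(LINT x|lborel. F' l x) - X = (LINT x|lborel. F' l x
   + ((g (p x) \<bullet> (a x - l *\<^sub>R a' x (a x))) * \<phi> x + f (p x) * (G x \<bullet> a x) + f (p x) * \<phi> x * diva s t x)
   - f x * (G x \<bullet> a x + diva s t x * \<phi> x))"
   unfolding X_def using 0 i1 i2 i3 by simp
  also have "\<bar>...\<bar> <= (B * Q * C ^ 2 * (N + 2) * (\<tau> * \<tau>)) * measure lborel (cball (0::'a) R)"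
  proof (rule integral_bound_compact_support)
   fix x :: 'a assume "x \<notin> cball 0 R"
   then show "F' l x + ((g (p x) \<bullet> (a x - l *\<^sub>R a' x (a x))) * \<phi> x + f (p x) * (G x \<bullet> a x) + f (p x) * \<phi> x * diva s t x)
   - f x * (G x \<bullet> a x + diva s t x * \<phi> x) = 0" using \<phi>0 by (simp add: F'_def)
  next
   fix x :: 'a assume x: "x \<in> cball 0 R"
   let ?r = "R + C * \<tau>"
   have la: "norm (l *\<^sub>R a x) <= C * \<tau>" using a_b[of x] l mult_mono[of "\<bar>l\<bar>" 1 "norm (a x)" "C * \<tau>"] by simp
   have px: "p x \<in> cball 0 ?r"
    using norm_triangle_ineq4[of x "l *\<^sub>R a x"] la x by (simp add: p_def)
   have xr: "x \<in> cball 0 ?r" using x C0 \<tau> by (simp add: add_increasing2)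
   have B': "norm (g y) <= B" if "y \<in> cball 0 ?r" for y using B that by (simp add: \<tau>_def)
   have B0: "0 <= B" using B'[OF xr] norm_ge_zero order_trans by blast
   have Q0: "0 <= Q" by (rule tameD(7)[OF \<phi>])
   have "\<bar>f (p x) - f x\<bar> <= B * norm (p x - x)" by (rule lipschitz_of_gradient[OF f B' px xr])
   also have "... <= B * (C * \<tau>)" using la B0 by (intro mult_left_mono) (auto simp: p_def)
   finally have fl: "\<bar>f (p x) - f x\<bar> <= B * (C * \<tau>)" .
   have Ga: "\<bar>G x \<bullet> a x + diva s t x * \<phi> x\<bar> <= Q * (C * \<tau>) + (N * C * \<tau>) * Q"
   proof -
    have "\<bar>G x \<bullet> a x\<bar> <= norm (G x) * norm (a x)" by (rule Cauchy_Schwarz_ineq2)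
    also have "... <= Q * (C * \<tau>)" using tameD(5)[OF \<phi>] a_b Q0 by (intro mult_mono) auto
    finally have "\<bar>G x \<bullet> a x\<bar> <= Q * (C * \<tau>)" .
    moreover have "\<bar>diva s t x * \<phi> x\<bar> <= (N * C * \<tau>) * Q"
     unfolding abs_mult using diva_bound[OF st, of x] tameD(4)[OF \<phi>, of x] N C0 \<tau>
     by (intro mult_mono) (auto simp: \<tau>_def)
    ultimately show ?thesis by linarith
   qed
   have gaa: "\<bar>l * (g (p x) \<bullet> a' x (a x)) * \<phi> x\<bar> <= B * (C * \<tau> * (C * \<tau>)) * Q"
   proof -
    have "\<bar>g (p x) \<bullet> a' x (a x)\<bar> <= norm (g (p x)) * norm (a' x (a x))" by (rule Cauchy_Schwarz_ineq2)
    also have "... <= B * (C * \<tau> * (C * \<tau>))"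
     using B'[OF px] a'_b[of x "a x"] mult_left_mono[OF a_b[of x], of "C * \<tau>"] C0 \<tau> B0
     by (intro mult_mono) auto
    finally have "\<bar>l\<bar> * \<bar>g (p x) \<bullet> a' x (a x)\<bar> <= 1 * (B * (C * \<tau> * (C * \<tau>)))" using l by (intro mult_mono) auto
    then have l1: "\<bar>l * (g (p x) \<bullet> a' x (a x))\<bar> <= B * (C * \<tau> * (C * \<tau>))" by (simp add: abs_mult)
    show ?thesis unfolding abs_mult[of "l * (g (p x) \<bullet> a' x (a x))"]
     by (rule mult_mono[OF l1 tameD(4)[OF \<phi>]]) (use B0 C0 \<tau> in auto)
   qed
   \<comment> \<open>What remains is quadratic in \<tau>: f moves by order \<tau> and meets a factor
     of order \<tau>, and a' x (a x) contains the increment of the field twice.\<close>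
   have "F' l x + ((g (p x) \<bullet> (a x - l *\<^sub>R a' x (a x))) * \<phi> x + f (p x) * (G x \<bullet> a x) + f (p x) * \<phi> x * diva s t x)
   - f x * (G x \<bullet> a x + diva s t x * \<phi> x)
   = (f (p x) - f x) * (G x \<bullet> a x + diva s t x * \<phi> x) - l * (g (p x) \<bullet> a' x (a x)) * \<phi> x"
    unfolding F'_def p_def[symmetric] by (simp add: inner_diff_right algebra_simps)
   also have "\<bar>...\<bar> <= \<bar>f (p x) - f x\<bar> * \<bar>G x \<bullet> a x + diva s t x * \<phi> x\<bar> + \<bar>l * (g (p x) \<bullet> a' x (a x)) * \<phi> x\<bar>"
    unfolding abs_mult[symmetric] by (rule abs_triangle_ineq4)
   also have "... <= (B * (C * \<tau>)) * (Q * (C * \<tau>) + (N * C * \<tau>) * Q) + B * (C * \<tau> * (C * \<tau>)) * Q"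
    using fl Ga gaa B0 C0 \<tau> by (intro add_mono mult_mono) auto
   also have "... = B * Q * C ^ 2 * (N + 2) * (\<tau> * \<tau>)" by (simp add: power2_eq_square algebra_simps)
   finally show "\<bar>F' l x + ((g (p x) \<bullet> (a x - l *\<^sub>R a' x (a x))) * \<phi> x + f (p x) * (G x \<bullet> a x) + f (p x) * \<phi> x * diva s t x)
   - f x * (G x \<bullet> a x + diva s t x * \<phi> x)\<bar> <= B * Q * C ^ 2 * (N + 2) * (\<tau> * \<tau>)" .
  qed
  finally show ?thesis by (simp add: K_def)
 qed
 \<comment> \<open>Mean value inequality on [0, 1] for the integral of F l minus its linear
   prediction l * X.\<close>
 have "norm (((LINT x|lborel. F 1 x) - 1 * X) - ((LINT x|lborel. F 0 x) - 0 * X)) <= K * norm (1 - (0::real))"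
 proof (rule differentiable_bound[of "{0..1}" "\<lambda>l. (LINT x|lborel. F l x) - l * X" "\<lambda>l h. ((LINT x|lborel. F' l x) - X) * h"])
  fix l :: real assume l: "l \<in> {0..1}"
  have "((\<lambda>l. (LINT x|lborel. F l x) - l * X) has_real_derivative (LINT x|lborel. F' l x) - X) (at l within {0..1})"
   using DERIV_diff[OF deriv[OF l] DERIV_cmult_right[OF DERIV_ident, of X]] by simp
  then show "((\<lambda>l. (LINT x|lborel. F l x) - l * X) has_derivative (\<lambda>h. ((LINT x|lborel. F' l x) - X) * h)) (at l within {0..1})"
   by (simp add: has_field_derivative_def)
  show "onorm (\<lambda>h. ((LINT x|lborel. F' l x) - X) * h) <= K"
   using Yb[OF l] by (intro onorm_le) (auto simp: abs_mult intro!: mult_right_mono)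
 qed auto
 moreover have "(LINT x|lborel. F 1 x) - (LINT x|lborel. F 0 x) = (LINT x|lborel. (f (x - dA s t x) - f x) * \<phi> x)"
 proof -
  have "integrable lborel (F 1)" "integrable lborel (F 0)"
   unfolding F_def[abs_def] by (rule intg; use \<phi>0 in \<open>auto intro!: continuous_intros\<close>)+
  then have "(LINT x|lborel. F 1 x) - (LINT x|lborel. F 0 x) = (LINT x|lborel. F 1 x - F 0 x)" by simp
  then show ?thesis by (simp add: F_def a_def algebra_simps)
 qed
 ultimately show ?thesis by (simp add: X_def K_def \<tau>_def a_def algebra_simps)
qed

end

section \<open>The transport equation: existence\<close>

lemma exp_remainder: "\<bar>exp z - 1 - z\<bar> <= z ^ 2 * exp \<bar>z\<bar>" for z :: real
proof -
 obtain t where t: "\<bar>t\<bar> <= \<bar>z\<bar>" "exp z = (\<Sum>m<2. z ^ m / fact m) + exp t / fact 2 * z ^ 2"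
  using Maclaurin_exp_le[of z 2] by blast
 have eq: "exp z - 1 - z = exp t / 2 * z ^ 2" using t(2) by (simp add: numeral_2_eq_2)
 have "\<bar>exp z - 1 - z\<bar> = exp t / 2 * z ^ 2" unfolding eq by (simp add: abs_mult)
 also have "... <= exp \<bar>z\<bar> * z ^ 2"
 proof (rule mult_right_mono)
  have "exp t <= exp \<bar>z\<bar>" using t by simp
  then show "exp t / 2 <= exp \<bar>z\<bar>" using exp_gt_zero[of "\<bar>z\<bar>"] by linarith
 qed simp
 finally show ?thesis by (simp add: mult.commute)
qed

lemma compact_bound_joint:
 fixes g :: "real => 'a::euclidean_space => 'b::real_normed_vector"
 assumes "continuous_on ({0..T} \<times> UNIV) (\<lambda>(t, x). g t x)"
 shows "\<exists>B\<ge>0. \<forall>t\<in>{0..T}. \<forall>x\<in>cball 0 R. norm (g t x) <= B"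
proof -
 have "bounded ((\<lambda>(t, x). g t x) ` ({0..T} \<times> cball 0 R))"
  by (intro compact_imp_bounded compact_continuous_image continuous_on_subset[OF assms] compact_Times) auto
 then obtain B where B: "\<And>y. y \<in> (\<lambda>(t, x). g t x) ` ({0..T} \<times> cball 0 R) ==> norm y <= B"
  unfolding bounded_iff by blast
 have "norm (g t x) <= max B 0" if "t \<in> {0..T}" "x \<in> cball 0 R" for t x
  using B[of "g t x"] that by force
 then show ?thesis by (intro exI[of _ "max B 0"]) auto
qed

lemma gradient_vector:
 fixes f' :: "'a::euclidean_space => real"
 assumes "linear f'"
 shows "f' h = (\<Sum>b\<in>Basis. f' b *\<^sub>R b) \<bullet> h"
proof -
 interpret lin: linear f' by (rule assms)
 have "f' h = f' (\<Sum>b\<in>Basis. (h \<bullet> b) *\<^sub>R b)" by (simp add: euclidean_representation)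
 also have "... = (\<Sum>b\<in>Basis. (h \<bullet> b) * f' b)" by (simp add: lin.sum lin.scale)
 finally show ?thesis by (simp add: inner_sum_left inner_commute[of h] mult.commute)
qed

lemma continuous_on_slice:
 assumes "continuous_on ({0..T} \<times> UNIV) (\<lambda>(t, x). g t x)" "t \<in> {0..T::real}"
 shows "continuous_on UNIV (g t)"
 by (rule continuous_on_compose2[OF assms(1), of _ "\<lambda>x. (t, x)", simplified])
  (use assms(2) in \<open>auto intro!: continuous_intros\<close>)

context transport_coeffs
begin

text \<open>The transport solution that equals \<open>h\<close> at time \<open>r\<close>. The sign
  of the exponent is hidden in the order of the times: for r <= t, Z t r x is minus the integral of
  c over [r, t] along the characteristic that ends at x. r = 0 solves the initial value problem; a
  general r is needed for the dual problem with prescribed final value.\<close>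

definition transported where "transported r h t x = h (\<Phi> t r x) * exp (Z t r x)"

lemma transported_split:
 assumes "r \<in> I" "s \<in> I" "t \<in> I"
 shows "transported r h t x = transported r h s (\<Phi> t s x) * exp (Z t s x)"
 using cocycle[OF assms(3,2,1), of x] by (simp add: transported_def exp_add[symmetric] add.commute)

lemma transported_gradient:
 assumes r: "r \<in> I" and h: "\<And>x. (h has_derivative (\<lambda>k. g0 x \<bullet> k)) (at x)" and g0: "continuous_on UNIV g0"
 shows "\<exists>g. continuous_on (I \<times> UNIV) (\<lambda>(t, x). g t x) \<and>
  (\<forall>t\<in>I. \<forall>x. (transported r h t has_derivative (\<lambda>k. g t x \<bullet> k)) (at x))"
proof -
 obtain J K where J: "\<And>t x. t \<in> I ==> (\<Phi> t r has_derivative J t x) (at x)" "\<And>t x. t \<in> I ==> (Z t r has_derivative K t x) (at x)"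
  and Jc: "\<And>h. continuous_on (I \<times> UNIV) (\<lambda>w. J (fst w) (snd w) h)" "\<And>h. continuous_on (I \<times> UNIV) (\<lambda>w. K (fst w) (snd w) h)"
  using flow_deriv[OF r] by blast
 have hc: "continuous_on UNIV h" using h by (meson continuous_at_imp_continuous_on has_derivative_continuous)
 define U' where "U' t x k = h (\<Phi> t r x) * (exp (Z t r x) * K t x k) + (g0 (\<Phi> t r x) \<bullet> J t x k) * exp (Z t r x)" for t x k
 have d: "(transported r h t has_derivative U' t x) (at x)" if "t \<in> I" for t x
 proof -
  note 1 = has_derivative_compose[OF J(1)[OF that] h]
  have 2: "((\<lambda>x. exp (Z t r x)) has_derivative (\<lambda>k. exp (Z t r x) * K t x k)) (at x)"
   using has_derivative_exp[OF J(2)[OF that, of x]] by (simp add: mult.commute)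
  show ?thesis using has_derivative_mult[OF 1 2] by (simp add: transported_def[abs_def] U'_def[abs_def])
 qed
 define g where "g t x = (\<Sum>b\<in>Basis. U' t x b *\<^sub>R b)" for t x
 have "continuous_on (I \<times> UNIV) (\<lambda>w. U' (fst w) (snd w) b)" for b
  unfolding U'_def
  by (intro continuous_intros Jc flow_continuous[OF r] continuous_on_compose2[OF hc] continuous_on_compose2[OF g0]) auto
 then have "continuous_on (I \<times> UNIV) (\<lambda>(t, x). g t x)"
  unfolding g_def case_prod_beta' by (intro continuous_intros)
 moreover have "(transported r h t has_derivative (\<lambda>k. g t x \<bullet> k)) (at x)" if "t \<in> I" for t x
 proof -
  have "U' t x = (\<lambda>k. g t x \<bullet> k)"
   unfolding g_def by (rule ext, rule gradient_vector[OF has_derivative_linear[OF d[OF that]]])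
  then show ?thesis using d[OF that, of x] by simp
 qed
 ultimately show ?thesis by blast
qed

lemma transported_continuous:
 assumes r: "r \<in> I" and h: "continuous_on UNIV h"
 shows "continuous_on (I \<times> UNIV) (\<lambda>(t, x). transported r h t x)"
 unfolding transported_def case_prod_beta'
 by (intro continuous_intros flow_continuous[OF r] continuous_on_compose2[OF h]) auto

text \<open>Integrand of the weak transport equation over one time step, with the gradient of \<phi>
  supplied as the vector field \<open>G\<close>.\<close>

definition wk where "wk s t \<phi> G x = G x \<bullet> dA s t x + (diva s t x - dc s t x) * \<phi> x"

text \<open>The transported function satisfies the weak equation to first order, with a constant depending
 on the test function only through its support and \<open>Q\<close>.\<close>

lemma transported_expansion:
 assumes r: "r \<in> I" and h: "\<And>x. (h has_derivative (\<lambda>k. g0 x \<bullet> k)) (at x)" and g0: "continuous_on UNIV g0"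
 shows "\<exists>K\<ge>0. \<forall>s\<in>I. \<forall>t\<in>I. \<forall>Q \<phi> G. tame R Q \<phi> G -->
  \<bar>fun_dist (transported r h) t \<phi> - fun_dist (transported r h) s \<phi>
   - fun_dist (transported r h) s (wk s t \<phi> G)\<bar> <= K * Q * \<bar>t - s\<bar> powr \<theta>"
proof -
 obtain g where gc: "continuous_on (I \<times> UNIV) (\<lambda>(t, x). g t x)"
  and gd: "\<And>t x. t \<in> I ==> (transported r h t has_derivative (\<lambda>k. g t x \<bullet> k)) (at x)"
  using transported_gradient[OF r h g0] by blast
 have hc: "continuous_on UNIV h" using h by (meson continuous_at_imp_continuous_on has_derivative_continuous)
 define U where "U = transported r h"
 have Uc: "continuous_on (I \<times> UNIV) (\<lambda>(t, x). U t x)" using transported_continuous[OF r hc] by (simp add: U_def)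
 define R' where "R' = R + (C + Hf) * T powr \<alpha>"
 obtain B1 where B1: "0 <= B1" "\<And>t x. t \<in> I ==> x \<in> cball 0 R' ==> \<bar>U t x\<bar> <= B1"
  using compact_bound_joint[OF Uc, of R'] by auto
 obtain B2 where B2: "0 <= B2" "\<And>t x. t \<in> I ==> x \<in> cball 0 R' ==> norm (g t x) <= B2"
  using compact_bound_joint[OF gc, of R'] by auto
 define B where "B = max B1 B2"
 have B: "0 <= B" "\<And>t x. t \<in> I ==> x \<in> cball 0 R' ==> \<bar>U t x\<bar> <= B" "\<And>t x. t \<in> I ==> x \<in> cball 0 R' ==> norm (g t x) <= B"
  unfolding B_def using B1 B2 by (simp_all add: le_max_iff_disj)
 define E where "E = exp (Hf * T powr \<alpha>)"
 have E: "1 <= E" using Hf by (simp add: E_def)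
 define P where "P = T powr (2 * \<alpha> - \<theta>)"
 have P: "0 <= P" by (simp add: P_def)
 define vol where "vol = measure lborel (cball (0::'a) R)"
 have vol: "0 <= vol" by (simp add: vol_def)
 define K1 where "K1 = B * (Mf * E + Hf ^ 2 * E * P + Mf + C ^ 2 * P)"
 have K1: "0 <= K1" using B(1) Mf E P by (simp add: K1_def)
 define K where "K = K1 * vol + B * C ^ 2 * (N + 2) * P * vol"
 have K0: "0 <= K" using K1 vol B(1) N P by (simp add: K_def)
 have "\<bar>fun_dist U t \<phi> - fun_dist U s \<phi> - fun_dist U s (wk s t \<phi> G)\<bar> <= K * Q * \<bar>t - s\<bar> powr \<theta>"
  if st: "s \<in> I" "t \<in> I" and \<phi>: "tame R Q \<phi> G" for s t Q \<phi> G
 proof -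
  define \<rho> where "\<rho> = \<bar>t - s\<bar>"
  have \<rho>: "0 <= \<rho>" "\<rho> <= T" using st by (auto simp: \<rho>_def)
  have \<rho>T: "\<rho> powr \<alpha> <= T powr \<alpha>" using \<rho> \<alpha> by (intro powr_mono2) auto
  have Q0: "0 <= Q" by (rule tameD(7)[OF \<phi>])
  have pw: "\<bar>U t x - U s (x - dA s t x) + U s x * dc s t x\<bar> <= K1 * \<rho> powr \<theta>" if x: "x \<in> cball 0 R" for x
  proof -
   define y where "y = \<Phi> t s x"
   define z where "z = Z t s x"
   define x' where "x' = x - dA s t x"
   \<comment> \<open>The solution at time t is traced back along the flow to time s, so only the
     spatial regularity of \<open>U s\<close> is involved.\<close>
   have Ut: "U t x = U s y * exp z" unfolding U_def y_def z_def by (rule transported_split[OF r st])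
   have dt: "dA t s x = - dA s t x" "dc t s x = - dc s t x" by (simp_all add: dA_def dc_def)
   have "y - x' = \<Phi> t s x - \<Phi> t t x - dA t s (\<Phi> t t x)" using st by (simp add: y_def x'_def dt)
   then have yx: "norm (y - x') <= Mf * \<rho> powr \<theta>"
    using flow_davie(1)[OF st(2,2,1), of x] by (simp add: \<rho>_def abs_minus_commute)
   have zc: "\<bar>z + dc s t x\<bar> <= Mf * \<rho> powr \<theta>"
    using flow_davie(2)[OF st(2,2,1), of x] st by (simp add: z_def dt \<rho>_def abs_minus_commute)
   have zb: "\<bar>z\<bar> <= Hf * \<rho> powr \<alpha>"
    using flow_holder(2)[OF st(2,2,1), of x] st by (simp add: z_def \<rho>_def abs_minus_commute)
   have ynear: "norm (y - x) <= Hf * \<rho> powr \<alpha>"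
    using flow_holder(1)[OF st(2,2,1), of x] st by (simp add: y_def \<rho>_def abs_minus_commute)
   have ab: "norm (dA s t x) <= C * \<rho> powr \<alpha>" using dA_bound[OF st] by (simp add: \<rho>_def)
   have R'1: "Hf * \<rho> powr \<alpha> <= Hf * T powr \<alpha>" "C * \<rho> powr \<alpha> <= C * T powr \<alpha>" using \<rho>T Hf C0 by (auto intro: mult_left_mono)
   have CT: "0 <= C * T powr \<alpha>" "0 <= Hf * T powr \<alpha>" using C0 Hf by auto
   have xR: "x \<in> cball 0 R'" using x CT by (simp add: R'_def algebra_simps)
   have yR: "y \<in> cball 0 R'"
    using x CT R'1 ynear norm_triangle_ineq[of x "y - x"] by (simp add: R'_def algebra_simps)
   have x'R: "x' \<in> cball 0 R'"
    using x CT R'1 ab norm_triangle_ineq4[of x "dA s t x"] by (simp add: R'_def x'_def algebra_simps)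
   have lipU: "\<bar>U s a - U s b\<bar> <= B * norm (a - b)" if "a \<in> cball 0 R'" "b \<in> cball 0 R'" for a b
    by (rule lipschitz_of_gradient[where g = "g s" and R = R']) (use gd[OF st(1)] B(3)[OF st(1)] that U_def in auto)
   have expz: "exp z <= E" "exp \<bar>z\<bar> <= E" using zb R'1 abs_ge_self[of z] by (auto simp: E_def)
   have r2: "\<rho> powr \<alpha> * \<rho> powr \<alpha> <= P * \<rho> powr \<theta>" using powr_2\<alpha> \<rho> by (simp add: P_def)
   \<comment> \<open>Four errors: the flow against one Euler step, the exponential beyond first
     order, Z against the increment of c, and the change of base point in the c-term. The first and
     third have order \<theta>, the other two have order 2 * \<alpha>.\<close>
   have "U t x - U s x' + U s x * dc s t x =
    (U s y - U s x') * exp z + U s x' * (exp z - 1 - z) + U s x' * (z + dc s t x) - (U s x' - U s x) * dc s t x"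
    by (simp add: Ut algebra_simps)
   moreover have "\<bar>(U s y - U s x') * exp z\<bar> <= (B * (Mf * \<rho> powr \<theta>)) * E"
    unfolding abs_mult using order_trans[OF lipU[OF yR x'R] mult_left_mono[OF yx B(1)]] expz B(1) Mf
    by (intro mult_mono) auto
   moreover have "\<bar>U s x' * (exp z - 1 - z)\<bar> <= B * (Hf ^ 2 * (P * \<rho> powr \<theta>) * E)"
   proof -
    have "z ^ 2 <= (Hf * \<rho> powr \<alpha>) ^ 2" using power_mono[OF zb, of 2] by simp
    also have "... = Hf ^ 2 * (\<rho> powr \<alpha> * \<rho> powr \<alpha>)" by (simp add: power2_eq_square mult_ac)
    also have "... <= Hf ^ 2 * (P * \<rho> powr \<theta>)" using r2 by (intro mult_left_mono) auto
    finally have z2: "z ^ 2 <= Hf ^ 2 * (P * \<rho> powr \<theta>)" .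
    have "\<bar>exp z - 1 - z\<bar> <= z ^ 2 * exp \<bar>z\<bar>" by (rule exp_remainder)
    also have "... <= Hf ^ 2 * (P * \<rho> powr \<theta>) * E" using z2 expz P by (intro mult_mono) auto
    finally show ?thesis unfolding abs_mult using B(2)[OF st(1) x'R] B(1) by (intro mult_mono) auto
   qed
   moreover have "\<bar>U s x' * (z + dc s t x)\<bar> <= B * (Mf * \<rho> powr \<theta>)"
    unfolding abs_mult using B(2)[OF st(1) x'R] zc B(1) by (intro mult_mono) auto
   moreover have "\<bar>(U s x' - U s x) * dc s t x\<bar> <= B * (C ^ 2 * (P * \<rho> powr \<theta>))"
   proof -
    have "\<bar>U s x' - U s x\<bar> <= B * (C * \<rho> powr \<alpha>)"
     using order_trans[OF lipU[OF x'R xR] mult_left_mono[OF _ B(1)]] ab by (simp add: x'_def)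
    then have "\<bar>(U s x' - U s x) * dc s t x\<bar> <= (B * (C * \<rho> powr \<alpha>)) * (C * \<rho> powr \<alpha>)"
     unfolding abs_mult using dc_bound[OF st, of x] B(1) C0 by (intro mult_mono) (auto simp: \<rho>_def)
    also have "... = B * (C ^ 2 * (\<rho> powr \<alpha> * \<rho> powr \<alpha>))" by (simp add: power2_eq_square mult_ac)
    also have "... <= B * (C ^ 2 * (P * \<rho> powr \<theta>))" using r2 B(1) by (intro mult_left_mono) auto
    finally show ?thesis .
   qed
   ultimately have "\<bar>U t x - U s x' + U s x * dc s t x\<bar> <= (B * (Mf * \<rho> powr \<theta>)) * E + B * (Hf ^ 2 * (P * \<rho> powr \<theta>) * E)
    + B * (Mf * \<rho> powr \<theta>) + B * (C ^ 2 * (P * \<rho> powr \<theta>))" by linarith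
   also have "... = K1 * \<rho> powr \<theta>" by (simp add: K1_def algebra_simps)
   finally show ?thesis by (simp add: x'_def)
  qed
  have Ucs[continuous_intros]: "continuous_on S (\<lambda>x. U t (k x))" if "continuous_on S k" "t \<in> I" for S t and k :: "'a => 'a"
   by (rule continuous_on_compose2[OF continuous_on_slice[OF Uc that(2)] that(1)]) auto
  have \<phi>_c[continuous_intros]: "continuous_on S \<phi>" for S by (rule continuous_on_subset[OF tameD(9)[OF \<phi>]]) simp
  have G_c[continuous_intros]: "continuous_on S G" for S by (rule continuous_on_subset[OF tameD(10)[OF \<phi>]]) simp
  have a_c[continuous_intros]: "continuous_on S (dA s t)" for S using continuous_on_subset[OF dA_continuous[OF st]] by simp
  have div_c[continuous_intros]: "continuous_on S (diva s t)" for S using continuous_on_subset[OF diva_continuous[OF st]] by simp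
  have dc_c[continuous_intros]: "continuous_on S (dc s t)" for S using continuous_on_subset[OF dc_continuous[OF st]] by simp
  have \<phi>0: "\<phi> x = 0" "G x = 0" if "x \<notin> cball 0 R" for x using tameD(2,3)[OF \<phi> that] .
  have intg: "integrable lborel k" if "continuous_on UNIV k" "\<And>x. x \<notin> cball 0 R ==> k x = 0" for k :: "'a => real"
   using integrable_compact_support that by blast
  have i1: "integrable lborel (\<lambda>x. U t x * \<phi> x)" "integrable lborel (\<lambda>x. U s x * \<phi> x)"
   "integrable lborel (\<lambda>x. U s x * wk s t \<phi> G x)"
   "integrable lborel (\<lambda>x. U s (x - dA s t x) * \<phi> x)"
   "integrable lborel (\<lambda>x. U s x * dc s t x * \<phi> x)" "integrable lborel (\<lambda>x. U s x * (G x \<bullet> dA s t x + diva s t x * \<phi> x))"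
   unfolding wk_def by (rule intg; use \<phi>0 st in \<open>auto intro!: continuous_intros\<close>)+
  \<comment> \<open>\<open>X\<close> integrates the pointwise errors, \<open>Y\<close> is the
    displacement inside the integral, estimated by \<open>homotopy\<close>; together they are
    exactly the quantity to be bounded.\<close>
  define X where "X = (LINT x|lborel. (U t x - U s (x - dA s t x) + U s x * dc s t x) * \<phi> x)"
  define Y where "Y = (LINT x|lborel. (U s (x - dA s t x) - U s x) * \<phi> x) - (LINT x|lborel. U s x * (G x \<bullet> dA s t x + diva s t x * \<phi> x))"
  have "(LINT x|lborel. U s x * wk s t \<phi> G x) = (LINT x|lborel. U s x * (G x \<bullet> dA s t x + diva s t x * \<phi> x) - U s x * dc s t x * \<phi> x)"
   by (rule Bochner_Integration.integral_cong) (auto simp: wk_def algebra_simps)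
  also have "... = (LINT x|lborel. U s x * (G x \<bullet> dA s t x + diva s t x * \<phi> x)) - (LINT x|lborel. U s x * dc s t x * \<phi> x)"
   using i1 by simp
  finally have w: "(LINT x|lborel. U s x * wk s t \<phi> G x) = (LINT x|lborel. U s x * (G x \<bullet> dA s t x + diva s t x * \<phi> x)) - (LINT x|lborel. U s x * dc s t x * \<phi> x)" .
  have Xe: "X = (LINT x|lborel. U t x * \<phi> x) - (LINT x|lborel. U s (x - dA s t x) * \<phi> x) + (LINT x|lborel. U s x * dc s t x * \<phi> x)"
  proof -
   have "X = (LINT x|lborel. U t x * \<phi> x - U s (x - dA s t x) * \<phi> x + U s x * dc s t x * \<phi> x)"
    unfolding X_def by (rule Bochner_Integration.integral_cong) (auto simp: algebra_simps)
   then show ?thesis using i1 by simp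
  qed
  have Ye: "Y = (LINT x|lborel. U s (x - dA s t x) * \<phi> x) - (LINT x|lborel. U s x * \<phi> x) - (LINT x|lborel. U s x * (G x \<bullet> dA s t x + diva s t x * \<phi> x))"
  proof -
   have "(LINT x|lborel. (U s (x - dA s t x) - U s x) * \<phi> x) = (LINT x|lborel. U s (x - dA s t x) * \<phi> x - U s x * \<phi> x)"
    by (rule Bochner_Integration.integral_cong) (auto simp: algebra_simps)
   then show ?thesis unfolding Y_def using i1 by simp
  qed
  have "fun_dist U t \<phi> - fun_dist U s \<phi> - fun_dist U s (wk s t \<phi> G) = X + Y"
   unfolding fun_dist_def Xe Ye w by simp
  moreover have "\<bar>X\<bar> <= (K1 * \<rho> powr \<theta> * Q) * vol"
   unfolding X_def vol_def
  proof (rule integral_bound_compact_support)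
   show "\<bar>(U t x - U s (x - dA s t x) + U s x * dc s t x) * \<phi> x\<bar> <= K1 * \<rho> powr \<theta> * Q" if "x \<in> cball 0 R" for x
    unfolding abs_mult using pw[OF that] tameD(4)[OF \<phi>, of x] K1 by (intro mult_mono) auto
  qed (use \<phi>0 in auto)
  moreover have "\<bar>Y\<bar> <= B * Q * C ^ 2 * (N + 2) * (P * \<rho> powr \<theta>) * vol"
  proof -
   have "\<bar>Y\<bar> <= B * Q * C ^ 2 * (N + 2) * (\<bar>t - s\<bar> powr \<alpha> * \<bar>t - s\<bar> powr \<alpha>) * measure lborel (cball (0::'a) R)"
    unfolding Y_def
   proof (rule homotopy[OF st \<phi>])
    show "(U s has_derivative (\<lambda>h. g s x \<bullet> h)) (at x)" for x using gd[OF st(1)] by (simp add: U_def)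
    show "continuous_on UNIV (g s)" by (rule continuous_on_slice[OF gc st(1)])
    show "norm (g s x) <= B" if "x \<in> cball 0 (R + C * \<bar>t - s\<bar> powr \<alpha>)" for x
    proof (rule B(3)[OF st(1)])
     have "C * \<rho> powr \<alpha> <= C * T powr \<alpha>" "0 <= Hf * T powr \<alpha>" using \<rho>T C0 Hf by (auto intro: mult_left_mono)
     then show "x \<in> cball 0 R'" using that by (simp add: R'_def \<rho>_def algebra_simps)
    qed
   qed
   also have "... <= B * Q * C ^ 2 * (N + 2) * (P * \<rho> powr \<theta>) * vol"
    unfolding vol_def using powr_2\<alpha>[OF \<rho>] B(1) Q0 N by (intro mult_right_mono mult_left_mono) (auto simp: P_def \<rho>_def)
   finally show ?thesis .
  qed
  ultimately have "\<bar>fun_dist U t \<phi> - fun_dist U s \<phi> - fun_dist U s (wk s t \<phi> G)\<bar>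
   <= (K1 * \<rho> powr \<theta> * Q) * vol + B * Q * C ^ 2 * (N + 2) * (P * \<rho> powr \<theta>) * vol" by linarith
  also have "... = K * Q * \<rho> powr \<theta>" by (simp add: K_def algebra_simps)
  finally show ?thesis by (simp add: \<rho>_def)
 qed
 then have "\<forall>s\<in>I. \<forall>t\<in>I. \<forall>Q \<phi> G. tame R Q \<phi> G -->
   \<bar>fun_dist U t \<phi> - fun_dist U s \<phi> - fun_dist U s (wk s t \<phi> G)\<bar> <= K * Q * \<bar>t - s\<bar> powr \<theta>"
  by (intro ballI allI impI)
 then show ?thesis using K0 unfolding U_def by (intro exI[of _ K] conjI)
qed

end

section \<open>Norms of test functions and the classes of weak solutions\<close>

lemma powr_le_powr_lower:
 fixes r T a b :: real
 assumes "0 <= r" "r <= T" "b <= a"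
 shows "r powr a <= T powr (a - b) * r powr b"
proof -
 have "r powr a = r powr (a - b) * r powr b" by (simp add: powr_add[symmetric])
 also have "... <= T powr (a - b) * r powr b" using assms by (intro mult_right_mono powr_mono2) auto
 finally show ?thesis .
qed

lemma compact_imp_subset_cball: "compact K ==> \<exists>R\<ge>0. K \<subseteq> cball (0::'a::euclidean_space) R"
proof -
 assume "compact K"
 then obtain R where "\<forall>x\<in>K. norm x <= R" using compact_imp_bounded bounded_iff by metis
 then show ?thesis by (intro exI[of _ "max R 0"]) auto
qed

lemma sup_norm_upper:
 fixes f :: "'a => real"
 assumes "\<And>x. \<bar>f x\<bar> <= B"
 shows "\<bar>f x\<bar> <= sup_norm f"
proof -
 have "norm (f x) <= Sup (range (\<lambda>x. norm (f x)))"
  by (rule cSUP_upper) (use assms in \<open>auto intro!: bdd_aboveI[of _ B]\<close>)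
 then show ?thesis by (simp add: sup_norm_def)
qed

lemma sup_norm_least:
 fixes f :: "'a => real"
 shows "(\<And>x. \<bar>f x\<bar> <= B) ==> sup_norm f <= B"
 unfolding sup_norm_def by (intro cSUP_least) auto

lemma bounded_of_compact_support:
 fixes f :: "'a::euclidean_space => real"
 assumes "continuous_on UNIV f" "\<And>x. x \<notin> cball 0 R ==> f x = 0"
 obtains B where "0 <= B" "\<And>x. \<bar>f x\<bar> <= B"
proof -
 have "bounded (f ` cball 0 R)"
  by (intro compact_imp_bounded compact_continuous_image continuous_on_subset[OF assms(1)]) auto
 then obtain B where B': "\<forall>y\<in>f ` cball 0 R. norm y <= B" unfolding bounded_iff by blast
 have B: "\<bar>f x\<bar> <= B" if "x \<in> cball 0 R" for x using B'[THEN bspec, OF imageI[OF that]] by simp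
 have "\<bar>f x\<bar> <= max B 0" for x using B[of x] assms(2)[of x] by (cases "x \<in> cball 0 R") (auto simp: le_max_iff_disj)
 then show ?thesis using that[of "max B 0"] by simp
qed

lemma C0_c_iff: "f \<in> C0_c \<longleftrightarrow> continuous_on UNIV f \<and> (\<exists>R. \<forall>x. x \<notin> cball 0 R --> f x = 0)" for f :: "'a::euclidean_space => real"
proof
 assume "f \<in> C0_c"
 then obtain K where K: "compact K" "continuous_on UNIV f" "\<forall>x. x \<notin> K --> f x = 0" by (auto simp: C0_c_def C0_K_def)
 obtain R where "K \<subseteq> cball 0 R" using compact_imp_subset_cball[OF K(1)] by blast
 then show "continuous_on UNIV f \<and> (\<exists>R. \<forall>x. x \<notin> cball 0 R --> f x = 0)" using K by blast
next
 assume "continuous_on UNIV f \<and> (\<exists>R. \<forall>x. x \<notin> cball 0 R --> f x = 0)"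
 then obtain R where "continuous_on UNIV f" "\<forall>x. x \<notin> cball 0 R --> f x = 0" by blast
 then show "f \<in> C0_c" unfolding C0_c_def C0_K_def by (intro UN_I[of "cball 0 R"]) auto
qed

lemma C0_KD:
 assumes "f \<in> C0_K K" "compact K"
 shows "f \<in> C0_c" "\<bar>f x\<bar> <= sup_norm f" "0 <= sup_norm f"
proof -
 show fc: "f \<in> C0_c" using assms by (auto simp: C0_c_def)
 then obtain R where R: "continuous_on UNIV f" "\<forall>x. x \<notin> cball 0 R --> f x = 0" unfolding C0_c_iff by blast
 obtain B where B: "\<And>x. \<bar>f x\<bar> <= B" using bounded_of_compact_support[of f R] R by blast
 show *: "\<bar>f x\<bar> <= sup_norm f" for x by (rule sup_norm_upper[OF B])
 show "0 <= sup_norm f" using *[of undefined] abs_ge_zero order_trans by blast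
qed

text \<open>The norms are suprema of sets of reals and carry information only once these sets are
  known to be bounded; membership in the Hoelder class provides the bound, and a basis vector a pair
  of distinct points.\<close>

lemma Cbeta_KD:
 fixes f :: "'a::euclidean_space => real"
 assumes f: "f \<in> Cbeta_K \<beta> K" and K: "compact K" and \<beta>: "0 < \<beta>"
 shows "f \<in> C0_K K" "\<bar>f x\<bar> <= holder_norm \<beta> f" "\<bar>f x - f y\<bar> <= holder_norm \<beta> f * norm (x - y) powr \<beta>" "0 <= holder_norm \<beta> f"
proof -
 obtain C where C: "\<And>x y. \<bar>f x - f y\<bar> <= C * dist x y powr \<beta>" and f0: "\<And>x. x \<notin> K ==> f x = 0"
  using f by (auto simp: Cbeta_K_def)
 have "continuous_on UNIV f"
  by (rule holder_imp_continuous_on[OF \<beta>, of _ C]) (use C in \<open>auto simp: dist_norm\<close>)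
 then show fK: "f \<in> C0_K K" using f0 by (auto simp: C0_K_def)
 let ?S = "{norm (f x - f y) / (dist x y powr \<beta>) | x y. x \<noteq> y}"
 have bdd: "bdd_above ?S"
 proof (rule bdd_aboveI[of _ C])
  fix z assume "z \<in> ?S"
  then obtain x y where "z = norm (f x - f y) / (dist x y powr \<beta>)" "x \<noteq> y" by blast
  then show "z <= C" using C[of x y] by (simp add: divide_le_eq)
 qed
 have semi: "norm (f x - f y) / (dist x y powr \<beta>) <= holder_seminorm \<beta> f" if "x \<noteq> y" for x y
  unfolding holder_seminorm_def using that by (intro cSup_upper bdd) blast
 obtain b :: 'a where b: "b \<in> Basis" using nonempty_Basis by blast
 then have "b \<noteq> 0" by auto
 then have s0: "0 <= holder_seminorm \<beta> f" using semi[of b 0] by (meson divide_nonneg_nonneg norm_ge_zero order_trans powr_ge_zero)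
 note sn = C0_KD(2,3)[OF fK K]
 show "\<bar>f x\<bar> <= holder_norm \<beta> f" using sn(1)[of x] s0 by (simp add: holder_norm_def)
 show "0 <= holder_norm \<beta> f" using sn(2) s0 by (simp add: holder_norm_def)
 show "\<bar>f x - f y\<bar> <= holder_norm \<beta> f * norm (x - y) powr \<beta>"
 proof (cases "x = y")
  case False
  then have "\<bar>f x - f y\<bar> <= holder_seminorm \<beta> f * dist x y powr \<beta>" using semi[OF False] by (simp add: divide_le_eq)
  also have "... <= holder_norm \<beta> f * dist x y powr \<beta>"
   using sn(2) by (intro mult_right_mono) (auto simp: holder_norm_def)
  finally show ?thesis by (simp add: dist_norm)
 qed simp
qed

lemma holder_norm_le:
 fixes f :: "'a::euclidean_space => real"
 assumes "\<And>x. \<bar>f x\<bar> <= A" "\<And>x y. \<bar>f x - f y\<bar> <= B * norm (x - y) powr \<beta>"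
 shows "holder_norm \<beta> f <= A + B"
proof -
 obtain b :: 'a where b: "b \<in> Basis" using nonempty_Basis by blast
 then have b0: "b \<noteq> 0" by auto
 have "holder_seminorm \<beta> f <= B"
  unfolding holder_seminorm_def
 proof (rule cSup_least)
  show "{norm (f x - f y) / (dist x y powr \<beta>) | x y. x \<noteq> y} \<noteq> {}" using b0 by blast
  fix z assume "z \<in> {norm (f x - f y) / (dist x y powr \<beta>) | x y. x \<noteq> y}"
  then obtain x y where "z = norm (f x - f y) / (dist x y powr \<beta>)" "x \<noteq> y" by blast
  then show "z <= B" using assms(2)[of x y] by (simp add: divide_le_eq dist_norm)
 qed
 then show ?thesis using sup_norm_least[of f A, OF assms(1)] by (simp add: holder_norm_def)
qed

text \<open>Up to distance 1 the Lipschitz bound is the stronger one, beyond it twice the sup bound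
  suffices.\<close>

lemma lipschitz_imp_holder:
 fixes f :: "'a::real_normed_vector => real"
 assumes A: "\<And>x. \<bar>f x\<bar> <= A" and B: "\<And>x y. \<bar>f x - f y\<bar> <= B * norm (x - y)" and \<beta>: "0 < \<beta>" "\<beta> < 1" and B0: "0 <= B"
 shows "\<bar>f x - f y\<bar> <= (B + 2 * A) * norm (x - y) powr \<beta>"
proof (cases "norm (x - y) <= 1")
 case True
 have A0: "0 <= A" using A[of x] abs_ge_zero order_trans by blast
 have "norm (x - y) powr 1 <= norm (x - y) powr \<beta>" using True \<beta> by (intro powr_mono') auto
 then have "B * norm (x - y) <= B * norm (x - y) powr \<beta>" using B0 by (intro mult_left_mono) auto
 also have "... <= (B + 2 * A) * norm (x - y) powr \<beta>" using A0 by (intro mult_right_mono) auto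
 finally show ?thesis using B[of x y] by linarith
next
 case False
 have A0: "0 <= A" using A[of x] abs_ge_zero order_trans by blast
 have "1 <= norm (x - y) powr \<beta>" using False \<beta> by (intro ge_one_powr_ge_zero) auto
 then have "(B + 2 * A) * 1 <= (B + 2 * A) * norm (x - y) powr \<beta>" using A0 B0 by (intro mult_left_mono) auto
 moreover have "\<bar>f x - f y\<bar> <= (B + 2 * A) * 1" using abs_triangle_ineq4[of "f x" "f y"] A[of x] A[of y] B0 by simp
 ultimately show ?thesis by (rule order_trans[rotated])
qed

lemma fun_classD:
 fixes w :: "real => 'a::euclidean_space => real"
 assumes "fun_class T \<alpha> w"
 shows "continuous_on ({0..T} \<times> UNIV) (\<lambda>(t, x). w t x)" "t \<in> {0..T} ==> continuous_on UNIV (w t)"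
  "\<exists>C\<ge>0. \<forall>s\<in>{0..T}. \<forall>t\<in>{0..T}. \<forall>x. norm x <= R --> \<bar>w t x - w s x\<bar> <= C * \<bar>t - s\<bar> powr \<alpha>"
  "\<exists>g. continuous_on ({0..T} \<times> UNIV) (\<lambda>(t, x). g t x) \<and> (\<forall>t\<in>{0..T}. \<forall>x. (w t has_derivative (\<lambda>h. g t x \<bullet> h)) (at x))"
proof -
 show c: "continuous_on ({0..T} \<times> UNIV) (\<lambda>(t, x). w t x)" using assms by (simp add: fun_class_def)
 show "continuous_on UNIV (w t)" if "t \<in> {0..T}" by (rule continuous_on_slice[OF c that])
 have "\<forall>R. \<exists>C. \<forall>s\<in>{0..T}. \<forall>t\<in>{0..T}. \<forall>x. norm x <= R --> \<bar>w t x - w s x\<bar> <= C * \<bar>t - s\<bar> powr \<alpha>"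
  using assms by (simp add: fun_class_def)
 then obtain C where C: "\<forall>s\<in>{0..T}. \<forall>t\<in>{0..T}. \<forall>x. norm x <= R --> \<bar>w t x - w s x\<bar> <= C * \<bar>t - s\<bar> powr \<alpha>" by blast
 have "\<forall>s\<in>{0..T}. \<forall>t\<in>{0..T}. \<forall>x. norm x <= R --> \<bar>w t x - w s x\<bar> <= max C 0 * \<bar>t - s\<bar> powr \<alpha>"
 proof (intro ballI allI impI)
  fix s t and x :: 'a assume "s \<in> {0..T}" "t \<in> {0..T}" "norm x <= R"
  then have "\<bar>w t x - w s x\<bar> <= C * \<bar>t - s\<bar> powr \<alpha>" using C by blast
  also have "... <= max C 0 * \<bar>t - s\<bar> powr \<alpha>" by (intro mult_right_mono) auto
  finally show "\<bar>w t x - w s x\<bar> <= max C 0 * \<bar>t - s\<bar> powr \<alpha>" .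
 qed
 then show "\<exists>C\<ge>0. \<forall>s\<in>{0..T}. \<forall>t\<in>{0..T}. \<forall>x. norm x <= R --> \<bar>w t x - w s x\<bar> <= C * \<bar>t - s\<bar> powr \<alpha>"
  by (intro exI[of _ "max C 0"]) simp
 show "\<exists>g. continuous_on ({0..T} \<times> UNIV) (\<lambda>(t, x). g t x) \<and> (\<forall>t\<in>{0..T}. \<forall>x. (w t has_derivative (\<lambda>h. g t x \<bullet> h)) (at x))"
  using assms by (simp add: fun_class_def)
qed

text \<open>The solution formula is identified with a transported function for times in {0..T} only,
  and the class looks at no other times.\<close>

lemma fun_class_cong:
 assumes u: "\<And>t. t \<in> {0..T} ==> u t = w t" and w: "fun_class T \<alpha> w" shows "fun_class T \<alpha> u"
 unfolding fun_class_def
proof (intro conjI)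
 note f = w[unfolded fun_class_def]
 show "continuous_on ({0..T} \<times> UNIV) (\<lambda>(t, x). u t x)"
  by (rule continuous_on_cong[THEN iffD1, OF refl _ fun_classD(1)[OF w]]) (use u in auto)
 show "\<forall>R. \<exists>C. \<forall>s\<in>{0..T}. \<forall>t\<in>{0..T}. \<forall>x. norm x <= R --> \<bar>u t x - u s x\<bar> <= C * \<bar>t - s\<bar> powr \<alpha>"
  using f[THEN conjunct2, THEN conjunct1] by (simp only: u simp_thms cong: ball_cong)
 show "\<exists>g. continuous_on ({0..T} \<times> UNIV) (\<lambda>(t, x). g t x) \<and> (\<forall>t\<in>{0..T}. \<forall>x. (u t has_derivative (\<lambda>h. g t x \<bullet> h)) (at x))"
  using f[THEN conjunct2, THEN conjunct2] by (simp only: u simp_thms cong: ball_cong)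
qed

lemma integrable_mult_C0_c:
 fixes f :: "'a::euclidean_space => real"
 assumes "continuous_on UNIV k" "f \<in> C0_c"
 shows "integrable lborel (\<lambda>x. k x * f x)"
proof -
 obtain R where R: "continuous_on UNIV f" "\<forall>x. x \<notin> cball 0 R --> f x = 0" using assms(2) unfolding C0_c_iff by blast
 show ?thesis by (rule integrable_compact_support[of _ R]) (use R assms in \<open>auto intro!: continuous_intros\<close>)
qed

lemma dist_class_fun_dist:
 fixes w :: "real => 'a::euclidean_space => real"
 assumes \<alpha>: "0 < \<alpha>" and \<beta>: "0 < \<beta>" "\<beta> < 1" and w: "fun_class T \<alpha> w"
 shows "dist_class T \<alpha> \<beta> (fun_dist w)"
 unfolding dist_class_def
proof (intro conjI ballI allI impI)
 fix t assume t: "t \<in> {0..T}"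
 note wc = fun_classD(2)[OF w t]
 show "linear_on_Cc (fun_dist w t)"
  unfolding linear_on_Cc_def fun_dist_def
 proof (intro ballI allI)
  fix f g :: "'a => real" and a b :: real assume fg: "f \<in> C0_c" "g \<in> C0_c"
  have "(LINT x|lborel. w t x * (a * f x + b * g x)) = (LINT x|lborel. a * (w t x * f x) + b * (w t x * g x))"
   by (rule Bochner_Integration.integral_cong) (auto simp: algebra_simps)
  then show "(LINT x|lborel. w t x * (a * f x + b * g x)) = a * (LINT x|lborel. w t x * f x) + b * (LINT x|lborel. w t x * g x)"
   using integrable_mult_C0_c[OF wc fg(1)] integrable_mult_C0_c[OF wc fg(2)] by simp
 qed
next
 fix K :: "'a set" assume K: "compact K"
 obtain R where R: "K \<subseteq> cball 0 R" using compact_imp_subset_cball[OF K] by blast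
 obtain B where B: "0 <= B" "\<And>t x. t \<in> {0..T} ==> x \<in> cball 0 R ==> \<bar>w t x\<bar> <= B"
  using compact_bound_joint[OF fun_classD(1)[OF w], of R] by auto
 show "\<exists>C. \<forall>t\<in>{0..T}. \<forall>f\<in>C0_K K. \<bar>fun_dist w t f\<bar> <= C * sup_norm f"
 proof (intro exI[of _ "B * measure lborel (cball (0::'a) R)"] ballI)
  fix t f assume t: "t \<in> {0..T}" and f: "f \<in> C0_K K"
  have "\<bar>fun_dist w t f\<bar> <= (B * sup_norm f) * measure lborel (cball (0::'a) R)"
   unfolding fun_dist_def
  proof (rule integral_bound_compact_support)
   show "w t x * f x = 0" if "x \<notin> cball 0 R" for x using f R that by (auto simp: C0_K_def)
   show "\<bar>w t x * f x\<bar> <= B * sup_norm f" if "x \<in> cball 0 R" for x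
    unfolding abs_mult using B t that C0_KD[OF f K] by (intro mult_mono) auto
  qed
  then show "\<bar>fun_dist w t f\<bar> <= B * measure lborel (cball (0::'a) R) * sup_norm f" by (simp add: mult_ac)
 qed
next
 fix K :: "'a set" assume K: "compact K"
 obtain R where R: "K \<subseteq> cball 0 R" using compact_imp_subset_cball[OF K] by blast
 obtain B where B: "0 <= B" "\<And>s t x. s \<in> {0..T} ==> t \<in> {0..T} ==> norm x <= R ==> \<bar>w t x - w s x\<bar> <= B * \<bar>t - s\<bar> powr \<alpha>"
  using fun_classD(3)[OF w, of R] by blast
 let ?v = "measure lborel (cball (0::'a) R)"
 show "\<exists>C. \<forall>s\<in>{0..T}. \<forall>t\<in>{0..T}. \<forall>f\<in>Cbeta_K \<beta> K. \<bar>fun_dist w t f - fun_dist w s f\<bar> <= C * \<bar>t - s\<bar> powr (\<alpha> * \<beta>) * holder_norm \<beta> f"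
 proof (intro exI[of _ "B * T powr (\<alpha> - \<alpha> * \<beta>) * ?v"] ballI)
  fix s t f assume st: "s \<in> {0..T}" "t \<in> {0..T}" and f: "f \<in> Cbeta_K \<beta> K"
  note fK = Cbeta_KD[OF f K \<beta>(1)]
  have fc: "f \<in> C0_c" by (rule C0_KD(1)[OF fK(1) K])
  have "fun_dist w t f - fun_dist w s f = (LINT x|lborel. (w t x - w s x) * f x)"
   unfolding fun_dist_def left_diff_distrib
   using integrable_mult_C0_c[OF fun_classD(2)[OF w st(1)] fc] integrable_mult_C0_c[OF fun_classD(2)[OF w st(2)] fc] by simp
  also have "\<bar>...\<bar> <= (B * \<bar>t - s\<bar> powr \<alpha> * holder_norm \<beta> f) * ?v"
  proof (rule integral_bound_compact_support)
   show "(w t x - w s x) * f x = 0" if "x \<notin> cball 0 R" for x using fK(1) R that by (auto simp: C0_K_def)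
   show "\<bar>(w t x - w s x) * f x\<bar> <= B * \<bar>t - s\<bar> powr \<alpha> * holder_norm \<beta> f" if "x \<in> cball 0 R" for x
    unfolding abs_mult using B st that fK by (intro mult_mono) auto
  qed
  also have "... <= (B * (T powr (\<alpha> - \<alpha> * \<beta>) * \<bar>t - s\<bar> powr (\<alpha> * \<beta>)) * holder_norm \<beta> f) * ?v"
  proof -
   have "\<alpha> * \<beta> <= \<alpha> * 1" using \<alpha> \<beta> by (intro mult_left_mono) auto
   then have "\<bar>t - s\<bar> powr \<alpha> <= T powr (\<alpha> - \<alpha> * \<beta>) * \<bar>t - s\<bar> powr (\<alpha> * \<beta>)"
    using st by (intro powr_le_powr_lower) auto
   then show ?thesis using B(1) fK(4) by (intro mult_right_mono mult_left_mono) auto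
  qed
  finally show "\<bar>fun_dist w t f - fun_dist w s f\<bar> <= B * T powr (\<alpha> - \<alpha> * \<beta>) * ?v * \<bar>t - s\<bar> powr (\<alpha> * \<beta>) * holder_norm \<beta> f"
   by (simp add: mult_ac)
 qed
qed

lemma smoothE:
 fixes f :: "'a::euclidean_space => real"
 assumes "smooth f"
 obtains Df where "continuous_on UNIV f" "\<And>x. (f has_derivative Df x) (at x)" "\<And>v. smooth (\<lambda>x. Df x v)"
 using assms by (cases rule: smooth.cases) blast

lemma smooth_continuous: "smooth f ==> continuous_on UNIV f" for f :: "'a::euclidean_space => real"
 by (erule smoothE)

text \<open>The gradient is Lipschitz because directional derivatives of a smooth function are again
  smooth, hence C1, and inherit the compact support.\<close>

lemma Cinf_c_tame:
 fixes \<phi> :: "'a::euclidean_space => real"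
 assumes "\<phi> \<in> Cinf_c"
 shows "\<exists>R Q G. tame R Q \<phi> G"
proof -
 obtain K where sm: "smooth \<phi>" and K: "compact K" "\<forall>x. x \<notin> K --> \<phi> x = 0" using assms by (auto simp: Cinf_c_def)
 obtain R where "K \<subseteq> cball 0 R" using compact_imp_subset_cball[OF K(1)] by blast
 then have \<phi>0: "\<phi> x = 0" if "x \<notin> cball 0 R" for x using K that by blast
 obtain D where D: "continuous_on UNIV \<phi>" "\<And>x. (\<phi> has_derivative D x) (at x)" "\<And>v. smooth (\<lambda>x. D x v)"
  by (rule smoothE[OF sm], rule that)
 define G where "G x = (\<Sum>b\<in>Basis. D x b *\<^sub>R b)" for x
 have GD: "(\<lambda>h. G x \<bullet> h) = D x" for x
  unfolding G_def by (rule ext, rule gradient_vector[OF has_derivative_linear[OF D(2)], symmetric])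
 have Db0: "D x b = 0" if "x \<notin> cball 0 R" for x b using has_derivative_0_outside[OF D(2) \<phi>0 that] by simp
 have Dc: "continuous_on UNIV (\<lambda>x. D x b)" for b by (rule smooth_continuous[OF D(3)])
 have "\<exists>B. \<forall>x y. \<bar>D x b - D y b\<bar> <= B * norm (x - y)" for b
 proof -
  obtain D2 where "continuous_on UNIV (\<lambda>x. D x b)"
   and D2: "\<And>x. ((\<lambda>x. D x b) has_derivative D2 x) (at x)" "\<And>v. smooth (\<lambda>x. D2 x v)"
   by (rule smoothE[OF D(3)[of b]], rule that)
  obtain B where "\<And>x y. norm (D x b - D y b) <= B * norm (x - y)"
   using C1_compact_support_lipschitz[OF D2(1) Db0 smooth_continuous[OF D2(2)]] by blast
  then show ?thesis by (intro exI[of _ B]) simp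
 qed
 then obtain B where B: "\<And>b x y. \<bar>D x b - D y b\<bar> <= B b * norm (x - y)" by metis
 define Q1 where "Q1 = (\<Sum>b\<in>(Basis::'a set). B b)"
 have Gl: "norm (G x - G y) <= Q1 * norm (x - y)" for x y
 proof -
  have "norm (G x - G y) = norm (\<Sum>b\<in>(Basis::'a set). (D x b - D y b) *\<^sub>R b)"
   by (simp add: G_def sum_subtractf scaleR_diff_left)
  also have "... <= (\<Sum>b\<in>(Basis::'a set). B b * norm (x - y))"
   by (rule sum_norm_le) (use B in simp)
  finally show ?thesis by (simp add: Q1_def sum_distrib_right)
 qed
 have Gc: "continuous_on UNIV (\<lambda>x. norm (G x))" unfolding G_def by (intro continuous_intros Dc)
 have G0: "norm (G x) = 0" if "x \<notin> cball 0 R" for x using Db0[OF that] by (simp add: G_def)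
 obtain Q2 where Q2: "\<And>x. \<bar>norm (G x)\<bar> <= Q2"
  using bounded_of_compact_support[OF Gc G0] by blast
 obtain Q3 where Q3: "\<And>x. \<bar>\<phi> x\<bar> <= Q3" using bounded_of_compact_support[OF D(1) \<phi>0] by blast
 have "tame R (max Q1 (max Q2 Q3)) \<phi> G"
  unfolding tame_def
 proof (intro conjI allI impI)
  show "(\<phi> has_derivative (\<lambda>h. G x \<bullet> h)) (at x)" for x unfolding GD by (rule D(2))
  show "\<phi> x = 0" if "x \<notin> cball 0 R" for x by (rule \<phi>0[OF that])
  show "\<bar>\<phi> x\<bar> <= max Q1 (max Q2 Q3)" for x using Q3[of x] by simp
  show "norm (G x) <= max Q1 (max Q2 Q3)" for x using Q2[of x] by simp
  show "norm (G x - G y) <= max Q1 (max Q2 Q3) * norm (x - y)" for x y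
   by (rule order_trans[OF Gl]) (intro mult_right_mono; simp)
 qed
 then show ?thesis by blast
qed

context transport_coeffs
begin

text \<open>Time regularity is inherited from space regularity: by \<open>transported_split\<close>
  a time increment is a displacement of order \<bar>t - s\<bar> powr \<alpha> together with a factor
  exp (Z t s x) that differs from 1 by the same order.\<close>

lemma transported_fun_class:
 assumes r: "r \<in> I" and h: "C1_loc h"
 shows "fun_class T \<alpha> (transported r h)"
proof -
 obtain g0 where g0: "continuous_on UNIV g0" "\<And>x. (h has_derivative (\<lambda>k. g0 x \<bullet> k)) (at x)"
  using h unfolding C1_loc_def by blast
 have hc: "continuous_on UNIV h" using g0(2) by (meson continuous_at_imp_continuous_on has_derivative_continuous)
 obtain g where gc: "continuous_on (I \<times> UNIV) (\<lambda>(t, x). g t x)"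
  and gd: "\<And>t x. t \<in> I ==> (transported r h t has_derivative (\<lambda>k. g t x \<bullet> k)) (at x)"
  using transported_gradient[OF r g0(2,1)] by blast
 define U where "U = transported r h"
 have Uc: "continuous_on (I \<times> UNIV) (\<lambda>(t, x). U t x)" using transported_continuous[OF r hc] by (simp add: U_def)
 have "\<exists>K. \<forall>s\<in>I. \<forall>t\<in>I. \<forall>x. norm x <= R --> \<bar>U t x - U s x\<bar> <= K * \<bar>t - s\<bar> powr \<alpha>" for R
 proof -
  define R' where "R' = R + Hf * T powr \<alpha>"
  obtain B1 where B1: "0 <= B1" "\<And>t x. t \<in> I ==> x \<in> cball 0 R' ==> \<bar>U t x\<bar> <= B1"
   using compact_bound_joint[OF Uc, of R'] by auto
  obtain B2 where B2: "0 <= B2" "\<And>t x. t \<in> I ==> x \<in> cball 0 R' ==> norm (g t x) <= B2"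
   using compact_bound_joint[OF gc, of R'] by auto
  define E where "E = exp (Hf * T powr \<alpha>)"
  have HT: "0 <= Hf * T powr \<alpha>" using Hf by simp
  have "\<bar>U t x - U s x\<bar> <= (B2 * Hf * E + B1 * (Hf * (1 + Hf * T powr \<alpha> * E))) * \<bar>t - s\<bar> powr \<alpha>"
   if st: "s \<in> I" "t \<in> I" and x: "norm x <= R" for s t x
  proof -
   define \<rho> where "\<rho> = \<bar>t - s\<bar> powr \<alpha>"
   have \<rho>: "0 <= \<rho>" "\<rho> <= T powr \<alpha>" using st \<alpha> by (auto simp: \<rho>_def intro!: powr_mono2)
   define y where "y = \<Phi> t s x"
   define z where "z = Z t s x"
   have z: "\<bar>z\<bar> <= Hf * \<rho>" using flow_holder(2)[OF st(2,2,1), of x] st by (simp add: z_def \<rho>_def abs_minus_commute)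
   have y: "norm (y - x) <= Hf * \<rho>" using flow_holder(1)[OF st(2,2,1), of x] st by (simp add: y_def \<rho>_def abs_minus_commute)
   have H\<rho>T: "Hf * \<rho> <= Hf * T powr \<alpha>" using \<rho> Hf by (intro mult_left_mono) auto
   have xR: "x \<in> cball 0 R'" using x HT by (simp add: R'_def)
   have yR: "y \<in> cball 0 R'" using x y H\<rho>T norm_triangle_ineq[of x "y - x"] by (simp add: R'_def)
   have ez: "exp z <= E" "exp \<bar>z\<bar> <= E" using z H\<rho>T by (auto simp: E_def)
   have "\<bar>U s y - U s x\<bar> <= B2 * norm (y - x)"
    by (rule lipschitz_of_gradient[where g = "g s" and R = R']) (use gd[OF st(1)] B2(2)[OF st(1)] xR yR U_def in auto)
   also have "... <= B2 * (Hf * \<rho>)" using y B2 by (intro mult_left_mono) auto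
   finally have 1: "\<bar>U s y - U s x\<bar> <= B2 * (Hf * \<rho>)" .
   have 2: "\<bar>exp z - 1\<bar> <= Hf * \<rho> * (1 + Hf * T powr \<alpha> * E)"
   proof -
    have "\<bar>exp z - 1\<bar> <= \<bar>exp z - 1 - z\<bar> + \<bar>z\<bar>" by linarith
    also have "... <= \<bar>z\<bar> * \<bar>z\<bar> * exp \<bar>z\<bar> + \<bar>z\<bar>" using exp_remainder[of z] by (simp add: power2_eq_square abs_mult[symmetric])
    also have "... <= (Hf * \<rho>) * (Hf * T powr \<alpha>) * E + Hf * \<rho>"
     using z ez H\<rho>T Hf \<rho> by (intro add_mono mult_mono) auto
    finally show ?thesis by (simp add: algebra_simps)
   qed
   have "U t x - U s x = (U s y - U s x) * exp z + U s x * (exp z - 1)"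
    using transported_split[OF r st, of h x] by (simp add: U_def y_def z_def algebra_simps)
   then have "\<bar>U t x - U s x\<bar> <= \<bar>U s y - U s x\<bar> * \<bar>exp z\<bar> + \<bar>U s x\<bar> * \<bar>exp z - 1\<bar>"
    by (metis abs_mult abs_triangle_ineq)
   also have "... <= (B2 * (Hf * \<rho>)) * E + B1 * (Hf * \<rho> * (1 + Hf * T powr \<alpha> * E))"
    using 1 2 ez B1(2)[OF st(1) xR] B1(1) B2(1) Hf \<rho> by (intro add_mono mult_mono) auto
   also have "... = (B2 * Hf * E + B1 * (Hf * (1 + Hf * T powr \<alpha> * E))) * \<rho>" by (simp add: algebra_simps)
   finally show ?thesis by (simp add: \<rho>_def)
  qed
  then show ?thesis by blast
 qed
 then show ?thesis unfolding fun_class_def using Uc gc gd by (auto simp: U_def)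
qed

lemma diva_divergence: "s \<in> I ==> t \<in> I ==> diva s t x = divergence A t x - divergence A s x"
 by (simp add: divergence_eq diva_def da_def inner_diff_left sum_subtractf)

lemma wk_eq:
 assumes "s \<in> I" "t \<in> I" "tame R Q \<phi> G"
 shows "(\<lambda>x. frechet_derivative \<phi> (at x) (A t x - A s x) + ((divergence A t x - divergence A s x) - (c t x - c s x)) * \<phi> x)
  = wk s t \<phi> G"
 unfolding wk_def[abs_def] diva_divergence[OF assms(1,2)] tameD(11)[OF assms(3)] dA_def dc_def ..

lemma transported_weak_sol:
 assumes r: "r \<in> I" and h: "C1_loc h" and u: "\<And>t. t \<in> I ==> u t = transported r h t"
 shows "fun_class T \<alpha> u" "weak_sol_transport T \<alpha> \<beta> A c (fun_dist u)"
proof -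
 show cl: "fun_class T \<alpha> u" by (rule fun_class_cong[OF u transported_fun_class[OF r h]])
 have eq: "fun_dist (transported r h) t f = fun_dist u t f" if "t \<in> I" for t f unfolding fun_dist_def u[OF that] ..
 show "weak_sol_transport T \<alpha> \<beta> A c (fun_dist u)"
 unfolding weak_sol_transport_def
proof (intro conjI ballI)
 show "dist_class T \<alpha> \<beta> (fun_dist u)" by (rule dist_class_fun_dist[OF \<alpha>(1) \<beta> cl])
 fix \<phi> :: "'a => real" and t assume "\<phi> \<in> Cinf_c" and t: "t \<in> I"
 then obtain R Q G where \<phi>: "tame R Q \<phi> G" using Cinf_c_tame by blast
 obtain g0 where g0: "continuous_on UNIV g0" "\<And>x. (h has_derivative (\<lambda>k. g0 x \<bullet> k)) (at x)"
  using h unfolding C1_loc_def by blast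
 obtain K where K: "\<And>s t Q \<phi> G. s \<in> I ==> t \<in> I ==> tame R Q \<phi> G ==>
  \<bar>fun_dist (transported r h) t \<phi> - fun_dist (transported r h) s \<phi>
   - fun_dist (transported r h) s (wk s t \<phi> G)\<bar> <= K * Q * \<bar>t - s\<bar> powr \<theta>"
  using transported_expansion[OF r g0(2,1), of R] by blast
 show "riemann_lim (\<lambda>ts. \<Sum>i<length ts - 1. fun_dist u (ts ! i)
  (\<lambda>x. frechet_derivative \<phi> (at x) (A (ts ! Suc i) x - A (ts ! i) x) +
    (divergence A (ts ! Suc i) x - divergence A (ts ! i) x - (c (ts ! Suc i) x - c (ts ! i) x)) * \<phi> x))
  0 t (fun_dist u t \<phi> - fun_dist u 0 \<phi>)"
 proof (rule riemann_lim_of_expansion[OF _ \<theta>1, where M = "K * Q"])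
  fix a b assume ab: "0 <= a" "a < b" "b <= t"
  then have I: "a \<in> I" "b \<in> I" using t by auto
  show "norm (fun_dist u b \<phi> - fun_dist u a \<phi> -
    fun_dist u a (\<lambda>x. frechet_derivative \<phi> (at x) (A b x - A a x) +
    (divergence A b x - divergence A a x - (c b x - c a x)) * \<phi> x)) <= K * Q * (b - a) powr \<theta>"
   unfolding wk_eq[OF I \<phi>] using K[OF I \<phi>] eq[OF I(1)] eq[OF I(2)] ab by simp
 qed (use t in auto)
qed
qed

end

section \<open>The continuity equation: expansion and existence\<close>

lemma exp_diff_bound:
 fixes a b h :: real
 assumes "a <= h" "b <= h"
 shows "\<bar>exp a - exp b\<bar> <= exp h * \<bar>a - b\<bar>"
proof -
 have 1: "exp u - exp v <= exp u * (u - v)" for u v :: real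
 proof -
  have "1 + (v - u) <= exp (v - u)" by (rule exp_ge_add_one_self)
  then have "exp u * (1 + (v - u)) <= exp u * exp (v - u)" by (intro mult_left_mono) auto
  also have "exp u * exp (v - u) = exp v" by (simp add: exp_add[symmetric])
  finally show ?thesis by (simp add: algebra_simps)
 qed
 show ?thesis
 proof (cases "b <= a")
  case True
  have "exp a - exp b <= exp a * (a - b)" by (rule 1)
  also have "... <= exp h * (a - b)" using assms True by (intro mult_right_mono) auto
  finally show ?thesis using True by simp
 next
  case False
  have "exp b - exp a <= exp b * (b - a)" by (rule 1)
  also have "... <= exp h * (b - a)" using assms False by (intro mult_right_mono) auto
  finally show ?thesis using False by simp
 qed
qed

lemma tame_taylor:
 fixes \<phi> :: "'a::euclidean_space => real"
 assumes "tame R Q \<phi> G"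
 shows "\<bar>\<phi> y' - \<phi> y - G y \<bullet> (y' - y)\<bar> <= Q * (norm (y' - y) * norm (y' - y))"
proof -
 define z where "z = y' - y"
 have "norm ((\<phi> (y + z) - G y \<bullet> z) - (\<phi> (y + 0) - G y \<bullet> 0)) <= Q * norm z * norm (z - 0)"
 proof (rule differentiable_bound[of "cball 0 (norm z)" "\<lambda>v. \<phi> (y + v) - G y \<bullet> v" "\<lambda>v h. G (y + v) \<bullet> h - G y \<bullet> h"])
  fix v :: 'a assume v: "v \<in> cball 0 (norm z)"
  have 1: "((\<lambda>v. y + v) has_derivative (\<lambda>h. h)) (at v within cball 0 (norm z))" by (auto intro!: derivative_eq_intros)
  show "((\<lambda>v. \<phi> (y + v) - G y \<bullet> v) has_derivative (\<lambda>h. G (y + v) \<bullet> h - G y \<bullet> h)) (at v within cball 0 (norm z))"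
   by (intro has_derivative_diff has_derivative_compose[OF 1 tameD(1)[OF assms]] has_derivative_inner_right has_derivative_ident)
  show "onorm (\<lambda>h. G (y + v) \<bullet> h - G y \<bullet> h) <= Q * norm z"
  proof (rule onorm_le)
   fix h
   have "\<bar>(G (y + v) - G y) \<bullet> h\<bar> <= norm (G (y + v) - G y) * norm h" by (rule Cauchy_Schwarz_ineq2)
   also have "... <= Q * norm z * norm h"
    using tameD(6)[OF assms, of "y + v" y] v tameD(7)[OF assms] mult_left_mono[of "norm v" "norm z" Q]
    by (intro mult_right_mono) auto
   finally show "norm (G (y + v) \<bullet> h - G y \<bullet> h) <= Q * norm z * norm h" by (simp add: inner_diff_left)
  qed
 qed auto
 then show ?thesis by (simp add: z_def mult.assoc algebra_simps)
qed

lemma linear_on_Cc_comb: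
 assumes "linear_on_Cc \<Lambda>" "f \<in> C0_c" "g \<in> C0_c"
 shows "\<Lambda> (\<lambda>x. f x - g x) = \<Lambda> f - \<Lambda> g" "\<Lambda> (\<lambda>x. f x + g x) = \<Lambda> f + \<Lambda> g"
proof -
 have *: "\<forall>a b. \<Lambda> (\<lambda>x. a * f x + b * g x) = a * \<Lambda> f + b * \<Lambda> g"
  using assms unfolding linear_on_Cc_def by blast
 show "\<Lambda> (\<lambda>x. f x - g x) = \<Lambda> f - \<Lambda> g" using *[THEN spec, THEN spec, of 1 "-1"] by simp
 show "\<Lambda> (\<lambda>x. f x + g x) = \<Lambda> f + \<Lambda> g" using *[THEN spec, THEN spec, of 1 1] by simp
qed

lemma dist_classD:
 fixes v :: "real => ('a::euclidean_space => real) => real"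
 assumes v: "dist_class T \<alpha> \<beta> v"
 shows "t \<in> {0..T} ==> linear_on_Cc (v t)"
  "\<exists>C\<ge>0. \<forall>t\<in>{0..T}. \<forall>f\<in>C0_K (cball 0 R). \<bar>v t f\<bar> <= C * sup_norm f"
  "0 < \<beta> ==> \<exists>C\<ge>0. \<forall>s\<in>{0..T}. \<forall>t\<in>{0..T}. \<forall>f\<in>Cbeta_K \<beta> (cball 0 R).
    \<bar>v t f - v s f\<bar> <= C * \<bar>t - s\<bar> powr (\<alpha> * \<beta>) * holder_norm \<beta> f"
proof -
 note d = v[unfolded dist_class_def]
 show "t \<in> {0..T} ==> linear_on_Cc (v t)" by (rule d[THEN conjunct1, THEN bspec])
 obtain C where C: "\<forall>t\<in>{0..T}. \<forall>f\<in>C0_K (cball 0 R). \<bar>v t f\<bar> <= C * sup_norm f"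
  using d[THEN conjunct2, THEN conjunct1, THEN spec, THEN mp, OF compact_cball] by (rule exE)
 show "\<exists>C\<ge>0. \<forall>t\<in>{0..T}. \<forall>f\<in>C0_K (cball 0 R). \<bar>v t f\<bar> <= C * sup_norm f"
 proof (intro exI[of _ "max C 0"] conjI ballI)
  fix t f assume t: "t \<in> {0..T}" and f: "f \<in> C0_K (cball (0::'a) R)"
  have "\<bar>v t f\<bar> <= C * sup_norm f" by (rule C[THEN bspec, OF t, THEN bspec, OF f])
  also have "... <= max C 0 * sup_norm f" by (rule mult_right_mono[OF _ C0_KD(3)[OF f compact_cball]]) simp
  finally show "\<bar>v t f\<bar> <= max C 0 * sup_norm f" .
 qed simp
 obtain D where D: "\<forall>s\<in>{0..T}. \<forall>t\<in>{0..T}. \<forall>f\<in>Cbeta_K \<beta> (cball 0 R).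
    \<bar>v t f - v s f\<bar> <= D * \<bar>t - s\<bar> powr (\<alpha> * \<beta>) * holder_norm \<beta> f"
  using d[THEN conjunct2, THEN conjunct2, THEN spec, THEN mp, OF compact_cball] by (rule exE)
 assume \<beta>: "0 < \<beta>"
 show "\<exists>C\<ge>0. \<forall>s\<in>{0..T}. \<forall>t\<in>{0..T}. \<forall>f\<in>Cbeta_K \<beta> (cball 0 R).
    \<bar>v t f - v s f\<bar> <= C * \<bar>t - s\<bar> powr (\<alpha> * \<beta>) * holder_norm \<beta> f"
 proof (intro exI[of _ "max D 0"] conjI ballI)
  fix s t f assume st: "s \<in> {0..T}" "t \<in> {0..T}" and f: "f \<in> Cbeta_K \<beta> (cball (0::'a) R)"
  have "\<bar>v t f - v s f\<bar> <= D * \<bar>t - s\<bar> powr (\<alpha> * \<beta>) * holder_norm \<beta> f"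
   by (rule D[THEN bspec, OF st(1), THEN bspec, OF st(2), THEN bspec, OF f])
  also have "... <= max D 0 * \<bar>t - s\<bar> powr (\<alpha> * \<beta>) * holder_norm \<beta> f"
   by (intro mult_right_mono Cbeta_KD(4)[OF f compact_cball \<beta>]) auto
  finally show "\<bar>v t f - v s f\<bar> <= max D 0 * \<bar>t - s\<bar> powr (\<alpha> * \<beta>) * holder_norm \<beta> f" .
 qed simp
qed

lemma zero_in_C0_c: "(\<lambda>_. 0) \<in> C0_c" unfolding C0_c_iff by auto

lemma linear_on_Cc_zero: assumes "linear_on_Cc \<Lambda>" shows "\<Lambda> (\<lambda>_. 0) = 0"
proof -
 have "\<Lambda> (\<lambda>x. 0 * (\<lambda>_. 0) x + 0 * (\<lambda>_. 0) x) = 0 * \<Lambda> (\<lambda>_. 0) + 0 * \<Lambda> (\<lambda>_. 0)"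
  using assms[unfolded linear_on_Cc_def, THEN bspec, OF zero_in_C0_c, THEN bspec, OF zero_in_C0_c] by blast
 then show ?thesis by simp
qed

lemma C0_c_diff: "f \<in> C0_c ==> g \<in> C0_c ==> (\<lambda>x. f x - g x) \<in> C0_c" for f g :: "'a::euclidean_space => real"
proof -
 assume "f \<in> C0_c" "g \<in> C0_c"
 then obtain R R' where *: "continuous_on UNIV f" "\<forall>x. x \<notin> cball 0 R --> f x = 0"
  "continuous_on UNIV g" "\<forall>x. x \<notin> cball 0 R' --> g x = 0"
  unfolding C0_c_iff by blast
 have "f x - g x = 0" if "x \<notin> cball 0 (max R R')" for x
 proof -
  have "x \<notin> cball 0 R" "x \<notin> cball 0 R'" using that by auto
  then show ?thesis using * by simp
 qed
 then show ?thesis unfolding C0_c_iff using * by (intro conjI exI[of _ "max R R'"]) (auto intro!: continuous_intros)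
qed

section \<open>First order expansions forced by the weak equations\<close>

context transport_coeffs
begin

text \<open>The continuity equation is the transport equation with coefficient div A - c, so the
  divergence cancels in its integrand. Unlike \<open>wk\<close>, this integrand is built from
  Lipschitz factors only.\<close>

definition wkc where "wkc s t \<phi> G x = G x \<bullet> dA s t x + dc s t x * \<phi> x"

lemma wkc_eq:
 assumes "s \<in> I" "t \<in> I" "tame R Q \<phi> G"
 shows "(\<lambda>x. frechet_derivative \<phi> (at x) (A t x - A s x) + ((divergence A t x - divergence A s x) -
  ((divergence A t x - c t x) - (divergence A s x - c s x))) * \<phi> x) = wkc s t \<phi> G"
 unfolding wkc_def[abs_def] tameD(11)[OF assms(3)] dA_def dc_def by (simp add: fun_eq_iff)

lemma weak_sol_continuity_eq:
 "weak_sol_continuity T \<alpha> \<beta> A c v \<longleftrightarrow> dist_class T \<alpha> \<beta> v \<and>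
  (\<forall>\<phi>\<in>Cinf_c. \<forall>t\<in>I. riemann_lim (\<lambda>ts. \<Sum>i < length ts - 1.
      v (ts ! i) (\<lambda>x. frechet_derivative \<phi> (at x) (A (ts ! Suc i) x - A (ts ! i) x) +
      ((divergence A (ts ! Suc i) x - divergence A (ts ! i) x) -
  ((divergence A (ts ! Suc i) x - c (ts ! Suc i) x) - (divergence A (ts ! i) x - c (ts ! i) x))) * \<phi> x))
     0 t (v t \<phi> - v 0 \<phi>))"
 by (simp add: weak_sol_continuity_def weak_sol_transport_def)

lemma wkc_props:
 assumes st: "s \<in> I" "t \<in> I" and \<phi>: "tame R Q \<phi> G"
 shows "\<bar>wkc s t \<phi> G x\<bar> <= 2 * C * Q * \<bar>t - s\<bar> powr \<alpha>"
  "\<bar>wkc s t \<phi> G x - wkc s t \<phi> G y\<bar> <= 4 * C * Q * \<bar>t - s\<bar> powr \<alpha> * norm (x - y)"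
  "x \<notin> cball 0 R ==> wkc s t \<phi> G x = 0" "continuous_on UNIV (wkc s t \<phi> G)"
proof -
 define \<tau> where "\<tau> = \<bar>t - s\<bar> powr \<alpha>"
 have \<tau>: "0 <= \<tau>" by (simp add: \<tau>_def)
 have Q0: "0 <= Q" by (rule tameD(7)[OF \<phi>])
 have a: "norm (dA s t x) <= C * \<tau>" for x using dA_bound[OF st] by (simp add: \<tau>_def)
 have al: "norm (dA s t x - dA s t y) <= C * \<tau> * norm (x - y)" for x y using dA_lip[OF st] by (simp add: \<tau>_def)
 have cb: "\<bar>dc s t x\<bar> <= C * \<tau>" for x using dc_bound[OF st] by (simp add: \<tau>_def)
 have cl: "\<bar>dc s t x - dc s t y\<bar> <= C * \<tau> * norm (x - y)" for x y using dc_lip[OF st] by (simp add: \<tau>_def)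
 have "\<bar>G x \<bullet> dA s t x\<bar> <= Q * (C * \<tau>)"
  by (rule order_trans[OF Cauchy_Schwarz_ineq2 mult_mono[OF tameD(5)[OF \<phi>] a Q0]]) simp
 moreover have "\<bar>dc s t x * \<phi> x\<bar> <= (C * \<tau>) * Q"
  unfolding abs_mult by (rule mult_mono[OF cb tameD(4)[OF \<phi>]]) (use C0 \<tau> in auto)
 ultimately show "\<bar>wkc s t \<phi> G x\<bar> <= 2 * C * Q * \<bar>t - s\<bar> powr \<alpha>"
  unfolding wkc_def \<tau>_def[symmetric] by (simp add: algebra_simps abs_le_iff)
 have 1: "\<bar>(G x - G y) \<bullet> dA s t x\<bar> <= (Q * norm (x - y)) * (C * \<tau>)"
  by (rule order_trans[OF Cauchy_Schwarz_ineq2 mult_mono[OF tameD(6)[OF \<phi>] a]]) (use Q0 in auto)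
 have 2: "\<bar>G y \<bullet> (dA s t x - dA s t y)\<bar> <= Q * (C * \<tau> * norm (x - y))"
  by (rule order_trans[OF Cauchy_Schwarz_ineq2 mult_mono[OF tameD(5)[OF \<phi>] al Q0]]) simp
 have 3: "\<bar>(dc s t x - dc s t y) * \<phi> x\<bar> <= (C * \<tau> * norm (x - y)) * Q"
  unfolding abs_mult by (rule mult_mono[OF cl tameD(4)[OF \<phi>]]) (use C0 \<tau> in auto)
 have 4: "\<bar>dc s t y * (\<phi> x - \<phi> y)\<bar> <= (C * \<tau>) * (Q * norm (x - y))"
  unfolding abs_mult by (rule mult_mono[OF cb tameD(8)[OF \<phi>]]) (use C0 \<tau> in auto)
 have "wkc s t \<phi> G x - wkc s t \<phi> G y = (G x - G y) \<bullet> dA s t x + G y \<bullet> (dA s t x - dA s t y)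
  + (dc s t x - dc s t y) * \<phi> x + dc s t y * (\<phi> x - \<phi> y)"
  by (simp add: wkc_def inner_diff_left inner_diff_right algebra_simps)
 also have "\<bar>...\<bar> <= (Q * norm (x - y)) * (C * \<tau>) + Q * (C * \<tau> * norm (x - y)) + (C * \<tau> * norm (x - y)) * Q + (C * \<tau>) * (Q * norm (x - y))"
  using 1 2 3 4 by (intro order_trans[OF abs_triangle_ineq] add_mono) auto
 finally show "\<bar>wkc s t \<phi> G x - wkc s t \<phi> G y\<bar> <= 4 * C * Q * \<bar>t - s\<bar> powr \<alpha> * norm (x - y)"
  unfolding \<tau>_def[symmetric] by (simp add: algebra_simps)
 show "x \<notin> cball 0 R ==> wkc s t \<phi> G x = 0" using tameD(2,3)[OF \<phi>] by (simp add: wkc_def)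
 show "continuous_on UNIV (wkc s t \<phi> G)"
  unfolding wkc_def[abs_def]
  by (intro continuous_intros tameD(9,10)[OF \<phi>] dA_continuous[OF st] dc_continuous[OF st])
qed

lemma wkc_C0_c: assumes "s \<in> I" "t \<in> I" "tame R Q \<phi> G" shows "wkc s t \<phi> G \<in> C0_c"
 unfolding C0_c_iff using wkc_props(3,4)[OF assms] by blast

lemma wkc_add: "wkc a d \<phi> G x = wkc a b \<phi> G x + wkc b d \<phi> G x"
 by (simp add: wkc_def dA_def dc_def algebra_simps inner_diff_right)

text \<open>The defect of the germ is v b - v a tested with the integrand over [b, d]. Time
  regularity \<alpha> * \<beta> of v and size \<alpha> of the test function add up to \<theta>, so
  sewing applies with a constant linear in \<open>Q\<close>.\<close>

lemma continuity_expansion: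
 assumes v: "weak_sol_continuity T \<alpha> \<beta> A c v"
 shows "\<exists>K\<ge>0. \<forall>s t Q \<phi> G. 0 <= s --> s <= t --> t <= T --> tame R Q \<phi> G --> \<phi> \<in> Cinf_c -->
  \<bar>v t \<phi> - v s \<phi> - v s (wkc s t \<phi> G)\<bar> <= K * Q * (t - s) powr \<theta>"
proof -
 have dc: "dist_class T \<alpha> \<beta> v" by (rule v[unfolded weak_sol_continuity_eq, THEN conjunct1])
 note lin = dist_classD(1)[OF dc]
 obtain D' where D': "0 <= D'" and D: "\<And>s t f. s \<in> I ==> t \<in> I ==> f \<in> Cbeta_K \<beta> (cball 0 R) ==>
   \<bar>v t f - v s f\<bar> <= D' * \<bar>t - s\<bar> powr (\<alpha> * \<beta>) * holder_norm \<beta> f"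
  using dist_classD(3)[OF dc \<beta>(1), of R] by blast
 define K where "K = sewing_const \<theta> * (D' * (10 * C))"
 have K0: "0 <= K" using sewing_const(1)[OF \<theta>1] D' C0 by (simp add: K_def)
 have "\<bar>v t \<phi> - v s \<phi> - v s (wkc s t \<phi> G)\<bar> <= K * Q * (t - s) powr \<theta>"
  if st: "0 <= s" "s <= t" "t <= T" and \<phi>: "tame R Q \<phi> G" and \<phi>s: "\<phi> \<in> Cinf_c" for s t Q \<phi> G
 proof -
  have Q0: "0 <= Q" by (rule tameD(7)[OF \<phi>])
  define \<Xi> where "\<Xi> a b = v a (\<lambda>x. frechet_derivative \<phi> (at x) (A b x - A a x) +
      ((divergence A b x - divergence A a x) -
  ((divergence A b x - c b x) - (divergence A a x - c a x))) * \<phi> x)" for a b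
  have \<Xi>: "\<Xi> a b = v a (wkc a b \<phi> G)" if "a \<in> I" "b \<in> I" for a b
   unfolding \<Xi>_def wkc_eq[OF that \<phi>] ..
  have "norm (v t \<phi> - v s \<phi> - \<Xi> s t) <= sewing_const \<theta> * (D' * (10 * C * Q)) * (t - s) powr \<theta>"
  proof (rule expansion_of_riemann_lim[OF \<theta>1, of _ 0 T])
   show "0 <= D' * (10 * C * Q)" using D' C0 Q0 by simp
   show "riemann_lim (\<lambda>ts. \<Sum>i<length ts - 1. \<Xi> (ts ! i) (ts ! Suc i)) 0 t (v t \<phi> - v 0 \<phi>)" if "0 <= t" "t <= T" for t
    using v \<phi>s that unfolding weak_sol_continuity_eq \<Xi>_def by simp
   fix a b d assume abd: "0 <= a" "a <= b" "b <= d" "d <= T"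
   then have I: "a \<in> I" "b \<in> I" "d \<in> I" by auto
   let ?f = "wkc b d \<phi> G"
   define \<tau> where "\<tau> = \<bar>d - b\<bar> powr \<alpha>"
   have "v a (wkc a d \<phi> G) = v a (\<lambda>x. wkc a b \<phi> G x + wkc b d \<phi> G x)" by (simp add: wkc_add[of a d \<phi> G _ b, abs_def])
   also have "... = v a (wkc a b \<phi> G) + v a ?f"
    by (rule linear_on_Cc_comb(2)[OF lin[OF I(1)] wkc_C0_c[OF I(1,2) \<phi>] wkc_C0_c[OF I(2,3) \<phi>]])
   finally have e1: "\<Xi> a d - \<Xi> a b - \<Xi> b d = - (v b ?f - v a ?f)"
    unfolding \<Xi>[OF I(1,3)] \<Xi>[OF I(1,2)] \<Xi>[OF I(2,3)] by simp
   have hold: "\<bar>?f x - ?f y\<bar> <= (8 * C * Q * \<tau>) * norm (x - y) powr \<beta>" for x y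
    using lipschitz_imp_holder[of ?f "2 * C * Q * \<tau>" "4 * C * Q * \<tau>" \<beta> x y] wkc_props(1,2)[OF I(2,3) \<phi>] \<beta> C0 Q0
    by (simp add: \<tau>_def)
   \<comment> \<open>10 = 2 + 8: the sup bound plus the Hoelder constant, where 8 = 4 + 2 * 2 comes
     from \<open>lipschitz_imp_holder\<close>.\<close>
   have hn: "holder_norm \<beta> ?f <= 10 * C * Q * \<tau>"
    using holder_norm_le[of ?f "2 * C * Q * \<tau>" "8 * C * Q * \<tau>" \<beta>] wkc_props(1)[OF I(2,3) \<phi>] hold by (simp add: \<tau>_def)
   have fK: "?f \<in> Cbeta_K \<beta> (cball 0 R)"
    using hold wkc_props(3)[OF I(2,3) \<phi>] unfolding Cbeta_K_def dist_norm by blast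
   have hn0: "0 <= holder_norm \<beta> ?f" by (rule Cbeta_KD(4)[OF fK compact_cball \<beta>(1)])
   have "\<bar>v b ?f - v a ?f\<bar> <= D' * \<bar>b - a\<bar> powr (\<alpha> * \<beta>) * holder_norm \<beta> ?f" by (rule D[OF I(1,2) fK])
   also have "... <= D' * (d - a) powr (\<alpha> * \<beta>) * (10 * C * Q * (d - a) powr \<alpha>)"
   proof -
    have "\<tau> <= (d - a) powr \<alpha>" using abd \<alpha> by (auto simp: \<tau>_def intro!: powr_mono2)
    then have "10 * C * Q * \<tau> <= 10 * C * Q * (d - a) powr \<alpha>" using C0 Q0 by (intro mult_left_mono) auto
    moreover have "\<bar>b - a\<bar> powr (\<alpha> * \<beta>) <= (d - a) powr (\<alpha> * \<beta>)" using abd \<alpha> \<beta> by (intro powr_mono2) auto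
    ultimately show ?thesis using D' hn hn0 by (intro mult_mono) auto
   qed
   also have "... = D' * (10 * C * Q) * (d - a) powr \<theta>" by (simp add: F.\<theta>(1) powr_add mult_ac)
   finally show "norm (\<Xi> a d - \<Xi> a b - \<Xi> b d) <= D' * (10 * C * Q) * (d - a) powr \<theta>" unfolding e1 by simp
  next
   fix a assume "0 <= a" "a <= T"
   then have I: "a \<in> I" by simp
   have "wkc a a \<phi> G = (\<lambda>_. 0)" by (simp add: wkc_def fun_eq_iff dA_def dc_def)
   then show "\<Xi> a a = 0" using linear_on_Cc_zero[OF lin[OF I]] by (simp add: \<Xi>[OF I I])
  qed (use st in auto)
  then show ?thesis using \<Xi>[of s t] st by (simp add: K_def mult_ac)
 qed
 then show ?thesis using K0 by blast
qed

lemma wk_props: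
 assumes st: "s \<in> I" "t \<in> I" and \<phi>: "tame R Q \<phi> G"
 shows "\<bar>wk s t \<phi> G x\<bar> <= (N + 2) * C * Q * \<bar>t - s\<bar> powr \<alpha>"
  "x \<notin> cball 0 R ==> wk s t \<phi> G x = 0" "continuous_on UNIV (wk s t \<phi> G)" "wk s t \<phi> G \<in> C0_c"
proof -
 define \<tau> where "\<tau> = \<bar>t - s\<bar> powr \<alpha>"
 have \<tau>: "0 <= \<tau>" by (simp add: \<tau>_def)
 have Q0: "0 <= Q" by (rule tameD(7)[OF \<phi>])
 have "\<bar>G x \<bullet> dA s t x\<bar> <= Q * (C * \<tau>)"
  unfolding \<tau>_def by (rule order_trans[OF Cauchy_Schwarz_ineq2 mult_mono[OF tameD(5)[OF \<phi>] dA_bound[OF st] Q0]]) simp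
 moreover have "\<bar>(diva s t x - dc s t x) * \<phi> x\<bar> <= (N * C * \<tau> + C * \<tau>) * Q"
  unfolding abs_mult
  by (rule mult_mono[OF order_trans[OF abs_triangle_ineq4 add_mono[OF diva_bound[OF st, of x] dc_bound[OF st, of x], folded \<tau>_def]] tameD(4)[OF \<phi>]])
   (use C0 \<tau> N in auto)
 ultimately show "\<bar>wk s t \<phi> G x\<bar> <= (N + 2) * C * Q * \<bar>t - s\<bar> powr \<alpha>"
  unfolding wk_def \<tau>_def[symmetric] by (simp add: algebra_simps abs_le_iff)
 show z: "x \<notin> cball 0 R ==> wk s t \<phi> G x = 0" for x using tameD(2,3)[OF \<phi>] by (simp add: wk_def)
 show c: "continuous_on UNIV (wk s t \<phi> G)"
  unfolding wk_def[abs_def]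
  by (intro continuous_intros tameD(9,10)[OF \<phi>] dA_continuous[OF st] dc_continuous[OF st] diva_continuous[OF st])
 show "wk s t \<phi> G \<in> C0_c" unfolding C0_c_iff using z c by blast
qed

lemma wk_add: "wk a d \<phi> G x = wk a b \<phi> G x + wk b d \<phi> G x"
proof -
 have "diva a d x = diva a b x + diva b d x"
  by (simp add: diva_def da_def sum.distrib[symmetric] inner_add_left[symmetric])
 then show ?thesis by (simp add: wk_def dA_def dc_def algebra_simps inner_diff_right)
qed

text \<open>For a function in the solution class time increments are \<alpha>-Hoelder uniformly on
  balls. The defect then has order 2 * \<alpha>, and a sup bound on \<open>wk\<close> suffices
  although the divergence in it is only Hoelder.\<close>

lemma transport_expansion:
 assumes w: "fun_class T \<alpha> w" "weak_sol_transport T \<alpha> \<beta> A c (fun_dist w)"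
 shows "\<exists>K\<ge>0. \<forall>s t Q \<phi> G. 0 <= s --> s <= t --> t <= T --> tame R Q \<phi> G --> \<phi> \<in> Cinf_c -->
  \<bar>fun_dist w t \<phi> - fun_dist w s \<phi> - fun_dist w s (wk s t \<phi> G)\<bar> <= K * Q * (t - s) powr \<theta>"
proof -
 note lin = dist_classD(1)[OF w(2)[unfolded weak_sol_transport_def, THEN conjunct1]]
 obtain D where D: "0 <= D" "\<And>s t x. s \<in> I ==> t \<in> I ==> norm x <= R ==> \<bar>w t x - w s x\<bar> <= D * \<bar>t - s\<bar> powr \<alpha>"
  using fun_classD(3)[OF w(1), of R] by blast
 define vol where "vol = measure lborel (cball (0::'a) R)"
 have vol: "0 <= vol" by (simp add: vol_def)
 define P where "P = T powr (2 * \<alpha> - \<theta>)"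
 have P: "0 <= P" by (simp add: P_def)
 define K where "K = sewing_const \<theta> * (D * ((N + 2) * C) * P * vol)"
 have K0: "0 <= K" using sewing_const(1)[OF \<theta>1] D(1) C0 N P vol by (simp add: K_def)
 have "\<bar>fun_dist w t \<phi> - fun_dist w s \<phi> - fun_dist w s (wk s t \<phi> G)\<bar> <= K * Q * (t - s) powr \<theta>"
  if st: "0 <= s" "s <= t" "t <= T" and \<phi>: "tame R Q \<phi> G" and \<phi>s: "\<phi> \<in> Cinf_c" for s t Q \<phi> G
 proof -
  have Q0: "0 <= Q" by (rule tameD(7)[OF \<phi>])
  define \<Xi> where "\<Xi> a b = fun_dist w a (\<lambda>x. frechet_derivative \<phi> (at x) (A b x - A a x) +
      ((divergence A b x - divergence A a x) - (c b x - c a x)) * \<phi> x)" for a b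
  have \<Xi>: "\<Xi> a b = fun_dist w a (wk a b \<phi> G)" if "a \<in> I" "b \<in> I" for a b
   unfolding \<Xi>_def wk_eq[OF that \<phi>] ..
  have "norm (fun_dist w t \<phi> - fun_dist w s \<phi> - \<Xi> s t) <= sewing_const \<theta> * (D * ((N + 2) * C * Q) * P * vol) * (t - s) powr \<theta>"
  proof (rule expansion_of_riemann_lim[OF \<theta>1, of _ 0 T])
   show "0 <= D * ((N + 2) * C * Q) * P * vol" using D C0 Q0 N P vol by simp
   show "riemann_lim (\<lambda>ts. \<Sum>i<length ts - 1. \<Xi> (ts ! i) (ts ! Suc i)) 0 t (fun_dist w t \<phi> - fun_dist w 0 \<phi>)" if "0 <= t" "t <= T" for t
    using w(2) \<phi>s that unfolding weak_sol_transport_def \<Xi>_def by simp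
   fix a b d assume abd: "0 <= a" "a <= b" "b <= d" "d <= T"
   then have I: "a \<in> I" "b \<in> I" "d \<in> I" by auto
   let ?f = "wk b d \<phi> G"
   define \<rho> where "\<rho> = (d - a) powr \<alpha>"
   have "fun_dist w a (wk a d \<phi> G) = fun_dist w a (\<lambda>x. wk a b \<phi> G x + wk b d \<phi> G x)" by (simp add: wk_add[of a d \<phi> G _ b, abs_def])
   also have "... = fun_dist w a (wk a b \<phi> G) + fun_dist w a ?f"
    by (rule linear_on_Cc_comb(2)[OF lin[OF I(1)] wk_props(4)[OF I(1,2) \<phi>] wk_props(4)[OF I(2,3) \<phi>]])
   finally have e: "\<Xi> a d - \<Xi> a b - \<Xi> b d = fun_dist w a ?f - fun_dist w b ?f"
    unfolding \<Xi>[OF I(1,3)] \<Xi>[OF I(1,2)] \<Xi>[OF I(2,3)] by simp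
   have "fun_dist w a ?f - fun_dist w b ?f = (LINT x|lborel. (w a x - w b x) * ?f x)"
    unfolding fun_dist_def left_diff_distrib
    using integrable_mult_C0_c[OF fun_classD(2)[OF w(1) I(1)] wk_props(4)[OF I(2,3) \<phi>]]
     integrable_mult_C0_c[OF fun_classD(2)[OF w(1) I(2)] wk_props(4)[OF I(2,3) \<phi>]] by simp
   moreover have "\<bar>LINT x|lborel. (w a x - w b x) * ?f x\<bar> <= ((D * \<rho>) * ((N + 2) * C * Q * \<rho>)) * vol"
    unfolding vol_def
   proof (rule integral_bound_compact_support)
    show "(w a x - w b x) * ?f x = 0" if "x \<notin> cball 0 R" for x using wk_props(2)[OF I(2,3) \<phi> that] by simp
    fix x :: 'a assume x: "x \<in> cball 0 R"
    have "\<bar>w a x - w b x\<bar> <= D * \<bar>a - b\<bar> powr \<alpha>" using D(2)[OF I(2,1)] x by simp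
    also have "... <= D * \<rho>" using abd \<alpha> D(1) by (auto simp: \<rho>_def intro!: mult_left_mono powr_mono2)
    finally have 1: "\<bar>w a x - w b x\<bar> <= D * \<rho>" .
    have "\<bar>?f x\<bar> <= (N + 2) * C * Q * \<bar>d - b\<bar> powr \<alpha>" by (rule wk_props(1)[OF I(2,3) \<phi>])
    also have "... <= (N + 2) * C * Q * \<rho>"
     using abd \<alpha> N C0 Q0 by (auto simp: \<rho>_def intro!: mult_left_mono powr_mono2)
    finally have 2: "\<bar>?f x\<bar> <= (N + 2) * C * Q * \<rho>" .
    show "\<bar>(w a x - w b x) * ?f x\<bar> <= (D * \<rho>) * ((N + 2) * C * Q * \<rho>)"
     unfolding abs_mult using D(1) by (intro mult_mono 1 2) (auto simp: \<rho>_def)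
   qed
   moreover have "((D * \<rho>) * ((N + 2) * C * Q * \<rho>)) * vol <= D * ((N + 2) * C * Q) * P * vol * (d - a) powr \<theta>"
   proof -
    have "((D * \<rho>) * ((N + 2) * C * Q * \<rho>)) * vol = (D * ((N + 2) * C * Q)) * vol * (\<rho> * \<rho>)" by (simp add: mult_ac)
    also have "... <= (D * ((N + 2) * C * Q)) * vol * (P * (d - a) powr \<theta>)"
     using powr_2\<alpha>[of "d - a"] abd D(1) N C0 Q0 vol by (intro mult_left_mono) (auto simp: \<rho>_def P_def)
    finally show ?thesis by (simp add: mult_ac)
   qed
   ultimately show "norm (\<Xi> a d - \<Xi> a b - \<Xi> b d) <= D * ((N + 2) * C * Q) * P * vol * (d - a) powr \<theta>" using e by simp
  next
   fix a assume "0 <= a" "a <= T"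
   then have I: "a \<in> I" by simp
   have "wk a a \<phi> G = (\<lambda>_. 0)" by (simp add: wk_def fun_eq_iff dA_def dc_def diva_def da_def)
   then show "\<Xi> a a = 0" using linear_on_Cc_zero[OF lin[OF I]] by (simp add: \<Xi>[OF I I])
  qed (use st in auto)
  then show ?thesis using \<Xi>[of s t] st by (simp add: K_def mult_ac)
 qed
 then show ?thesis using K0 by blast
qed

end

section \<open>Weighted push-forward of a measure along the flow\<close>

context transport_coeffs
begin

definition pushed where "pushed \<mu> t f = \<mu> (\<lambda>x. f (\<Phi> 0 t x) * exp (Z 0 t x))"

text \<open>A trajectory moves by at most Hf * T powr \<alpha>, so one that starts outside this
  radius does not enter the ball of radius R.\<close>

definition Rflow where "Rflow R = R + Hf * T powr \<alpha>"

lemma zero_I: "0 \<in> I" using T by simp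

lemma powr_le_T\<alpha>: "0 <= r ==> r <= T ==> r powr \<alpha> <= T powr \<alpha>" using \<alpha> by (intro powr_mono2) auto

lemma exp_Z_bound:
 assumes "s \<in> I" "t \<in> I"
 shows "\<bar>Z s t x\<bar> <= Hf * T powr \<alpha>" "exp (Z s t x) <= exp (Hf * T powr \<alpha>)"
proof -
 have "\<bar>Z s t x\<bar> <= Hf * \<bar>t - s\<bar> powr \<alpha>" using flow_holder(2)[OF assms(1,1,2), of x] assms by simp
 also have "... <= Hf * T powr \<alpha>" using powr_le_T\<alpha>[of "\<bar>t - s\<bar>"] assms Hf by (intro mult_left_mono) auto
 finally show "\<bar>Z s t x\<bar> <= Hf * T powr \<alpha>" .
 then show "exp (Z s t x) <= exp (Hf * T powr \<alpha>)" by simp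
qed

lemma flow_outside:
 assumes "t \<in> I" "x \<notin> cball 0 (Rflow R)" shows "\<Phi> 0 t x \<notin> cball 0 R"
proof -
 have "norm (\<Phi> 0 t x - x) <= Hf * \<bar>t - 0\<bar> powr \<alpha>" using flow_holder(1)[OF zero_I zero_I assms(1), of x] zero_I by simp
 also have "... <= Hf * T powr \<alpha>" using powr_le_T\<alpha>[of t] assms Hf by (intro mult_left_mono) auto
 finally have "norm (\<Phi> 0 t x - x) <= Hf * T powr \<alpha>" .
 moreover have "norm x <= norm (\<Phi> 0 t x) + norm (\<Phi> 0 t x - x)"
  using norm_triangle_ineq4[of "\<Phi> 0 t x" "\<Phi> 0 t x - x"] by simp
 ultimately show ?thesis using assms(2) by (simp add: Rflow_def)
qed

lemma flow_slice_continuous: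
 assumes "s \<in> I" "t \<in> I"
 shows "continuous_on UNIV (\<Phi> s t)" "continuous_on UNIV (Z s t)"
proof -
 show "continuous_on UNIV (\<Phi> s t)"
  by (rule lipschitz_on_continuous_on[of Qf])
   (use flow_lipschitz(1)[OF assms] Qf(1) in \<open>auto simp: lipschitz_on_def dist_norm\<close>)
 show "continuous_on UNIV (Z s t)"
  by (rule lipschitz_on_continuous_on[of Qf])
   (use flow_lipschitz(2)[OF assms] Qf(1) in \<open>auto simp: lipschitz_on_def dist_norm\<close>)
qed

lemma pulled_C0:
 assumes t: "t \<in> I" and f: "continuous_on UNIV f" "\<And>x. x \<notin> cball 0 R ==> f x = 0"
 shows "(\<lambda>x. f (\<Phi> 0 t x) * exp (Z 0 t x)) \<in> C0_K (cball 0 (Rflow R))"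
  "(\<lambda>x. f (\<Phi> 0 t x) * exp (Z 0 t x)) \<in> C0_c"
proof -
 have "continuous_on UNIV (\<lambda>x. f (\<Phi> 0 t x) * exp (Z 0 t x))"
  by (intro continuous_intros continuous_on_compose2[OF f(1)] flow_slice_continuous[OF zero_I t]) auto
 moreover have "f (\<Phi> 0 t x) * exp (Z 0 t x) = 0" if "x \<notin> cball 0 (Rflow R)" for x
  using f(2)[OF flow_outside[OF t that]] by simp
 ultimately show *: "(\<lambda>x. f (\<Phi> 0 t x) * exp (Z 0 t x)) \<in> C0_K (cball 0 (Rflow R))" by (simp add: C0_K_def)
 show "(\<lambda>x. f (\<Phi> 0 t x) * exp (Z 0 t x)) \<in> C0_c" by (rule C0_KD(1)[OF * compact_cball])
qed

lemma MlocD: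
 fixes \<mu> :: "('a => real) => real"
 assumes \<mu>: "Mloc \<mu>"
 shows "linear_on_Cc \<mu>" "\<exists>B\<ge>0. \<forall>f\<in>C0_K (cball 0 R). \<forall>e. (\<forall>x. \<bar>f x\<bar> <= e) --> \<bar>\<mu> f\<bar> <= B * e"
proof -
 note m = \<mu>[unfolded Mloc_def]
 show "linear_on_Cc \<mu>" by (rule m[THEN conjunct1])
 obtain C where C: "\<forall>f\<in>C0_K (cball 0 R). \<bar>\<mu> f\<bar> <= C * sup_norm f"
  using m[THEN conjunct2, THEN spec, THEN mp, OF compact_cball] by (rule exE)
 show "\<exists>B\<ge>0. \<forall>f\<in>C0_K (cball 0 R). \<forall>e. (\<forall>x. \<bar>f x\<bar> <= e) --> \<bar>\<mu> f\<bar> <= B * e"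
 proof (intro exI[of _ "max C 0"] conjI ballI allI impI)
  fix f e assume f: "f \<in> C0_K (cball (0::'a) R)" and e: "\<forall>x. \<bar>f x\<bar> <= e"
  have "\<bar>\<mu> f\<bar> <= C * sup_norm f" by (rule C[THEN bspec, OF f])
  also have "... <= max C 0 * sup_norm f" by (rule mult_right_mono[OF _ C0_KD(3)[OF f compact_cball]]) simp
  also have "... <= max C 0 * e" using sup_norm_least[of f e] e by (intro mult_left_mono) auto
  finally show "\<bar>\<mu> f\<bar> <= max C 0 * e" .
 qed simp
qed

lemma C0_K_diff: "f \<in> C0_K K ==> g \<in> C0_K K ==> (\<lambda>x. f x - g x) \<in> C0_K K" for f g :: "'a => real"
 by (auto simp: C0_K_def intro!: continuous_intros)

text \<open>For f of class \<beta> the composition with an \<alpha>-Hoelder trajectory is \<alpha> *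
  \<beta>-Hoelder in time, uniformly in the starting point; this is exactly the time regularity in
  the solution class.\<close>

lemma pushed_dist_class:
 assumes \<mu>: "Mloc \<mu>" shows "dist_class T \<alpha> \<beta> (pushed \<mu>)"
 unfolding dist_class_def
proof (intro conjI ballI allI impI)
 note lin = MlocD(1)[OF \<mu>]
 define E where "E = exp (Hf * T powr \<alpha>)"
 have E: "0 <= E" by (simp add: E_def)
 fix t assume t: "t \<in> I"
 show "linear_on_Cc (pushed \<mu> t)"
  unfolding linear_on_Cc_def
 proof (intro ballI allI)
  fix f g :: "'a => real" and a b :: real assume fg: "f \<in> C0_c" "g \<in> C0_c"
  have p: "(\<lambda>x. k (\<Phi> 0 t x) * exp (Z 0 t x)) \<in> C0_c" if "k \<in> C0_c" for k
   using that pulled_C0(2)[OF t] unfolding C0_c_iff by blast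
  have "\<mu> (\<lambda>x. a * (f (\<Phi> 0 t x) * exp (Z 0 t x)) + b * (g (\<Phi> 0 t x) * exp (Z 0 t x))) =
   a * \<mu> (\<lambda>x. f (\<Phi> 0 t x) * exp (Z 0 t x)) + b * \<mu> (\<lambda>x. g (\<Phi> 0 t x) * exp (Z 0 t x))"
   by (rule lin[unfolded linear_on_Cc_def, THEN bspec, OF p[OF fg(1)], THEN bspec, OF p[OF fg(2)], THEN spec, THEN spec])
  moreover have "(\<lambda>x. a * (f (\<Phi> 0 t x) * exp (Z 0 t x)) + b * (g (\<Phi> 0 t x) * exp (Z 0 t x)))
   = (\<lambda>x. (a * f (\<Phi> 0 t x) + b * g (\<Phi> 0 t x)) * exp (Z 0 t x))"
   by (simp add: fun_eq_iff algebra_simps)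
  ultimately show "pushed \<mu> t (\<lambda>x. a * f x + b * g x) = a * pushed \<mu> t f + b * pushed \<mu> t g"
   by (simp add: pushed_def)
 qed
next
 define E where "E = exp (Hf * T powr \<alpha>)"
 fix K :: "'a set" assume K: "compact K"
 obtain R where R: "K \<subseteq> cball 0 R" using compact_imp_subset_cball[OF K] by blast
 obtain B where B: "0 <= B" "\<forall>f\<in>C0_K (cball 0 (Rflow R)). \<forall>e. (\<forall>x. \<bar>f x\<bar> <= e) --> \<bar>\<mu> f\<bar> <= B * e"
  using MlocD(2)[OF \<mu>] by blast
 show "\<exists>C. \<forall>t\<in>I. \<forall>f\<in>C0_K K. \<bar>pushed \<mu> t f\<bar> <= C * sup_norm f"
 proof (intro exI[of _ "B * E"] ballI)
  fix t f assume t: "t \<in> I" and f: "f \<in> C0_K K"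
  have fc: "continuous_on UNIV f" "\<And>x. x \<notin> cball 0 R ==> f x = 0" using f R by (auto simp: C0_K_def)
  have "\<bar>f (\<Phi> 0 t x) * exp (Z 0 t x)\<bar> <= sup_norm f * E" for x
   unfolding abs_mult using C0_KD(2,3)[OF f K] exp_Z_bound(2)[OF zero_I t] by (intro mult_mono) (auto simp: E_def)
  then have "\<bar>pushed \<mu> t f\<bar> <= B * (sup_norm f * E)"
   unfolding pushed_def using B(2)[THEN bspec, OF pulled_C0(1)[OF t fc]] by simp
  then show "\<bar>pushed \<mu> t f\<bar> <= B * E * sup_norm f" by (simp add: mult_ac)
 qed
next
 define E where "E = exp (Hf * T powr \<alpha>)"
 have E: "1 <= E" using Hf by (simp add: E_def)
 fix K :: "'a set" assume K: "compact K"
 obtain R where R: "K \<subseteq> cball 0 R" using compact_imp_subset_cball[OF K] by blast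
 obtain B where B: "0 <= B" "\<forall>f\<in>C0_K (cball 0 (Rflow R)). \<forall>e. (\<forall>x. \<bar>f x\<bar> <= e) --> \<bar>\<mu> f\<bar> <= B * e"
  using MlocD(2)[OF \<mu>] by blast
 define M where "M = Hf powr \<beta> * E + E * Hf * T powr (\<alpha> - \<alpha> * \<beta>)"
 show "\<exists>C. \<forall>s\<in>I. \<forall>t\<in>I. \<forall>f\<in>Cbeta_K \<beta> K. \<bar>pushed \<mu> t f - pushed \<mu> s f\<bar> <= C * \<bar>t - s\<bar> powr (\<alpha> * \<beta>) * holder_norm \<beta> f"
 proof (intro exI[of _ "B * M"] ballI)
  fix s t f assume s: "s \<in> I" and t: "t \<in> I" and f: "f \<in> Cbeta_K \<beta> K"
  note fK = Cbeta_KD[OF f K \<beta>(1)]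
  have fc: "continuous_on UNIV f" "\<And>x. x \<notin> cball 0 R ==> f x = 0" using fK(1) R by (auto simp: C0_K_def)
  define \<rho> where "\<rho> = \<bar>t - s\<bar>"
  have \<rho>: "0 <= \<rho>" "\<rho> <= T" using s t by (auto simp: \<rho>_def)
  define h where "h = holder_norm \<beta> f"
  have h: "0 <= h" by (simp add: h_def fK)
  have "\<bar>f (\<Phi> 0 t x) * exp (Z 0 t x) - f (\<Phi> 0 s x) * exp (Z 0 s x)\<bar> <= h * M * \<rho> powr (\<alpha> * \<beta>)" for x
  proof -
   have 1: "\<bar>f (\<Phi> 0 t x) - f (\<Phi> 0 s x)\<bar> <= h * (Hf powr \<beta> * \<rho> powr (\<alpha> * \<beta>))"
   proof -
    have "norm (\<Phi> 0 t x - \<Phi> 0 s x) powr \<beta> <= (Hf * \<rho> powr \<alpha>) powr \<beta>"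
     using flow_holder(1)[OF zero_I s t, of x] \<beta> by (intro powr_mono2) (auto simp: \<rho>_def)
    also have "... = Hf powr \<beta> * \<rho> powr (\<alpha> * \<beta>)" using Hf by (simp add: powr_mult powr_powr)
    finally have "h * norm (\<Phi> 0 t x - \<Phi> 0 s x) powr \<beta> <= h * (Hf powr \<beta> * \<rho> powr (\<alpha> * \<beta>))" using h by (intro mult_left_mono)
    then show ?thesis using fK(3)[of "\<Phi> 0 t x" "\<Phi> 0 s x"] by (simp add: h_def)
   qed
   have 2: "\<bar>exp (Z 0 t x) - exp (Z 0 s x)\<bar> <= E * (Hf * (T powr (\<alpha> - \<alpha> * \<beta>) * \<rho> powr (\<alpha> * \<beta>)))"
   proof -
    have "Z 0 t x <= Hf * T powr \<alpha>" "Z 0 s x <= Hf * T powr \<alpha>"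
     using exp_Z_bound(1)[OF zero_I t, of x] exp_Z_bound(1)[OF zero_I s, of x] by auto
    then have "\<bar>exp (Z 0 t x) - exp (Z 0 s x)\<bar> <= E * \<bar>Z 0 t x - Z 0 s x\<bar>" unfolding E_def by (rule exp_diff_bound)
    also have "... <= E * (Hf * \<rho> powr \<alpha>)" using flow_holder(2)[OF zero_I s t, of x] E by (intro mult_left_mono) (auto simp: \<rho>_def)
    also have "... <= E * (Hf * (T powr (\<alpha> - \<alpha> * \<beta>) * \<rho> powr (\<alpha> * \<beta>)))"
    proof -
     have "\<alpha> * \<beta> <= \<alpha> * 1" using \<alpha> \<beta> by (intro mult_left_mono) auto
     then show ?thesis using powr_le_powr_lower[OF \<rho>, of "\<alpha> * \<beta>" \<alpha>] E Hf by (intro mult_left_mono) auto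
    qed
    finally show ?thesis .
   qed
   have eq: "f (\<Phi> 0 t x) * exp (Z 0 t x) - f (\<Phi> 0 s x) * exp (Z 0 s x)
    = (f (\<Phi> 0 t x) - f (\<Phi> 0 s x)) * exp (Z 0 t x) + f (\<Phi> 0 s x) * (exp (Z 0 t x) - exp (Z 0 s x))"
    by (simp add: algebra_simps)
   have "\<bar>f (\<Phi> 0 t x) * exp (Z 0 t x) - f (\<Phi> 0 s x) * exp (Z 0 s x)\<bar> <= \<bar>f (\<Phi> 0 t x) - f (\<Phi> 0 s x)\<bar> * \<bar>exp (Z 0 t x)\<bar> + \<bar>f (\<Phi> 0 s x)\<bar> * \<bar>exp (Z 0 t x) - exp (Z 0 s x)\<bar>"
    unfolding eq abs_mult[symmetric] by (rule abs_triangle_ineq)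
   also have "... <= (h * (Hf powr \<beta> * \<rho> powr (\<alpha> * \<beta>))) * E + h * (E * (Hf * (T powr (\<alpha> - \<alpha> * \<beta>) * \<rho> powr (\<alpha> * \<beta>))))"
   proof -
    have 3: "\<bar>exp (Z 0 t x)\<bar> <= E" using exp_Z_bound(2)[OF zero_I t, of x] by (simp add: E_def)
    have 4: "\<bar>f (\<Phi> 0 s x)\<bar> <= h" using fK(2)[of "\<Phi> 0 s x"] by (simp add: h_def)
    show ?thesis
     by (rule add_mono[OF mult_mono[OF 1 3] mult_mono[OF 4 2]])
      (use h in \<open>auto intro!: mult_nonneg_nonneg\<close>)
   qed
   also have "... = h * M * \<rho> powr (\<alpha> * \<beta>)" by (simp add: M_def algebra_simps)
   finally show ?thesis .
  qed
  moreover have "pushed \<mu> t f - pushed \<mu> s f = \<mu> (\<lambda>x. f (\<Phi> 0 t x) * exp (Z 0 t x) - f (\<Phi> 0 s x) * exp (Z 0 s x))"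
   unfolding pushed_def by (rule linear_on_Cc_comb(1)[OF MlocD(1)[OF \<mu>] pulled_C0(2)[OF t fc] pulled_C0(2)[OF s fc], symmetric])
  ultimately have "\<bar>pushed \<mu> t f - pushed \<mu> s f\<bar> <= B * (h * M * \<rho> powr (\<alpha> * \<beta>))"
   using B(2)[THEN bspec, OF C0_K_diff[OF pulled_C0(1)[OF t fc] pulled_C0(1)[OF s fc]]] by simp
  then show "\<bar>pushed \<mu> t f - pushed \<mu> s f\<bar> <= B * M * \<bar>t - s\<bar> powr (\<alpha> * \<beta>) * holder_norm \<beta> f"
   by (simp add: \<rho>_def h_def mult_ac)
 qed
qed

text \<open>Chain rule to first order in the time step. Second order terms in flow and exponent have
  order 2 * \<alpha>, the Davie remainders have order \<theta>. The bound is uniform in y and can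
  therefore be applied under any Radon measure.\<close>

lemma pulled_expansion:
 assumes st: "s \<in> I" "t \<in> I" and \<phi>: "tame R Q \<phi> G"
 shows "\<bar>\<phi> (\<Phi> s t y) * exp (Z s t y) - \<phi> y - wkc s t \<phi> G y\<bar> <=
  (Hf ^ 2 * (exp (Hf * T powr \<alpha>) + 1) * T powr (2 * \<alpha> - \<theta>) + Mf * 2 + Hf ^ 2 * exp (Hf * T powr \<alpha>) * T powr (2 * \<alpha> - \<theta>)) * Q * \<bar>t - s\<bar> powr \<theta>"
proof -
 define \<rho> where "\<rho> = \<bar>t - s\<bar>"
 have \<rho>: "0 <= \<rho>" "\<rho> <= T" using st by (auto simp: \<rho>_def)
 define E where "E = exp (Hf * T powr \<alpha>)"
 have E: "1 <= E" using Hf by (simp add: E_def)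
 define P where "P = T powr (2 * \<alpha> - \<theta>)"
 have P: "0 <= P" by (simp add: P_def)
 have Q0: "0 <= Q" by (rule tameD(7)[OF \<phi>])
 define y' where "y' = \<Phi> s t y"
 define z where "z = Z s t y"
 have r2: "\<rho> powr \<alpha> * \<rho> powr \<alpha> <= P * \<rho> powr \<theta>" using powr_2\<alpha> \<rho> by (simp add: P_def)
 have yy: "norm (y' - y) <= Hf * \<rho> powr \<alpha>" using flow_holder(1)[OF st(1,1,2), of y] st by (simp add: y'_def \<rho>_def)
 have zb: "\<bar>z\<bar> <= Hf * \<rho> powr \<alpha>" using flow_holder(2)[OF st(1,1,2), of y] st by (simp add: z_def \<rho>_def)
 have ya: "norm (y' - y - dA s t y) <= Mf * \<rho> powr \<theta>" using flow_davie(1)[OF st(1,1,2), of y] st by (simp add: y'_def \<rho>_def)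
 have zc: "\<bar>z - dc s t y\<bar> <= Mf * \<rho> powr \<theta>" using flow_davie(2)[OF st(1,1,2), of y] st by (simp add: z_def \<rho>_def)
 have zT: "\<bar>z\<bar> <= Hf * T powr \<alpha>" using exp_Z_bound(1)[OF st] by (simp add: z_def)
 have sq: "(Hf * \<rho> powr \<alpha>) * (Hf * \<rho> powr \<alpha>) <= Hf ^ 2 * (P * \<rho> powr \<theta>)"
  using mult_left_mono[OF r2, of "Hf ^ 2"] by (simp add: power2_eq_square mult_ac)
 have 1: "\<bar>\<phi> y' - \<phi> y - G y \<bullet> (y' - y)\<bar> <= Q * (Hf ^ 2 * (P * \<rho> powr \<theta>))"
 proof -
  have "norm (y' - y) * norm (y' - y) <= (Hf * \<rho> powr \<alpha>) * (Hf * \<rho> powr \<alpha>)" using yy Hf by (intro mult_mono) auto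
  then have "Q * (norm (y' - y) * norm (y' - y)) <= Q * (Hf ^ 2 * (P * \<rho> powr \<theta>))" using sq Q0 by (intro mult_left_mono) auto
  then show ?thesis using tame_taylor[OF \<phi>, of y' y] by linarith
 qed
 have 2: "\<bar>G y \<bullet> (y' - y - dA s t y)\<bar> <= Q * (Mf * \<rho> powr \<theta>)"
  by (rule order_trans[OF Cauchy_Schwarz_ineq2 mult_mono[OF tameD(5)[OF \<phi>] ya Q0]]) simp
 have 3: "\<bar>(\<phi> y' - \<phi> y) * (exp z - 1)\<bar> <= (Q * E) * (Hf ^ 2 * (P * \<rho> powr \<theta>))"
 proof -
  have "\<bar>exp z - exp 0\<bar> <= E * \<bar>z - 0\<bar>" unfolding E_def using zT Hf by (intro exp_diff_bound) auto
  then have "\<bar>exp z - 1\<bar> <= E * \<bar>z\<bar>" by simp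
  also have "... <= E * (Hf * \<rho> powr \<alpha>)" using zb E by (intro mult_left_mono) auto
  finally have "\<bar>exp z - 1\<bar> <= E * (Hf * \<rho> powr \<alpha>)" .
  moreover have "\<bar>\<phi> y' - \<phi> y\<bar> <= Q * (Hf * \<rho> powr \<alpha>)" using tameD(8)[OF \<phi>, of y' y] mult_left_mono[OF yy Q0] by linarith
  ultimately have "\<bar>(\<phi> y' - \<phi> y) * (exp z - 1)\<bar> <= (Q * (Hf * \<rho> powr \<alpha>)) * (E * (Hf * \<rho> powr \<alpha>))"
   unfolding abs_mult using Q0 Hf by (intro mult_mono) auto
  also have "... = (Q * E) * ((Hf * \<rho> powr \<alpha>) * (Hf * \<rho> powr \<alpha>))" by (simp add: mult_ac)
  also have "... <= (Q * E) * (Hf ^ 2 * (P * \<rho> powr \<theta>))" using sq Q0 E by (intro mult_left_mono) auto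
  finally show ?thesis .
 qed
 have 4: "\<bar>\<phi> y * (exp z - 1 - z)\<bar> <= Q * ((Hf ^ 2 * (P * \<rho> powr \<theta>)) * E)"
 proof -
  have "z ^ 2 <= (Hf * \<rho> powr \<alpha>) ^ 2" using power_mono[OF zb, of 2] by simp
  also have "... <= Hf ^ 2 * (P * \<rho> powr \<theta>)" using sq by (simp add: power2_eq_square)
  finally have "z ^ 2 * exp \<bar>z\<bar> <= (Hf ^ 2 * (P * \<rho> powr \<theta>)) * E" using zT P by (intro mult_mono) (auto simp: E_def)
  then have "\<bar>exp z - 1 - z\<bar> <= (Hf ^ 2 * (P * \<rho> powr \<theta>)) * E" using exp_remainder[of z] by linarith
  then show ?thesis unfolding abs_mult using tameD(4)[OF \<phi>, of y] Q0 by (intro mult_mono) auto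
 qed
 have 5: "\<bar>\<phi> y * (z - dc s t y)\<bar> <= Q * (Mf * \<rho> powr \<theta>)"
  unfolding abs_mult using tameD(4)[OF \<phi>, of y] zc Q0 by (intro mult_mono) auto
 have eq: "\<phi> y' * exp z - \<phi> y - wkc s t \<phi> G y = (\<phi> y' - \<phi> y - G y \<bullet> (y' - y)) + G y \<bullet> (y' - y - dA s t y)
  + (\<phi> y' - \<phi> y) * (exp z - 1) + \<phi> y * (exp z - 1 - z) + \<phi> y * (z - dc s t y)"
  by (simp add: wkc_def inner_diff_right algebra_simps)
 have "\<bar>\<phi> y' * exp z - \<phi> y - wkc s t \<phi> G y\<bar> <= Q * (Hf ^ 2 * (P * \<rho> powr \<theta>)) + Q * (Mf * \<rho> powr \<theta>) + (Q * E) * (Hf ^ 2 * (P * \<rho> powr \<theta>))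
  + Q * ((Hf ^ 2 * (P * \<rho> powr \<theta>)) * E) + Q * (Mf * \<rho> powr \<theta>)"
  unfolding eq by (intro order_trans[OF abs_triangle_ineq] add_mono 1 2 3 4 5)
 also have "... = (Hf ^ 2 * (E + 1) * P + Mf * 2 + Hf ^ 2 * E * P) * Q * \<rho> powr \<theta>" by (simp add: algebra_simps)
 finally show ?thesis by (simp add: y'_def z_def E_def P_def \<rho>_def)
qed

text \<open>By the cocycle identities the step from a to b starts at the point \<Phi> 0 a x, so
  \<open>pulled_expansion\<close> applies there, weighted with exp (Z 0 a x).\<close>

lemma pushed_weak_sol:
 assumes \<mu>: "Mloc \<mu>" shows "weak_sol_continuity T \<alpha> \<beta> A c (pushed \<mu>)"
 unfolding weak_sol_continuity_eq
proof (intro conjI ballI)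
 show "dist_class T \<alpha> \<beta> (pushed \<mu>)" by (rule pushed_dist_class[OF \<mu>])
 fix \<phi> :: "'a => real" and t assume "\<phi> \<in> Cinf_c" and t: "t \<in> I"
 then obtain R Q G where \<phi>: "tame R Q \<phi> G" using Cinf_c_tame by blast
 define E where "E = exp (Hf * T powr \<alpha>)"
 define K where "K = (Hf ^ 2 * (E + 1) * T powr (2 * \<alpha> - \<theta>) + Mf * 2 + Hf ^ 2 * E * T powr (2 * \<alpha> - \<theta>)) * Q"
 have K0: "0 <= K" using Mf tameD(7)[OF \<phi>] by (simp add: K_def E_def)
 obtain B where B: "0 <= B" "\<forall>f\<in>C0_K (cball 0 (Rflow R)). \<forall>e. (\<forall>x. \<bar>f x\<bar> <= e) --> \<bar>\<mu> f\<bar> <= B * e"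
  using MlocD(2)[OF \<mu>] by blast
 show "riemann_lim (\<lambda>ts. \<Sum>i < length ts - 1.
      pushed \<mu> (ts ! i) (\<lambda>x. frechet_derivative \<phi> (at x) (A (ts ! Suc i) x - A (ts ! i) x) +
      ((divergence A (ts ! Suc i) x - divergence A (ts ! i) x) -
  ((divergence A (ts ! Suc i) x - c (ts ! Suc i) x) - (divergence A (ts ! i) x - c (ts ! i) x))) * \<phi> x))
     0 t (pushed \<mu> t \<phi> - pushed \<mu> 0 \<phi>)"
 proof (rule riemann_lim_of_expansion[OF _ \<theta>1, where M = "B * (K * E)"])
  fix a b assume ab: "0 <= a" "a < b" "b <= t"
  then have I: "a \<in> I" "b \<in> I" using t by auto
  define k where "k x = \<phi> (\<Phi> 0 b x) * exp (Z 0 b x)" for x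
  define l where "l x = \<phi> (\<Phi> 0 a x) * exp (Z 0 a x)" for x
  define m where "m x = wkc a b \<phi> G (\<Phi> 0 a x) * exp (Z 0 a x)" for x
  note kC = pulled_C0[OF I(2) tameD(9,2)[OF \<phi>], folded k_def[abs_def]]
  note lC = pulled_C0[OF I(1) tameD(9,2)[OF \<phi>], folded l_def[abs_def]]
  note mC = pulled_C0[OF I(1) wkc_props(4,3)[OF I \<phi>], folded m_def[abs_def]]
  have "pushed \<mu> b \<phi> - pushed \<mu> a \<phi> - pushed \<mu> a (wkc a b \<phi> G) = \<mu> k - \<mu> l - \<mu> m"
   by (simp add: pushed_def k_def[abs_def] l_def[abs_def] m_def[abs_def])
  also have "... = \<mu> (\<lambda>x. k x - l x - m x)"
   using linear_on_Cc_comb(1)[OF MlocD(1)[OF \<mu>] kC(2) lC(2)]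
    linear_on_Cc_comb(1)[OF MlocD(1)[OF \<mu>] C0_c_diff[OF kC(2) lC(2)] mC(2)] by simp
  finally have eq: "pushed \<mu> b \<phi> - pushed \<mu> a \<phi> - pushed \<mu> a (wkc a b \<phi> G) = \<mu> (\<lambda>x. k x - l x - m x)" .
  have "\<bar>\<mu> (\<lambda>x. k x - l x - m x)\<bar> <= B * (K * \<bar>b - a\<bar> powr \<theta> * E)"
  proof -
   have "\<bar>k x - l x - m x\<bar> <= K * \<bar>b - a\<bar> powr \<theta> * E" for x
   proof -
    let ?y = "\<Phi> 0 a x"
    have eq: "k x - l x - m x = (\<phi> (\<Phi> a b ?y) * exp (Z a b ?y) - \<phi> ?y - wkc a b \<phi> G ?y) * exp (Z 0 a x)"
     using cocycle[OF zero_I I, of x, symmetric]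
     by (simp add: k_def l_def m_def exp_add algebra_simps)
    show ?thesis
     unfolding eq abs_mult
    proof (rule mult_mono)
     show "\<bar>\<phi> (\<Phi> a b ?y) * exp (Z a b ?y) - \<phi> ?y - wkc a b \<phi> G ?y\<bar> <= K * \<bar>b - a\<bar> powr \<theta>"
      using pulled_expansion[OF I \<phi>, of ?y] by (simp add: K_def E_def)
     show "\<bar>exp (Z 0 a x)\<bar> <= E" using exp_Z_bound(2)[OF zero_I I(1), of x] by (simp add: E_def)
    qed (use K0 in auto)
   qed
   then show ?thesis using B(2)[THEN bspec, OF C0_K_diff[OF C0_K_diff[OF kC(1) lC(1)] mC(1)]] by blast
  qed
  then show "norm (pushed \<mu> b \<phi> - pushed \<mu> a \<phi> -
    pushed \<mu> a (\<lambda>x. frechet_derivative \<phi> (at x) (A b x - A a x) +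
      ((divergence A b x - divergence A a x) -
  ((divergence A b x - c b x) - (divergence A a x - c a x))) * \<phi> x)) <= B * (K * E) * (b - a) powr \<theta>"
   unfolding wkc_eq[OF I \<phi>] eq using ab by (simp add: mult_ac)
 qed (use t in auto)
qed

end

section \<open>Mollification and the commutator\<close>

subsection \<open>Smooth kernels and mollification\<close>

text \<open>A polynomial in 1 / s times exp (- 1 / s), extended by 0: a family that contains the
  standard flat function and is closed under differentiation.\<close>

definition flat :: "real poly => real => real" where
 "flat p s = (if 0 < s then poly p (1 / s) * exp (- (1 / s)) else 0)"

lemma poly_exp_tendsto_0: "((\<lambda>x. poly p x * exp (- x)) \<longlongrightarrow> 0) at_top" for p :: "real poly"
proof -
 have "((\<lambda>x. \<Sum>i\<le>degree p. coeff p i * (x ^ i / exp x)) \<longlongrightarrow> (\<Sum>i\<le>degree p. coeff p i * 0)) at_top"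
  by (intro tendsto_intros tendsto_power_div_exp_0)
 moreover have "(\<lambda>x. \<Sum>i\<le>degree p. coeff p i * (x ^ i / exp x)) = (\<lambda>x. poly p x * exp (- x))"
  by (simp add: poly_altdef sum_distrib_right exp_minus divide_inverse mult.assoc fun_eq_iff)
 ultimately show ?thesis by simp
qed

text \<open>Differentiation multiplies p - p' by the square of the variable 1 / s. At 0 the quotient
  of \<open>flat p h\<close> by h has the same form for h > 0, so it vanishes in the limit.\<close>

lemma flat_deriv: "(flat p has_real_derivative flat ([:0, 0, 1:] * (p - pderiv p)) s) (at s)"
proof -
 consider "0 < s" | "s < 0" | "s = 0" by linarith
 then show ?thesis
 proof cases
  case 1
  have "((\<lambda>s. poly p (1 / s) * exp (- (1 / s))) has_real_derivative
    (1 / s) ^ 2 * (poly p (1 / s) - poly (pderiv p) (1 / s)) * exp (- (1 / s))) (at s)"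
   using 1 by (auto intro!: derivative_eq_intros poly_DERIV[THEN DERIV_chain2] simp: power2_eq_square field_simps)
  then have "(flat p has_real_derivative (1 / s) ^ 2 * (poly p (1 / s) - poly (pderiv p) (1 / s)) * exp (- (1 / s))) (at s)"
   by (rule has_field_derivative_transform_within_open[of _ _ _ "{0<..}"]) (use 1 in \<open>auto simp: flat_def\<close>)
  then show ?thesis using 1 by (simp add: flat_def power2_eq_square mult_ac)
 next
  case 2
  have "((\<lambda>s. 0) has_real_derivative 0) (at s)" by simp
  then have "(flat p has_real_derivative 0) (at s)"
   by (rule has_field_derivative_transform_within_open[of _ _ _ "{..<0}"]) (use 2 in \<open>auto simp: flat_def\<close>)
  then show ?thesis using 2 by (simp add: flat_def)
 next
  case 3
  have "((\<lambda>h. flat p h / h) \<longlongrightarrow> 0) (at_right 0)"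
  proof -
   have "((\<lambda>h. poly ([:0, 1:] * p) (inverse h) * exp (- inverse h)) \<longlongrightarrow> 0) (at_right 0)"
    by (rule filterlim_compose[OF poly_exp_tendsto_0 filterlim_inverse_at_top_right])
   then show ?thesis
    by (rule Lim_transform_eventually)
     (auto simp: eventually_at_filter flat_def field_simps inverse_eq_divide intro!: always_eventually)
  qed
  moreover have "((\<lambda>h. flat p h / h) \<longlongrightarrow> 0) (at_left 0)"
   by (rule Lim_transform_eventually[OF tendsto_const]) (auto simp: eventually_at_filter flat_def)
  ultimately have "((\<lambda>h. flat p h / h) \<longlongrightarrow> 0) (at 0)" by (simp add: filterlim_split_at)
  then have "(flat p has_real_derivative 0) (at 0)" by (simp add: DERIV_def flat_def)
  then show ?thesis using 3 by (simp add: flat_def)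
 qed
qed

text \<open>\<open>smooth\<close> is coinductive, so proving it needs a set of functions stable
  under directional derivatives. Differentiating a radial bump produces inner products with the
  direction, whence the closure rules.\<close>

inductive bumpy :: "('a::euclidean_space => real) => bool" where
 flat: "bumpy (\<lambda>x. flat p (1 - k * (x \<bullet> x)))"
| inner: "bumpy f ==> bumpy (\<lambda>x. (x \<bullet> v) * f x)"
| add: "bumpy f ==> bumpy g ==> bumpy (\<lambda>x. f x + g x)"
| scale: "bumpy f ==> bumpy (\<lambda>x. r * f x)"

lemma bumpy_deriv:
 "bumpy f ==> \<exists>Df. (\<forall>x. (f has_derivative Df x) (at x)) \<and> (\<forall>v. bumpy (\<lambda>x. Df x v))"
proof (induction rule: bumpy.induct)
 case (flat p k)
 let ?p = "[:0, 0, 1:] * (p - pderiv p)"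
 have "((\<lambda>x. flat p (1 - k * (x \<bullet> x))) has_derivative (\<lambda>v. (- 2 * k) * ((x \<bullet> v) * flat ?p (1 - k * (x \<bullet> x))))) (at x)" for x :: 'a
 proof -
  have g: "((\<lambda>x. 1 - k * (x \<bullet> x)) has_derivative (\<lambda>v. - (k * (2 * (x \<bullet> v))))) (at x)"
   by (auto intro!: derivative_eq_intros simp: inner_commute)
  have f: "(flat p has_derivative (*) (flat ?p (1 - k * (x \<bullet> x)))) (at (1 - k * (x \<bullet> x)))"
   using flat_deriv by (simp add: has_field_derivative_def)
  show ?thesis by (rule has_derivative_eq_rhs[OF has_derivative_compose[OF g f]]) (simp add: fun_eq_iff)
 qed
 moreover have "bumpy (\<lambda>x. (- 2 * k) * ((x \<bullet> v) * flat ?p (1 - k * (x \<bullet> x))))" for v :: 'a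
  by (intro bumpy.scale bumpy.inner bumpy.flat)
 ultimately show ?case by (intro exI[of _ "\<lambda>x v. (- 2 * k) * ((x \<bullet> v) * flat ?p (1 - k * (x \<bullet> x)))"]) blast
next
 case (inner f w)
 then obtain D where D: "\<And>x. (f has_derivative D x) (at x)" "\<And>v. bumpy (\<lambda>x. D x v)" by blast
 have "((\<lambda>x. (x \<bullet> w) * f x) has_derivative (\<lambda>v. (x \<bullet> w) * D x v + (v \<bullet> w) * f x)) (at x)" for x
  by (intro has_derivative_mult has_derivative_inner_left has_derivative_ident D)
 moreover have "bumpy (\<lambda>x. (x \<bullet> w) * D x v + (v \<bullet> w) * f x)" for v
  by (intro bumpy.add bumpy.inner bumpy.scale D inner)
 ultimately show ?case by (intro exI[of _ "\<lambda>x v. (x \<bullet> w) * D x v + (v \<bullet> w) * f x"]) blast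
next
 case (add f g)
 then obtain D E where D: "\<And>x. (f has_derivative D x) (at x)" "\<And>v. bumpy (\<lambda>x. D x v)"
  and E: "\<And>x. (g has_derivative E x) (at x)" "\<And>v. bumpy (\<lambda>x. E x v)" by blast
 show ?case
  by (intro exI[of _ "\<lambda>x v. D x v + E x v"] conjI allI has_derivative_add bumpy.add D E)
next
 case (scale f r)
 then obtain D where D: "\<And>x. (f has_derivative D x) (at x)" "\<And>v. bumpy (\<lambda>x. D x v)" by blast
 show ?case
  by (intro exI[of _ "\<lambda>x v. r * D x v"] conjI allI has_derivative_mult_right bumpy.scale D)
qed

lemma bumpy_smooth: "bumpy f ==> smooth f"
proof (coinduction arbitrary: f rule: smooth.coinduct)
 case (smooth f)
 then obtain D where D: "\<forall>x. (f has_derivative D x) (at x)" "\<forall>v. bumpy (\<lambda>x. D x v)" using bumpy_deriv by blast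
 have "continuous_on UNIV f" using D(1) by (meson continuous_at_imp_continuous_on has_derivative_continuous)
 then show ?case using D by blast
qed

text \<open>Coinduction over the functions z \<mapsto> k * h (x - z) with h smooth; the scalar is
  carried because each derivative changes the sign.\<close>

lemma smooth_compose_reflect:
 fixes f :: "'a::euclidean_space => real"
 assumes "smooth f" shows "smooth (\<lambda>z. r * f (x - z))"
proof -
 have "\<exists>h k. g = (\<lambda>z. k * h (x - z)) \<and> smooth h ==> smooth g" for g :: "'a => real"
 proof (coinduction arbitrary: g rule: smooth.coinduct)
  case (smooth g)
  then obtain h k where g: "g = (\<lambda>z. k * h (x - z))" and h: "smooth h" by blast
  obtain D where D: "continuous_on UNIV h" "\<And>x. (h has_derivative D x) (at x)" "\<And>v. smooth (\<lambda>x. D x v)"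
   using smoothE[OF h] by metis
  have d: "(g has_derivative (\<lambda>v. (- k) * D (x - z) v)) (at z)" for z
  proof -
   have 1: "((\<lambda>z. x - z) has_derivative (\<lambda>v. - v)) (at z)" by (auto intro!: derivative_eq_intros)
   have "linear (D (x - z))" by (rule has_derivative_linear[OF D(2)])
   then have "(\<lambda>v. k * D (x - z) (- v)) = (\<lambda>v. (- k) * D (x - z) v)"
    by (simp add: linear_neg fun_eq_iff)
   then show ?thesis unfolding g using has_derivative_mult_right[OF has_derivative_compose[OF 1 D(2)], of k] by simp
  qed
  have "continuous_on UNIV g" using d by (meson continuous_at_imp_continuous_on has_derivative_continuous)
  moreover have "\<exists>h' k'. (\<lambda>z. (- k) * D (x - z) v) = (\<lambda>z. k' * h' (x - z)) \<and> smooth h'" for v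
   using D(3) by (intro exI[of _ "\<lambda>y. D y v"] exI[of _ "- k"]) simp
  ultimately show ?case using d by (intro exI[of _ g] conjI refl exI[of _ "\<lambda>z v. (- k) * D (x - z) v"]) blast+
 qed
 then show ?thesis using assms by blast
qed

lemma Cinf_c_iff: "\<phi> \<in> Cinf_c \<longleftrightarrow> smooth \<phi> \<and> (\<exists>R. \<forall>x. x \<notin> cball 0 R --> \<phi> x = 0)" for \<phi> :: "'a::euclidean_space => real"
proof
 assume "\<phi> \<in> Cinf_c"
 then obtain K where K: "smooth \<phi>" "compact K" "\<forall>x. x \<notin> K --> \<phi> x = 0" unfolding Cinf_c_def by blast
 obtain R where "K \<subseteq> cball 0 R" using compact_imp_subset_cball[OF K(2)] by blast
 then show "smooth \<phi> \<and> (\<exists>R. \<forall>x. x \<notin> cball 0 R --> \<phi> x = 0)" using K by blast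
next
 assume "smooth \<phi> \<and> (\<exists>R. \<forall>x. x \<notin> cball 0 R --> \<phi> x = 0)"
 then show "\<phi> \<in> Cinf_c" unfolding Cinf_c_def using compact_cball by blast
qed

text \<open>The three bounds on the kernel make \<open>\<rho>\<close> and \<open>\<bar>\<xi>\<bar> * \<bar>G \<xi>\<bar>\<close> integrable uniformly in \<open>\<epsilon>\<close>.\<close>

definition kernel :: "real => real => ('a::euclidean_space => real) => ('a => 'a) => real => bool" where
 "kernel W \<epsilon> \<rho> G Q \<longleftrightarrow> \<rho> \<in> Cinf_c \<and> tame \<epsilon> Q \<rho> G \<and> (\<forall>x. 0 <= \<rho> x) \<and> (LINT x|lborel. \<rho> x) = 1 \<and>
  (\<forall>x. \<rho> x * measure lborel (cball (0::'a) \<epsilon>) <= W) \<and>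
  (\<forall>x. norm (G x) * \<epsilon> * measure lborel (cball (0::'a) \<epsilon>) <= W)"

lemma measure_cball: "0 <= r ==> measure lborel (cball (c::'a::euclidean_space) r) = unit_ball_vol DIM('a) * r ^ DIM('a)"
 by (simp add: measure_def emeasure_cball unit_ball_vol_nonneg)

lemma kernel_exists:
 "\<exists>W\<ge>0. \<forall>\<epsilon>>0. \<exists>(\<rho>::'a::euclidean_space => real) G Q. kernel W \<epsilon> \<rho> G Q"
proof -
 \<comment> \<open>Lower bound of the bump on the ball of half the radius, where its argument is at
   least 3 / 4.\<close>
 define \<kappa> where "\<kappa> = exp (- (4 / 3) :: real)"
 have \<kappa>: "0 < \<kappa>" by (simp add: \<kappa>_def)
 \<comment> \<open>The volumes of the balls of radius \<epsilon> and \<epsilon> / 2 have the ratio 2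
   ^ DIM('a), normalisation contributes 1 / \<kappa>, and the gradient the factor 4. No \<epsilon>
   remains.\<close>
 define W where "W = 4 * 2 ^ DIM('a) / \<kappa>"
 have W0: "0 <= W" using \<kappa> by (simp add: W_def)
 have "\<exists>(\<rho>::'a => real) G Q. kernel W \<epsilon> \<rho> G Q" if \<epsilon>: "0 < \<epsilon>" for \<epsilon>
 proof -
  define b where "b x = flat [:1:] (1 - inverse (\<epsilon> ^ 2) * (x \<bullet> x))" for x :: 'a
  have bb: "bumpy b" unfolding b_def by (rule bumpy.flat)
  have xx: "x \<bullet> x = norm x ^ 2" for x :: 'a by (simp add: power2_norm_eq_inner)
  have b0: "b x = 0" if "x \<notin> cball 0 \<epsilon>" for x
  proof -
   have "\<epsilon> ^ 2 <= norm x ^ 2" using that \<epsilon> by (intro power_mono) auto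
   then have "1 <= inverse (\<epsilon> ^ 2) * (x \<bullet> x)" using \<epsilon> by (simp add: xx field_simps)
   then show ?thesis by (simp add: b_def flat_def)
  qed
  have b1: "0 <= b x" "b x <= 1" for x by (auto simp: b_def flat_def)
  have bk: "\<kappa> <= b x" if "x \<in> cball 0 (\<epsilon> / 2)" for x
  proof -
   have "norm x ^ 2 <= (\<epsilon> / 2) ^ 2" using that by (intro power_mono) auto
   then have "inverse (\<epsilon> ^ 2) * (x \<bullet> x) <= 1 / 4" using \<epsilon> by (simp add: xx field_simps power2_eq_square)
   then have s: "3 / 4 <= 1 - inverse (\<epsilon> ^ 2) * (x \<bullet> x)" by simp
   then have "1 / (1 - inverse (\<epsilon> ^ 2) * (x \<bullet> x)) <= 1 / (3 / 4)" by (intro divide_left_mono) auto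
   then show ?thesis using s by (simp add: b_def flat_def \<kappa>_def)
  qed
  have bs: "smooth b" by (rule bumpy_smooth[OF bb])
  have bc: "continuous_on UNIV b" by (rule smooth_continuous[OF bs])
  have bi: "integrable lborel b" by (rule integrable_compact_support[OF bc b0])
  define Z\<epsilon> where "Z\<epsilon> = (LINT x|lborel. b x)"
  define V where "V = measure lborel (cball (0::'a) (\<epsilon> / 2))"
  have V: "0 < V" using \<epsilon> unit_ball_vol_pos[of "real DIM('a)"] by (simp add: V_def measure_cball)
  have Zl: "\<kappa> * V <= Z\<epsilon>"
  proof -
   have fin: "emeasure lborel (cball (0::'a) (\<epsilon> / 2)) < \<infinity>" using emeasure_bounded_finite[OF bounded_cball] .
   have "\<kappa> * V = (LINT x|lborel. \<kappa> * indicator (cball (0::'a) (\<epsilon> / 2)) x)" by (simp add: V_def)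
   also have "... <= Z\<epsilon>"
    unfolding Z\<epsilon>_def
   proof (rule integral_mono)
    show "integrable lborel (\<lambda>x. \<kappa> * indicator (cball (0::'a) (\<epsilon> / 2)) x)"
     using fin by (intro integrable_mult_right integrable_real_indicator) auto
    show "\<kappa> * indicator (cball 0 (\<epsilon> / 2)) x <= b x" for x using bk[of x] b1[of x] by (auto simp: indicator_def)
   qed (rule bi)
   finally show ?thesis .
  qed
  have Z0: "0 < Z\<epsilon>" using Zl \<kappa> V by (meson mult_pos_pos less_le_trans)
  define \<rho> where "\<rho> x = inverse Z\<epsilon> * b x" for x
  have \<rho>b: "bumpy \<rho>" unfolding \<rho>_def by (rule bumpy.scale[OF bb])
  have \<rho>0: "\<rho> x = 0" if "x \<notin> cball 0 \<epsilon>" for x using b0[OF that] by (simp add: \<rho>_def)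
  have \<rho>C: "\<rho> \<in> Cinf_c" unfolding Cinf_c_iff using bumpy_smooth[OF \<rho>b] \<rho>0 by blast
  obtain R Q G where t: "tame R Q \<rho> G" using Cinf_c_tame[OF \<rho>C] by blast
  have t\<epsilon>: "tame \<epsilon> Q \<rho> G" using t \<rho>0 by (simp add: tame_def)
  have volr: "measure lborel (cball (0::'a) \<epsilon>) = 2 ^ DIM('a) * V"
   using \<epsilon> by (simp add: V_def measure_cball power_divide)
  have iZ: "inverse Z\<epsilon> * (2 ^ DIM('a) * V) <= 2 ^ DIM('a) / \<kappa>"
  proof -
   have "inverse Z\<epsilon> <= inverse (\<kappa> * V)" using Zl \<kappa> V by (intro le_imp_inverse_le) auto
   then have "inverse Z\<epsilon> * (2 ^ DIM('a) * V) <= inverse (\<kappa> * V) * (2 ^ DIM('a) * V)" using V by (intro mult_right_mono) auto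
   then show ?thesis using \<kappa> V by (simp add: field_simps)
  qed
  have "kernel W \<epsilon> \<rho> G Q"
   unfolding kernel_def
  proof (intro conjI allI \<rho>C t\<epsilon>)
   show "0 <= \<rho> x" for x using b1 Z0 by (simp add: \<rho>_def)
   show "(LINT x|lborel. \<rho> x) = 1" using Z0 by (simp add: \<rho>_def Z\<epsilon>_def[symmetric])
   show "\<rho> x * measure lborel (cball (0::'a) \<epsilon>) <= W" for x
   proof -
    have "\<rho> x <= inverse Z\<epsilon>" using b1[of x] Z0 by (simp add: \<rho>_def)
    then have "\<rho> x * (2 ^ DIM('a) * V) <= inverse Z\<epsilon> * (2 ^ DIM('a) * V)" using V by (intro mult_right_mono) auto
    also have "... <= 2 ^ DIM('a) / \<kappa>" by (rule iZ)
    also have "... <= W" using \<kappa> by (simp add: W_def divide_right_mono)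
    finally show ?thesis by (simp add: volr)
   qed
   show "norm (G x) * \<epsilon> * measure lborel (cball (0::'a) \<epsilon>) <= W" for x
   proof (cases "x \<in> cball 0 \<epsilon>")
    case True
    let ?s = "1 - inverse (\<epsilon> ^ 2) * (x \<bullet> x)"
    let ?p = "[:0, 0, 1:] * ([:1:] - pderiv [:1:]) :: real poly"
    have "(\<rho> has_derivative (\<lambda>v. inverse Z\<epsilon> * ((- 2 * inverse (\<epsilon> ^ 2)) * ((x \<bullet> v) * flat ?p ?s)))) (at x)"
    proof -
     have g: "((\<lambda>x. 1 - inverse (\<epsilon> ^ 2) * (x \<bullet> x)) has_derivative (\<lambda>v. - (inverse (\<epsilon> ^ 2) * (2 * (x \<bullet> v))))) (at x)"
      by (auto intro!: derivative_eq_intros simp: inner_commute)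
     have f: "(flat [:1:] has_derivative (*) (flat ?p ?s)) (at ?s)"
      using flat_deriv[of "[:1:]" ?s] unfolding has_field_derivative_def .
     have "(b has_derivative (\<lambda>v. flat ?p ?s * - (inverse (\<epsilon> ^ 2) * (2 * (x \<bullet> v))))) (at x)"
      unfolding b_def[abs_def] by (rule has_derivative_compose[OF g f])
     from has_derivative_mult_right[OF this, of "inverse Z\<epsilon>"]
     show ?thesis unfolding \<rho>_def[abs_def] by (rule has_derivative_eq_rhs) (simp add: fun_eq_iff mult_ac)
    qed
    then have "(\<lambda>h. G x \<bullet> h) = (\<lambda>v. inverse Z\<epsilon> * ((- 2 * inverse (\<epsilon> ^ 2)) * ((x \<bullet> v) * flat ?p ?s)))"
     using has_derivative_unique tameD(1)[OF t\<epsilon>] by blast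
    \<comment> \<open>Testing the identity with the direction \<open>G x\<close> itself turns it
      into a bound for norm (G x).\<close>
    then have Gx: "G x \<bullet> G x = inverse Z\<epsilon> * ((- 2 * inverse (\<epsilon> ^ 2)) * ((x \<bullet> G x) * flat ?p ?s))" by metis
    have fl: "\<bar>flat ?p ?s\<bar> <= 2"
    proof (cases "0 < ?s")
     case True
     define u where "u = 1 / ?s"
     have u: "0 < u" using True by (simp add: u_def)
     \<comment> \<open>The quadratic lower bound for exp gives u * u * exp (- u) <= 2, a bound that
       does not depend on \<epsilon>.\<close>
     have "1 + u + u\<^sup>2 / 2 <= exp u" by (rule exp_lower_Taylor_quadratic) (use u in simp)
     then have "u * u <= 2 * exp u" using u by (simp add: power2_eq_square)
     then have "u * u * exp (- u) <= 2 * exp u * exp (- u)" by (intro mult_right_mono) auto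
     also have "... = 2" by (simp add: exp_minus)
     finally have "u * u * exp (- u) <= 2" .
     moreover have "flat ?p ?s = u * u * exp (- u)" using True by (simp add: flat_def u_def)
     ultimately show ?thesis using u by simp
    qed (simp add: flat_def)
    have "norm (G x) * norm (G x) = \<bar>G x \<bullet> G x\<bar>" by (simp add: dot_square_norm power2_eq_square)
    also have "... = inverse Z\<epsilon> * (2 * inverse (\<epsilon> ^ 2) * (\<bar>x \<bullet> G x\<bar> * \<bar>flat ?p ?s\<bar>))"
     unfolding Gx using Z0 \<epsilon> by (simp add: abs_mult)
    also have "... <= inverse Z\<epsilon> * (2 * inverse (\<epsilon> ^ 2) * ((\<epsilon> * norm (G x)) * 2))"
    proof -
     have "\<bar>x \<bullet> G x\<bar> <= \<epsilon> * norm (G x)"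
      using Cauchy_Schwarz_ineq2[of x "G x"] True mult_right_mono[of "norm x" \<epsilon> "norm (G x)"] by simp
     then have "\<bar>x \<bullet> G x\<bar> * \<bar>flat ?p ?s\<bar> <= (\<epsilon> * norm (G x)) * 2" using fl \<epsilon> by (intro mult_mono) auto
     then show ?thesis using Z0 by (intro mult_left_mono) auto
    qed
    also have "... = (4 * inverse Z\<epsilon> / \<epsilon>) * norm (G x)" using \<epsilon> by (simp add: field_simps power2_eq_square)
    finally have "norm (G x) <= 4 * inverse Z\<epsilon> / \<epsilon>"
     using Z0 \<epsilon> mult_right_le_imp_le[of "norm (G x)" "norm (G x)" "4 * inverse Z\<epsilon> / \<epsilon>"]
     by (cases "G x = 0") auto
    then have "norm (G x) * \<epsilon> <= 4 * inverse Z\<epsilon>" using \<epsilon> mult_right_mono[of "norm (G x)" "4 * inverse Z\<epsilon> / \<epsilon>" \<epsilon>] by simp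
    then have "norm (G x) * \<epsilon> * (2 ^ DIM('a) * V) <= 4 * inverse Z\<epsilon> * (2 ^ DIM('a) * V)" using V by (intro mult_right_mono) auto
    also have "... = 4 * (inverse Z\<epsilon> * (2 ^ DIM('a) * V))" by (simp add: mult_ac)
    also have "... <= 4 * (2 ^ DIM('a) / \<kappa>)" using iZ by (intro mult_left_mono) auto
    finally show ?thesis by (simp add: volr W_def)
   next
    case False
    then show ?thesis using tameD(3)[OF t\<epsilon> False] W0 by simp
   qed
  qed
  then show ?thesis by blast
 qed
 then show ?thesis using W0 by blast
qed

definition moll :: "('a::euclidean_space => real) => ('a => real) => 'a => real" where
 "moll \<rho> w x = (LINT z|lborel. w z * \<rho> (x - z))"

context
 fixes w :: "'a::euclidean_space => real" and B R0 :: real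
 assumes wc: "continuous_on UNIV w" and w0: "\<And>x. x \<notin> cball 0 R0 ==> w x = 0" and wB: "\<And>x. \<bar>w x\<bar> <= B"
begin

lemma moll_integrable:
 assumes "continuous_on UNIV \<rho>" shows "integrable lborel (\<lambda>z. w z * \<rho> (x - z))"
 by (rule integrable_compact_support[of _ R0])
  (use w0 in \<open>auto intro!: continuous_intros wc continuous_on_compose2[OF assms]\<close>)

lemma moll_bound:
 assumes "\<And>x. \<bar>f x\<bar> <= Q" shows "\<bar>LINT z|lborel. w z * f z\<bar> <= B * Q * measure lborel (cball (0::'a) R0)"
proof (rule integral_bound_compact_support)
 show "w z * f z = 0" if "z \<notin> cball 0 R0" for z using w0[OF that] by simp
 have "0 <= B" using wB[of 0] abs_ge_zero order_trans by blast
 then show "\<bar>w z * f z\<bar> <= B * Q" for z unfolding abs_mult using assms wB by (intro mult_mono) auto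
qed

text \<open>The second order Taylor remainder of the kernel is uniform in z, so it can be integrated
  directly, without a limit theorem.\<close>

lemma moll_deriv:
 assumes \<phi>: "tame R Q \<phi> G"
 shows "(moll \<phi> w has_derivative (\<lambda>h. LINT z|lborel. w z * (G (x - z) \<bullet> h))) (at x)"
 unfolding has_derivative_at_alt
proof (intro conjI allI impI)
 define V where "V = measure lborel (cball (0::'a) R0)"
 have V: "0 <= V" by (simp add: V_def)
 have B0: "0 <= B" using wB[of 0] abs_ge_zero order_trans by blast
 have Q0: "0 <= Q" by (rule tameD(7)[OF \<phi>])
 have iG: "integrable lborel (\<lambda>z. w z * (G (x - z) \<bullet> h))" for h
  by (rule moll_integrable[of "\<lambda>y. G y \<bullet> h"]) (intro continuous_intros tameD(10)[OF \<phi>])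
 have lin: "linear (\<lambda>h. LINT z|lborel. w z * (G (x - z) \<bullet> h))"
 proof (rule linearI)
  show "(LINT z|lborel. w z * (G (x - z) \<bullet> (h + k))) = (LINT z|lborel. w z * (G (x - z) \<bullet> h)) + (LINT z|lborel. w z * (G (x - z) \<bullet> k))" for h k
   using iG[of h] iG[of k] by (simp add: inner_add_right distrib_left)
  show "(LINT z|lborel. w z * (G (x - z) \<bullet> (r *\<^sub>R h))) = r *\<^sub>R (LINT z|lborel. w z * (G (x - z) \<bullet> h))" for r h
   by (simp add: mult.left_commute)
 qed
 then show "bounded_linear (\<lambda>h. LINT z|lborel. w z * (G (x - z) \<bullet> h))" by (rule linear_conv_bounded_linear[THEN iffD1])
 fix e :: real assume e: "0 < e"
 define K where "K = B * Q * V + 1"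
 have K: "0 < K" using B0 Q0 V by (simp add: K_def add_nonneg_pos)
 show "\<exists>d>0. \<forall>y. norm (y - x) < d --> norm (moll \<phi> w y - moll \<phi> w x - (LINT z|lborel. w z * (G (x - z) \<bullet> (y - x)))) <= e * norm (y - x)"
 proof (intro exI[of _ "e / K"] conjI allI impI)
  show "0 < e / K" using e K by simp
  fix y assume y: "norm (y - x) < e / K"
  have "moll \<phi> w y - moll \<phi> w x - (LINT z|lborel. w z * (G (x - z) \<bullet> (y - x)))
   = (LINT z|lborel. w z * \<phi> (y - z) - w z * \<phi> (x - z) - w z * (G (x - z) \<bullet> (y - x)))"
   unfolding moll_def using moll_integrable[OF tameD(9)[OF \<phi>]] iG by simp
  also have "... = (LINT z|lborel. w z * (\<phi> (y - z) - \<phi> (x - z) - G (x - z) \<bullet> ((y - z) - (x - z))))"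
   by (rule Bochner_Integration.integral_cong) (auto simp: algebra_simps)
  finally have eq: "moll \<phi> w y - moll \<phi> w x - (LINT z|lborel. w z * (G (x - z) \<bullet> (y - x))) =
   (LINT z|lborel. w z * (\<phi> (y - z) - \<phi> (x - z) - G (x - z) \<bullet> ((y - z) - (x - z))))" .
  have "\<bar>\<phi> (y - z) - \<phi> (x - z) - G (x - z) \<bullet> ((y - z) - (x - z))\<bar> <= Q * (norm (y - x) * norm (y - x))" for z
   using tame_taylor[OF \<phi>, of "y - z" "x - z"] by simp
  from moll_bound[OF this]
  have "norm (moll \<phi> w y - moll \<phi> w x - (LINT z|lborel. w z * (G (x - z) \<bullet> (y - x)))) <= (B * Q * V) * (norm (y - x) * norm (y - x))"
   unfolding eq by (simp add: V_def mult_ac)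
  also have "... <= K * (norm (y - x) * norm (y - x))" by (intro mult_right_mono) (auto simp: K_def)
  also have "... = (K * norm (y - x)) * norm (y - x)" by simp
  also have "... <= e * norm (y - x)" using y K by (intro mult_right_mono) (auto simp: field_simps)
  finally show "norm (moll \<phi> w y - moll \<phi> w x - (LINT z|lborel. w z * (G (x - z) \<bullet> (y - x)))) <= e * norm (y - x)" .
 qed
qed

lemma moll_outside:
 assumes "\<And>x. x \<notin> cball 0 R ==> \<phi> x = 0" "x \<notin> cball 0 (R0 + R)"
 shows "moll \<phi> w x = 0"
proof -
 have z0: "w z * \<phi> (x - z) = 0" for z
 proof (cases "z \<in> cball 0 R0")
  case True
  then have "x - z \<notin> cball 0 R" using assms(2) norm_triangle_ineq2[of x z] by auto
  then show ?thesis using assms(1) by simp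
 qed (use w0 in simp)
 show ?thesis unfolding moll_def z0 by simp
qed

text \<open>Derivatives fall on the kernel, so the functions \<open>moll \<phi> w\<close> with
  \<phi> in \<open>Cinf_c\<close> are closed under directional derivatives and form an invariant for
  coinduction.\<close>

lemma moll_smooth: assumes "\<phi> \<in> Cinf_c" shows "smooth (moll \<phi> w)"
proof -
 have "\<exists>\<phi>\<in>Cinf_c. g = moll \<phi> w ==> smooth g" for g
 proof (coinduction arbitrary: g rule: smooth.coinduct)
  case (smooth g)
  then obtain \<phi> where \<phi>: "\<phi> \<in> Cinf_c" and g: "g = moll \<phi> w" by blast
  obtain R Q G where t: "tame R Q \<phi> G" using Cinf_c_tame[OF \<phi>] by blast
  have s\<phi>: "smooth \<phi>" using \<phi> by (simp add: Cinf_c_iff)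
  obtain D where D: "\<And>x. (\<phi> has_derivative D x) (at x)" "\<And>v. smooth (\<lambda>x. D x v)"
   using smoothE[OF s\<phi>] by metis
  have DG: "D x = (\<lambda>h. G x \<bullet> h)" for x using has_derivative_unique[OF D(1) tameD(1)[OF t]] .
  have "(\<lambda>x. G x \<bullet> v) \<in> Cinf_c" for v
   unfolding Cinf_c_iff using D(2)[of v] tameD(3)[OF t] by (auto simp: DG intro!: exI[of _ R])
  moreover note d = moll_deriv[OF t]
  moreover have "continuous_on UNIV g" unfolding g using d by (meson continuous_at_imp_continuous_on has_derivative_continuous)
  ultimately show ?case
   unfolding g
   by (intro exI[of _ "moll \<phi> w"] conjI refl exI[of _ "\<lambda>x h. LINT z|lborel. w z * (G (x - z) \<bullet> h)"])
    (auto simp: moll_def[abs_def])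
 qed
 then show ?thesis using assms by blast
qed

lemma moll_tame:
 assumes \<phi>: "tame R Q \<phi> G"
 shows "\<exists>Gm. tame (R0 + R) (B * Q * measure lborel (cball (0::'a) R0)) (moll \<phi> w) Gm \<and>
  (\<forall>x h. Gm x \<bullet> h = (LINT z|lborel. w z * (G (x - z) \<bullet> h)))"
proof -
 define D where "D x h = (LINT z|lborel. w z * (G (x - z) \<bullet> h))" for x h
 define Gm where "Gm x = (\<Sum>b\<in>Basis. D x b *\<^sub>R b)" for x
 have d: "(moll \<phi> w has_derivative D x) (at x)" for x unfolding D_def[abs_def] by (rule moll_deriv[OF \<phi>])
 have GD: "Gm x \<bullet> h = D x h" for x h
  unfolding Gm_def by (rule gradient_vector[OF has_derivative_linear[OF d], symmetric])
 \<comment> \<open>Bounds on all inner products bound the vector; this reduces gradient estimates to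
   the scalar integrals that define \<open>D\<close>.\<close>
 have self: "norm u <= K" if "\<And>h. \<bar>u \<bullet> h\<bar> <= K * norm h" for u :: 'a and K :: real
 proof (cases "u = 0")
  case True
  obtain b :: 'a where "b \<in> Basis" using nonempty_Basis by blast
  then show ?thesis using True that[of b] by simp
 next
  case False
  have "norm u * norm u <= K * norm u" using that[of u] by (simp add: dot_square_norm power2_eq_square)
  then show ?thesis using False by simp
 qed
 let ?K = "B * Q * measure lborel (cball (0::'a) R0)"
 have iG: "integrable lborel (\<lambda>z. w z * (G (x - z) \<bullet> h))" for x h
  by (rule moll_integrable[of "\<lambda>y. G y \<bullet> h"]) (intro continuous_intros tameD(10)[OF \<phi>])
 have "tame (R0 + R) ?K (moll \<phi> w) Gm"
  unfolding tame_def
 proof (intro conjI allI impI)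
  show "(moll \<phi> w has_derivative (\<lambda>h. Gm x \<bullet> h)) (at x)" for x unfolding GD using d by (simp add: eta_contract_eq)
  show "moll \<phi> w x = 0" if "x \<notin> cball 0 (R0 + R)" for x by (rule moll_outside[OF tameD(2)[OF \<phi>] that])
  show "\<bar>moll \<phi> w x\<bar> <= ?K" for x unfolding moll_def by (rule moll_bound[OF tameD(4)[OF \<phi>]])
  show "norm (Gm x) <= ?K" for x
  proof (rule self)
   fix h
   have "\<bar>G (x - z) \<bullet> h\<bar> <= Q * norm h" for z
    by (rule order_trans[OF Cauchy_Schwarz_ineq2 mult_right_mono[OF tameD(5)[OF \<phi>]]]) simp
   from moll_bound[OF this] show "\<bar>Gm x \<bullet> h\<bar> <= ?K * norm h" unfolding GD D_def by (simp add: mult_ac)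
  qed
  show "norm (Gm x - Gm y) <= ?K * norm (x - y)" for x y
  proof (rule self)
   fix h
   have "\<bar>(G (x - z) - G (y - z)) \<bullet> h\<bar> <= Q * norm (x - y) * norm h" for z
    using order_trans[OF Cauchy_Schwarz_ineq2 mult_right_mono[OF tameD(6)[OF \<phi>, of "x - z" "y - z"]], of h] by simp
   note b = moll_bound[OF this]
   have "(Gm x - Gm y) \<bullet> h = (LINT z|lborel. w z * (G (x - z) \<bullet> h) - w z * (G (y - z) \<bullet> h))"
    unfolding inner_diff_left GD D_def using iG by simp
   also have "... = (LINT z|lborel. w z * ((G (x - z) - G (y - z)) \<bullet> h))"
    by (rule Bochner_Integration.integral_cong) (auto simp: algebra_simps inner_diff_left)
   finally have eq: "(Gm x - Gm y) \<bullet> h = (LINT z|lborel. w z * ((G (x - z) - G (y - z)) \<bullet> h))" .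
   show "\<bar>(Gm x - Gm y) \<bullet> h\<bar> <= ?K * norm (x - y) * norm h" unfolding eq using b by (simp add: mult_ac)
  qed
 qed
 then show ?thesis by (intro exI[of _ Gm] conjI allI) (simp_all only: GD D_def)
qed

end

lemma tame_reflect:
 fixes \<phi> :: "'a::euclidean_space => real"
 assumes \<phi>: "tame R Q \<phi> G" shows "tame (norm x + R) Q (\<lambda>z. \<phi> (x - z)) (\<lambda>z. - G (x - z))"
 unfolding tame_def
proof (intro conjI allI impI)
 show "((\<lambda>z. \<phi> (x - z)) has_derivative (\<lambda>h. - G (x - z) \<bullet> h)) (at z)" for z
 proof -
  have 1: "((\<lambda>z. x - z) has_derivative (\<lambda>v. - v)) (at z)" by (auto intro!: derivative_eq_intros)
  show ?thesis using has_derivative_compose[OF 1 tameD(1)[OF \<phi>]] by simp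
 qed
 show "\<phi> (x - z) = 0" if "z \<notin> cball 0 (norm x + R)" for z
  using that norm_triangle_ineq2[of z x] by (intro tameD(2)[OF \<phi>]) (auto simp: norm_minus_commute)
 show "\<bar>\<phi> (x - z)\<bar> <= Q" "norm (- G (x - z)) <= Q" for z using tameD(4,5)[OF \<phi>] by auto
 show "norm (- G (x - z) - - G (x - y)) <= Q * norm (z - y)" for z y
  using tameD(6)[OF \<phi>, of "x - y" "x - z"] by (simp add: norm_minus_commute)
qed

lemma Cinf_c_reflect:
 fixes \<phi> :: "'a::euclidean_space => real"
 assumes "\<phi> \<in> Cinf_c" shows "(\<lambda>z. \<phi> (x - z)) \<in> Cinf_c"
proof -
 obtain R where s: "smooth \<phi>" and R: "\<forall>x. x \<notin> cball 0 R --> \<phi> x = 0" using assms by (auto simp: Cinf_c_iff)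
 have "\<phi> (x - z) = 0" if "z \<notin> cball 0 (norm x + R)" for z
  using that norm_triangle_ineq2[of z x] R by (auto simp: norm_minus_commute)
 moreover have "smooth (\<lambda>z. \<phi> (x - z))" using smooth_compose_reflect[OF s, of 1 x] by simp
 ultimately show ?thesis unfolding Cinf_c_iff by blast
qed

section \<open>Commutator estimates, uniform in \<epsilon>\<close>

context transport_coeffs
begin

text \<open>The kernel of the commutator between mollification and the two first order operators.\<close>

definition cker where
 "cker \<rho> G s t x \<xi> = G \<xi> \<bullet> (dA s t x - dA s t (x - \<xi>)) + (diva s t (x - \<xi>) + dc s t x - dc s t (x - \<xi>)) * \<rho> \<xi>"

definition comm where "comm \<rho> G s t w x = (LINT \<xi>|lborel. w (x - \<xi>) * cker \<rho> G s t x \<xi>)"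

context
 fixes W \<epsilon> Q :: real and \<rho> :: "'a => real" and G :: "'a => 'a" and s t :: real
 assumes ker: "kernel W \<epsilon> \<rho> G Q" and \<epsilon>: "0 < \<epsilon>" "\<epsilon> <= 1" and st: "s \<in> I" "t \<in> I"
begin

private definition "V = measure lborel (cball (0::'a) \<epsilon>)"
private definition "\<tau> = \<bar>t - s\<bar> powr \<alpha>"

private lemma V: "0 < V" using \<epsilon> unit_ball_vol_pos[of "real DIM('a)"] by (simp add: V_def measure_cball)
private lemma \<tau>: "0 <= \<tau>" by (simp add: \<tau>_def)
private lemma tm: "tame \<epsilon> Q \<rho> G" using ker by (simp add: kernel_def)
private lemma \<rho>0: "0 <= \<rho> \<xi>" using ker by (simp add: kernel_def)
private lemma \<rho>V: "\<rho> \<xi> * V <= W" using ker by (simp add: kernel_def V_def)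
private lemma GV: "norm (G \<xi>) * \<epsilon> * V <= W" using ker by (simp add: kernel_def V_def)
private lemma \<rho>_int: "(LINT \<xi>|lborel. \<rho> \<xi>) = 1" using ker by (simp add: kernel_def)
private lemma W: "0 <= W" using \<rho>V[of 0] \<rho>0[of 0] V by (meson mult_nonneg_nonneg order_trans less_imp_le)
private lemma outside: "\<xi> \<notin> cball 0 \<epsilon> ==> \<rho> \<xi> = 0" "\<xi> \<notin> cball 0 \<epsilon> ==> G \<xi> = 0" using tameD(2,3)[OF tm] by auto
private lemma cont [continuous_intros]: "continuous_on S \<rho>" "continuous_on S G"
  "continuous_on S (dA s t)" "continuous_on S (diva s t)" "continuous_on S (dc s t)"
 using tameD(9,10)[OF tm] dA_continuous[OF st] diva_continuous[OF st] dc_continuous[OF st] continuous_on_subset by blast+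

lemma shift_cont:
 fixes f :: "'a => 'b::topological_space"
 assumes "continuous_on UNIV f" shows "continuous_on S (\<lambda>\<xi>. f (x - \<xi>))"
 by (rule continuous_on_compose2[OF assms]) (auto intro!: continuous_intros)

private lemma cker_cont: "continuous_on UNIV (cker \<rho> G s t x)"
 unfolding cker_def[abs_def] by (intro continuous_intros shift_cont)

private lemma cker_outside: "\<xi> \<notin> cball 0 \<epsilon> ==> cker \<rho> G s t x \<xi> = 0"
 using outside by (simp add: cker_def)

private lemma dA_l: "norm (dA s t x - dA s t y) <= C * \<tau> * norm (x - y)" using dA_lip[OF st] by (simp add: \<tau>_def)
private lemma dc_l: "\<bar>dc s t x - dc s t y\<bar> <= C * \<tau> * norm (x - y)" using dc_lip[OF st] by (simp add: \<tau>_def)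
private lemma dc_b: "\<bar>dc s t x\<bar> <= C * \<tau>" using dc_bound[OF st] by (simp add: \<tau>_def)
private lemma diva_b: "\<bar>diva s t x\<bar> <= N * C * \<tau>" using diva_bound[OF st] by (simp add: \<tau>_def)
private lemma diva_h: "\<bar>diva s t x - diva s t y\<bar> <= N * C * \<tau> * norm (x - y) powr \<beta>" using diva_holder[OF st] by (simp add: \<tau>_def)

private lemma from_V: "a * V <= b ==> a <= b / V" using V by (simp add: pos_le_divide_eq)

text \<open>The gradient of the kernel is of order 1 / (\<epsilon> * V), and the difference of the
  field at distance \<epsilon> compensates the factor 1 / \<epsilon>. What remains is of order 1 / V
  on a ball of volume V, so integrals of \<open>cker\<close> are bounded uniformly in
  \<epsilon>.\<close>

private lemma cker_bound: "\<bar>cker \<rho> G s t x \<xi>\<bar> <= C * \<tau> * W * (N + 2) / V"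
proof (rule from_V, cases "\<xi> \<in> cball 0 \<epsilon>")
 case True
 then have \<xi>: "norm \<xi> <= \<epsilon>" by simp
 have 1: "\<bar>G \<xi> \<bullet> (dA s t x - dA s t (x - \<xi>))\<bar> <= norm (G \<xi>) * (C * \<tau> * \<epsilon>)"
 proof (rule order_trans[OF Cauchy_Schwarz_ineq2 mult_left_mono])
  have "norm (dA s t x - dA s t (x - \<xi>)) <= C * \<tau> * norm \<xi>" using dA_l[of x "x - \<xi>"] by simp
  also have "... <= C * \<tau> * \<epsilon>" using \<xi> C0 \<tau> by (intro mult_left_mono) auto
  finally show "norm (dA s t x - dA s t (x - \<xi>)) <= C * \<tau> * \<epsilon>" .
 qed simp
 have 2: "\<bar>(diva s t (x - \<xi>) + dc s t x - dc s t (x - \<xi>)) * \<rho> \<xi>\<bar> <= (C * \<tau> * (N + 1)) * \<rho> \<xi>"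
 proof -
  have "\<bar>dc s t x - dc s t (x - \<xi>)\<bar> <= C * \<tau> * norm \<xi>" using dc_l[of x "x - \<xi>"] by simp
  also have "... <= C * \<tau> * 1" using \<xi> \<epsilon> C0 \<tau> by (intro mult_left_mono) auto
  finally have "\<bar>diva s t (x - \<xi>) + dc s t x - dc s t (x - \<xi>)\<bar> <= C * \<tau> * (N + 1)"
   using diva_b[of "x - \<xi>"] by (simp add: algebra_simps abs_le_iff)
  then show ?thesis unfolding abs_mult using \<rho>0[of \<xi>] by (simp add: mult_right_mono)
 qed
 have "\<bar>cker \<rho> G s t x \<xi>\<bar> <= norm (G \<xi>) * (C * \<tau> * \<epsilon>) + (C * \<tau> * (N + 1)) * \<rho> \<xi>"
  unfolding cker_def by (rule order_trans[OF abs_triangle_ineq add_mono[OF 1 2]])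
 then have "\<bar>cker \<rho> G s t x \<xi>\<bar> * V <= (norm (G \<xi>) * (C * \<tau> * \<epsilon>) + (C * \<tau> * (N + 1)) * \<rho> \<xi>) * V"
  using V by (intro mult_right_mono) auto
 also have "... = C * \<tau> * (norm (G \<xi>) * \<epsilon> * V) + (C * \<tau> * (N + 1)) * (\<rho> \<xi> * V)" by (simp add: algebra_simps)
 also have "... <= C * \<tau> * W + (C * \<tau> * (N + 1)) * W"
  using GV[of \<xi>] \<rho>V[of \<xi>] C0 \<tau> N by (intro add_mono mult_left_mono) auto
 also have "... = C * \<tau> * W * (N + 2)" by (simp add: algebra_simps)
 finally show "\<bar>cker \<rho> G s t x \<xi>\<bar> * V <= C * \<tau> * W * (N + 2)" .
next
 case False
 then show "\<bar>cker \<rho> G s t x \<xi>\<bar> * V <= C * \<tau> * W * (N + 2)" using cker_outside C0 \<tau> W N by simp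
qed

text \<open>The same balance of powers of \<epsilon>: \<open>inc_four\<close> keeps the factor norm
  \<xi> and adds norm (x - y) powr \<beta>. In N + 7 the gradient term contributes 1, the divergence
  N, and two Hoelder bounds for c contribute 3 each.\<close>

private lemma cker_holder: "\<bar>cker \<rho> G s t x \<xi> - cker \<rho> G s t y \<xi>\<bar> <= C * \<tau> * W * (N + 7) * norm (x - y) powr \<beta> / V"
proof (rule from_V, cases "\<xi> \<in> cball 0 \<epsilon>")
 case True
 then have \<xi>: "norm \<xi> <= \<epsilon>" by simp
 let ?p = "norm (x - y) powr \<beta>"
 have 1: "\<bar>G \<xi> \<bullet> ((dA s t x - dA s t (x - \<xi>)) - (dA s t y - dA s t (y - \<xi>)))\<bar> <= norm (G \<xi>) * (C * \<tau> * ?p * \<epsilon>)"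
 proof (rule order_trans[OF Cauchy_Schwarz_ineq2 mult_left_mono])
  have "norm ((dA s t (x - \<xi>) - dA s t x) - (dA s t (y - \<xi>) - dA s t y)) <= C * \<tau> * ?p * norm \<xi>"
   using F.inc_four[OF st, of "x - \<xi>" x "y - \<xi>" y] by (simp add: dA_eq \<tau>_def)
  also have "... <= C * \<tau> * ?p * \<epsilon>" using \<xi> C0 \<tau> by (intro mult_left_mono) auto
  finally have "norm ((dA s t (x - \<xi>) - dA s t x) - (dA s t (y - \<xi>) - dA s t y)) <= C * \<tau> * ?p * \<epsilon>" .
  moreover have "(dA s t x - dA s t (x - \<xi>)) - (dA s t y - dA s t (y - \<xi>)) = - ((dA s t (x - \<xi>) - dA s t x) - (dA s t (y - \<xi>) - dA s t y))" by simp
  ultimately show "norm ((dA s t x - dA s t (x - \<xi>)) - (dA s t y - dA s t (y - \<xi>))) <= C * \<tau> * ?p * \<epsilon>" by (simp only: norm_minus_cancel)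
 qed simp
 have dch: "\<bar>dc s t a - dc s t b\<bar> <= 3 * (C * \<tau>) * norm (a - b) powr \<beta>" for a b
  using lipschitz_imp_holder[of "dc s t" "C * \<tau>" "C * \<tau>" \<beta> a b] dc_b dc_l \<beta> C0 \<tau> by simp
 have 2: "\<bar>((diva s t (x - \<xi>) - diva s t (y - \<xi>)) + (dc s t x - dc s t y) - (dc s t (x - \<xi>) - dc s t (y - \<xi>))) * \<rho> \<xi>\<bar> <= (C * \<tau> * (N + 6) * ?p) * \<rho> \<xi>"
 proof -
  have "\<bar>(diva s t (x - \<xi>) - diva s t (y - \<xi>)) + (dc s t x - dc s t y) - (dc s t (x - \<xi>) - dc s t (y - \<xi>))\<bar>
   <= \<bar>diva s t (x - \<xi>) - diva s t (y - \<xi>)\<bar> + \<bar>dc s t x - dc s t y\<bar> + \<bar>dc s t (x - \<xi>) - dc s t (y - \<xi>)\<bar>" by arith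
  also have "... <= N * C * \<tau> * ?p + 3 * (C * \<tau>) * ?p + 3 * (C * \<tau>) * ?p"
   using diva_h[of "x - \<xi>" "y - \<xi>"] dch[of x y] dch[of "x - \<xi>" "y - \<xi>"] by (intro add_mono) auto
  also have "... = C * \<tau> * (N + 6) * ?p" by (simp add: algebra_simps)
  finally show ?thesis unfolding abs_mult using \<rho>0[of \<xi>] by (simp add: mult_right_mono)
 qed
 have eq: "cker \<rho> G s t x \<xi> - cker \<rho> G s t y \<xi> = G \<xi> \<bullet> ((dA s t x - dA s t (x - \<xi>)) - (dA s t y - dA s t (y - \<xi>)))
  + ((diva s t (x - \<xi>) - diva s t (y - \<xi>)) + (dc s t x - dc s t y) - (dc s t (x - \<xi>) - dc s t (y - \<xi>))) * \<rho> \<xi>"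
  by (simp add: cker_def inner_diff_right algebra_simps)
 have "\<bar>cker \<rho> G s t x \<xi> - cker \<rho> G s t y \<xi>\<bar> <= norm (G \<xi>) * (C * \<tau> * ?p * \<epsilon>) + (C * \<tau> * (N + 6) * ?p) * \<rho> \<xi>"
  unfolding eq by (rule order_trans[OF abs_triangle_ineq add_mono[OF 1 2]])
 then have "\<bar>cker \<rho> G s t x \<xi> - cker \<rho> G s t y \<xi>\<bar> * V <= (norm (G \<xi>) * (C * \<tau> * ?p * \<epsilon>) + (C * \<tau> * (N + 6) * ?p) * \<rho> \<xi>) * V"
  using V by (intro mult_right_mono) auto
 also have "... = C * \<tau> * ?p * (norm (G \<xi>) * \<epsilon> * V) + (C * \<tau> * (N + 6) * ?p) * (\<rho> \<xi> * V)" by (simp add: algebra_simps)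
 also have "... <= C * \<tau> * ?p * W + (C * \<tau> * (N + 6) * ?p) * W"
  using GV[of \<xi>] \<rho>V[of \<xi>] C0 \<tau> N by (intro add_mono mult_left_mono) auto
 also have "... = C * \<tau> * W * (N + 7) * ?p" by (simp add: algebra_simps)
 finally show "\<bar>cker \<rho> G s t x \<xi> - cker \<rho> G s t y \<xi>\<bar> * V <= C * \<tau> * W * (N + 7) * ?p" .
next
 case False
 then show "\<bar>cker \<rho> G s t x \<xi> - cker \<rho> G s t y \<xi>\<bar> * V <= C * \<tau> * W * (N + 7) * norm (x - y) powr \<beta>"
  using cker_outside C0 \<tau> W N by simp
qed

lemma int_cker:
 assumes "continuous_on UNIV u" shows "integrable lborel (\<lambda>\<xi>. u \<xi> * cker \<rho> G s t x \<xi>)"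
 by (rule integrable_compact_support[of _ \<epsilon>])
  (use cker_outside in \<open>auto intro!: continuous_intros assms cker_cont\<close>)

text \<open>The gradient term and the divergence term of \<open>cker\<close> together are the
  divergence in \<xi> of the field \<rho> \<xi> times dA s t x - dA s t (x - \<xi>), so they
  integrate to 0. Only the c-term is left, and c is Lipschitz. This cancellation makes the
  commutator small and not merely bounded.\<close>

private lemma cker_mean: "\<bar>LINT \<xi>|lborel. cker \<rho> G s t x \<xi>\<bar> <= C * \<tau> * \<epsilon>"
proof -
 define a where "a \<xi> = dA s t x - dA s t (x - \<xi>)" for \<xi>
 define Vf where "Vf \<xi> = \<rho> \<xi> *\<^sub>R a \<xi>" for \<xi>
 define Vf' where "Vf' \<xi> h = \<rho> \<xi> *\<^sub>R da s t (x - \<xi>) h + (G \<xi> \<bullet> h) *\<^sub>R a \<xi>" for \<xi> h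
 have dlin: "linear (da s t y)" for y using has_derivative_linear[OF dA_deriv[OF st]] .
 have d: "(Vf has_derivative Vf' \<xi>) (at \<xi>)" for \<xi>
 proof -
  have 1: "((\<lambda>\<xi>. x - \<xi>) has_derivative (\<lambda>v. - v)) (at \<xi>)" by (auto intro!: derivative_eq_intros)
  have "(a has_derivative (\<lambda>h. 0 - da s t (x - \<xi>) (- h))) (at \<xi>)"
   unfolding a_def[abs_def] by (intro has_derivative_diff has_derivative_const has_derivative_compose[OF 1 dA_deriv[OF st]])
  then have "(a has_derivative da s t (x - \<xi>)) (at \<xi>)" by (rule has_derivative_eq_rhs) (simp add: linear_neg[OF dlin] fun_eq_iff)
  from has_derivative_scaleR[OF tameD(1)[OF tm] this] show ?thesis unfolding Vf_def[abs_def] Vf'_def[abs_def] .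
 qed
 have V0: "Vf \<xi> = 0" if "\<xi> \<notin> cball 0 \<epsilon>" for \<xi> using outside[OF that] by (simp add: Vf_def)
 have V'0: "Vf' \<xi> h = 0" if "\<xi> \<notin> cball 0 \<epsilon>" for \<xi> h using outside[OF that] by (simp add: Vf'_def)
 have V'c: "continuous_on UNIV (\<lambda>\<xi>. Vf' \<xi> h)" for h
  unfolding Vf'_def a_def by (intro continuous_intros shift_cont[OF da_continuous[OF st]] shift_cont)
 obtain BV where BV: "\<And>x y. norm (Vf x - Vf y) <= BV * norm (x - y)"
  using C1_compact_support_lipschitz[OF d V0 V'c] by blast
 have "(LINT \<xi>|lborel. (\<Sum>b\<in>Basis. Vf' \<xi> b \<bullet> b)) = 0"
 proof (rule integral_divergence_eq_0[OF d BV V0])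
  show "integrable lborel (\<lambda>\<xi>. Vf' \<xi> b \<bullet> b)" for b
   by (rule integrable_compact_support[of _ \<epsilon>]) (use V'0 in \<open>auto intro!: continuous_intros V'c\<close>)
 qed
 moreover have "(\<Sum>b\<in>Basis. Vf' \<xi> b \<bullet> b) = \<rho> \<xi> * diva s t (x - \<xi>) + G \<xi> \<bullet> a \<xi>" for \<xi>
 proof -
  have "(\<Sum>b\<in>Basis. Vf' \<xi> b \<bullet> b) = \<rho> \<xi> * diva s t (x - \<xi>) + (\<Sum>b\<in>Basis. (G \<xi> \<bullet> b) * (a \<xi> \<bullet> b))"
   by (simp add: Vf'_def diva_def inner_add_left sum.distrib sum_distrib_left)
  then show ?thesis by (simp add: euclidean_inner[of "G \<xi>" "a \<xi>"])
 qed
 ultimately have 0: "(LINT \<xi>|lborel. \<rho> \<xi> * diva s t (x - \<xi>) + G \<xi> \<bullet> a \<xi>) = 0" by simp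
 have i1: "integrable lborel (\<lambda>\<xi>. \<rho> \<xi> * diva s t (x - \<xi>) + G \<xi> \<bullet> a \<xi>)"
  unfolding a_def by (rule integrable_compact_support[of _ \<epsilon>]) (use outside in \<open>auto intro!: continuous_intros shift_cont\<close>)
 have i2: "integrable lborel (\<lambda>\<xi>. (dc s t x - dc s t (x - \<xi>)) * \<rho> \<xi>)"
  by (rule integrable_compact_support[of _ \<epsilon>]) (use outside in \<open>auto intro!: continuous_intros shift_cont\<close>)
 have i3: "integrable lborel (\<lambda>\<xi>. (C * \<tau> * \<epsilon>) * \<rho> \<xi>)"
  by (rule integrable_compact_support[of _ \<epsilon>]) (use outside in \<open>auto intro!: continuous_intros\<close>)
 have "(LINT \<xi>|lborel. cker \<rho> G s t x \<xi>) = (LINT \<xi>|lborel. (\<rho> \<xi> * diva s t (x - \<xi>) + G \<xi> \<bullet> a \<xi>) + (dc s t x - dc s t (x - \<xi>)) * \<rho> \<xi>)"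
  by (rule Bochner_Integration.integral_cong) (auto simp: cker_def a_def algebra_simps)
 also have "... = (LINT \<xi>|lborel. (dc s t x - dc s t (x - \<xi>)) * \<rho> \<xi>)" using i1 i2 0 by simp
 finally have eq: "(LINT \<xi>|lborel. cker \<rho> G s t x \<xi>) = (LINT \<xi>|lborel. (dc s t x - dc s t (x - \<xi>)) * \<rho> \<xi>)" .
 have "\<bar>LINT \<xi>|lborel. (dc s t x - dc s t (x - \<xi>)) * \<rho> \<xi>\<bar> <= (LINT \<xi>|lborel. \<bar>(dc s t x - dc s t (x - \<xi>)) * \<rho> \<xi>\<bar>)"
  using integral_norm_bound[of lborel "\<lambda>\<xi>. (dc s t x - dc s t (x - \<xi>)) * \<rho> \<xi>"] by simp
 also have "... <= (LINT \<xi>|lborel. (C * \<tau> * \<epsilon>) * \<rho> \<xi>)"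
 proof (rule integral_mono[OF _ i3])
  show "integrable lborel (\<lambda>\<xi>. \<bar>(dc s t x - dc s t (x - \<xi>)) * \<rho> \<xi>\<bar>)" using i2 by (rule integrable_abs)
  show "\<bar>(dc s t x - dc s t (x - \<xi>)) * \<rho> \<xi>\<bar> <= C * \<tau> * \<epsilon> * \<rho> \<xi>" for \<xi>
  proof (cases "\<xi> \<in> cball 0 \<epsilon>")
   case True
   have "\<bar>dc s t x - dc s t (x - \<xi>)\<bar> <= C * \<tau> * norm \<xi>" using dc_l[of x "x - \<xi>"] by simp
   also have "... <= C * \<tau> * \<epsilon>" using True C0 \<tau> by (intro mult_left_mono) auto
   finally show ?thesis unfolding abs_mult using \<rho>0[of \<xi>] by (simp add: mult_right_mono)
  qed (use outside in simp)
 qed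
 also have "... = C * \<tau> * \<epsilon>" by (simp add: \<rho>_int)
 finally show ?thesis unfolding eq .
qed

lemma comm_bound:
 assumes "\<And>x. \<bar>w x\<bar> <= B"
 shows "\<bar>comm \<rho> G s t w x\<bar> <= B * (C * W * (N + 2)) * \<bar>t - s\<bar> powr \<alpha>"
proof -
 have B0: "0 <= B" using assms[of 0] abs_ge_zero order_trans by blast
 have "\<bar>comm \<rho> G s t w x\<bar> <= (B * (C * \<tau> * W * (N + 2) / V)) * V"
  unfolding comm_def V_def[symmetric]
 proof (subst (2) V_def, rule integral_bound_compact_support)
  show "w (x - \<xi>) * cker \<rho> G s t x \<xi> = 0" if "\<xi> \<notin> cball 0 \<epsilon>" for \<xi> using cker_outside[OF that] by simp
  show "\<bar>w (x - \<xi>) * cker \<rho> G s t x \<xi>\<bar> <= B * (C * \<tau> * W * (N + 2) / V)" for \<xi>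
   unfolding abs_mult using assms cker_bound B0 by (intro mult_mono) auto
 qed
 also have "... = B * (C * W * (N + 2)) * \<tau>" using V by simp
 finally show ?thesis by (simp add: \<tau>_def)
qed

text \<open>Replacing w (x - \<xi>) by w x costs order \<epsilon> because w is Lipschitz, and the
  constant part meets the mean of \<open>cker\<close>.\<close>

lemma comm_small:
 assumes wc: "continuous_on UNIV w" and wB: "\<And>x. \<bar>w x\<bar> <= B" and wL: "\<And>x y. \<bar>w x - w y\<bar> <= B * norm (x - y)"
 shows "\<bar>comm \<rho> G s t w x\<bar> <= B * \<epsilon> * (C * (W * (N + 2) + 1)) * \<bar>t - s\<bar> powr \<alpha>"
proof -
 have B0: "0 <= B" using wB[of 0] abs_ge_zero order_trans by blast
 have i1: "integrable lborel (\<lambda>\<xi>. (w (x - \<xi>) - w x) * cker \<rho> G s t x \<xi>)"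
  by (rule int_cker) (intro continuous_intros shift_cont[OF wc])
 have i2: "integrable lborel (\<lambda>\<xi>. w x * cker \<rho> G s t x \<xi>)" by (rule int_cker) (intro continuous_intros)
 have "comm \<rho> G s t w x = (LINT \<xi>|lborel. (w (x - \<xi>) - w x) * cker \<rho> G s t x \<xi> + w x * cker \<rho> G s t x \<xi>)"
  unfolding comm_def by (rule Bochner_Integration.integral_cong) (auto simp: algebra_simps)
 also have "... = (LINT \<xi>|lborel. (w (x - \<xi>) - w x) * cker \<rho> G s t x \<xi>) + w x * (LINT \<xi>|lborel. cker \<rho> G s t x \<xi>)"
  using i1 i2 by simp
 finally have eq: "comm \<rho> G s t w x = (LINT \<xi>|lborel. (w (x - \<xi>) - w x) * cker \<rho> G s t x \<xi>) + w x * (LINT \<xi>|lborel. cker \<rho> G s t x \<xi>)" .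
 have 1: "\<bar>LINT \<xi>|lborel. (w (x - \<xi>) - w x) * cker \<rho> G s t x \<xi>\<bar> <= (B * \<epsilon>) * (C * \<tau> * W * (N + 2))"
 proof -
  have "\<bar>LINT \<xi>|lborel. (w (x - \<xi>) - w x) * cker \<rho> G s t x \<xi>\<bar> <= ((B * \<epsilon>) * (C * \<tau> * W * (N + 2) / V)) * V"
  proof (subst (2) V_def, rule integral_bound_compact_support)
   show "(w (x - \<xi>) - w x) * cker \<rho> G s t x \<xi> = 0" if "\<xi> \<notin> cball 0 \<epsilon>" for \<xi> using cker_outside[OF that] by simp
   show "\<bar>(w (x - \<xi>) - w x) * cker \<rho> G s t x \<xi>\<bar> <= (B * \<epsilon>) * (C * \<tau> * W * (N + 2) / V)" if "\<xi> \<in> cball 0 \<epsilon>" for \<xi>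
   proof -
    have "\<bar>w (x - \<xi>) - w x\<bar> <= B * norm \<xi>" using wL[of "x - \<xi>" x] by simp
    also have "... <= B * \<epsilon>" using that B0 by (intro mult_left_mono) auto
    finally show ?thesis unfolding abs_mult using cker_bound B0 \<epsilon> by (intro mult_mono) auto
   qed
  qed
  then show ?thesis using V by simp
 qed
 have 2: "\<bar>w x * (LINT \<xi>|lborel. cker \<rho> G s t x \<xi>)\<bar> <= B * (C * \<tau> * \<epsilon>)"
  unfolding abs_mult using wB cker_mean B0 by (intro mult_mono) auto
 have "\<bar>comm \<rho> G s t w x\<bar> <= (B * \<epsilon>) * (C * \<tau> * W * (N + 2)) + B * (C * \<tau> * \<epsilon>)"
  unfolding eq by (rule order_trans[OF abs_triangle_ineq add_mono[OF 1 2]])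
 also have "... = B * \<epsilon> * (C * (W * (N + 2) + 1)) * \<tau>" by (simp add: algebra_simps)
 finally show ?thesis by (simp add: \<tau>_def)
qed

text \<open>Needed because the measures are regular in time only when tested with Hoelder functions.
  The constant is 3 * (N + 2) + (N + 7), from the increments of w and of
  \<open>cker\<close>.\<close>

lemma comm_holder:
 assumes wc: "continuous_on UNIV w" and wB: "\<And>x. \<bar>w x\<bar> <= B" and wL: "\<And>x y. \<bar>w x - w y\<bar> <= B * norm (x - y)"
 shows "\<bar>comm \<rho> G s t w x - comm \<rho> G s t w y\<bar> <= B * (C * W * (4 * N + 13)) * \<bar>t - s\<bar> powr \<alpha> * norm (x - y) powr \<beta>"
proof -
 have B0: "0 <= B" using wB[of 0] abs_ge_zero order_trans by blast
 let ?p = "norm (x - y) powr \<beta>"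
 have i1: "integrable lborel (\<lambda>\<xi>. (w (x - \<xi>) - w (y - \<xi>)) * cker \<rho> G s t x \<xi>)"
  by (rule int_cker) (intro continuous_intros shift_cont[OF wc])
 have i2: "integrable lborel (\<lambda>\<xi>. w (y - \<xi>) * (cker \<rho> G s t x \<xi> - cker \<rho> G s t y \<xi>))"
  using int_cker[OF shift_cont[OF wc], of y x] int_cker[OF shift_cont[OF wc], of y y] by (simp add: right_diff_distrib)
 have "comm \<rho> G s t w x - comm \<rho> G s t w y = (LINT \<xi>|lborel. w (x - \<xi>) * cker \<rho> G s t x \<xi> - w (y - \<xi>) * cker \<rho> G s t y \<xi>)"
  unfolding comm_def using int_cker[OF shift_cont[OF wc]] by simp
 also have "... = (LINT \<xi>|lborel. (w (x - \<xi>) - w (y - \<xi>)) * cker \<rho> G s t x \<xi> + w (y - \<xi>) * (cker \<rho> G s t x \<xi> - cker \<rho> G s t y \<xi>))"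
  by (rule Bochner_Integration.integral_cong) (auto simp: algebra_simps)
 also have "... = (LINT \<xi>|lborel. (w (x - \<xi>) - w (y - \<xi>)) * cker \<rho> G s t x \<xi>) + (LINT \<xi>|lborel. w (y - \<xi>) * (cker \<rho> G s t x \<xi> - cker \<rho> G s t y \<xi>))"
  using i1 i2 by simp
 finally have eq: "comm \<rho> G s t w x - comm \<rho> G s t w y = (LINT \<xi>|lborel. (w (x - \<xi>) - w (y - \<xi>)) * cker \<rho> G s t x \<xi>) + (LINT \<xi>|lborel. w (y - \<xi>) * (cker \<rho> G s t x \<xi> - cker \<rho> G s t y \<xi>))" .
 have 1: "\<bar>LINT \<xi>|lborel. (w (x - \<xi>) - w (y - \<xi>)) * cker \<rho> G s t x \<xi>\<bar> <= (3 * B * ?p) * (C * \<tau> * W * (N + 2))"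
 proof -
  have "\<bar>LINT \<xi>|lborel. (w (x - \<xi>) - w (y - \<xi>)) * cker \<rho> G s t x \<xi>\<bar> <= ((3 * B * ?p) * (C * \<tau> * W * (N + 2) / V)) * V"
  proof (subst (2) V_def, rule integral_bound_compact_support)
   show "(w (x - \<xi>) - w (y - \<xi>)) * cker \<rho> G s t x \<xi> = 0" if "\<xi> \<notin> cball 0 \<epsilon>" for \<xi> using cker_outside[OF that] by simp
   show "\<bar>(w (x - \<xi>) - w (y - \<xi>)) * cker \<rho> G s t x \<xi>\<bar> <= (3 * B * ?p) * (C * \<tau> * W * (N + 2) / V)" for \<xi>
   proof -
    have "\<bar>w (x - \<xi>) - w (y - \<xi>)\<bar> <= 3 * B * ?p"
     using lipschitz_imp_holder[of w B B \<beta> "x - \<xi>" "y - \<xi>"] wB wL \<beta> B0 by simp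
    then show ?thesis unfolding abs_mult using cker_bound B0 by (intro mult_mono) auto
   qed
  qed
  then show ?thesis using V by simp
 qed
 have 2: "\<bar>LINT \<xi>|lborel. w (y - \<xi>) * (cker \<rho> G s t x \<xi> - cker \<rho> G s t y \<xi>)\<bar> <= B * (C * \<tau> * W * (N + 7) * ?p)"
 proof -
  have "\<bar>LINT \<xi>|lborel. w (y - \<xi>) * (cker \<rho> G s t x \<xi> - cker \<rho> G s t y \<xi>)\<bar> <= (B * (C * \<tau> * W * (N + 7) * ?p / V)) * V"
  proof (subst (2) V_def, rule integral_bound_compact_support)
   show "w (y - \<xi>) * (cker \<rho> G s t x \<xi> - cker \<rho> G s t y \<xi>) = 0" if "\<xi> \<notin> cball 0 \<epsilon>" for \<xi> using cker_outside[OF that] by simp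
   show "\<bar>w (y - \<xi>) * (cker \<rho> G s t x \<xi> - cker \<rho> G s t y \<xi>)\<bar> <= B * (C * \<tau> * W * (N + 7) * ?p / V)" for \<xi>
    unfolding abs_mult using wB cker_holder B0 by (intro mult_mono) auto
  qed
  then show ?thesis using V by simp
 qed
 have "\<bar>comm \<rho> G s t w x - comm \<rho> G s t w y\<bar> <= (3 * B * ?p) * (C * \<tau> * W * (N + 2)) + B * (C * \<tau> * W * (N + 7) * ?p)"
  unfolding eq by (rule order_trans[OF abs_triangle_ineq add_mono[OF 1 2]])
 also have "... = B * (C * W * (4 * N + 13)) * \<tau> * ?p" by (simp add: algebra_simps)
 finally show ?thesis by (simp add: \<tau>_def)
qed

lemma comm_outside:
 assumes "\<And>x. x \<notin> cball 0 R0 ==> w x = 0" "x \<notin> cball 0 (R0 + 1)"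
 shows "comm \<rho> G s t w x = 0"
proof -
 have z: "w (x - \<xi>) * cker \<rho> G s t x \<xi> = 0" for \<xi>
 proof (cases "\<xi> \<in> cball 0 \<epsilon>")
  case True
  then have "x - \<xi> \<notin> cball 0 R0" using assms(2) norm_triangle_ineq2[of x \<xi>] \<epsilon> by auto
  then show ?thesis using assms(1) by simp
 qed (use cker_outside in simp)
 show ?thesis unfolding comm_def z by simp
qed

lemma comm_diff:
 assumes "continuous_on UNIV w" "continuous_on UNIV w'"
 shows "comm \<rho> G s t (\<lambda>x. w x - w' x) x = comm \<rho> G s t w x - comm \<rho> G s t w' x"
 unfolding comm_def left_diff_distrib using int_cker[OF shift_cont[OF assms(1)]] int_cker[OF shift_cont[OF assms(2)]] by simp

text \<open>The substitution z = x - \<xi> identifies the commutator: \<open>wkc\<close> acts on the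
  mollified function, as in the continuity equation, and \<open>wk\<close> acts on the reflected
  kernel under the integral, as in the transport equation.\<close>

lemma comm_eq:
 assumes wc: "continuous_on UNIV w" and w0: "\<And>x. x \<notin> cball 0 R0 ==> w x = 0"
  and Gm: "Gm x \<bullet> dA s t x = (LINT z|lborel. w z * (G (x - z) \<bullet> dA s t x))"
 shows "comm \<rho> G s t w x = wkc s t (moll \<rho> w) Gm x + (LINT z|lborel. w z * wk s t (\<lambda>z. \<rho> (x - z)) (\<lambda>z. - G (x - z)) z)"
proof -
 define F where "F z = w z * cker \<rho> G s t x (x - z)" for z
 have int: "integrable lborel (\<lambda>z. w z * k z)" if "continuous_on UNIV k" for k
  by (rule integrable_compact_support[of _ R0]) (use w0 in \<open>auto intro!: continuous_intros wc that\<close>)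
 have Fi: "integrable lborel F" unfolding F_def by (rule int) (rule shift_cont[OF cker_cont])
 have i1: "integrable lborel (\<lambda>z. w z * (G (x - z) \<bullet> dA s t x))" by (rule int) (intro continuous_intros shift_cont)
 have i2: "integrable lborel (\<lambda>z. dc s t x * (w z * \<rho> (x - z)))" by (intro integrable_mult_right int shift_cont continuous_intros)
 have i3: "integrable lborel (\<lambda>z. w z * wk s t (\<lambda>z. \<rho> (x - z)) (\<lambda>z. - G (x - z)) z)"
  unfolding wk_def by (rule int) (intro continuous_intros shift_cont)
 have "comm \<rho> G s t w x = (LINT \<xi>|lborel. F (x - \<xi>))" by (simp add: comm_def F_def)
 also have "... = (LINT z|lborel. F z)" using borel_measurable_integrable[OF Fi] by (intro lborel_integral_reflect) simp
 also have "... = (LINT z|lborel. w z * (G (x - z) \<bullet> dA s t x) + dc s t x * (w z * \<rho> (x - z)) + w z * wk s t (\<lambda>z. \<rho> (x - z)) (\<lambda>z. - G (x - z)) z)"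
  by (rule Bochner_Integration.integral_cong) (auto simp: F_def cker_def wk_def inner_diff_right algebra_simps)
 also have "... = (LINT z|lborel. w z * (G (x - z) \<bullet> dA s t x)) + dc s t x * moll \<rho> w x + (LINT z|lborel. w z * wk s t (\<lambda>z. \<rho> (x - z)) (\<lambda>z. - G (x - z)) z)"
  unfolding moll_def using i1 i2 i3 by simp
 finally show ?thesis by (simp add: wkc_def Gm)
qed

lemma moll_close:
 assumes wc: "continuous_on UNIV w" and w0: "\<And>x. x \<notin> cball 0 R0 ==> w x = 0" and we: "\<And>\<xi>. norm \<xi> <= \<epsilon> ==> \<bar>w (x - \<xi>) - w x\<bar> <= e"
 shows "\<bar>moll \<rho> w x - w x\<bar> <= e"
proof -
 have ic: "integrable lborel (\<lambda>\<xi>. u \<xi> * \<rho> \<xi>)" if "continuous_on UNIV u" for u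
  by (rule integrable_compact_support[of _ \<epsilon>]) (use outside in \<open>auto intro!: continuous_intros that\<close>)
 have Fi: "integrable lborel (\<lambda>z. w z * \<rho> (x - z))"
  by (rule integrable_compact_support[of _ R0]) (use w0 in \<open>auto intro!: continuous_intros wc shift_cont\<close>)
 have "moll \<rho> w x = (LINT \<xi>|lborel. w (x - \<xi>) * \<rho> (x - (x - \<xi>)))"
  unfolding moll_def using borel_measurable_integrable[OF Fi] by (intro lborel_integral_reflect[symmetric]) simp
 then have "moll \<rho> w x - w x = (LINT \<xi>|lborel. w (x - \<xi>) * \<rho> \<xi>) - w x * (LINT \<xi>|lborel. \<rho> \<xi>)" by (simp add: \<rho>_int)
 also have "... = (LINT \<xi>|lborel. (w (x - \<xi>) - w x) * \<rho> \<xi>)"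
  unfolding left_diff_distrib using ic[OF shift_cont[OF wc]] ic[of "\<lambda>_. w x"] by simp
 finally have eq: "moll \<rho> w x - w x = (LINT \<xi>|lborel. (w (x - \<xi>) - w x) * \<rho> \<xi>)" .
 have i2: "integrable lborel (\<lambda>\<xi>. (w (x - \<xi>) - w x) * \<rho> \<xi>)" by (intro ic continuous_intros shift_cont wc)
 have "\<bar>LINT \<xi>|lborel. (w (x - \<xi>) - w x) * \<rho> \<xi>\<bar> <= (LINT \<xi>|lborel. \<bar>(w (x - \<xi>) - w x) * \<rho> \<xi>\<bar>)"
  using integral_norm_bound[of lborel "\<lambda>\<xi>. (w (x - \<xi>) - w x) * \<rho> \<xi>"] by simp
 also have "... <= (LINT \<xi>|lborel. e * \<rho> \<xi>)"
 proof (rule integral_mono)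
  show "integrable lborel (\<lambda>\<xi>. \<bar>(w (x - \<xi>) - w x) * \<rho> \<xi>\<bar>)" using i2 by (rule integrable_abs)
  show "integrable lborel (\<lambda>\<xi>. e * \<rho> \<xi>)" by (rule ic) (intro continuous_intros)
  show "\<bar>(w (x - \<xi>) - w x) * \<rho> \<xi>\<bar> <= e * \<rho> \<xi>" for \<xi>
  proof (cases "\<xi> \<in> cball 0 \<epsilon>")
   case True
   then have "\<bar>w (x - \<xi>) - w x\<bar> <= e" using we by simp
   then show ?thesis unfolding abs_mult using \<rho>0[of \<xi>] by (simp add: mult_right_mono)
  qed (use outside in simp)
 qed
 also have "... = e" by (simp add: \<rho>_int)
 finally show ?thesis unfolding eq .
qed

end

lemma comm_add:
 assumes ker: "kernel W \<epsilon> \<rho> G Q" and \<epsilon>: "0 < \<epsilon>" "\<epsilon> <= 1" and I: "a \<in> I" "b \<in> I" "d \<in> I" and wc: "continuous_on UNIV w"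
 shows "comm \<rho> G a d w x = comm \<rho> G a b w x + comm \<rho> G b d w x"
proof -
 have "cker \<rho> G a d x \<xi> = cker \<rho> G a b x \<xi> + cker \<rho> G b d x \<xi>" for \<xi>
 proof -
  have "diva a d y = diva a b y + diva b d y" for y
   by (simp add: diva_def da_def sum.distrib[symmetric] inner_add_left[symmetric])
  then show ?thesis by (simp add: cker_def dA_def dc_def algebra_simps inner_diff_right)
 qed
 moreover have "integrable lborel (\<lambda>\<xi>. w (x - \<xi>) * cker \<rho> G a b x \<xi>)" "integrable lborel (\<lambda>\<xi>. w (x - \<xi>) * cker \<rho> G b d x \<xi>)"
  by (rule int_cker[OF ker \<epsilon> I(1,2) shift_cont[OF ker \<epsilon> I(1,2) wc]])
   (rule int_cker[OF ker \<epsilon> I(2,3) shift_cont[OF ker \<epsilon> I(2,3) wc]])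
 ultimately show ?thesis unfolding comm_def by (simp add: distrib_left)
qed

end

section \<open>Duality between the two equations\<close>

lemma le_of_small:
 fixes y a M :: real
 assumes "0 <= M" "\<And>e. 0 < e ==> e <= 1 ==> y <= a + e * M" shows "y <= a"
proof (rule field_le_epsilon)
 fix e :: real assume e: "0 < e"
 have "y <= a + min 1 (e / (M + 1)) * M" using assms(1) e by (intro assms(2)) auto
 also have "... <= a + e / (M + 1) * M" using assms(1) by (intro add_left_mono mult_right_mono) auto
 also have "... <= a + e" using assms(1) e by (simp add: field_simps)
 finally show "y <= a + e" .
qed

text \<open>A Lipschitz cutoff is enough, since the cut function is mollified before it serves as a
  smooth test function.\<close>

definition cut :: "real => 'a::euclidean_space => real" where "cut r y = max 0 (min 1 (r + 1 - norm y))"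

lemma cut_props:
 fixes x y :: "'a::euclidean_space"
 shows "0 <= cut r x" "cut r x <= 1" "\<bar>cut r x - cut r y\<bar> <= norm (x - y)"
  "norm x <= r ==> cut r x = 1" "x \<notin> cball 0 (r + 1) ==> cut r x = 0"
 using norm_triangle_ineq3[of x y] by (auto simp: cut_def)

lemma cutoff_bounds:
 fixes u :: "real => 'a::euclidean_space => real"
 assumes u: "fun_class T \<alpha> u"
 shows "\<exists>B. (\<forall>t\<in>{0..T}. \<forall>x. \<bar>cut r x * u t x\<bar> <= B) \<and>
  (\<forall>t\<in>{0..T}. \<forall>x y. \<bar>cut r x * u t x - cut r y * u t y\<bar> <= B * norm (x - y)) \<and>
  (\<forall>s\<in>{0..T}. \<forall>t\<in>{0..T}. \<forall>x. \<bar>cut r x * u t x - cut r x * u s x\<bar> <= B * \<bar>t - s\<bar> powr \<alpha>)"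
proof -
 obtain B1 where B1: "0 <= B1" "\<And>t x. t \<in> {0..T} ==> x \<in> cball 0 (r + 1) ==> \<bar>u t x\<bar> <= B1"
  using compact_bound_joint[OF fun_classD(1)[OF u], of "r + 1"] by auto
 obtain g where g: "continuous_on ({0..T} \<times> UNIV) (\<lambda>(t, x). g t x)" "\<And>t x. t \<in> {0..T} ==> (u t has_derivative (\<lambda>h. g t x \<bullet> h)) (at x)"
  using fun_classD(4)[OF u] by blast
 obtain B2 where B2: "0 <= B2" "\<And>t x. t \<in> {0..T} ==> x \<in> cball 0 (r + 1) ==> norm (g t x) <= B2"
  using compact_bound_joint[OF g(1), of "r + 1"] by blast
 obtain B3 where B3: "0 <= B3" "\<And>s t x. s \<in> {0..T} ==> t \<in> {0..T} ==> norm x <= r + 1 ==> \<bar>u t x - u s x\<bar> <= B3 * \<bar>t - s\<bar> powr \<alpha>"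
  using fun_classD(3)[OF u, of "r + 1"] by blast
 have out: "\<bar>cut r x * u t x - cut r y * u t y\<bar> <= B1 * norm (x - y)" if t: "t \<in> {0..T}" and y: "y \<notin> cball 0 (r + 1)" for t x y
 proof (cases "x \<in> cball 0 (r + 1)")
  case True
  have "\<bar>cut r x - cut r y\<bar> * \<bar>u t x\<bar> <= norm (x - y) * B1"
   by (rule mult_mono[OF cut_props(3) B1(2)[OF t True]]) auto
  then show ?thesis using cut_props(5)[OF y] by (simp add: abs_mult mult.commute)
 qed (use y B1 in \<open>simp add: cut_props(5)\<close>)
 show ?thesis
 proof (intro exI[of _ "B1 + B2 + B3"] conjI ballI allI)
  fix t x assume t: "t \<in> {0..T}"
  show "\<bar>cut r x * u t x\<bar> <= B1 + B2 + B3"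
  proof (cases "x \<in> cball 0 (r + 1)")
   case True
   have "\<bar>cut r x\<bar> * \<bar>u t x\<bar> <= 1 * B1"
    by (rule mult_mono[OF _ B1(2)[OF t True]]) (use cut_props(1,2)[of r x] in auto)
   then show ?thesis using B2(1) B3(1) by (simp add: abs_mult)
  qed (use B1 B2 B3 in \<open>simp add: cut_props(5)\<close>)
  fix y
  have "\<bar>cut r x * u t x - cut r y * u t y\<bar> <= (B1 + B2) * norm (x - y)"
  proof -
   consider "y \<notin> cball 0 (r + 1)" | "x \<notin> cball 0 (r + 1)" | "x \<in> cball 0 (r + 1)" "y \<in> cball 0 (r + 1)" by blast
   then show ?thesis
   proof cases
    case 1
    show ?thesis using out[OF t 1, of x] mult_nonneg_nonneg[OF B2(1) norm_ge_zero[of "x - y"]] unfolding distrib_right by linarith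
   next
    case 2
    show ?thesis using out[OF t 2, of y] mult_nonneg_nonneg[OF B2(1) norm_ge_zero[of "x - y"]]
     unfolding distrib_right norm_minus_commute[of y x] abs_minus_commute[of "cut r y * u t y"] by linarith
   next
    case 3
    have "cut r x * u t x - cut r y * u t y = (cut r x - cut r y) * u t x + cut r y * (u t x - u t y)" by (simp add: algebra_simps)
    moreover have "\<bar>(cut r x - cut r y) * u t x\<bar> <= norm (x - y) * B1"
     unfolding abs_mult by (rule mult_mono[OF cut_props(3) B1(2)[OF t 3(1)]]) auto
    moreover have "\<bar>cut r y * (u t x - u t y)\<bar> <= 1 * (B2 * norm (x - y))"
     unfolding abs_mult
     by (rule mult_mono[OF _ lipschitz_of_gradient[OF g(2)[OF t] B2(2)[OF t] 3]]) (use cut_props(1,2)[of r y] in auto)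
    ultimately show ?thesis unfolding distrib_right by (simp add: mult.commute)
   qed
  qed
  then show "\<bar>cut r x * u t x - cut r y * u t y\<bar> <= (B1 + B2 + B3) * norm (x - y)"
   using mult_nonneg_nonneg[OF B3(1) norm_ge_zero[of "x - y"]] unfolding distrib_right by linarith
 next
  fix s t x assume st: "s \<in> {0..T}" "t \<in> {0..T}"
  have "\<bar>cut r x * u t x - cut r x * u s x\<bar> <= B3 * \<bar>t - s\<bar> powr \<alpha>"
  proof (cases "x \<in> cball 0 (r + 1)")
   case True
   have "\<bar>cut r x\<bar> * \<bar>u t x - u s x\<bar> <= 1 * (B3 * \<bar>t - s\<bar> powr \<alpha>)"
    by (rule mult_mono[OF _ B3(2)[OF st]]) (use True cut_props(1,2)[of r x] in auto)
   then show ?thesis by (simp add: abs_mult[symmetric] right_diff_distrib)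
  qed (use B3 in \<open>simp add: cut_props(5)\<close>)
  also have "B3 * \<bar>t - s\<bar> powr \<alpha> <= (B1 + B2 + B3) * \<bar>t - s\<bar> powr \<alpha>" using B1(1) B2(1) by (intro mult_right_mono) auto
  finally show "\<bar>cut r x * u t x - cut r x * u s x\<bar> <= (B1 + B2 + B3) * \<bar>t - s\<bar> powr \<alpha>" .
 qed
qed

section \<open>The pairing is constant in time\<close>

context transport_coeffs
begin

text \<open>\<open>S\<close> is where the measures are seen: v t is bounded through values on S, and
  w has to satisfy the transport expansion only against kernels of radius at most 1 centred in S. A
  cutoff may thus destroy the equation elsewhere. The setting covers a moving Dirac mass, with S its
  trajectory, and a general measure, with S a ball.\<close>

context
 fixes v :: "real => ('a => real) => real" and w :: "real => 'a => real" and B R0 Cv K :: real and S :: "'a set"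
 assumes v: "weak_sol_continuity T \<alpha> \<beta> A c v"
  and w0: "\<And>t x. t \<in> I ==> x \<notin> cball 0 R0 ==> w t x = 0" and wB: "\<And>t x. t \<in> I ==> \<bar>w t x\<bar> <= B"
  and wL: "\<And>t x y. t \<in> I ==> \<bar>w t x - w t y\<bar> <= B * norm (x - y)"
  and wt: "\<And>s t x. s \<in> I ==> t \<in> I ==> \<bar>w t x - w s x\<bar> <= B * \<bar>t - s\<bar> powr \<alpha>"
  and w_sol: "\<And>s t x R Q \<phi> G. 0 <= s ==> s <= t ==> t <= T ==> x \<in> S ==> R <= 1 ==> tame R Q \<phi> G ==> \<phi> \<in> Cinf_c ==>
   \<bar>fun_dist w t (\<lambda>z. \<phi> (x - z)) - fun_dist w s (\<lambda>z. \<phi> (x - z)) -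
    fun_dist w s (wk s t (\<lambda>z. \<phi> (x - z)) (\<lambda>z. - G (x - z)))\<bar> <= K * Q * (t - s) powr \<theta>"
  and K: "0 <= K" and Cv: "0 <= Cv"
  and vS: "\<And>t F e. t \<in> I ==> F \<in> C0_K (cball 0 (R0 + 1)) ==> 0 <= e ==> (\<And>x. x \<in> S ==> \<bar>F x\<bar> <= e) ==> \<bar>v t F\<bar> <= Cv * e"
begin

private lemma B0: "0 <= B" using wB[OF zero_I, of 0] abs_ge_zero order_trans by blast
private lemma wc: "t \<in> I ==> continuous_on UNIV (w t)"
 by (rule holder_imp_continuous_on[of 1 _ B]) (use wL in auto)
private lemma dc: "dist_class T \<alpha> \<beta> v" by (rule v[unfolded weak_sol_continuity_eq, THEN conjunct1])
private lemma lin: "t \<in> I ==> linear_on_Cc (v t)" by (rule dist_classD(1)[OF dc])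
private lemma C0c: "f \<in> C0_K (cball 0 R) ==> f \<in> C0_c" by (rule C0_KD(1)[OF _ compact_cball])

private lemma comm_C0_K:
 assumes "kernel W \<epsilon> \<rho> G Q" "0 < \<epsilon>" "\<epsilon> <= 1" "s \<in> I" "t \<in> I" "a \<in> I"
 shows "comm \<rho> G s t (w a) \<in> C0_K (cball 0 (R0 + 1))"
proof -
 have "continuous_on UNIV (comm \<rho> G s t (w a))"
  by (rule holder_imp_continuous_on[OF \<beta>(1)]) (use comm_holder[OF assms(1-5) wc wB wL] assms(6) in simp)
 then show ?thesis using comm_outside[where w = "w a" and ?R0.0 = R0, OF assms(1-5) w0[OF assms(6)]] unfolding C0_K_def by blast
qed

text \<open>The defect splits into v b - v a tested with a commutator, of order \<alpha> * \<beta> +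
  \<alpha>, and v b tested with the commutator of w a - w b, of order 2 * \<alpha>. The constants
  involve \<open>W\<close> but not the kernel bound \<open>Q\<close>, so they are uniform in
  \<epsilon>.\<close>

private lemma tested_germ:
 assumes ker: "kernel W \<epsilon> \<rho> G Q" "0 < \<epsilon>" "\<epsilon> <= 1" and W: "0 <= W"
  and D: "0 <= D" "\<forall>s\<in>I. \<forall>t\<in>I. \<forall>f\<in>Cbeta_K \<beta> (cball 0 (R0 + 1)). \<bar>v t f - v s f\<bar> <= D * \<bar>t - s\<bar> powr (\<alpha> * \<beta>) * holder_norm \<beta> f"
  and abd: "0 <= a" "a <= b" "b <= d" "d <= T"
 shows "\<bar>v a (comm \<rho> G a d (w a)) - v a (comm \<rho> G a b (w a)) - v b (comm \<rho> G b d (w b))\<bar> <=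
  (D * (B * (C * W * (N + 2)) + B * (C * W * (4 * N + 13))) + Cv * (B * (C * W * (N + 2))) * T powr (2 * \<alpha> - \<theta>)) * (d - a) powr \<theta>"
proof -
 have I: "a \<in> I" "b \<in> I" "d \<in> I" using abd by auto
 define f where "f = comm \<rho> G b d (w a)"
 define g where "g = comm \<rho> G b d (w b)"
 define H where "H = B * (C * W * (N + 2)) + B * (C * W * (4 * N + 13))"
 define q where "q = \<bar>d - b\<bar> powr \<alpha>"
 have H: "0 <= H" and X: "0 <= B * (C * W * (N + 2))" using B0 C0 W N by (auto simp: H_def)
 have q: "0 <= q" "q <= (d - a) powr \<alpha>" unfolding q_def using abd \<alpha> by (auto intro: powr_mono2)
 note fK = comm_C0_K[OF ker I(2,3,1), folded f_def] and gK = comm_C0_K[OF ker I(2,3,2), folded g_def]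
 have fH: "\<bar>f x - f y\<bar> <= B * (C * W * (4 * N + 13)) * q * norm (x - y) powr \<beta>" for x y
  unfolding f_def q_def by (rule comm_holder[OF ker I(2,3) wc[OF I(1)] wB[OF I(1)] wL[OF I(1)]])
 have fB: "\<bar>f x\<bar> <= B * (C * W * (N + 2)) * q" for x
  unfolding f_def q_def by (rule comm_bound[OF ker I(2,3) wB[OF I(1)]])
 have fC: "f \<in> Cbeta_K \<beta> (cball 0 (R0 + 1))"
  using fH fK unfolding Cbeta_K_def C0_K_def dist_norm by blast
 have hn: "holder_norm \<beta> f <= H * q" using holder_norm_le[of f, OF fB fH] by (simp add: H_def algebra_simps)
 have \<theta>': "(d - a) powr (\<alpha> * \<beta>) * (d - a) powr \<alpha> = (d - a) powr \<theta>" by (simp add: powr_add[symmetric] \<theta>_def algebra_simps)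
 have 1: "\<bar>v b f - v a f\<bar> <= (D * H) * (d - a) powr \<theta>"
 proof -
  have "\<bar>v b f - v a f\<bar> <= D * \<bar>b - a\<bar> powr (\<alpha> * \<beta>) * holder_norm \<beta> f" using D(2) I fC by blast
  also have "... <= D * (d - a) powr (\<alpha> * \<beta>) * (H * (d - a) powr \<alpha>)"
  proof (rule mult_mono)
   show "D * \<bar>b - a\<bar> powr (\<alpha> * \<beta>) <= D * (d - a) powr (\<alpha> * \<beta>)"
    using abd \<alpha> \<beta> D(1) by (intro mult_left_mono powr_mono2) auto
   show "holder_norm \<beta> f <= H * (d - a) powr \<alpha>" by (rule order_trans[OF hn mult_left_mono[OF q(2) H]])
   show "0 <= D * (d - a) powr (\<alpha> * \<beta>)" using D(1) by simp
   show "0 <= holder_norm \<beta> f" by (rule Cbeta_KD(4)[OF fC compact_cball \<beta>(1)])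
  qed
  also have "... = (D * H) * (d - a) powr \<theta>" unfolding \<theta>'[symmetric] by (simp add: mult_ac)
  finally show ?thesis .
 qed
 have 2: "\<bar>v b f - v b g\<bar> <= Cv * (B * (C * W * (N + 2))) * T powr (2 * \<alpha> - \<theta>) * (d - a) powr \<theta>"
 proof -
  have "v b f - v b g = v b (\<lambda>x. f x - g x)" by (rule linear_on_Cc_comb(1)[OF lin[OF I(2)] C0c[OF fK] C0c[OF gK], symmetric])
  moreover have "\<bar>v b (\<lambda>x. f x - g x)\<bar> <= Cv * ((B * \<bar>b - a\<bar> powr \<alpha>) * (C * W * (N + 2)) * q)"
  proof (rule vS[OF I(2) C0_K_diff[OF fK gK]])
   show "0 <= B * \<bar>b - a\<bar> powr \<alpha> * (C * W * (N + 2)) * q" using B0 C0 W N q by simp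
   have "f x - g x = comm \<rho> G b d (\<lambda>x. w a x - w b x) x" for x
    unfolding f_def g_def by (rule comm_diff[OF ker I(2,3) wc[OF I(1)] wc[OF I(2)], symmetric])
   then show "\<bar>f x - g x\<bar> <= B * \<bar>b - a\<bar> powr \<alpha> * (C * W * (N + 2)) * q" for x
    unfolding q_def using comm_bound[OF ker I(2,3), of "\<lambda>x. w a x - w b x"] wt[OF I(2,1)] by (simp add: abs_minus_commute)
  qed
  moreover have "\<bar>b - a\<bar> powr \<alpha> * q <= T powr (2 * \<alpha> - \<theta>) * (d - a) powr \<theta>"
  proof -
   have "\<bar>b - a\<bar> powr \<alpha> * q <= (d - a) powr \<alpha> * (d - a) powr \<alpha>"
    using abd \<alpha> q by (intro mult_mono powr_mono2) auto
   then show ?thesis using powr_2\<alpha>[of "d - a"] abd by simp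
  qed
  then have "Cv * (B * (C * W * (N + 2))) * (\<bar>b - a\<bar> powr \<alpha> * q) <= Cv * (B * (C * W * (N + 2))) * (T powr (2 * \<alpha> - \<theta>) * (d - a) powr \<theta>)"
   using Cv X by (intro mult_left_mono) auto
  ultimately show ?thesis by (simp add: mult_ac)
 qed
 have "comm \<rho> G a d (w a) = (\<lambda>x. comm \<rho> G a b (w a) x + f x)"
  unfolding f_def by (rule ext) (rule comm_add[OF ker I wc[OF I(1)]])
 then have "v a (comm \<rho> G a d (w a)) = v a (comm \<rho> G a b (w a)) + v a f"
  using linear_on_Cc_comb(2)[OF lin[OF I(1)] C0c[OF comm_C0_K[OF ker I(1,2,1)]] C0c[OF fK]] by simp
 then have "v a (comm \<rho> G a d (w a)) - v a (comm \<rho> G a b (w a)) - v b (comm \<rho> G b d (w b)) = (v b f - v b g) - (v b f - v a f)"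
  by (simp add: g_def)
 then have "\<bar>v a (comm \<rho> G a d (w a)) - v a (comm \<rho> G a b (w a)) - v b (comm \<rho> G b d (w b))\<bar> <= \<bar>v b f - v b g\<bar> + \<bar>v b f - v a f\<bar>"
  using abs_triangle_ineq4 by metis
 also note add_mono[OF 2 1]
 finally show ?thesis by (simp add: H_def algebra_simps)
qed

text \<open>A product rule: the continuity equation handles the change of v, the transport equation
  tested with the reflected kernel handles the change of w on S, and the mixed term has order
  \<alpha> * \<beta> + \<alpha>. The constant involves \<open>Q\<close> and is not controlled in
  \<epsilon>; later only its existence matters.\<close>

private lemma moll_expansion:
 assumes ker: "kernel W \<epsilon> \<rho> G Q" "0 < \<epsilon>" "\<epsilon> <= 1"
 shows "\<exists>M. \<forall>s t. 0 <= s --> s <= t --> t <= T -->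
  \<bar>v t (moll \<rho> (w t)) - v s (moll \<rho> (w s)) - v s (comm \<rho> G s t (w s))\<bar> <= M * (t - s) powr \<theta>"
proof -
 obtain D where D: "0 <= D" "\<And>s t f. s \<in> I ==> t \<in> I ==> f \<in> Cbeta_K \<beta> (cball 0 (R0 + 1)) ==>
   \<bar>v t f - v s f\<bar> <= D * \<bar>t - s\<bar> powr (\<alpha> * \<beta>) * holder_norm \<beta> f"
  using dist_classD(3)[OF dc \<beta>(1), of "R0 + 1"] by blast
 obtain K' where K': "\<And>s t Q \<phi> G. 0 <= s ==> s <= t ==> t <= T ==> tame (R0 + \<epsilon>) Q \<phi> G ==> \<phi> \<in> Cinf_c ==>
  \<bar>v t \<phi> - v s \<phi> - v s (wkc s t \<phi> G)\<bar> <= K' * Q * (t - s) powr \<theta>"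
  using continuity_expansion[OF v, of "R0 + \<epsilon>"] by blast
 define Vl where "Vl = measure lborel (cball (0::'a) R0)"
 have \<rho>: "\<rho> \<in> Cinf_c" "tame \<epsilon> Q \<rho> G" using ker by (auto simp: kernel_def)
 note \<rho>c = tameD(9)[OF \<rho>(2)]
 have Q0: "0 <= Q" by (rule tameD(7)[OF \<rho>(2)])
 have sub: "f \<in> C0_K (cball 0 (R0 + 1))" if "continuous_on UNIV f" "\<And>x. x \<notin> cball 0 (R0 + \<epsilon>) ==> f x = 0" for f :: "'a => real"
  using that ker(3) by (auto simp: C0_K_def)
 show ?thesis
 proof (intro exI[of _ "K' * (B * Q * Vl) + Cv * (K * Q) + D * (4 * (B * Q * Vl))"] allI impI)
  fix s t :: real assume st: "0 <= s" "s <= t" "t <= T"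
  then have I: "s \<in> I" "t \<in> I" by auto
  note ws = wc[OF I(1)] w0[OF I(1)] wB[OF I(1)] and wt' = wc[OF I(2)] w0[OF I(2)] wB[OF I(2)]
  define \<tau> where "\<tau> = \<bar>t - s\<bar> powr \<alpha>"
  define ms where "ms = moll \<rho> (w s)"
  \<comment> \<open>Mollified time increment of w. Its bounds carry the factor \<tau>, which makes
    the mixed term v t d - v s d small.\<close>
  define d where "d x = moll \<rho> (w t) x - ms x" for x
  obtain Gm where Gm: "tame (R0 + \<epsilon>) (B * Q * Vl) ms Gm" "\<And>x h. Gm x \<bullet> h = (LINT z|lborel. w s z * (G (x - z) \<bullet> h))"
   using moll_tame[OF ws \<rho>(2)] unfolding Vl_def ms_def by blast
  have d_eq: "moll \<rho> (\<lambda>x. w t x - w s x) = d"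
   unfolding moll_def[abs_def] d_def[abs_def] ms_def left_diff_distrib
   using moll_integrable[OF ws \<rho>c] moll_integrable[OF wt' \<rho>c] by simp
  obtain Gd where Gd: "tame (R0 + \<epsilon>) ((B * \<tau>) * Q * Vl) d Gd"
   using moll_tame[of "\<lambda>x. w t x - w s x" R0 "B * \<tau>", OF _ _ _ \<rho>(2)] ws wt' wt[OF I]
   unfolding d_eq Vl_def \<tau>_def by (force intro: continuous_intros)
  have msC: "ms \<in> Cinf_c" unfolding Cinf_c_iff
   using moll_smooth[OF ws \<rho>(1)] tameD(2)[OF Gm(1)] unfolding ms_def by blast
  have msK: "ms \<in> C0_K (cball 0 (R0 + 1))" by (rule sub[OF tameD(9,2)[OF Gm(1)]])
  have dK: "d \<in> C0_K (cball 0 (R0 + 1))" by (rule sub[OF tameD(9,2)[OF Gd]])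
  define k where "k = wkc s t ms Gm"
  have kK: "k \<in> C0_K (cball 0 (R0 + 1))" unfolding k_def by (rule sub[OF wkc_props(4,3)[OF I Gm(1)]])
  define e where "e = comm \<rho> G s t (w s)"
  have eK: "e \<in> C0_K (cball 0 (R0 + 1))" unfolding e_def by (rule comm_C0_K[OF ker I I(1)])
  \<comment> \<open>The commutator minus the continuity part; by \<open>comm_eq\<close> its value at
    x is the transport germ tested with the kernel centred at x.\<close>
  define n where "n x = e x - k x" for x
  have nK: "n \<in> C0_K (cball 0 (R0 + 1))" unfolding n_def[abs_def] by (rule C0_K_diff[OF eK kK])
  have 1: "\<bar>v t ms - v s ms - v s k\<bar> <= K' * (B * Q * Vl) * (t - s) powr \<theta>"
   unfolding k_def by (rule K'[OF st Gm(1) msC])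
  have 2: "\<bar>v s d - v s n\<bar> <= Cv * (K * Q) * (t - s) powr \<theta>"
  proof -
   have "v s d - v s n = v s (\<lambda>x. d x - n x)" by (rule linear_on_Cc_comb(1)[OF lin[OF I(1)] C0c[OF dK] C0c[OF nK], symmetric])
   moreover have "\<bar>v s (\<lambda>x. d x - n x)\<bar> <= Cv * (K * Q * (t - s) powr \<theta>)"
   proof (rule vS[OF I(1) C0_K_diff[OF dK nK]])
    show "0 <= K * Q * (t - s) powr \<theta>" using K Q0 by simp
    fix x assume x: "x \<in> S"
    have "d x - n x = fun_dist w t (\<lambda>z. \<rho> (x - z)) - fun_dist w s (\<lambda>z. \<rho> (x - z)) -
      fun_dist w s (wk s t (\<lambda>z. \<rho> (x - z)) (\<lambda>z. - G (x - z)))"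
     using comm_eq[where w = "w s" and ?R0.0 = R0 and Gm = Gm and x = x, OF ker I ws(1) ws(2) Gm(2)] by (simp add: n_def e_def k_def ms_def d_def fun_dist_def moll_def[of \<rho> "w s" x] moll_def[of \<rho> "w t" x])
    then show "\<bar>d x - n x\<bar> <= K * Q * (t - s) powr \<theta>" using w_sol[OF st x ker(3) \<rho>(2,1)] by simp
   qed
   ultimately show ?thesis by (simp add: mult_ac)
  qed
  have 3: "\<bar>v t d - v s d\<bar> <= D * (4 * (B * Q * Vl)) * (t - s) powr \<theta>"
  proof -
   let ?Q = "(B * \<tau>) * Q * Vl"
   have h: "\<bar>d x - d y\<bar> <= (?Q + 2 * ?Q) * norm (x - y) powr \<beta>" for x y
    by (rule lipschitz_imp_holder[OF tameD(4,8)[OF Gd] \<beta> tameD(7)[OF Gd]])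
   have dC: "d \<in> Cbeta_K \<beta> (cball 0 (R0 + 1))" using h dK unfolding Cbeta_K_def C0_K_def dist_norm by blast
   have "holder_norm \<beta> d <= ?Q + (?Q + 2 * ?Q)" by (rule holder_norm_le[OF tameD(4)[OF Gd] h])
   then have "D * \<bar>t - s\<bar> powr (\<alpha> * \<beta>) * holder_norm \<beta> d <= D * \<bar>t - s\<bar> powr (\<alpha> * \<beta>) * (?Q + (?Q + 2 * ?Q))"
    using D(1) by (intro mult_left_mono) auto
   also have "... = D * (4 * (B * Q * Vl)) * (\<bar>t - s\<bar> powr (\<alpha> * \<beta>) * \<tau>)" by (simp add: algebra_simps)
   also have "\<bar>t - s\<bar> powr (\<alpha> * \<beta>) * \<tau> = (t - s) powr \<theta>"
    using st by (simp add: \<tau>_def powr_add[symmetric] \<theta>_def algebra_simps)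
   finally show ?thesis using D(2)[OF I dC] by linarith
  qed
  have "moll \<rho> (w t) = (\<lambda>x. ms x + d x)" by (simp add: d_def fun_eq_iff)
  then have "v t (moll \<rho> (w t)) = v t ms + v t d"
   using linear_on_Cc_comb(2)[OF lin[OF I(2)] C0c[OF msK] C0c[OF dK]] by simp
  moreover have "v s n = v s e - v s k"
   unfolding n_def[abs_def] by (rule linear_on_Cc_comb(1)[OF lin[OF I(1)] C0c[OF eK] C0c[OF kK]])
  ultimately have "v t (moll \<rho> (w t)) - v s (moll \<rho> (w s)) - v s (comm \<rho> G s t (w s)) =
    (v t ms - v s ms - v s k) + (v s d - v s n) + (v t d - v s d)" by (simp add: ms_def e_def)
  then show "\<bar>v t (moll \<rho> (w t)) - v s (moll \<rho> (w s)) - v s (comm \<rho> G s t (w s))\<bar> <=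
    (K' * (B * Q * Vl) + Cv * (K * Q) + D * (4 * (B * Q * Vl))) * (t - s) powr \<theta>"
   unfolding distrib_right using 1 2 3 by linarith
 qed
qed

text \<open>Sewing replaces the uncontrolled constant of \<open>moll_expansion\<close> by that of
  \<open>tested_germ\<close>. With the time step fixed, \<epsilon> may then tend to 0: the germ and
  the mollification error are of order \<epsilon>. The pairing is left with increments of order
  \<theta> > 1.\<close>

lemma duality_const:
 assumes t: "t \<in> I" shows "v t (w t) = v 0 (w 0)"
proof -
 obtain D where D: "0 <= D" "\<forall>s\<in>I. \<forall>t\<in>I. \<forall>f\<in>Cbeta_K \<beta> (cball 0 (R0 + 1)).
   \<bar>v t f - v s f\<bar> <= D * \<bar>t - s\<bar> powr (\<alpha> * \<beta>) * holder_norm \<beta> f"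
  using dist_classD(3)[OF dc \<beta>(1), of "R0 + 1"] by blast
 obtain W where W: "0 <= W" "\<And>\<epsilon>. 0 < \<epsilon> ==> \<exists>(\<rho>::'a => real) G Q. kernel W \<epsilon> \<rho> G Q" using kernel_exists by blast
 define K5 where "K5 = D * (B * (C * W * (N + 2)) + B * (C * W * (4 * N + 13))) + Cv * (B * (C * W * (N + 2))) * T powr (2 * \<alpha> - \<theta>)"
 have K5: "0 <= K5" unfolding K5_def using D(1) B0 C0 W N Cv by simp
 have key: "norm (v b (w b) - v a (w a) - 0) <= sewing_const \<theta> * K5 * (b - a) powr \<theta>" if ab: "0 <= a" "a <= b" "b <= T" for a b
 proof (rule le_of_small)
  have I: "a \<in> I" "b \<in> I" using ab by auto
  define M where "M = Cv * (B * (C * (W * (N + 2) + 1)) * \<bar>b - a\<bar> powr \<alpha>) + 2 * (Cv * B)"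
  show "0 <= M" unfolding M_def using Cv B0 C0 W N by simp
  fix \<epsilon> :: real assume \<epsilon>: "0 < \<epsilon>" "\<epsilon> <= 1"
  then obtain \<rho> :: "'a => real" and G Q where "kernel W \<epsilon> \<rho> G Q" using W(2) by blast
  note ker = this \<epsilon>
  obtain Me where Me: "\<And>s t. 0 <= s ==> s <= t ==> t <= T ==>
    \<bar>v t (moll \<rho> (w t)) - v s (moll \<rho> (w s)) - v s (comm \<rho> G s t (w s))\<bar> <= Me * (t - s) powr \<theta>"
   using moll_expansion[OF ker] by blast
  have 1: "norm (v b (moll \<rho> (w b)) - v a (moll \<rho> (w a)) - v a (comm \<rho> G a b (w a))) <= sewing_const \<theta> * K5 * (b - a) powr \<theta>"
  \<comment> \<open>The expansion with \<open>Me\<close> serves only to produce the Riemann limits;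
    the constant that comes back depends on the defect bound \<open>K5\<close> alone.\<close>
  proof (rule expansion_of_riemann_lim[OF \<theta>1 K5, of 0 T "\<lambda>s t. v s (comm \<rho> G s t (w s))" _ "v 0 (moll \<rho> (w 0))"])
   show "riemann_lim (\<lambda>ts. \<Sum>i<length ts - 1. v (ts ! i) (comm \<rho> G (ts ! i) (ts ! Suc i) (w (ts ! i)))) 0 t
     (v t (moll \<rho> (w t)) - v 0 (moll \<rho> (w 0)))" if "0 <= t" "t <= T" for t
    by (rule riemann_lim_of_expansion[OF that(1) \<theta>1, where M = Me]) (use Me that in auto)
   show "norm (v a (comm \<rho> G a d (w a)) - v a (comm \<rho> G a b (w a)) - v b (comm \<rho> G b d (w b))) <= K5 * (d - a) powr \<theta>"
    if "0 <= a" "a <= b" "b <= d" "d <= T" for a b d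
    unfolding K5_def real_norm_def by (rule tested_germ[OF ker W(1) D that])
   \<comment> \<open>For s = t the expansion itself forces this, since 0 powr \<theta> = 0.\<close>
   show "v a (comm \<rho> G a a (w a)) = 0" if "0 <= a" "a <= T" for a
    using Me[of a a] that by simp
  qed (use ab in auto)
  have 2: "\<bar>v a (comm \<rho> G a b (w a))\<bar> <= Cv * (B * \<epsilon> * (C * (W * (N + 2) + 1)) * \<bar>b - a\<bar> powr \<alpha>)"
  proof (rule vS[OF I(1) comm_C0_K[OF ker I I(1)]])
   show "0 <= B * \<epsilon> * (C * (W * (N + 2) + 1)) * \<bar>b - a\<bar> powr \<alpha>" using B0 C0 W N \<epsilon> by simp
  qed (rule comm_small[OF ker I wc[OF I(1)] wB[OF I(1)] wL[OF I(1)]])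
  have 3: "\<bar>v s (moll \<rho> (w s)) - v s (w s)\<bar> <= Cv * (B * \<epsilon>)" if s: "s \<in> I" for s
  proof -
   have \<rho>: "tame \<epsilon> Q \<rho> G" using ker by (simp add: kernel_def)
   obtain Gm Q' where Gm: "tame (R0 + \<epsilon>) Q' (moll \<rho> (w s)) Gm"
    using moll_tame[OF wc[OF s] w0[OF s] wB[OF s] \<rho>] by blast
   have mK: "moll \<rho> (w s) \<in> C0_K (cball 0 (R0 + 1))"
    using tameD(9,2)[OF Gm] \<epsilon> by (auto simp: C0_K_def)
   have wK: "w s \<in> C0_K (cball 0 (R0 + 1))" using wc[OF s] w0[OF s] by (auto simp: C0_K_def)
   have "v s (moll \<rho> (w s)) - v s (w s) = v s (\<lambda>x. moll \<rho> (w s) x - w s x)"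
    by (rule linear_on_Cc_comb(1)[OF lin[OF s] C0c[OF mK] C0c[OF wK], symmetric])
   moreover have "\<bar>v s (\<lambda>x. moll \<rho> (w s) x - w s x)\<bar> <= Cv * (B * \<epsilon>)"
   proof (rule vS[OF s C0_K_diff[OF mK wK]])
    show "\<bar>moll \<rho> (w s) x - w s x\<bar> <= B * \<epsilon>" for x
    proof (rule moll_close[OF ker I wc[OF s] w0[OF s]])
     fix \<xi> :: 'a assume "norm \<xi> <= \<epsilon>"
     then show "\<bar>w s (x - \<xi>) - w s x\<bar> <= B * \<epsilon>"
      using wL[OF s, of "x - \<xi>" x] mult_left_mono[OF _ B0, of "norm \<xi>" \<epsilon>] by simp
    qed
   qed (use B0 \<epsilon> in simp)
   ultimately show ?thesis by simp
  qed
  have "norm (v b (w b) - v a (w a) - 0) <= sewing_const \<theta> * K5 * (b - a) powr \<theta> +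
    Cv * (B * \<epsilon> * (C * (W * (N + 2) + 1)) * \<bar>b - a\<bar> powr \<alpha>) + 2 * (Cv * (B * \<epsilon>))"
   using 1 2 3[OF I(1)] 3[OF I(2)] unfolding real_norm_def by linarith
  also have "... = sewing_const \<theta> * K5 * (b - a) powr \<theta> + \<epsilon> * M" by (simp add: M_def algebra_simps)
  finally show "norm (v b (w b) - v a (w a) - 0) <= sewing_const \<theta> * K5 * (b - a) powr \<theta> + \<epsilon> * M" .
 qed
 have 0: "0 <= t" using t by simp
 \<comment> \<open>The increment of the pairing and 0 are both Riemann limits of the zero
   germ.\<close>
 have "v t (w t) - v 0 (w 0) = 0 - (0::real)"
 proof (rule riemann_lim_unique[OF 0, of "\<lambda>_ _. 0"])
  show "riemann_lim (\<lambda>ts. \<Sum>i<length ts - 1. 0) 0 t (v t (w t) - v 0 (w 0))"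
   by (rule riemann_lim_of_expansion[OF 0 \<theta>1, where M = "sewing_const \<theta> * K5"]) (use key t in auto)
  show "riemann_lim (\<lambda>ts. \<Sum>i<length ts - 1. 0) 0 t (0 - (0::real))"
   by (rule riemann_lim_of_expansion[OF 0 \<theta>1, where M = 0 and I = "\<lambda>_. 0"]) simp
 qed
 then show ?thesis by simp
qed

end

text \<open>Within distance 1 of S the cutoff leaves u unchanged, so against kernels centred in S
  the cut function satisfies the same expansion as u. The radius r + 3 is that of a ball containing
  S plus that of the kernel.\<close>

lemma duality:
 assumes v: "weak_sol_continuity T \<alpha> \<beta> A c v"
  and u: "fun_class T \<alpha> u" "weak_sol_transport T \<alpha> \<beta> A c (fun_dist u)"
  and S: "S \<subseteq> cball 0 (r + 2)" and Cv: "0 <= Cv"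
  and cut: "\<And>x z t. t \<in> I ==> x \<in> S ==> norm (x - z) <= 1 ==> cut r z * u t z = u t z"
  and vS: "\<And>t F e. t \<in> I ==> F \<in> C0_K (cball 0 (r + 1 + 1)) ==> 0 <= e ==> (\<And>x. x \<in> S ==> \<bar>F x\<bar> <= e) ==> \<bar>v t F\<bar> <= Cv * e"
  and t: "t \<in> I"
 shows "v t (\<lambda>x. cut r x * u t x) = v 0 (\<lambda>x. cut r x * u 0 x)"
proof -
 define w where "w t x = cut r x * u t x" for t x
 obtain B where B: "\<And>t x. t \<in> I ==> \<bar>w t x\<bar> <= B" "\<And>t x y. t \<in> I ==> \<bar>w t x - w t y\<bar> <= B * norm (x - y)"
   "\<And>s t x. s \<in> I ==> t \<in> I ==> \<bar>w t x - w s x\<bar> <= B * \<bar>t - s\<bar> powr \<alpha>"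
  using cutoff_bounds[OF u(1), of r] unfolding w_def by blast
 obtain K where K: "0 <= K" "\<And>s t Q \<phi> G. 0 <= s ==> s <= t ==> t <= T ==> tame (r + 3) Q \<phi> G ==> \<phi> \<in> Cinf_c ==>
  \<bar>fun_dist u t \<phi> - fun_dist u s \<phi> - fun_dist u s (wk s t \<phi> G)\<bar> <= K * Q * (t - s) powr \<theta>"
  using transport_expansion[OF u, of "r + 3"] by blast
 have "v t (w t) = v 0 (w 0)"
 proof (rule duality_const[OF v, where B = B and ?R0.0 = "r + 1" and S = S, OF _ B _ K(1) Cv vS t])
  show "w t x = 0" if "x \<notin> cball 0 (r + 1)" for t x using cut_props(5)[OF that] by (simp add: w_def)
  fix s t R Q :: real and x :: 'a and \<phi> :: "'a => real" and G :: "'a => 'a"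
  assume st: "0 <= s" "s <= t" "t <= T" and x: "x \<in> S" and R: "R <= 1" and \<phi>: "tame R Q \<phi> G" "\<phi> \<in> Cinf_c"
  have eq: "fun_dist w a f = fun_dist u a f" if a: "a \<in> I" and f: "\<And>z. x - z \<notin> cball 0 R ==> f z = 0" for a f
   unfolding fun_dist_def
  proof (rule Bochner_Integration.integral_cong[OF refl])
   fix z show "w a z * f z = u a z * f z"
    by (cases "x - z \<in> cball 0 R") (use cut[OF a x, of z] f[of z] R in \<open>auto simp: w_def\<close>)
  qed
  have "norm x + R <= r + 3" using S x R by auto
  then have tm: "tame (r + 3) Q (\<lambda>z. \<phi> (x - z)) (\<lambda>z. - G (x - z))"
   using tame_reflect[OF \<phi>(1), of x] unfolding tame_def by auto
  have I: "s \<in> I" "t \<in> I" using st by auto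
  have wk0: "wk s t (\<lambda>z. \<phi> (x - z)) (\<lambda>z. - G (x - z)) z = 0" if "x - z \<notin> cball 0 R" for z
   using tameD(2,3)[OF \<phi>(1) that] by (simp add: wk_def)
  have e: "fun_dist w a (\<lambda>z. \<phi> (x - z)) = fun_dist u a (\<lambda>z. \<phi> (x - z))" if "a \<in> I" for a
   by (rule eq[OF that tameD(2)[OF \<phi>(1)]])
  have "fun_dist w s (wk s t (\<lambda>z. \<phi> (x - z)) (\<lambda>z. - G (x - z))) = fun_dist u s (wk s t (\<lambda>z. \<phi> (x - z)) (\<lambda>z. - G (x - z)))"
   by (rule eq[OF I(1) wk0])
  then show "\<bar>fun_dist w t (\<lambda>z. \<phi> (x - z)) - fun_dist w s (\<lambda>z. \<phi> (x - z)) -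
    fun_dist w s (wk s t (\<lambda>z. \<phi> (x - z)) (\<lambda>z. - G (x - z)))\<bar> <= K * Q * (t - s) powr \<theta>"
   using e[OF I(1)] e[OF I(2)] K(2)[OF st tm Cinf_c_reflect[OF \<phi>(2)]] by simp
 qed
 then show ?thesis unfolding w_def[abs_def] .
qed

text \<open>The measure is the weighted Dirac mass that starts at y = \<Phi> t 0 x and sits at x at
  time t. Constancy of the pairing reads u t x * exp (Z 0 t y) = u 0 y, which is the representation
  formula.\<close>

lemma transport_along_flow:
 assumes u: "fun_class T \<alpha> u" "weak_sol_transport T \<alpha> \<beta> A c (fun_dist u)" and t: "t \<in> I"
 shows "u t x = transported 0 (u 0) t x"
proof -
 define y where "y = \<Phi> t 0 x"
 \<comment> \<open>Trajectories from y stay in the ball of radius r - 1, so the cutoff is 1 up to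
   distance 1 from them.\<close>
 define r where "r = norm y + Hf * T powr \<alpha> + 1"
 have "Mloc (\<lambda>f. f y)"
  unfolding Mloc_def linear_on_Cc_def by (auto intro!: exI[of _ 1] C0_KD(2))
 from pushed_weak_sol[OF this] have v: "weak_sol_continuity T \<alpha> \<beta> A c (pushed (\<lambda>f. f y))" .
 have path: "norm (\<Phi> 0 s y) <= r - 1" if "s \<in> I" for s
 proof -
  have "norm (\<Phi> 0 s y - y) <= Hf * \<bar>s - 0\<bar> powr \<alpha>" using flow_holder(1)[OF zero_I zero_I that, of y] zero_I by simp
  also have "... <= Hf * T powr \<alpha>" using powr_le_T\<alpha>[of s] that Hf by (intro mult_left_mono) auto
  finally show ?thesis using norm_triangle_ineq2[of "\<Phi> 0 s y" y] by (simp add: r_def)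
 qed
 have "pushed (\<lambda>f. f y) t (\<lambda>x. cut r x * u t x) = pushed (\<lambda>f. f y) 0 (\<lambda>x. cut r x * u 0 x)"
 proof (rule duality[OF v u _ _ _ _ t, where S = "(\<lambda>s. \<Phi> 0 s y) ` I" and Cv = "exp (Hf * T powr \<alpha>)"])
  show "(\<lambda>s. \<Phi> 0 s y) ` I \<subseteq> cball 0 (r + 2)" using path by force
  fix z z' s assume "z \<in> (\<lambda>s. \<Phi> 0 s y) ` I" "norm (z - z') <= 1"
  then have "norm z' <= r" using path norm_triangle_ineq2[of z' z] by (force simp: norm_minus_commute)
  then show "cut r z' * u s z' = u s z'" by (simp add: cut_props(4))
 next
  fix s e :: real and F :: "'a => real" assume s: "s \<in> I" and e: "0 <= e" and F: "\<And>x. x \<in> (\<lambda>s. \<Phi> 0 s y) ` I ==> \<bar>F x\<bar> <= e"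
  have "\<bar>F (\<Phi> 0 s y)\<bar> * exp (Z 0 s y) <= e * exp (Hf * T powr \<alpha>)"
   by (rule mult_mono[OF F exp_Z_bound(2)[OF zero_I s] e]) (use s in auto)
  then show "\<bar>pushed (\<lambda>f. f y) s F\<bar> <= exp (Hf * T powr \<alpha>) * e" by (simp add: pushed_def abs_mult mult.commute)
 qed simp
 then have "u t (\<Phi> 0 t y) * exp (Z 0 t y) = u 0 y"
  using path[OF t] path[OF zero_I] zero_I by (simp add: pushed_def cut_props(4))
 moreover have "\<Phi> 0 t y = x" unfolding y_def by (rule flow_inv[OF t zero_I])
 moreover have "Z 0 t y = - Z t 0 x" using cocycle(2)[OF t zero_I t, of x] t by (simp add: y_def)
 ultimately show ?thesis by (simp add: transported_def y_def[symmetric] exp_minus field_simps)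
qed

text \<open>The transport solution with value \<phi> at the final time t is paired with v. Its
  support stays in one ball during [0, T], so the cutoff changes nothing, and v t on \<phi> is
  expressed through v 0.\<close>

lemma continuity_dual:
 assumes v: "weak_sol_continuity T \<alpha> \<beta> A c v" and \<phi>: "tame R Q \<phi> G" and t: "t \<in> I"
 shows "v t \<phi> = v 0 (transported t \<phi> 0)" "transported t \<phi> 0 \<in> C0_c"
proof -
 define r where "r = R + Hf * T powr \<alpha>"
 have C1: "C1_loc \<phi>" unfolding C1_loc_def using tameD(1,10)[OF \<phi>] by blast
 note u = transported_weak_sol[OF t C1 refl]
 have supp: "transported t \<phi> s x = 0" if s: "s \<in> I" and x: "x \<notin> cball 0 r" for s x
 proof -
  have "norm (\<Phi> s t x - x) <= Hf * \<bar>t - s\<bar> powr \<alpha>" using flow_holder(1)[OF s s t, of x] s by simp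
  also have "... <= Hf * T powr \<alpha>" using powr_le_T\<alpha>[of "\<bar>t - s\<bar>"] s t Hf by (intro mult_left_mono) auto
  finally have "norm x - norm (\<Phi> s t x) <= Hf * T powr \<alpha>"
   using norm_triangle_ineq2[of x "\<Phi> s t x"] by (simp add: norm_minus_commute)
  then have "\<Phi> s t x \<notin> cball 0 R" using x by (simp add: r_def)
  then show ?thesis using tameD(2)[OF \<phi>] by (simp add: transported_def)
 qed
 have cut: "cut r x * transported t \<phi> s x = transported t \<phi> s x" if "s \<in> I" for s x
  by (cases "x \<in> cball 0 r") (use cut_props(4)[of x r] supp[OF that] in auto)
 show "transported t \<phi> 0 \<in> C0_c"
  unfolding C0_c_iff using fun_classD(2)[OF u(1) zero_I] supp[OF zero_I] by blast
 obtain D where D: "0 <= D" "\<And>t f. t \<in> I ==> f \<in> C0_K (cball 0 (r + 1 + 1)) ==> \<bar>v t f\<bar> <= D * sup_norm f"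
  using dist_classD(2)[OF v[unfolded weak_sol_continuity_eq, THEN conjunct1], of "r + 1 + 1"] by blast
 have "v t (\<lambda>x. cut r x * transported t \<phi> t x) = v 0 (\<lambda>x. cut r x * transported t \<phi> 0 x)"
 proof (rule duality[OF v u _ D(1) _ _ t, where S = "cball 0 (r + 2)"])
  fix s e :: real and F :: "'a => real"
  assume s: "s \<in> I" and F: "F \<in> C0_K (cball 0 (r + 1 + 1))" and e: "0 <= e" "\<And>x. x \<in> cball 0 (r + 2) ==> \<bar>F x\<bar> <= e"
  have "\<bar>F x\<bar> <= e" for x
   by (cases "x \<in> cball 0 (r + 2)") (use e F in \<open>auto simp: C0_K_def\<close>)
  then have "sup_norm F <= e" by (rule sup_norm_least)
  then show "\<bar>v s F\<bar> <= D * e" using D(2)[OF s F] mult_left_mono[OF _ D(1)] order_trans by blast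
 qed (use cut in auto)
 moreover have "transported t \<phi> t = \<phi>" using t by (simp add: transported_def fun_eq_iff)
 ultimately show "v t \<phi> = v 0 (transported t \<phi> 0)" unfolding cut[OF t] cut[OF zero_I] by simp
qed

lemma Cinf_c_dense:
 fixes f :: "'a => real"
 assumes f: "f \<in> C0_c"
 shows "\<exists>R. f \<in> C0_K (cball 0 R) \<and> (\<forall>e>0. \<exists>m\<in>C0_K (cball 0 R) \<inter> Cinf_c. \<forall>x. \<bar>m x - f x\<bar> <= e)"
proof -
 obtain R where R: "continuous_on UNIV f" "\<And>x. x \<notin> cball 0 R ==> f x = 0" using f unfolding C0_c_iff by blast
 obtain B where B: "\<And>x. \<bar>f x\<bar> <= B" using bounded_of_compact_support[OF R] by blast
 obtain W where W: "\<And>\<epsilon>. 0 < \<epsilon> ==> \<exists>(\<rho>::'a => real) G Q. kernel W \<epsilon> \<rho> G Q" using kernel_exists by blast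
 show ?thesis
 proof (intro exI[of _ "R + 1"] conjI allI impI)
  show "f \<in> C0_K (cball 0 (R + 1))" using R by (auto simp: C0_K_def)
  fix e :: real assume e: "0 < e"
  have "uniformly_continuous_on (cball 0 (R + 2)) f"
   by (rule compact_uniformly_continuous[OF continuous_on_subset[OF R(1)]]) auto
  then obtain \<delta> where \<delta>: "0 < \<delta>" "\<And>x y. x \<in> cball 0 (R + 2) ==> y \<in> cball 0 (R + 2) ==> norm (y - x) < \<delta> ==> \<bar>f y - f x\<bar> < e"
   unfolding uniformly_continuous_on_def dist_norm real_norm_def using e by meson
  define \<epsilon> where "\<epsilon> = min 1 (\<delta> / 2)"
  have \<epsilon>: "0 < \<epsilon>" "\<epsilon> <= 1" "\<epsilon> < \<delta>" using \<delta>(1) by (auto simp: \<epsilon>_def)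
  obtain \<rho> :: "'a => real" and G Q where ker: "kernel W \<epsilon> \<rho> G Q" using W[OF \<epsilon>(1)] by blast
  then have \<rho>: "\<rho> \<in> Cinf_c" "tame \<epsilon> Q \<rho> G" by (auto simp: kernel_def)
  have out: "moll \<rho> f x = 0" if "x \<notin> cball 0 (R + 1)" for x
   by (rule moll_outside[OF R B tameD(2)[OF \<rho>(2)]]) (use that \<epsilon> in auto)
  have sm: "smooth (moll \<rho> f)" by (rule moll_smooth[OF R B \<rho>(1)])
  have "\<bar>moll \<rho> f x - f x\<bar> <= e" for x
  proof (cases "x \<in> cball 0 (R + 1)")
   case True
   show ?thesis
   proof (rule moll_close[OF ker \<epsilon>(1,2) zero_I zero_I R])
    fix \<xi> :: 'a assume \<xi>: "norm \<xi> <= \<epsilon>"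
    then have "x - \<xi> \<in> cball 0 (R + 2)" using True \<epsilon> norm_triangle_ineq4[of x \<xi>] by simp
    then show "\<bar>f (x - \<xi>) - f x\<bar> <= e" using \<delta>(2)[of x "x - \<xi>"] True \<xi> \<epsilon> by simp
   qed
  next
   case False
   then show ?thesis using out R(2)[of x] e by auto
  qed
  moreover have "moll \<rho> f \<in> C0_K (cball 0 (R + 1))" using smooth_continuous[OF sm] out by (simp add: C0_K_def)
  moreover have "moll \<rho> f \<in> Cinf_c" using sm out unfolding Cinf_c_iff by blast
  ultimately show "\<exists>m\<in>C0_K (cball 0 (R + 1)) \<inter> Cinf_c. \<forall>x. \<bar>m x - f x\<bar> <= e" by blast
 qed
qed

text \<open>Duality determines v t on smooth test functions. The bound by the sup norm on a fixed
  ball extends this to \<open>C0_c\<close>, since the approximants can be taken with support in that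
  ball.\<close>

lemma continuity_unique:
 assumes v1: "weak_sol_continuity T \<alpha> \<beta> A c v1" and v2: "weak_sol_continuity T \<alpha> \<beta> A c v2"
  and init: "\<And>f. f \<in> C0_c ==> v1 0 f = v2 0 f" and t: "t \<in> I" and f: "f \<in> C0_c"
 shows "v1 t f = v2 t f"
proof -
 note d = v1[unfolded weak_sol_continuity_eq, THEN conjunct1] v2[unfolded weak_sol_continuity_eq, THEN conjunct1]
 obtain R where R: "f \<in> C0_K (cball 0 R)" "\<And>e. 0 < e ==> \<exists>m\<in>C0_K (cball 0 R) \<inter> Cinf_c. \<forall>x. \<bar>m x - f x\<bar> <= e"
  using Cinf_c_dense[OF f] by blast
 obtain D1 where D1: "0 <= D1" "\<And>f. f \<in> C0_K (cball 0 R) ==> \<bar>v1 t f\<bar> <= D1 * sup_norm f"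
  using dist_classD(2)[OF d(1), of R] t by blast
 obtain D2 where D2: "0 <= D2" "\<And>f. f \<in> C0_K (cball 0 R) ==> \<bar>v2 t f\<bar> <= D2 * sup_norm f"
  using dist_classD(2)[OF d(2), of R] t by blast
 have "\<bar>v1 t f - v2 t f\<bar> <= 0"
 proof (rule le_of_small)
  show "0 <= D1 + D2" using D1 D2 by simp
  fix e :: real assume e: "0 < e"
  obtain m where m: "m \<in> C0_K (cball 0 R)" "m \<in> Cinf_c" "\<And>x. \<bar>m x - f x\<bar> <= e" using R(2)[OF e] by blast
  obtain R' Q G where tm: "tame R' Q m G" using Cinf_c_tame[OF m(2)] by blast
  note cd = continuity_dual[OF _ tm t]
  have eq: "v1 t m = v2 t m" using cd(1)[OF v1] cd(1)[OF v2] init[OF cd(2)[OF v1]] by simp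
  note mf = C0_K_diff[OF m(1) R(1)] C0_KD(1)[OF m(1) compact_cball]
  have s: "sup_norm (\<lambda>x. m x - f x) <= e" by (rule sup_norm_least[OF m(3)])
  have "\<bar>v1 t m - v1 t f\<bar> <= D1 * e"
   using D1(2)[OF mf(1)] mult_left_mono[OF s D1(1)] linear_on_Cc_comb(1)[OF dist_classD(1)[OF d(1) t] mf(2) f] by simp
  moreover have "\<bar>v2 t m - v2 t f\<bar> <= D2 * e"
   using D2(2)[OF mf(1)] mult_left_mono[OF s D2(1)] linear_on_Cc_comb(1)[OF dist_classD(1)[OF d(2) t] mf(2) f] by simp
  ultimately show "\<bar>v1 t f - v2 t f\<bar> <= 0 + e * (D1 + D2)" using eq by (simp add: algebra_simps)
 qed
 then show ?thesis by simp
qed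

section \<open>Translation into the explicit solution formulas\<close>

lemma transport_well_posed:
 assumes u0: "C1_loc u0"
  and u: "u = (\<lambda>t x. u0 (flow_bwd T \<alpha> \<beta> A 0 t x) * exp (- young_int c (\<lambda>s. flow_bwd T \<alpha> \<beta> A s t x) 0 t))"
 shows "fun_class T \<alpha> u \<and> weak_sol_transport T \<alpha> \<beta> A c (fun_dist u) \<and> (\<forall>x. u 0 x = u0 x) \<and>
  (\<forall>u'. fun_class T \<alpha> u' \<and> weak_sol_transport T \<alpha> \<beta> A c (fun_dist u') \<and> (\<forall>x. u' 0 x = u0 x) --> (\<forall>t\<in>{0..T}. \<forall>x. u' t x = u t x))"
proof -
 have eq: "u t = transported 0 u0 t" if t: "t \<in> {0..T}" for t
 proof
  fix x
  have "young_int c (\<lambda>s. flow_bwd T \<alpha> \<beta> A s t x) 0 t = Z t t x - Z t 0 x"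
   by (rule young_int_along_flow[OF t t]) (rule flow_bwd_eq, use t in auto)
  moreover have "flow_bwd T \<alpha> \<beta> A 0 t x = \<Phi> t 0 x" by (rule flow_bwd_eq) (use t in auto)
  ultimately show "u t x = transported 0 u0 t x" using t by (simp add: u transported_def)
 qed
 have "u' t x = u t x" if "fun_class T \<alpha> u'" "weak_sol_transport T \<alpha> \<beta> A c (fun_dist u')" "\<forall>x. u' 0 x = u0 x" "t \<in> {0..T}" for u' t x
 proof -
  have "u' 0 = u0" using that(3) by (simp add: fun_eq_iff)
  then show ?thesis using transport_along_flow[OF that(1,2,4), of x] eq[OF that(4)] by simp
 qed
 moreover have "u 0 x = u0 x" for x using eq[OF zero_I] zero_I by (simp add: transported_def)
 ultimately show ?thesis using transported_weak_sol[OF zero_I u0 eq] by blast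
qed

lemma continuity_solution:
 assumes \<mu>0: "Mloc \<mu>0"
 shows "\<exists>v. weak_sol_continuity T \<alpha> \<beta> A c v \<and> (\<forall>f\<in>C0_c. v 0 f = \<mu>0 f) \<and>
  (\<forall>t\<in>{0..T}. \<forall>\<phi>\<in>Cinf_c. v t \<phi> = \<mu>0 (\<lambda>x. \<phi> (flow_fwd T \<alpha> \<beta> A 0 t x) *
   exp (young_int (\<lambda>s y. divergence A s y - (divergence A s y - c s y)) (\<lambda>s. flow_fwd T \<alpha> \<beta> A 0 s x) 0 t)))"
proof (intro exI[of _ "pushed \<mu>0"] conjI ballI)
 show "weak_sol_continuity T \<alpha> \<beta> A c (pushed \<mu>0)" by (rule pushed_weak_sol[OF \<mu>0])
 show "pushed \<mu>0 0 f = \<mu>0 f" for f using zero_I by (simp add: pushed_def)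
 fix t and \<phi> :: "'a => real" assume t: "t \<in> {0..T}"
 have "young_int c (\<lambda>s. flow_fwd T \<alpha> \<beta> A 0 s x) 0 t = Z 0 t x" for x
  using young_int_along_flow[OF zero_I t, of "\<lambda>s. flow_fwd T \<alpha> \<beta> A 0 s x" x] flow_fwd_eq[OF zero_I] t zero_I by simp
 \<comment> \<open>With the modified coefficient div A - c the integrand in the exponent collapses
   to c, so the exponent is Z 0 t x.\<close>
 moreover have "(\<lambda>s y. divergence A s y - (divergence A s y - c s y)) = c" by (simp add: fun_eq_iff)
 ultimately show "pushed \<mu>0 t \<phi> = \<mu>0 (\<lambda>x. \<phi> (flow_fwd T \<alpha> \<beta> A 0 t x) *
   exp (young_int (\<lambda>s y. divergence A s y - (divergence A s y - c s y)) (\<lambda>s. flow_fwd T \<alpha> \<beta> A 0 s x) 0 t))"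
  using flow_fwd_eq[OF zero_I t] by (simp add: pushed_def)
qed

end

theorem mainTheorem6:
  fixes A :: "real \<Rightarrow> 'a::euclidean_space \<Rightarrow> 'a" and c :: "real \<Rightarrow> 'a \<Rightarrow> real"
    and T \<alpha> \<beta> :: real
  assumes "T > 0"
    and "0 < \<alpha>" "\<alpha> < 1" "0 < \<beta>" "\<beta> < 1" "\<alpha> * (1 + \<beta>) > 1"
    and "CtC1x T \<alpha> \<beta> A" and "CtC1x T \<alpha> \<beta> c"
  shows
    "(\<forall>u0. C1_loc u0 \<longrightarrow>
       (let u = (\<lambda>t x. u0 (flow_bwd T \<alpha> \<beta> A 0 t x)
                   * exp (- young_int c (\<lambda>s. flow_bwd T \<alpha> \<beta> A s t x) 0 t))
        in fun_class T \<alpha> u \<and> weak_sol_transport T \<alpha> \<beta> A c (fun_dist u) \<and> (\<forall>x. u 0 x = u0 x) \<and>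
           (\<forall>u'. fun_class T \<alpha> u' \<and> weak_sol_transport T \<alpha> \<beta> A c (fun_dist u') \<and> (\<forall>x. u' 0 x = u0 x)
              \<longrightarrow> (\<forall>t\<in>{0..T}. \<forall>x. u' t x = u t x))))
   \<and>
     (\<forall>\<mu>0. Mloc \<mu>0 \<longrightarrow>
       (\<exists>v. weak_sol_continuity T \<alpha> \<beta> A c v \<and> (\<forall>f\<in>C0_c. v 0 f = \<mu>0 f) \<and>
          (\<forall>t\<in>{0..T}. \<forall>\<phi>\<in>Cinf_c.
             v t \<phi> = \<mu>0 (\<lambda>x. \<phi> (flow_fwd T \<alpha> \<beta> A 0 t x)
               * exp (young_int (\<lambda>s y. divergence A s y - (divergence A s y - c s y))
                                (\<lambda>s. flow_fwd T \<alpha> \<beta> A 0 s x) 0 t)))) \<and>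
       (\<forall>v1 v2. weak_sol_continuity T \<alpha> \<beta> A c v1 \<and> (\<forall>f\<in>C0_c. v1 0 f = \<mu>0 f) \<and>
                weak_sol_continuity T \<alpha> \<beta> A c v2 \<and> (\<forall>f\<in>C0_c. v2 0 f = \<mu>0 f)
          \<longrightarrow> (\<forall>t\<in>{0..T}. \<forall>f\<in>C0_c. v1 t f = v2 t f)))"
proof -
  obtain C DA Dc where "transport_coeffs T \<alpha> \<beta> (\<alpha> * (1 + \<beta>)) C A DA c Dc"
    using transport_coeffs_exist[OF assms] by blast
  then interpret transport_coeffs T \<alpha> \<beta> "\<alpha> * (1 + \<beta>)" C A DA c Dc .
  have uniq: "v1 t f = v2 t f" if "weak_sol_continuity T \<alpha> \<beta> A c v1 \<and> (\<forall>f\<in>C0_c. v1 0 f = \<mu>0 f) \<and>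
      weak_sol_continuity T \<alpha> \<beta> A c v2 \<and> (\<forall>f\<in>C0_c. v2 0 f = \<mu>0 f)" "t \<in> {0..T}" "f \<in> C0_c" for v1 v2 \<mu>0 t f
    by (rule continuity_unique[OF _ _ _ that(2,3)]) (use that(1) in auto)
  show ?thesis
    apply (rule conjI; intro allI impI)
    subgoal premises p unfolding Let_def by (rule transport_well_posed[OF p refl])
    subgoal premises p by (rule conjI[OF continuity_solution[OF p]]) (intro allI impI ballI, rule uniq, assumption+)
    done
qed

end
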